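(* Let $R$ be a (commutative noetherian) local ring, $M$ a G-perfect $R$-module of grade $g$, and $F$ a minimal free resolution of $M$. Set $N=\operatorname{Ext}_R^g(M,R)$ and $(-)^*=\operatorname{Hom}_R(-,R)$. (1) Suppose that $F$ is eventually periodic with period $a>0$. Then one has $(\Omega_R^i N)^*\approx\Omega_R^{g+ma-i}M$ for all integers $i\ge g$ and all integers $m\ge\frac{i}{a}$. (2) Suppose that there exist two integers $i\ge g$ and $j\ge0$ such that $i+j>g$ and $(\Omega_R^i N)^*\approx\Omega_R^j M$. Then $F$ is eventually periodic with period $i+j-g$.
   Context: All rings are commutative and noetherian, and all modules are finitely generated. Put $(-)^*=\operatorname{Hom}_R(-,R)$. The grade of a nonzero $R$-module $M$ is $\operatorname{grade}_R M=\inf\{i\ge 0:\operatorname{Ext}^i_R(M,R)\ne0\}$. An $R$-module $G$ is totally reflexive if the natural map $G\to G^{**}$ is an isomorphism and $\operatorname{Ext}^i_R(G,R)=\operatorname{Ext}^i_R(G^*,R)=0$ for all $i>0$. The Gorenstein dimension of $M$ is the infimum of the integers $n$ for which there is an exact sequence $0\to G_n\to\cdots\to G_0\to M\to0$ with all $G_i$ totally reflexive. $M$ is called G-perfect if $M\neq0$ and its Gorenstein dimension equals $\operatorname{grade}_R M$. For a local ring $R$ and a minimal free resolution $F=(\cdots\xrightarrow{d_2}F_1\xrightarrow{d_1}F_0\to0)$ of $M$, the $n$-th syzygy $\Omega^n_R M$ ($n\ge 0$) is the cokernel of $d_{n+1}$ (so $\Omega^0_R M= M$). For an integer $a>0$,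 $F$ is called eventually periodic with period $a$ if there is an integer $n\ge0$ such that $F$ is isomorphic to a complex which, from degree $n$ upward, repeats the same block of modules $F_{n+a-1},\dots,F_n$ and the same maps with period $a$; equivalently, there is an integer $n\ge0$ with $\Omega^n_R M\cong\Omega^{n+a}_R M$. (The period $a$ is not required to be minimal.) For $R$-modules $X$ and $Y$, $X\approx Y$ means that there exist projective $R$-modules $P,Q$ with $X\oplus P\cong Y\oplus Q$. *)

theory Defs
  imports Complex_Main "HOL-Algebra.Module" "HOL-Algebra.Ring_Divisibility" "HOL-Algebra.AbelCoset"
    "HOL-Library.Extended_Nat" "HOL-Library.FuncSet"
begin

(* The record type of modules also carries the multiplicative fields mult and one of a ring.
   They play no role in the theory of modules and are set to undefined below. *)

section \<open>Modules and homomorphisms\<close>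

(* As for ring_hom, only the values on the carrier matter. *)
definition mod_hom ::
  "('a, 'r) ring_scheme \<Rightarrow> ('a, 'b) module \<Rightarrow> ('a, 'c) module \<Rightarrow> ('b \<Rightarrow> 'c) set" where
  "mod_hom R M N = {h \<in> carrier M \<rightarrow> carrier N.
     (\<forall>x\<in>carrier M. \<forall>y\<in>carrier M. h (x \<oplus>\<^bsub>M\<^esub> y) = h x \<oplus>\<^bsub>N\<^esub> h y) \<and>
     (\<forall>a\<in>carrier R. \<forall>x\<in>carrier M. h (a \<odot>\<^bsub>M\<^esub> x) = a \<odot>\<^bsub>N\<^esub> h x)}"

definition mod_iso ::
  "('a, 'r) ring_scheme \<Rightarrow> ('a, 'b) module \<Rightarrow> ('a, 'c) module \<Rightarrow> ('b \<Rightarrow> 'c) set" where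
  "mod_iso R M N = {h \<in> mod_hom R M N. bij_betw h (carrier M) (carrier N)}"

definition mod_isomorphic ::
  "('a, 'r) ring_scheme \<Rightarrow> ('a, 'b) module \<Rightarrow> ('a, 'c) module \<Rightarrow> bool" where
  "mod_isomorphic R M N \<longleftrightarrow> mod_iso R M N \<noteq> {}"

definition zero_mod :: "('a, 'b) module \<Rightarrow> bool" where
  "zero_mod M \<longleftrightarrow> carrier M = {\<zero>\<^bsub>M\<^esub>}"

definition mod_span :: "('a, 'r) ring_scheme \<Rightarrow> ('a, 'b) module \<Rightarrow> 'b set \<Rightarrow> 'b set" where
  "mod_span R M S = \<Inter>{H. submodule H R M \<and> S \<subseteq> H}"

definition fg_module :: "('a, 'r) ring_scheme \<Rightarrow> ('a, 'b) module \<Rightarrow> bool" where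
  "fg_module R M \<longleftrightarrow> module R M \<and>
     (\<exists>S. finite S \<and> S \<subseteq> carrier M \<and> mod_span R M S = carrier M)"

definition ring_mod :: "('a, 'r) ring_scheme \<Rightarrow> ('a, 'a) module" where
  "ring_mod R = \<lparr>carrier = carrier R, mult = mult R, one = one R, zero = zero R, add = add R,
                 smult = mult R\<rparr>"

definition free_mod :: "('a, 'r) ring_scheme \<Rightarrow> nat \<Rightarrow> ('a, nat \<Rightarrow> 'a) module" where
  "free_mod R n = \<lparr>carrier = {..<n} \<rightarrow>\<^sub>E carrier R, mult = undefined, one = undefined,
     zero = (\<lambda>i\<in>{..<n}. \<zero>\<^bsub>R\<^esub>), add = (\<lambda>x y. \<lambda>i\<in>{..<n}. x i \<oplus>\<^bsub>R\<^esub> y i),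
     smult = (\<lambda>a x. \<lambda>i\<in>{..<n}. a \<otimes>\<^bsub>R\<^esub> x i)\<rparr>"

definition fg_free :: "('a, 'r) ring_scheme \<Rightarrow> ('a, 'b) module \<Rightarrow> bool" where
  "fg_free R F \<longleftrightarrow> module R F \<and> (\<exists>n. mod_isomorphic R (free_mod R n) F)"

definition quot_mod :: "('a, 'b) module \<Rightarrow> 'b set \<Rightarrow> ('a, 'b set) module" where
  "quot_mod M K = \<lparr>carrier = a_rcosets\<^bsub>M\<^esub> K, mult = undefined, one = undefined, zero = K,
     add = set_add M, smult = (\<lambda>a C. \<Union>x\<in>C. K +>\<^bsub>M\<^esub> (a \<odot>\<^bsub>M\<^esub> x))\<rparr>"

definition dsum_mod :: "('a, 'b) module \<Rightarrow> ('a, 'c) module \<Rightarrow> ('a, 'b \<times> 'c) module" where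
  "dsum_mod M N = \<lparr>carrier = carrier M \<times> carrier N, mult = undefined, one = undefined,
     zero = (\<zero>\<^bsub>M\<^esub>, \<zero>\<^bsub>N\<^esub>),
     add = (\<lambda>x y. (fst x \<oplus>\<^bsub>M\<^esub> fst y, snd x \<oplus>\<^bsub>N\<^esub> snd y)),
     smult = (\<lambda>a x. (a \<odot>\<^bsub>M\<^esub> fst x, a \<odot>\<^bsub>N\<^esub> snd x))\<rparr>"

(* Homomorphisms are taken extensional here, so that equal homomorphisms are equal elements. *)
definition Hom_mod ::
  "('a, 'r) ring_scheme \<Rightarrow> ('a, 'b) module \<Rightarrow> ('a, 'c) module \<Rightarrow> ('a, 'b \<Rightarrow> 'c) module" where
  "Hom_mod R M N = \<lparr>carrier = mod_hom R M N \<inter> extensional (carrier M),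
     mult = undefined, one = undefined,
     zero = (\<lambda>x\<in>carrier M. \<zero>\<^bsub>N\<^esub>),
     add = (\<lambda>f g. \<lambda>x\<in>carrier M. f x \<oplus>\<^bsub>N\<^esub> g x),
     smult = (\<lambda>a f. \<lambda>x\<in>carrier M. a \<odot>\<^bsub>N\<^esub> f x)\<rparr>"

definition dual_mod :: "('a, 'r) ring_scheme \<Rightarrow> ('a, 'b) module \<Rightarrow> ('a, 'b \<Rightarrow> 'a) module" where
  "dual_mod R M = Hom_mod R M (ring_mod R)"

(* Every finitely generated R-module is isomorphic to a quotient of some free_mod R n, hence to a
   module whose elements have type (nat => 'a) set. Quantifying over modules with elements of
   this type therefore quantifies over all finitely generated R-modules up to isomorphism;
   this is used here, in stably_iso and in G_dim. For a finitely generated P, the lifting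
   property along all surjections is equivalent to the one along surjections of such modules. *)
definition projective_mod :: "('a, 'r) ring_scheme \<Rightarrow> ('a, 'b) module \<Rightarrow> bool" where
  "projective_mod R P \<longleftrightarrow> fg_module R P \<and>
     (\<forall>(A :: ('a, (nat \<Rightarrow> 'a) set) module) (B :: ('a, (nat \<Rightarrow> 'a) set) module) p f.
        module R A \<and> module R B \<and> p \<in> mod_hom R A B \<and> p ` carrier A = carrier B \<and>
        f \<in> mod_hom R P B \<longrightarrow>
        (\<exists>h\<in>mod_hom R P A. \<forall>x\<in>carrier P. p (h x) = f x))"

definition stably_iso ::
  "('a, 'r) ring_scheme \<Rightarrow> ('a, 'b) module \<Rightarrow> ('a, 'c) module \<Rightarrow> bool" where
  "stably_iso R X Y \<longleftrightarrow>
     (\<exists>(P :: ('a, (nat \<Rightarrow> 'a) set) module) (Q :: ('a, (nat \<Rightarrow> 'a) set) module).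
        projective_mod R P \<and> projective_mod R Q \<and>
        mod_isomorphic R (dsum_mod X P) (dsum_mod Y Q))"


section \<open>Local rings\<close>

definition local_ring :: "('a, 'r) ring_scheme \<Rightarrow> bool" where
  "local_ring R \<longleftrightarrow> cring R \<and> (\<exists>!I. maximalideal I R)"

definition max_ideal :: "('a, 'r) ring_scheme \<Rightarrow> 'a set" where
  "max_ideal R = (THE I. maximalideal I R)"


section \<open>Resolutions and Ext\<close>

(* ... --d 2--> F 1 --d 1--> F 0 --e--> M --> 0 is exact; d 0 is not used. *)
definition resolution ::
  "('a, 'r) ring_scheme \<Rightarrow> ('a, 'b) module \<Rightarrow>
   (nat \<Rightarrow> ('a, 'f) module) \<Rightarrow> (nat \<Rightarrow> 'f \<Rightarrow> 'f) \<Rightarrow> ('f \<Rightarrow> 'b) \<Rightarrow> bool" where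
  "resolution R M F d e \<longleftrightarrow>
     (\<forall>n. module R (F n)) \<and>
     (\<forall>n. d (Suc n) \<in> mod_hom R (F (Suc n)) (F n)) \<and>
     e \<in> mod_hom R (F 0) M \<and>
     e ` carrier (F 0) = carrier M \<and>
     d 1 ` carrier (F 1) = a_kernel (F 0) M e \<and>
     (\<forall>n. d (Suc (Suc n)) ` carrier (F (Suc (Suc n))) = a_kernel (F (Suc n)) (F n) (d (Suc n)))"

definition free_resolution ::
  "('a, 'r) ring_scheme \<Rightarrow> ('a, 'b) module \<Rightarrow>
   (nat \<Rightarrow> ('a, 'f) module) \<Rightarrow> (nat \<Rightarrow> 'f \<Rightarrow> 'f) \<Rightarrow> ('f \<Rightarrow> 'b) \<Rightarrow> bool" where
  "free_resolution R M F d e \<longleftrightarrow> resolution R M F d e \<and> (\<forall>n. fg_free R (F n))"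

definition minimal_free_resolution ::
  "('a, 'r) ring_scheme \<Rightarrow> ('a, 'b) module \<Rightarrow>
   (nat \<Rightarrow> ('a, 'f) module) \<Rightarrow> (nat \<Rightarrow> 'f \<Rightarrow> 'f) \<Rightarrow> ('f \<Rightarrow> 'b) \<Rightarrow> bool" where
  "minimal_free_resolution R M F d e \<longleftrightarrow> free_resolution R M F d e \<and>
     (\<forall>n. d (Suc n) ` carrier (F (Suc n)) \<subseteq>
          mod_span R (F n) {a \<odot>\<^bsub>F n\<^esub> x | a x. a \<in> max_ideal R \<and> x \<in> carrier (F n)})"

(* The cokernel of d (n + 1). *)
definition syzygy ::
  "(nat \<Rightarrow> ('a, 'f) module) \<Rightarrow> (nat \<Rightarrow> 'f \<Rightarrow> 'f) \<Rightarrow> nat \<Rightarrow> ('a, 'f set) module" where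
  "syzygy F d n = quot_mod (F n) (d (Suc n) ` carrier (F (Suc n)))"

(* A finitely generated module over a noetherian ring has a resolution by the modules
   free_mod R k, whose elements have type nat => 'a. *)
definition some_free_resolution ::
  "('a, 'r) ring_scheme \<Rightarrow> ('a, 'b) module \<Rightarrow>
   (nat \<Rightarrow> ('a, nat \<Rightarrow> 'a) module) \<times> (nat \<Rightarrow> (nat \<Rightarrow> 'a) \<Rightarrow> (nat \<Rightarrow> 'a))" where
  "some_free_resolution R M = (SOME (F, d). \<exists>e. free_resolution R M F d e)"

definition cocycles ::
  "('a, 'r) ring_scheme \<Rightarrow> (nat \<Rightarrow> ('a, 'f) module) \<Rightarrow> (nat \<Rightarrow> 'f \<Rightarrow> 'f) \<Rightarrow> ('a, 'c) module \<Rightarrow> nat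
   \<Rightarrow> ('f \<Rightarrow> 'c) set" where
  "cocycles R F d X i =
     {f \<in> carrier (Hom_mod R (F i) X). \<forall>x\<in>carrier (F (Suc i)). f (d (Suc i) x) = \<zero>\<^bsub>X\<^esub>}"

definition coboundaries ::
  "('a, 'r) ring_scheme \<Rightarrow> (nat \<Rightarrow> ('a, 'f) module) \<Rightarrow> (nat \<Rightarrow> 'f \<Rightarrow> 'f) \<Rightarrow> ('a, 'c) module \<Rightarrow> nat
   \<Rightarrow> ('f \<Rightarrow> 'c) set" where
  "coboundaries R F d X i = (case i of
       0 \<Rightarrow> {\<zero>\<^bsub>Hom_mod R (F 0) X\<^esub>}
     | Suc j \<Rightarrow> (\<lambda>f. \<lambda>x\<in>carrier (F (Suc j)). f (d (Suc j) x)) ` carrier (Hom_mod R (F j) X))"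

definition Ext ::
  "('a, 'r) ring_scheme \<Rightarrow> nat \<Rightarrow> ('a, 'b) module \<Rightarrow> ('a, 'c) module
   \<Rightarrow> ('a, ((nat \<Rightarrow> 'a) \<Rightarrow> 'c) set) module" where
  "Ext R i M X = (case some_free_resolution R M of (F, d) \<Rightarrow>
     quot_mod ((Hom_mod R (F i) X)\<lparr>carrier := cocycles R F d X i\<rparr>) (coboundaries R F d X i))"


section \<open>Grade and Gorenstein dimension\<close>

definition grade :: "('a, 'r) ring_scheme \<Rightarrow> ('a, 'b) module \<Rightarrow> enat" where
  "grade R M = Inf {enat i | i. \<not> zero_mod (Ext R i M (ring_mod R))}"

definition bidual_map ::
  "('a, 'r) ring_scheme \<Rightarrow> ('a, 'b) module \<Rightarrow> 'b \<Rightarrow> ('b \<Rightarrow> 'a) \<Rightarrow> 'a" where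
  "bidual_map R G x = (\<lambda>f\<in>carrier (dual_mod R G). f x)"

definition totally_reflexive :: "('a, 'r) ring_scheme \<Rightarrow> ('a, 'b) module \<Rightarrow> bool" where
  "totally_reflexive R G \<longleftrightarrow> fg_module R G \<and>
     bidual_map R G \<in> mod_iso R G (dual_mod R (dual_mod R G)) \<and>
     (\<forall>i>0. zero_mod (Ext R i G (ring_mod R)) \<and> zero_mod (Ext R i (dual_mod R G) (ring_mod R)))"

(* An exact sequence 0 --> G n --> ... --> G 0 --> M --> 0 is encoded as a resolution of M
   with G i = 0 for i > n. The infimum of the empty set of extended naturals is \<infinity>. *)
definition G_dim :: "('a, 'r) ring_scheme \<Rightarrow> ('a, 'b) module \<Rightarrow> enat" where
  "G_dim R M = Inf {enat n | n.
     \<exists>(G :: nat \<Rightarrow> ('a, (nat \<Rightarrow> 'a) set) module) d e. resolution R M G d e \<and>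
       (\<forall>i\<le>n. totally_reflexive R (G i)) \<and> (\<forall>i>n. zero_mod (G i))}"

definition G_perfect :: "('a, 'r) ring_scheme \<Rightarrow> ('a, 'b) module \<Rightarrow> bool" where
  "G_perfect R M \<longleftrightarrow> fg_module R M \<and> \<not> zero_mod M \<and> G_dim R M = grade R M"


section \<open>Periodicity\<close>

definition complex_isomorphic ::
  "('a, 'r) ring_scheme \<Rightarrow> (nat \<Rightarrow> ('a, 'f) module) \<Rightarrow> (nat \<Rightarrow> 'f \<Rightarrow> 'f)
   \<Rightarrow> (nat \<Rightarrow> ('a, 'g) module) \<Rightarrow> (nat \<Rightarrow> 'g \<Rightarrow> 'g) \<Rightarrow> bool" where
  "complex_isomorphic R F d G \<delta> \<longleftrightarrow>
     (\<exists>\<theta>. (\<forall>k. \<theta> k \<in> mod_iso R (F k) (G k)) \<and>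
          (\<forall>k. \<forall>x\<in>carrier (F (Suc k)). \<theta> k (d (Suc k) x) = \<delta> (Suc k) (\<theta> (Suc k) x)))"

(* F is isomorphic to a complex G that from degree n upward repeats the block
   F (n + a - 1), ..., F n. The first map of the block that is repeated is
   \<delta> (n + 1) : G (n + 1) --> G n; the map out of G (n + a) is \<delta> (n + a), which goes to
   G (n + a - 1), and it need not agree with \<delta> n : G n --> G (n - 1). *)
definition eventually_periodic ::
  "('a, 'r) ring_scheme \<Rightarrow> (nat \<Rightarrow> ('a, 'f) module) \<Rightarrow> (nat \<Rightarrow> 'f \<Rightarrow> 'f) \<Rightarrow> nat \<Rightarrow> bool" where
  "eventually_periodic R F d a \<longleftrightarrow> a > 0 \<and>
     (\<exists>n (G :: nat \<Rightarrow> ('a, 'f) module) \<delta>.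
        (\<forall>k. module R (G k)) \<and>
        (\<forall>k. \<delta> (Suc k) \<in> mod_hom R (G (Suc k)) (G k)) \<and>
        complex_isomorphic R F d G \<delta> \<and>
        (\<forall>k. n \<le> k \<and> k < n + a \<longrightarrow> G k = F k) \<and>
        (\<forall>k\<ge>n. G (k + a) = G k) \<and>
        (\<forall>k>n. \<forall>x\<in>carrier (G k). \<delta> (k + a) x = \<delta> k x))"

end

theory Submission
  imports Defs
begin

text \<open>Call a homomorphism stably zero if it has finite rank, that is, if it factors through a finite free
  module. The relation \<open>\<approx>\<close> is isomorphism in the resulting stable category. Syzygies and duals
  are functors there, and \<open>\<Omega>X \<approx> \<Omega>Y\<close> implies \<open>X \<approx> Y\<close> when
  \<open>Ext\<^sup>1(X, R) = Ext\<^sup>1(Y, R) = 0\<close>, because then maps between syzygies extend to the covers.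

  The module \<open>K = \<Omega>\<^sup>gM\<close> is totally reflexive. The dual of a free resolution of \<open>M\<close> is exact below
  degree \<open>g\<close>, so \<open>N\<close> is the quotient of \<open>K\<^sup>*\<close> by a module of projective dimension less than \<open>g\<close>,
  and \<open>\<Omega>\<^sup>iN \<approx> \<Omega>\<^sup>iK\<^sup>*\<close> for \<open>i \<ge> g\<close>. Hence \<open>X = (\<Omega>\<^sup>iN)\<^sup>*\<close> is totally reflexive
  and \<open>\<Omega>\<^sup>iX \<approx> K\<close>.

  If \<open>F\<close> is eventually periodic, then \<open>X\<close> and \<open>\<Omega>\<^sup>s M\<close> with \<open>s = g + ma - i\<close> have the same high syzygies,
  and these determine totally reflexive modules stably. Conversely, \<open>X \<approx> \<Omega>\<^sup>jM\<close> gives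
  \<open>K \<approx> \<Omega>\<^bsup>i+j\<^esup>M\<close>; over a local ring, Nakayama's lemma turns a stable isomorphism into an
  isomorphism of the minimal resolutions from the second syzygies on.\<close>

section \<open>Modules and homomorphisms\<close>

text \<open>Two numerical conditions of the theorem are degree bounds. Since i is at most m a, the
  index g + m a - i is at least g, so the syzygy of M in that degree is a syzygy of K and, like X,
  has vanishing Ext; only then can X be compared with it through high syzygies. Since i is at least
  g, the module of projective dimension below g disappears from \<Omega>^i N. The definition of
  \<open>Ext\<close> picks one resolution, of which only the defining property is known. Vanishing
  of Ext is therefore restated as the extension of functionals from a syzygy to its cover, a
  property that passes to every other cover and along stable isomorphisms. Sequences are compared by
  pullbacks over a cover, not by long exact sequences of Ext. A map of first syzygies comes out
  invertible only modulo the maximal ideal, and endomorphisms congruent to the identity are shown to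
  be injective only on projective modules; genuine isomorphisms are therefore read off one step
  further down. The delay is harmless, as periodicity may start in any degree.\<close>

lemma mod_homI:
  assumes "\<And>x. x \<in> carrier M \<Longrightarrow> h x \<in> carrier N"
    and "\<And>x y. x \<in> carrier M \<Longrightarrow> y \<in> carrier M \<Longrightarrow> h (x \<oplus>\<^bsub>M\<^esub> y) = h x \<oplus>\<^bsub>N\<^esub> h y"
    and "\<And>a x. a \<in> carrier R \<Longrightarrow> x \<in> carrier M \<Longrightarrow> h (a \<odot>\<^bsub>M\<^esub> x) = a \<odot>\<^bsub>N\<^esub> h x"
  shows "h \<in> mod_hom R M N"
  using assms by (auto simp: mod_hom_def)

lemma mod_hom_closed [intro]: "h \<in> mod_hom R M N \<Longrightarrow> x \<in> carrier M \<Longrightarrow> h x \<in> carrier N"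
  and mod_hom_add: "h \<in> mod_hom R M N \<Longrightarrow> x \<in> carrier M \<Longrightarrow> y \<in> carrier M \<Longrightarrow>
    h (x \<oplus>\<^bsub>M\<^esub> y) = h x \<oplus>\<^bsub>N\<^esub> h y"
  and mod_hom_smult: "h \<in> mod_hom R M N \<Longrightarrow> a \<in> carrier R \<Longrightarrow> x \<in> carrier M \<Longrightarrow>
    h (a \<odot>\<^bsub>M\<^esub> x) = a \<odot>\<^bsub>N\<^esub> h x"
  by (auto simp: mod_hom_def)

lemma mod_hom_comp: "f \<in> mod_hom R A B \<Longrightarrow> g \<in> mod_hom R B C \<Longrightarrow> (\<lambda>x. g (f x)) \<in> mod_hom R A C"
  by (rule mod_homI) (auto simp: mod_hom_add mod_hom_smult mod_hom_closed)

lemma mod_hom_id: "(\<lambda>x. x) \<in> mod_hom R A A"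
  by (rule mod_homI) auto

lemma ring_mod_simps [simp]: "carrier (ring_mod R) = carrier R" "zero (ring_mod R) = zero R"
  "add (ring_mod R) = add R" "smult (ring_mod R) = mult R"
  by (auto simp: ring_mod_def)

lemma a_kernel_eq: "a_kernel M N h = {x \<in> carrier M. h x = \<zero>\<^bsub>N\<^esub>}"
  by (simp add: a_kernel_def kernel_def)

text \<open>The same record update as in the definition of \<open>Ext\<close>, so that the cocycles
  with their inherited operations are literally a \<open>sub_mod\<close>.\<close>

definition sub_mod :: "('a, 'b) module \<Rightarrow> 'b set \<Rightarrow> ('a, 'b) module" where
  "sub_mod M H = M\<lparr>carrier := H\<rparr>"

lemma sub_mod_simps [simp]: "carrier (sub_mod M H) = H" "zero (sub_mod M H) = zero M"
  "add (sub_mod M H) = add M" "smult (sub_mod M H) = smult M"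
  by (auto simp: sub_mod_def)

lemma dsum_mod_simps [simp]: "carrier (dsum_mod M N) = carrier M \<times> carrier N"
  "zero (dsum_mod M N) = (\<zero>\<^bsub>M\<^esub>, \<zero>\<^bsub>N\<^esub>)"
  "add (dsum_mod M N) = (\<lambda>x y. (fst x \<oplus>\<^bsub>M\<^esub> fst y, snd x \<oplus>\<^bsub>N\<^esub> snd y))"
  "smult (dsum_mod M N) = (\<lambda>a x. (a \<odot>\<^bsub>M\<^esub> fst x, a \<odot>\<^bsub>N\<^esub> snd x))"
  by (auto simp: dsum_mod_def)

lemma free_mod_simps [simp]: "carrier (free_mod R n) = {..<n} \<rightarrow>\<^sub>E carrier R"
  "zero (free_mod R n) = (\<lambda>i\<in>{..<n}. \<zero>\<^bsub>R\<^esub>)"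
  "add (free_mod R n) = (\<lambda>x y. \<lambda>i\<in>{..<n}. x i \<oplus>\<^bsub>R\<^esub> y i)"
  "smult (free_mod R n) = (\<lambda>a x. \<lambda>i\<in>{..<n}. a \<otimes>\<^bsub>R\<^esub> x i)"
  by (auto simp: free_mod_def)

lemma dual_mod_simps [simp]:
  "carrier (dual_mod R M) = mod_hom R M (ring_mod R) \<inter> extensional (carrier M)"
  "zero (dual_mod R M) = (\<lambda>x\<in>carrier M. \<zero>\<^bsub>R\<^esub>)"
  "add (dual_mod R M) = (\<lambda>f g. \<lambda>x\<in>carrier M. f x \<oplus>\<^bsub>R\<^esub> g x)"
  "smult (dual_mod R M) = (\<lambda>a f. \<lambda>x\<in>carrier M. a \<otimes>\<^bsub>R\<^esub> f x)"
  by (auto simp: dual_mod_def Hom_mod_def)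

lemma mod_isoI:
  assumes "f \<in> mod_hom R X Y" "g \<in> mod_hom R Y X" "\<And>x. x \<in> carrier X \<Longrightarrow> g (f x) = x"
    "\<And>y. y \<in> carrier Y \<Longrightarrow> f (g y) = y"
  shows "f \<in> mod_iso R X Y"
proof -
  have "bij_betw f (carrier X) (carrier Y)"
    by (rule bij_betw_byWitness[where f' = g])
      (use assms in \<open>auto simp: mod_hom_closed\<close>)
  then show ?thesis using assms(1) by (simp add: mod_iso_def)
qed

lemma mod_iso_inverse:
  assumes "f \<in> mod_iso R X Y"
    and cl: "\<And>x y. x \<in> carrier X \<Longrightarrow> y \<in> carrier X \<Longrightarrow> x \<oplus>\<^bsub>X\<^esub> y \<in> carrier X"
      "\<And>a x. a \<in> carrier R \<Longrightarrow> x \<in> carrier X \<Longrightarrow> a \<odot>\<^bsub>X\<^esub> x \<in> carrier X"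
  obtains g where "g \<in> mod_hom R Y X" "\<And>x. x \<in> carrier X \<Longrightarrow> g (f x) = x"
    "\<And>y. y \<in> carrier Y \<Longrightarrow> f (g y) = y"
proof
  let ?g = "inv_into (carrier X) f"
  have f: "f \<in> mod_hom R X Y" and b: "bij_betw f (carrier X) (carrier Y)"
    using assms(1) by (auto simp: mod_iso_def)
  show 1: "?g (f x) = x" if "x \<in> carrier X" for x
    using b that by (simp add: bij_betw_inv_into_left)
  show 2: "f (?g y) = y" if "y \<in> carrier Y" for y
    using b that by (simp add: bij_betw_inv_into_right)
  have c: "?g y \<in> carrier X" if "y \<in> carrier Y" for y
    using b that by (metis bij_betw_imp_surj_on inv_into_into)
  show "?g \<in> mod_hom R Y X"
  proof (rule mod_homI)
    fix x y assume *: "x \<in> carrier Y" "y \<in> carrier Y"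
    have "x \<oplus>\<^bsub>Y\<^esub> y = f (?g x \<oplus>\<^bsub>X\<^esub> ?g y)" using * c 2 f by (simp add: mod_hom_add)
    then show "?g (x \<oplus>\<^bsub>Y\<^esub> y) = ?g x \<oplus>\<^bsub>X\<^esub> ?g y" using * c cl 1 by simp
  next
    fix a x assume *: "a \<in> carrier R" "x \<in> carrier Y"
    have "a \<odot>\<^bsub>Y\<^esub> x = f (a \<odot>\<^bsub>X\<^esub> ?g x)" using * c 2 f by (simp add: mod_hom_smult)
    then show "?g (a \<odot>\<^bsub>Y\<^esub> x) = a \<odot>\<^bsub>X\<^esub> ?g x" using * c cl 1 by simp
  qed (rule c)
qed

context cring begin

section \<open>Arithmetic of modules over a fixed commutative ring\<close>

abbreviation "Modl M \<equiv> module R M"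
abbreviation "Hm M N \<equiv> mod_hom R M N"
abbreviation "RR \<equiv> ring_mod R"
abbreviation dual (\<open>_\<^sup>\<star>\<close> [1000] 999) where "dual M \<equiv> dual_mod R M"

lemma Mod_ag: "Modl M \<Longrightarrow> abelian_group M"
  by (simp add: module_def)

lemma Mod_simps [simp]:
  assumes "Modl M"
  shows "\<zero>\<^bsub>M\<^esub> \<in> carrier M"
    "x \<in> carrier M \<Longrightarrow> y \<in> carrier M \<Longrightarrow> x \<oplus>\<^bsub>M\<^esub> y \<in> carrier M"
    "a \<in> carrier R \<Longrightarrow> x \<in> carrier M \<Longrightarrow> a \<odot>\<^bsub>M\<^esub> x \<in> carrier M"
    "x \<in> carrier M \<Longrightarrow> \<ominus>\<^bsub>M\<^esub> x \<in> carrier M"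
    "x \<in> carrier M \<Longrightarrow> y \<in> carrier M \<Longrightarrow> x \<ominus>\<^bsub>M\<^esub> y \<in> carrier M"
    "x \<in> carrier M \<Longrightarrow> \<zero>\<^bsub>M\<^esub> \<oplus>\<^bsub>M\<^esub> x = x"
    "x \<in> carrier M \<Longrightarrow> x \<oplus>\<^bsub>M\<^esub> \<zero>\<^bsub>M\<^esub> = x"
    "x \<in> carrier M \<Longrightarrow> x \<ominus>\<^bsub>M\<^esub> x = \<zero>\<^bsub>M\<^esub>"
    "x \<in> carrier M \<Longrightarrow> \<one> \<odot>\<^bsub>M\<^esub> x = x"
    "x \<in> carrier M \<Longrightarrow> \<zero> \<odot>\<^bsub>M\<^esub> x = \<zero>\<^bsub>M\<^esub>"
    "a \<in> carrier R \<Longrightarrow> a \<odot>\<^bsub>M\<^esub> \<zero>\<^bsub>M\<^esub> = \<zero>\<^bsub>M\<^esub>"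
    "\<ominus>\<^bsub>M\<^esub> \<zero>\<^bsub>M\<^esub> = \<zero>\<^bsub>M\<^esub>"
proof -
  interpret module R M by fact
  show "\<zero>\<^bsub>M\<^esub> \<in> carrier M"
    "x \<in> carrier M \<Longrightarrow> y \<in> carrier M \<Longrightarrow> x \<oplus>\<^bsub>M\<^esub> y \<in> carrier M"
    "a \<in> carrier R \<Longrightarrow> x \<in> carrier M \<Longrightarrow> a \<odot>\<^bsub>M\<^esub> x \<in> carrier M"
    "x \<in> carrier M \<Longrightarrow> \<ominus>\<^bsub>M\<^esub> x \<in> carrier M"
    "x \<in> carrier M \<Longrightarrow> y \<in> carrier M \<Longrightarrow> x \<ominus>\<^bsub>M\<^esub> y \<in> carrier M"
    "x \<in> carrier M \<Longrightarrow> \<zero>\<^bsub>M\<^esub> \<oplus>\<^bsub>M\<^esub> x = x"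
    "x \<in> carrier M \<Longrightarrow> x \<oplus>\<^bsub>M\<^esub> \<zero>\<^bsub>M\<^esub> = x"
    "x \<in> carrier M \<Longrightarrow> x \<ominus>\<^bsub>M\<^esub> x = \<zero>\<^bsub>M\<^esub>"
    "x \<in> carrier M \<Longrightarrow> \<one> \<odot>\<^bsub>M\<^esub> x = x"
    "x \<in> carrier M \<Longrightarrow> \<zero> \<odot>\<^bsub>M\<^esub> x = \<zero>\<^bsub>M\<^esub>"
    "a \<in> carrier R \<Longrightarrow> a \<odot>\<^bsub>M\<^esub> \<zero>\<^bsub>M\<^esub> = \<zero>\<^bsub>M\<^esub>"
    "\<ominus>\<^bsub>M\<^esub> \<zero>\<^bsub>M\<^esub> = \<zero>\<^bsub>M\<^esub>"
    by (simp_all add: M.minus_eq M.r_neg)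
qed

lemma Mod_arith:
  assumes "Modl M"
  shows "x \<ominus>\<^bsub>M\<^esub> y = x \<oplus>\<^bsub>M\<^esub> (\<ominus>\<^bsub>M\<^esub> y)"
    "x \<in> carrier M \<Longrightarrow> y \<in> carrier M \<Longrightarrow> x \<oplus>\<^bsub>M\<^esub> y = y \<oplus>\<^bsub>M\<^esub> x"
    "x \<in> carrier M \<Longrightarrow> y \<in> carrier M \<Longrightarrow> z \<in> carrier M \<Longrightarrow>
      x \<oplus>\<^bsub>M\<^esub> y \<oplus>\<^bsub>M\<^esub> z = x \<oplus>\<^bsub>M\<^esub> (y \<oplus>\<^bsub>M\<^esub> z)"
    "x \<in> carrier M \<Longrightarrow> y \<in> carrier M \<Longrightarrow> z \<in> carrier M \<Longrightarrow>
      x \<oplus>\<^bsub>M\<^esub> (y \<oplus>\<^bsub>M\<^esub> z) = y \<oplus>\<^bsub>M\<^esub> (x \<oplus>\<^bsub>M\<^esub> z)"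
    "x \<in> carrier M \<Longrightarrow> y \<in> carrier M \<Longrightarrow> \<ominus>\<^bsub>M\<^esub> (x \<oplus>\<^bsub>M\<^esub> y) = \<ominus>\<^bsub>M\<^esub> x \<oplus>\<^bsub>M\<^esub> \<ominus>\<^bsub>M\<^esub> y"
    "x \<in> carrier M \<Longrightarrow> y \<in> carrier M \<Longrightarrow> x \<oplus>\<^bsub>M\<^esub> (\<ominus>\<^bsub>M\<^esub> x \<oplus>\<^bsub>M\<^esub> y) = y"
    "x \<in> carrier M \<Longrightarrow> y \<in> carrier M \<Longrightarrow> \<ominus>\<^bsub>M\<^esub> x \<oplus>\<^bsub>M\<^esub> (x \<oplus>\<^bsub>M\<^esub> y) = y"
    "x \<in> carrier M \<Longrightarrow> x \<oplus>\<^bsub>M\<^esub> \<ominus>\<^bsub>M\<^esub> x = \<zero>\<^bsub>M\<^esub>"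
    "x \<in> carrier M \<Longrightarrow> \<ominus>\<^bsub>M\<^esub> x \<oplus>\<^bsub>M\<^esub> x = \<zero>\<^bsub>M\<^esub>"
    "x \<in> carrier M \<Longrightarrow> \<ominus>\<^bsub>M\<^esub> (\<ominus>\<^bsub>M\<^esub> x) = x"
    "a \<in> carrier R \<Longrightarrow> x \<in> carrier M \<Longrightarrow> y \<in> carrier M \<Longrightarrow>
      a \<odot>\<^bsub>M\<^esub> (x \<oplus>\<^bsub>M\<^esub> y) = a \<odot>\<^bsub>M\<^esub> x \<oplus>\<^bsub>M\<^esub> a \<odot>\<^bsub>M\<^esub> y"
    "a \<in> carrier R \<Longrightarrow> b \<in> carrier R \<Longrightarrow> x \<in> carrier M \<Longrightarrow>
      (a \<oplus> b) \<odot>\<^bsub>M\<^esub> x = a \<odot>\<^bsub>M\<^esub> x \<oplus>\<^bsub>M\<^esub> b \<odot>\<^bsub>M\<^esub> x"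
    "a \<in> carrier R \<Longrightarrow> b \<in> carrier R \<Longrightarrow> x \<in> carrier M \<Longrightarrow>
      (a \<otimes> b) \<odot>\<^bsub>M\<^esub> x = a \<odot>\<^bsub>M\<^esub> (b \<odot>\<^bsub>M\<^esub> x)"
    "a \<in> carrier R \<Longrightarrow> x \<in> carrier M \<Longrightarrow> a \<odot>\<^bsub>M\<^esub> (\<ominus>\<^bsub>M\<^esub> x) = \<ominus>\<^bsub>M\<^esub> (a \<odot>\<^bsub>M\<^esub> x)"
    "a \<in> carrier R \<Longrightarrow> x \<in> carrier M \<Longrightarrow> (\<ominus> a) \<odot>\<^bsub>M\<^esub> x = \<ominus>\<^bsub>M\<^esub> (a \<odot>\<^bsub>M\<^esub> x)"
proof -
  interpret module R M by fact
  show "x \<ominus>\<^bsub>M\<^esub> y = x \<oplus>\<^bsub>M\<^esub> (\<ominus>\<^bsub>M\<^esub> y)"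
    "x \<in> carrier M \<Longrightarrow> y \<in> carrier M \<Longrightarrow> x \<oplus>\<^bsub>M\<^esub> y = y \<oplus>\<^bsub>M\<^esub> x"
    "x \<in> carrier M \<Longrightarrow> y \<in> carrier M \<Longrightarrow> z \<in> carrier M \<Longrightarrow>
      x \<oplus>\<^bsub>M\<^esub> y \<oplus>\<^bsub>M\<^esub> z = x \<oplus>\<^bsub>M\<^esub> (y \<oplus>\<^bsub>M\<^esub> z)"
    "x \<in> carrier M \<Longrightarrow> y \<in> carrier M \<Longrightarrow> z \<in> carrier M \<Longrightarrow>
      x \<oplus>\<^bsub>M\<^esub> (y \<oplus>\<^bsub>M\<^esub> z) = y \<oplus>\<^bsub>M\<^esub> (x \<oplus>\<^bsub>M\<^esub> z)"
    "x \<in> carrier M \<Longrightarrow> y \<in> carrier M \<Longrightarrow> \<ominus>\<^bsub>M\<^esub> (x \<oplus>\<^bsub>M\<^esub> y) = \<ominus>\<^bsub>M\<^esub> x \<oplus>\<^bsub>M\<^esub> \<ominus>\<^bsub>M\<^esub> y"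
    "x \<in> carrier M \<Longrightarrow> y \<in> carrier M \<Longrightarrow> x \<oplus>\<^bsub>M\<^esub> (\<ominus>\<^bsub>M\<^esub> x \<oplus>\<^bsub>M\<^esub> y) = y"
    "x \<in> carrier M \<Longrightarrow> y \<in> carrier M \<Longrightarrow> \<ominus>\<^bsub>M\<^esub> x \<oplus>\<^bsub>M\<^esub> (x \<oplus>\<^bsub>M\<^esub> y) = y"
    "x \<in> carrier M \<Longrightarrow> x \<oplus>\<^bsub>M\<^esub> \<ominus>\<^bsub>M\<^esub> x = \<zero>\<^bsub>M\<^esub>"
    "x \<in> carrier M \<Longrightarrow> \<ominus>\<^bsub>M\<^esub> x \<oplus>\<^bsub>M\<^esub> x = \<zero>\<^bsub>M\<^esub>"
    "x \<in> carrier M \<Longrightarrow> \<ominus>\<^bsub>M\<^esub> (\<ominus>\<^bsub>M\<^esub> x) = x"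
    by (simp_all add: M.minus_eq M.r_neg1 M.r_neg2 M.r_neg M.l_neg)
      (simp_all add: M.minus_add M.a_ac)
qed (use assms in \<open>simp_all add: module.smult_l_distr module.smult_r_distr module.smult_assoc1
      module.smult_r_minus module.smult_l_minus\<close>)

lemma Mod_eqI: "Modl M \<Longrightarrow> x \<in> carrier M \<Longrightarrow> y \<in> carrier M \<Longrightarrow> x \<ominus>\<^bsub>M\<^esub> y = \<zero>\<^bsub>M\<^esub> \<Longrightarrow> x = y"
proof -
  assume *: "Modl M" "x \<in> carrier M" "y \<in> carrier M" "x \<ominus>\<^bsub>M\<^esub> y = \<zero>\<^bsub>M\<^esub>"
  have "(x \<ominus>\<^bsub>M\<^esub> y) \<oplus>\<^bsub>M\<^esub> y = x"
    using *(1-3) by (simp add: Mod_arith(1)[OF *(1)] Mod_arith(3,9)[OF *(1)])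
  then show "x = y" using * by simp
qed

text \<open>Multiplication by -1 provides the additive inverses; for this it suffices that 0
  annihilates every element, which is the last assumption.\<close>

lemma ModI:
  assumes "\<And>x y. x \<in> carrier M \<Longrightarrow> y \<in> carrier M \<Longrightarrow> x \<oplus>\<^bsub>M\<^esub> y \<in> carrier M"
    "\<zero>\<^bsub>M\<^esub> \<in> carrier M"
    "\<And>x y z. x \<in> carrier M \<Longrightarrow> y \<in> carrier M \<Longrightarrow> z \<in> carrier M \<Longrightarrow>
      (x \<oplus>\<^bsub>M\<^esub> y) \<oplus>\<^bsub>M\<^esub> z = x \<oplus>\<^bsub>M\<^esub> (y \<oplus>\<^bsub>M\<^esub> z)"
    "\<And>x y. x \<in> carrier M \<Longrightarrow> y \<in> carrier M \<Longrightarrow> x \<oplus>\<^bsub>M\<^esub> y = y \<oplus>\<^bsub>M\<^esub> x"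
    "\<And>x. x \<in> carrier M \<Longrightarrow> \<zero>\<^bsub>M\<^esub> \<oplus>\<^bsub>M\<^esub> x = x"
    "\<And>a x. a \<in> carrier R \<Longrightarrow> x \<in> carrier M \<Longrightarrow> a \<odot>\<^bsub>M\<^esub> x \<in> carrier M"
    "\<And>a b x. a \<in> carrier R \<Longrightarrow> b \<in> carrier R \<Longrightarrow> x \<in> carrier M \<Longrightarrow>
      (a \<oplus> b) \<odot>\<^bsub>M\<^esub> x = a \<odot>\<^bsub>M\<^esub> x \<oplus>\<^bsub>M\<^esub> b \<odot>\<^bsub>M\<^esub> x"
    "\<And>a x y. a \<in> carrier R \<Longrightarrow> x \<in> carrier M \<Longrightarrow> y \<in> carrier M \<Longrightarrow>
      a \<odot>\<^bsub>M\<^esub> (x \<oplus>\<^bsub>M\<^esub> y) = a \<odot>\<^bsub>M\<^esub> x \<oplus>\<^bsub>M\<^esub> a \<odot>\<^bsub>M\<^esub> y"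
    "\<And>a b x. a \<in> carrier R \<Longrightarrow> b \<in> carrier R \<Longrightarrow> x \<in> carrier M \<Longrightarrow>
      (a \<otimes> b) \<odot>\<^bsub>M\<^esub> x = a \<odot>\<^bsub>M\<^esub> (b \<odot>\<^bsub>M\<^esub> x)"
    "\<And>x. x \<in> carrier M \<Longrightarrow> \<one> \<odot>\<^bsub>M\<^esub> x = x"
    "\<And>x. x \<in> carrier M \<Longrightarrow> \<zero> \<odot>\<^bsub>M\<^esub> x = \<zero>\<^bsub>M\<^esub>"
  shows "Modl M"
proof (rule moduleI)
  show "cring R" by (rule is_cring)
  show "abelian_group M"
  proof (rule abelian_groupI)
    show "\<exists>y\<in>carrier M. y \<oplus>\<^bsub>M\<^esub> x = \<zero>\<^bsub>M\<^esub>" if "x \<in> carrier M" for x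
    proof
      show "\<ominus> \<one> \<odot>\<^bsub>M\<^esub> x \<in> carrier M" using assms(6) that by simp
      have "\<ominus> \<one> \<odot>\<^bsub>M\<^esub> x \<oplus>\<^bsub>M\<^esub> x = (\<ominus> \<one> \<oplus> \<one>) \<odot>\<^bsub>M\<^esub> x"
        using assms(7)[of "\<ominus> \<one>" \<one> x] assms(10) that by simp
      then show "\<ominus> \<one> \<odot>\<^bsub>M\<^esub> x \<oplus>\<^bsub>M\<^esub> x = \<zero>\<^bsub>M\<^esub>" using assms(11) that by (simp add: l_neg)
    qed
  qed (fact assms)+
qed (fact assms)+

text \<open>The module axioms are equations and hence pass to any structure that is the image of a
  module under a map respecting the operations. Quotients and transported copies get their module
  structure in this way.\<close>

lemma Mod_surj_image:
  assumes M: "Modl M" and car: "carrier Q = f ` carrier M" and z: "\<zero>\<^bsub>Q\<^esub> = f \<zero>\<^bsub>M\<^esub>"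
    and add: "\<And>x y. x \<in> carrier M \<Longrightarrow> y \<in> carrier M \<Longrightarrow> f x \<oplus>\<^bsub>Q\<^esub> f y = f (x \<oplus>\<^bsub>M\<^esub> y)"
    and sm: "\<And>a x. a \<in> carrier R \<Longrightarrow> x \<in> carrier M \<Longrightarrow> a \<odot>\<^bsub>Q\<^esub> f x = f (a \<odot>\<^bsub>M\<^esub> x)"
  shows "Modl Q" "f \<in> Hm M Q"
proof -
  show "Modl Q"
    by (rule ModI; (unfold car z)?) (use M in \<open>auto simp: add sm Mod_arith[OF M]\<close>)
  show "f \<in> Hm M Q" by (rule mod_homI) (auto simp: car add sm)
qed

lemma Mod_RR: "Modl RR"
  by (rule ModI) (auto simp: a_ac m_ac l_distr r_distr)

lemma Mod_dsum: "Modl M \<Longrightarrow> Modl N \<Longrightarrow> Modl (dsum_mod M N)"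
  by (rule ModI) (auto simp: Mod_arith)

lemma Mod_free: "Modl (free_mod R n)"
  by (rule ModI) (auto simp: PiE_iff extensional_def fun_eq_iff a_ac m_ac l_distr r_distr)

lemma Mod_dual:
  assumes "Modl M"
  shows "Modl (M\<^sup>\<star>)"
proof (rule ModI)
  note m = assms Mod_RR
  have cl: "x \<in> carrier M \<Longrightarrow> f \<in> mod_hom R M RR \<Longrightarrow> f x \<in> carrier R" for f x
    using mod_hom_closed[of f R M RR x] by simp
  show "x \<oplus>\<^bsub>M\<^sup>\<star>\<^esub> y \<in> carrier (M\<^sup>\<star>)" if "x \<in> carrier (M\<^sup>\<star>)" "y \<in> carrier (M\<^sup>\<star>)" for x y
    using that m by (auto intro!: mod_homI simp: mod_hom_add mod_hom_smult cl a_ac r_distr)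
  show "a \<odot>\<^bsub>M\<^sup>\<star>\<^esub> x \<in> carrier (M\<^sup>\<star>)" if "a \<in> carrier R" "x \<in> carrier (M\<^sup>\<star>)" for x a
    using that m by (auto intro!: mod_homI simp: mod_hom_add mod_hom_smult cl m_ac r_distr)
  show "\<zero>\<^bsub>M\<^sup>\<star>\<^esub> \<in> carrier (M\<^sup>\<star>)" using m by (auto intro!: mod_homI)
qed (use assms in \<open>auto simp: fun_eq_iff extensional_def a_ac m_ac l_distr r_distr
    mod_hom_closed[of _ R M RR, simplified]\<close>)

lemma Mod_sub: "Modl M \<Longrightarrow> submodule H R M \<Longrightarrow> Modl (sub_mod M H)"
  unfolding sub_mod_def by (rule submodule.submodule_is_module)

lemma hom_zero [simp]: "Modl M \<Longrightarrow> Modl N \<Longrightarrow> h \<in> Hm M N \<Longrightarrow> h \<zero>\<^bsub>M\<^esub> = \<zero>\<^bsub>N\<^esub>"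
  by (metis Mod_simps(1,10) mod_hom_closed mod_hom_smult zero_closed)

lemma hom_uminus: "Modl M \<Longrightarrow> Modl N \<Longrightarrow> h \<in> Hm M N \<Longrightarrow> x \<in> carrier M \<Longrightarrow>
    h (\<ominus>\<^bsub>M\<^esub> x) = \<ominus>\<^bsub>N\<^esub> (h x)"
  by (smt (verit) Mod_arith(15) Mod_simps(9) a_inv_closed mod_hom_closed mod_hom_smult one_closed)

lemma hom_diff: "Modl M \<Longrightarrow> Modl N \<Longrightarrow> h \<in> Hm M N \<Longrightarrow> x \<in> carrier M \<Longrightarrow> y \<in> carrier M \<Longrightarrow>
    h (x \<ominus>\<^bsub>M\<^esub> y) = h x \<ominus>\<^bsub>N\<^esub> h y"
  by (simp add: Mod_arith(1) mod_hom_add hom_uminus)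

lemmas hom_simps = mod_hom_add mod_hom_smult hom_uminus hom_diff mod_hom_closed

lemma hom_const_zero: "Modl N \<Longrightarrow> (\<lambda>x. \<zero>\<^bsub>N\<^esub>) \<in> Hm M N"
  by (rule mod_homI) auto

lemma hom_plus: "Modl N \<Longrightarrow> f \<in> Hm M N \<Longrightarrow> g \<in> Hm M N \<Longrightarrow> (\<lambda>x. f x \<oplus>\<^bsub>N\<^esub> g x) \<in> Hm M N"
  by (rule mod_homI) (auto simp: hom_simps Mod_arith)

lemma hom_neg: "Modl N \<Longrightarrow> f \<in> Hm M N \<Longrightarrow> (\<lambda>x. \<ominus>\<^bsub>N\<^esub> f x) \<in> Hm M N"
  by (rule mod_homI) (auto simp: hom_simps Mod_arith)

lemma hom_minus: "Modl N \<Longrightarrow> f \<in> Hm M N \<Longrightarrow> g \<in> Hm M N \<Longrightarrow> (\<lambda>x. f x \<ominus>\<^bsub>N\<^esub> g x) \<in> Hm M N"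
  by (rule mod_homI) (auto simp: hom_simps Mod_arith)

lemma hom_RR_closed [simp]: "\<phi> \<in> Hm M RR \<Longrightarrow> x \<in> carrier M \<Longrightarrow> \<phi> x \<in> carrier R"
  using mod_hom_closed[of \<phi> R M RR x] by simp

lemma hom_rank_one: "Modl N \<Longrightarrow> \<phi> \<in> Hm M RR \<Longrightarrow> y \<in> carrier N \<Longrightarrow> (\<lambda>x. \<phi> x \<odot>\<^bsub>N\<^esub> y) \<in> Hm M N"
  by (rule mod_homI) (auto simp: hom_simps Mod_arith)

lemma hom_restrict: "Modl M \<Longrightarrow> f \<in> Hm M N \<Longrightarrow> restrict f (carrier M) \<in> Hm M N"
  by (rule mod_homI) (auto simp: hom_simps)

lemma hom_cong: "Modl M \<Longrightarrow> f \<in> Hm M N \<Longrightarrow> (\<And>x. x \<in> carrier M \<Longrightarrow> g x = f x) \<Longrightarrow> g \<in> Hm M N"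
  by (rule mod_homI) (auto simp: hom_simps)

lemma submodI:
  assumes "Modl M" "H \<subseteq> carrier M" "\<zero>\<^bsub>M\<^esub> \<in> H"
    "\<And>x y. x \<in> H \<Longrightarrow> y \<in> H \<Longrightarrow> x \<oplus>\<^bsub>M\<^esub> y \<in> H" "\<And>a x. a \<in> carrier R \<Longrightarrow> x \<in> H \<Longrightarrow> a \<odot>\<^bsub>M\<^esub> x \<in> H"
  shows "submodule H R M"
proof (rule module.submoduleI[OF assms(1-3) _ assms(4,5)])
  fix x assume "x \<in> H"
  then have "\<ominus>\<^bsub>M\<^esub> x = \<ominus> \<one> \<odot>\<^bsub>M\<^esub> x" using assms by (auto simp: Mod_arith)
  then show "\<ominus>\<^bsub>M\<^esub> x \<in> H" using assms(5) \<open>x \<in> H\<close> by simp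
qed auto

lemma submodD:
  assumes "Modl M" "submodule H R M"
  shows "H \<subseteq> carrier M" "\<zero>\<^bsub>M\<^esub> \<in> H" "x \<in> H \<Longrightarrow> y \<in> H \<Longrightarrow> x \<oplus>\<^bsub>M\<^esub> y \<in> H"
    "a \<in> carrier R \<Longrightarrow> x \<in> H \<Longrightarrow> a \<odot>\<^bsub>M\<^esub> x \<in> H" "x \<in> H \<Longrightarrow> \<ominus>\<^bsub>M\<^esub> x \<in> H"
    "x \<in> H \<Longrightarrow> y \<in> H \<Longrightarrow> x \<ominus>\<^bsub>M\<^esub> y \<in> H"
  using module.submoduleE[OF assms] subgroup.one_closed[OF submodule.axioms(1)[OF assms(2)]]
  by (auto simp: Mod_arith(1)[OF assms(1)])

lemma submod_kernel: "Modl M \<Longrightarrow> Modl N \<Longrightarrow> h \<in> Hm M N \<Longrightarrow> submodule (a_kernel M N h) R M"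
  by (rule submodI) (auto simp: a_kernel_eq hom_simps)

lemma submod_image:
  assumes "Modl M" "Modl N" "h \<in> Hm M N"
  shows "submodule (h ` carrier M) R N"
proof (rule submodI[OF assms(2)])
  show "\<zero>\<^bsub>N\<^esub> \<in> h ` carrier M" using assms by (metis Mod_simps(1) hom_zero imageI)
qed (use assms in \<open>auto simp: mod_hom_closed simp flip: mod_hom_add mod_hom_smult\<close>)

lemma submod_vimage: "Modl M \<Longrightarrow> Modl N \<Longrightarrow> h \<in> Hm M N \<Longrightarrow> submodule H R N \<Longrightarrow>
    submodule {x \<in> carrier M. h x \<in> H} R M"
  by (rule submodI) (auto simp: hom_simps submodD)

lemma hom_sub_incl: "Modl M \<Longrightarrow> H \<subseteq> carrier M \<Longrightarrow> (\<lambda>x. x) \<in> Hm (sub_mod M H) M"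
  by (rule mod_homI) auto

lemma hom_to_sub: "h \<in> Hm M N \<Longrightarrow> (\<And>x. x \<in> carrier M \<Longrightarrow> h x \<in> H) \<Longrightarrow> h \<in> Hm M (sub_mod N H)"
  by (rule mod_homI) (auto simp: hom_simps)

lemma hom_from_sub: "h \<in> Hm M N \<Longrightarrow> H \<subseteq> carrier M \<Longrightarrow> h \<in> Hm (sub_mod M H) N"
  by (rule mod_homI) (auto simp: hom_simps subsetD)

lemma hom_fst: "fst \<in> Hm (dsum_mod M N) M" and hom_snd: "snd \<in> Hm (dsum_mod M N) N"
  by (auto intro!: mod_homI)

lemma hom_pair: "f \<in> Hm X M \<Longrightarrow> g \<in> Hm X N \<Longrightarrow> (\<lambda>x. (f x, g x)) \<in> Hm X (dsum_mod M N)"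
  by (rule mod_homI) (auto simp: hom_simps)

lemma hom_copair:
  assumes "f \<in> Hm M X" "g \<in> Hm N X" "Modl X"
  shows "(\<lambda>x. f (fst x) \<oplus>\<^bsub>X\<^esub> g (snd x)) \<in> Hm (dsum_mod M N) X"
  by (rule hom_plus[OF assms(3) mod_hom_comp[OF hom_fst assms(1)] mod_hom_comp[OF hom_snd assms(2)]])

text \<open>Two preimages of one element differ by an element of the kernel of \<open>p\<close>,
  which \<open>h\<close> kills. So \<open>h\<close> may be evaluated at an arbitrarily chosen
  preimage, and the result is additive although the choice is not.\<close>

lemma hom_factor_surj:
  assumes m: "Modl A" "Modl B" "Modl C" and p: "p \<in> Hm A B" "p ` carrier A = carrier B"
    and h: "h \<in> Hm A C" and k: "\<And>x. x \<in> carrier A \<Longrightarrow> p x = \<zero>\<^bsub>B\<^esub> \<Longrightarrow> h x = \<zero>\<^bsub>C\<^esub>"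
  obtains f where "f \<in> Hm B C" "\<And>x. x \<in> carrier A \<Longrightarrow> f (p x) = h x"
proof -
  define s where "s y = (SOME x. x \<in> carrier A \<and> p x = y)" for y
  have s: "s y \<in> carrier A" "p (s y) = y" if "y \<in> carrier B" for y
  proof -
    have "y \<in> p ` carrier A" using p(2) that by simp
    then have "\<exists>x. x \<in> carrier A \<and> p x = y" by auto
    from someI_ex[OF this] show "s y \<in> carrier A" "p (s y) = y" by (simp_all add: s_def)
  qed
  have eq: "h (s (p x)) = h x" if "x \<in> carrier A" for x
  proof (rule Mod_eqI[OF m(3)])
    have px: "p x \<in> carrier B" using p that by auto
    have "h (s (p x) \<ominus>\<^bsub>A\<^esub> x) = \<zero>\<^bsub>C\<^esub>"
      by (rule k) (use m p s[OF px] that px in \<open>auto simp: hom_diff\<close>)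
    then show "h (s (p x)) \<ominus>\<^bsub>C\<^esub> h x = \<zero>\<^bsub>C\<^esub>" using m h s[OF px] that by (simp add: hom_diff)
    show "h (s (p x)) \<in> carrier C" using h s[OF px] by (auto)
  qed (use h that in auto)
  show ?thesis
  proof
    show "(\<lambda>y. h (s y)) \<in> Hm B C"
    proof (rule mod_homI)
      fix x y assume *: "x \<in> carrier B" "y \<in> carrier B"
      then have "x \<oplus>\<^bsub>B\<^esub> y = p (s x \<oplus>\<^bsub>A\<^esub> s y)" using p s by (simp add: hom_simps)
      then show "h (s (x \<oplus>\<^bsub>B\<^esub> y)) = h (s x) \<oplus>\<^bsub>C\<^esub> h (s y)" using eq m s * h by (simp add: hom_simps)
    next
      fix a y assume *: "a \<in> carrier R" "y \<in> carrier B"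
      then have "a \<odot>\<^bsub>B\<^esub> y = p (a \<odot>\<^bsub>A\<^esub> s y)" using p s by (simp add: hom_simps)
      then show "h (s (a \<odot>\<^bsub>B\<^esub> y)) = a \<odot>\<^bsub>C\<^esub> h (s y)" using eq m s * h by (simp add: hom_simps)
    qed (use s h in auto)
  qed (use eq in auto)
qed

lemma hom_factor_inj:
  assumes m: "Modl A" "Modl P" and i: "i \<in> Hm A P" "inj_on i (carrier A)" and h: "h \<in> Hm X P"
    and im: "\<And>x. x \<in> carrier X \<Longrightarrow> h x \<in> i ` carrier A"
  obtains f where "f \<in> Hm X A" "\<And>x. x \<in> carrier X \<Longrightarrow> i (f x) = h x"
proof -
  let ?j = "inv_into (carrier A) i"
  have 1: "?j (h x) \<in> carrier A" "i (?j (h x)) = h x" if "x \<in> carrier X" for x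
    using im[OF that] by (auto simp: inv_into_into f_inv_into_f)
  have 2: "?j (i a) = a" if "a \<in> carrier A" for a using i that by simp
  show ?thesis
  proof
    show "(\<lambda>x. ?j (h x)) \<in> Hm X A"
    proof (rule mod_homI)
      fix x y assume *: "x \<in> carrier X" "y \<in> carrier X"
      then have "h (x \<oplus>\<^bsub>X\<^esub> y) = i (?j (h x) \<oplus>\<^bsub>A\<^esub> ?j (h y))" using 1 h i by (simp add: hom_simps)
      then show "?j (h (x \<oplus>\<^bsub>X\<^esub> y)) = ?j (h x) \<oplus>\<^bsub>A\<^esub> ?j (h y)" using 1 2 * m by simp
    next
      fix a x assume *: "a \<in> carrier R" "x \<in> carrier X"
      then have "h (a \<odot>\<^bsub>X\<^esub> x) = i (a \<odot>\<^bsub>A\<^esub> ?j (h x))" using 1 h i by (simp add: hom_simps)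
      then show "?j (h (a \<odot>\<^bsub>X\<^esub> x)) = a \<odot>\<^bsub>A\<^esub> ?j (h x)" using 1 2 * m by simp
    qed (use 1 in auto)
  qed (use 1 in auto)
qed

lemma inj_onI_hom:
  assumes "Modl A" "Modl B" "h \<in> Hm A B" "\<And>x. x \<in> carrier A \<Longrightarrow> h x = \<zero>\<^bsub>B\<^esub> \<Longrightarrow> x = \<zero>\<^bsub>A\<^esub>"
  shows "inj_on h (carrier A)"
proof (rule inj_onI)
  fix x y assume *: "x \<in> carrier A" "y \<in> carrier A" "h x = h y"
  then have "x \<ominus>\<^bsub>A\<^esub> y = \<zero>\<^bsub>A\<^esub>" using assms(1-3) by (intro assms(4)) (simp_all add: hom_simps)
  then show "x = y" using Mod_eqI[OF assms(1) *(1,2)] by simp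
qed

end

section \<open>Finite-rank homomorphisms and the stable category\<close>

context cring begin

text \<open>The rules of \<open>Mod_arith\<close> cancel x only against an adjacent negative. These
  reach across one summand, so that \<open>Mod_ac\<close> also cancels when another term stands in
  between.\<close>

lemma Mod_cancel_neg:
  assumes "Modl M" "x \<in> carrier M" "y \<in> carrier M"
  shows "x \<oplus>\<^bsub>M\<^esub> (y \<oplus>\<^bsub>M\<^esub> \<ominus>\<^bsub>M\<^esub> x) = y" "\<ominus>\<^bsub>M\<^esub> x \<oplus>\<^bsub>M\<^esub> (y \<oplus>\<^bsub>M\<^esub> x) = y"
    "z \<in> carrier M \<Longrightarrow> x \<oplus>\<^bsub>M\<^esub> (y \<oplus>\<^bsub>M\<^esub> (\<ominus>\<^bsub>M\<^esub> x \<oplus>\<^bsub>M\<^esub> z)) = y \<oplus>\<^bsub>M\<^esub> z"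
    "z \<in> carrier M \<Longrightarrow> \<ominus>\<^bsub>M\<^esub> x \<oplus>\<^bsub>M\<^esub> (y \<oplus>\<^bsub>M\<^esub> (x \<oplus>\<^bsub>M\<^esub> z)) = y \<oplus>\<^bsub>M\<^esub> z"
proof -
  have n: "\<ominus>\<^bsub>M\<^esub> x \<in> carrier M" using assms by simp
  show "x \<oplus>\<^bsub>M\<^esub> (y \<oplus>\<^bsub>M\<^esub> \<ominus>\<^bsub>M\<^esub> x) = y"
    using assms n Mod_arith(2)[OF assms(1,3) n] Mod_arith(6)[OF assms] by simp
  show "\<ominus>\<^bsub>M\<^esub> x \<oplus>\<^bsub>M\<^esub> (y \<oplus>\<^bsub>M\<^esub> x) = y"
    using assms n Mod_arith(2)[OF assms(1,3,2)] Mod_arith(7)[OF assms] by simp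
  assume z: "z \<in> carrier M"
  show "x \<oplus>\<^bsub>M\<^esub> (y \<oplus>\<^bsub>M\<^esub> (\<ominus>\<^bsub>M\<^esub> x \<oplus>\<^bsub>M\<^esub> z)) = y \<oplus>\<^bsub>M\<^esub> z"
    using assms n z Mod_arith(4)[OF assms(1,3) n z] Mod_arith(6)[OF assms(1,2)] by simp
  show "\<ominus>\<^bsub>M\<^esub> x \<oplus>\<^bsub>M\<^esub> (y \<oplus>\<^bsub>M\<^esub> (x \<oplus>\<^bsub>M\<^esub> z)) = y \<oplus>\<^bsub>M\<^esub> z"
    using assms n z Mod_arith(4)[OF assms(1,3,2) z] Mod_arith(7)[OF assms(1,2)] by simp
qed

lemmas Mod_ac = Mod_arith Mod_cancel_neg

lemmas [simp] = Mod_RR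

lemma hom_RR_zero [simp]: "Modl X \<Longrightarrow> \<phi> \<in> Hm X RR \<Longrightarrow> \<phi> \<zero>\<^bsub>X\<^esub> = \<zero>"
  using hom_zero[of X RR \<phi>] by simp

text \<open>Over a ring, a homomorphism has finite rank iff it factors through a finite free module, and a
  module is finitely generated projective iff its identity has finite rank (dual basis). Functionals
  extend or lift one at a time, so no direct sums of free modules are needed.\<close>

inductive_set frank :: "('a, 'x) module \<Rightarrow> ('a, 'y) module \<Rightarrow> ('x \<Rightarrow> 'y) set" for X Y where
  zero: "(\<lambda>x. \<zero>\<^bsub>Y\<^esub>) \<in> frank X Y"
| add: "h \<in> frank X Y \<Longrightarrow> \<phi> \<in> Hm X RR \<Longrightarrow> y \<in> carrier Y \<Longrightarrow> (\<lambda>x. h x \<oplus>\<^bsub>Y\<^esub> \<phi> x \<odot>\<^bsub>Y\<^esub> y) \<in> frank X Y"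
| eq_on: "h \<in> frank X Y \<Longrightarrow> (\<And>x. x \<in> carrier X \<Longrightarrow> g x = h x) \<Longrightarrow> g \<in> frank X Y"

lemma frank_hom: "Modl X \<Longrightarrow> Modl Y \<Longrightarrow> h \<in> frank X Y \<Longrightarrow> h \<in> Hm X Y"
proof -
  assume m: "Modl X" "Modl Y" and "h \<in> frank X Y"
  from this(3) show "h \<in> Hm X Y"
    by induction (use m in \<open>auto intro: hom_const_zero hom_plus hom_rank_one hom_cong\<close>)
qed

lemma frank_plus:
  assumes m: "Modl X" "Modl Y" and h: "h \<in> frank X Y" and g: "g \<in> frank X Y"
  shows "(\<lambda>x. h x \<oplus>\<^bsub>Y\<^esub> g x) \<in> frank X Y"
  using g
proof (induction rule: frank.induct)
  case zero
  show ?case by (rule frank.eq_on[OF h]) (use m frank_hom[OF m h] in \<open>auto simp: hom_simps\<close>)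
next
  case (add k \<phi> y)
  show ?case
    by (rule frank.eq_on[OF frank.add[OF add(4,2,3)]])
      (use m add frank_hom[OF m h] frank_hom[OF m add(1)] in \<open>auto simp: hom_simps Mod_arith\<close>)
next
  case (eq_on k g)
  show ?case by (rule frank.eq_on[OF eq_on(3)]) (use eq_on in auto)
qed

lemma frank_comp_left:
  assumes m: "Modl X" "Modl Y" "Modl Z" and f: "f \<in> Hm Y Z" and h: "h \<in> frank X Y"
  shows "(\<lambda>x. f (h x)) \<in> frank X Z"
  using h
proof (induction rule: frank.induct)
  case zero
  show ?case by (rule frank.eq_on[OF frank.zero]) (use m f in auto)
next
  case (add k \<phi> y)
  show ?case
    by (rule frank.eq_on[OF frank.add[OF add(4,2) mod_hom_closed[OF f add(3)]]])
      (use m add f frank_hom[OF m(1,2) add(1)] in \<open>auto simp: hom_simps\<close>)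
next
  case (eq_on k g)
  show ?case by (rule frank.eq_on[OF eq_on(3)]) (use eq_on in auto)
qed

lemma frank_comp_right:
  assumes f: "f \<in> Hm W X" and h: "h \<in> frank X Y"
  shows "(\<lambda>x. h (f x)) \<in> frank W Y"
  using h
proof (induction rule: frank.induct)
  case zero
  show ?case by (rule frank.zero)
next
  case (add k \<phi> y)
  show ?case by (rule frank.add[OF add(4) mod_hom_comp[OF f add(2)] add(3)])
next
  case (eq_on k g)
  show ?case by (rule frank.eq_on[OF eq_on(3)]) (use eq_on f in \<open>auto simp: mod_hom_closed\<close>)
qed

lemma frank_neg:
  assumes m: "Modl X" "Modl Y" and h: "h \<in> frank X Y"
  shows "(\<lambda>x. \<ominus>\<^bsub>Y\<^esub> h x) \<in> frank X Y"
  by (rule frank_comp_left[OF m m(2) hom_neg[OF m(2) mod_hom_id] h])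

text \<open>In each rank-one summand the functional is kept and the vector is replaced by a preimage
  under \<open>p\<close>. Maps of finite rank therefore lift from any source, projective or
  not.\<close>

lemma frank_lift:
  assumes m: "Modl X" "Modl Y" "Modl P" and p: "p \<in> Hm P Y" "p ` carrier P = carrier Y" and h: "h \<in> frank X Y"
  obtains k where "k \<in> frank X P" "\<And>x. x \<in> carrier X \<Longrightarrow> p (k x) = h x"
proof -
  have "\<exists>k\<in>frank X P. \<forall>x\<in>carrier X. p (k x) = h x" using h
  proof (induction rule: frank.induct)
    case zero
    show ?case by (rule bexI[OF _ frank.zero]) (use m p in auto)
  next
    case (add k \<phi> y)
    obtain l where l: "l \<in> frank X P" "\<forall>x\<in>carrier X. p (l x) = k x" using add by auto
    have "y \<in> p ` carrier P" using p(2) add(3) by simp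
    then obtain z where z: "z \<in> carrier P" "y = p z" by auto
    show ?case by (rule bexI[OF _ frank.add[OF l(1) add(2) z(1)]])
      (use m p l z add frank_hom[OF m(1,3) l(1)] in \<open>auto simp: hom_simps\<close>)
  qed auto
  then show ?thesis using that by blast
qed

text \<open>When A is the kernel of a surjection from a projective module P onto X, this is the
  vanishing of Ext^1(X, R): the functionals on P restrict onto those on A.\<close>

definition ext_prop :: "('a, 'x) module \<Rightarrow> ('x \<Rightarrow> 'p) \<Rightarrow> ('a, 'p) module \<Rightarrow> bool" where
  "ext_prop A i P \<longleftrightarrow> (\<forall>\<phi>\<in>Hm A RR. \<exists>\<psi>\<in>Hm P RR. \<forall>a\<in>carrier A. \<psi> (i a) = \<phi> a)"

lemma ext_propD:
  assumes "ext_prop A i P" "\<phi> \<in> Hm A RR"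
  obtains \<psi> where "\<psi> \<in> Hm P RR" "\<And>a. a \<in> carrier A \<Longrightarrow> \<psi> (i a) = \<phi> a"
  using assms unfolding ext_prop_def by blast

text \<open>Dual to \<open>frank_lift\<close>: the vectors are kept and the functionals are
  extended.\<close>

lemma frank_extend:
  assumes m: "Modl A" "Modl P" "Modl Y" and i: "i \<in> Hm A P" "ext_prop A i P" and h: "h \<in> frank A Y"
  obtains k where "k \<in> frank P Y" "\<And>a. a \<in> carrier A \<Longrightarrow> k (i a) = h a"
proof -
  have "\<exists>k\<in>frank P Y. \<forall>x\<in>carrier A. k (i x) = h x" using h
  proof (induction rule: frank.induct)
    case zero
    show ?case by (rule bexI[OF _ frank.zero]) auto
  next
    case (add k \<phi> y)
    obtain l where l: "l \<in> frank P Y" "\<forall>x\<in>carrier A. l (i x) = k x" using add by auto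
    obtain \<psi> where \<psi>: "\<psi> \<in> Hm P RR" "\<And>a. a \<in> carrier A \<Longrightarrow> \<psi> (i a) = \<phi> a"
      using ext_propD[OF i(2) add(2)] by blast
    show ?case by (rule bexI[OF _ frank.add[OF l(1) \<psi>(1) add(3)]]) (use l \<psi> in auto)
  qed auto
  then show ?thesis using that by blast
qed

text \<open>The transpose of \<open>f\<close>. It is cut down to the carrier because the elements of
  a dual module are extensional functions.\<close>

definition dual_map :: "('a, 'x) module \<Rightarrow> ('x \<Rightarrow> 'y) \<Rightarrow> ('y \<Rightarrow> 'a) \<Rightarrow> 'x \<Rightarrow> 'a" where
  "dual_map X f \<psi> = (\<lambda>x\<in>carrier X. \<psi> (f x))"

lemma dual_map_apply [simp]: "x \<in> carrier X \<Longrightarrow> dual_map X f \<psi> x = \<psi> (f x)"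
  by (simp add: dual_map_def)

lemma dual_eqI: "\<phi> \<in> carrier (X\<^sup>\<star>) \<Longrightarrow> \<psi> \<in> carrier (X\<^sup>\<star>) \<Longrightarrow>
    (\<And>x. x \<in> carrier X \<Longrightarrow> \<phi> x = \<psi> x) \<Longrightarrow> \<phi> = \<psi>"
  by (rule extensionalityI[where A = "carrier X"]) simp_all

lemma dual_memI: "Modl X \<Longrightarrow> f \<in> Hm X RR \<Longrightarrow> restrict f (carrier X) \<in> carrier (X\<^sup>\<star>)"
  by (simp add: hom_restrict)

lemma dual_hom: "\<phi> \<in> carrier (X\<^sup>\<star>) \<Longrightarrow> \<phi> \<in> Hm X RR"
  by simp

lemma dual_map_in: "Modl X \<Longrightarrow> f \<in> Hm X Y \<Longrightarrow> \<psi> \<in> carrier (Y\<^sup>\<star>) \<Longrightarrow> dual_map X f \<psi> \<in> carrier (X\<^sup>\<star>)"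
  unfolding dual_map_def by (rule dual_memI) (auto intro: mod_hom_comp)

lemma dual_map_hom:
  assumes "Modl X" "f \<in> Hm X Y"
  shows "dual_map X f \<in> Hm (Y\<^sup>\<star>) (X\<^sup>\<star>)"
proof (rule mod_homI)
  show "dual_map X f \<psi> \<in> carrier (X\<^sup>\<star>)" if "\<psi> \<in> carrier (Y\<^sup>\<star>)" for \<psi> by (rule dual_map_in[OF assms that])
qed (use assms in \<open>auto simp: dual_map_def fun_eq_iff mod_hom_closed\<close>)

lemma eval_hom: "x \<in> carrier X \<Longrightarrow> (\<lambda>\<phi>. \<phi> x) \<in> Hm (X\<^sup>\<star>) RR"
  by (rule mod_homI) auto

text \<open>Transposition swaps the two ingredients of a rank-one map: the vector turns into the
  functional evaluating at it, and the functional turns into the vector.\<close>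

lemma frank_dual:
  assumes m: "Modl X" "Modl Y" and h: "h \<in> frank X Y"
  shows "dual_map X h \<in> frank (Y\<^sup>\<star>) (X\<^sup>\<star>)"
  using h
proof (induction rule: frank.induct)
  case zero
  show ?case by (rule frank.eq_on[OF frank.zero]) (use m in \<open>auto simp: dual_map_def fun_eq_iff\<close>)
next
  case (add k \<phi> y)
  note k = frank_hom[OF m add(1)]
  have "restrict \<phi> (carrier X) \<in> carrier (X\<^sup>\<star>)" using m add by (intro dual_memI)
  note * = frank.add[OF add(4) eval_hom[OF add(3)] this]
  show ?case by (rule frank.eq_on[OF *])
    (use m add k in \<open>auto simp: dual_map_def fun_eq_iff hom_simps m_comm\<close>)
next
  case (eq_on k g)
  show ?case by (rule frank.eq_on[OF eq_on(3)]) (use eq_on in \<open>auto simp: dual_map_def fun_eq_iff\<close>)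
qed

text \<open>A dual basis instead of a lifting property: no quantification over other modules occurs,
  so the notion is equally usable at every element type. \<open>proj_projective\<close> and
  \<open>projective_proj\<close> connect it with \<open>projective_mod\<close>.\<close>

definition proj :: "('a, 'x) module \<Rightarrow> bool" where
  "proj P \<longleftrightarrow> Modl P \<and> (\<lambda>x. x) \<in> frank P P"

lemma proj_Mod: "proj P \<Longrightarrow> Modl P"
  by (simp add: proj_def)

lemma proj_frank_to: "proj P \<Longrightarrow> f \<in> Hm X P \<Longrightarrow> f \<in> frank X P"
  using frank_comp_right[of f X P "\<lambda>x. x" P] by (simp add: proj_def)

lemma proj_frank_from: "proj P \<Longrightarrow> Modl Y \<Longrightarrow> f \<in> Hm P Y \<Longrightarrow> f \<in> frank P Y"
  using frank_comp_left[of P P Y f "\<lambda>x. x"] by (simp add: proj_def)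

text \<open>The target is cut down to the image of \<open>p\<close>, onto which \<open>p\<close> is
  surjective; there \<open>f\<close> has finite rank because its source is projective, and
  \<open>frank_lift\<close> applies.\<close>

lemma proj_lift:
  assumes P: "proj P" and m: "Modl A" "Modl B" and p: "p \<in> Hm A B" and f: "f \<in> Hm P B"
    and im: "\<And>x. x \<in> carrier P \<Longrightarrow> f x \<in> p ` carrier A"
  obtains h where "h \<in> Hm P A" "\<And>x. x \<in> carrier P \<Longrightarrow> p (h x) = f x"
proof -
  let ?B = "sub_mod B (p ` carrier A)"
  have B: "Modl ?B" by (rule Mod_sub[OF m(2) submod_image[OF m p]])
  have "f \<in> frank P ?B" by (rule proj_frank_from[OF P B hom_to_sub[OF f im]])
  moreover have "p \<in> Hm A ?B" by (rule hom_to_sub[OF p]) auto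
  ultimately obtain k where "k \<in> frank P A" "\<And>x. x \<in> carrier P \<Longrightarrow> p (k x) = f x"
    using frank_lift[OF proj_Mod[OF P] B m(1)] by (metis sub_mod_simps(1))
  then show ?thesis using that frank_hom[OF proj_Mod[OF P] m(1)] by blast
qed

lemma proj_dual: "proj P \<Longrightarrow> proj (P\<^sup>\<star>)"
  unfolding proj_def
proof (intro conjI)
  assume P: "Modl P \<and> (\<lambda>x. x) \<in> frank P P"
  then show "Modl (P\<^sup>\<star>)" by (simp add: Mod_dual)
  show "(\<lambda>x. x) \<in> frank (P\<^sup>\<star>) (P\<^sup>\<star>)"
    by (rule frank.eq_on[OF frank_dual[of P P "\<lambda>x. x"]])
      (use P in \<open>auto simp: dual_map_def fun_eq_iff extensional_def\<close>)
qed

text \<open>A short exact sequence with explicit maps. The kernel A is an abstract module with an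
  injection, not a submodule of P, so that terms can be replaced by isomorphic copies of another
  element type.\<close>

definition ses where
  "ses A i P p X \<longleftrightarrow> Modl A \<and> Modl P \<and> Modl X \<and> i \<in> Hm A P \<and> inj_on i (carrier A) \<and> p \<in> Hm P X \<and>
     p ` carrier P = carrier X \<and> i ` carrier A = {x \<in> carrier P. p x = \<zero>\<^bsub>X\<^esub>}"

lemma sesD:
  assumes "ses A i P p X"
  shows "Modl A" "Modl P" "Modl X" "i \<in> Hm A P" "inj_on i (carrier A)" "p \<in> Hm P X"
    "p ` carrier P = carrier X" "i ` carrier A = {x \<in> carrier P. p x = \<zero>\<^bsub>X\<^esub>}"
    "a \<in> carrier A \<Longrightarrow> p (i a) = \<zero>\<^bsub>X\<^esub>"
    "a \<in> carrier A \<Longrightarrow> i a \<in> carrier P"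
    "x \<in> carrier P \<Longrightarrow> p x \<in> carrier X"
proof -
  show *: "Modl A" "Modl P" "Modl X" "i \<in> Hm A P" "inj_on i (carrier A)" "p \<in> Hm P X"
    "p ` carrier P = carrier X" "i ` carrier A = {x \<in> carrier P. p x = \<zero>\<^bsub>X\<^esub>}"
    using assms by (auto simp: ses_def)
  show "a \<in> carrier A \<Longrightarrow> p (i a) = \<zero>\<^bsub>X\<^esub>" using *(8) by blast
  show "a \<in> carrier A \<Longrightarrow> i a \<in> carrier P" "x \<in> carrier P \<Longrightarrow> p x \<in> carrier X" using * by auto
qed

lemma ses_preimage:
  assumes "ses A i P p X" "x \<in> carrier P" "p x = \<zero>\<^bsub>X\<^esub>"
  obtains a where "a \<in> carrier A" "x = i a"
proof -
  have "x \<in> i ` carrier A" using sesD(8)[OF assms(1)] assms(2,3) by simp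
  then show ?thesis using that by auto
qed

lemma ses_lift:
  assumes "ses A i P p X" "y \<in> carrier X"
  obtains x where "x \<in> carrier P" "y = p x"
proof -
  have "y \<in> p ` carrier P" using sesD(7)[OF assms(1)] assms(2) by simp
  then show ?thesis using that by auto
qed

lemma ses_inj: "ses A i P p X \<Longrightarrow> a \<in> carrier A \<Longrightarrow> b \<in> carrier A \<Longrightarrow> i a = i b \<Longrightarrow> a = b"
  by (meson inj_onD sesD(5))

lemma ses_factor:
  assumes s: "ses A i P p X" and C: "Modl C" and h: "h \<in> Hm P C"
    and k: "\<And>a. a \<in> carrier A \<Longrightarrow> h (i a) = \<zero>\<^bsub>C\<^esub>"
  obtains f where "f \<in> Hm X C" "\<And>x. x \<in> carrier P \<Longrightarrow> f (p x) = h x"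
proof -
  have "h x = \<zero>\<^bsub>C\<^esub>" if "x \<in> carrier P" "p x = \<zero>\<^bsub>X\<^esub>" for x
    using ses_preimage[OF s that] k by metis
  then show ?thesis using hom_factor_surj[OF sesD(2,3)[OF s] C sesD(6,7)[OF s] h] that by blast
qed

lemma ses_factor_inj:
  assumes s: "ses A i P p X" and h: "h \<in> Hm W P" and k: "\<And>w. w \<in> carrier W \<Longrightarrow> p (h w) = \<zero>\<^bsub>X\<^esub>"
  obtains f where "f \<in> Hm W A" "\<And>w. w \<in> carrier W \<Longrightarrow> i (f w) = h w"
proof -
  have "h w \<in> i ` carrier A" if "w \<in> carrier W" for w
    using sesD(8)[OF s] k that h by auto
  then show ?thesis using hom_factor_inj[OF sesD(1,2,4,5)[OF s] h] that by blast
qed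

lemma ses_kernel:
  assumes "Modl P" "Modl X" "p \<in> Hm P X" "p ` carrier P = carrier X"
  shows "ses (sub_mod P (a_kernel P X p)) (\<lambda>x. x) P p X"
  unfolding ses_def using assms Mod_sub[OF assms(1) submod_kernel[OF assms(1-3)]]
  by (auto simp: a_kernel_eq intro!: hom_sub_incl)

text \<open>One step of the comparison theorem for resolutions: projectivity of P lifts the map to
  the covers, and the lift carries kernel to kernel.\<close>

lemma ses_hom_lifts:
  assumes s: "ses A i P p X" and t: "ses B j Q q Y" and P: "proj P" and f: "f \<in> Hm X Y"
  obtains f\<^sub>0 f\<^sub>1 where "f\<^sub>0 \<in> Hm P Q" "f\<^sub>1 \<in> Hm A B" "\<And>x. x \<in> carrier P \<Longrightarrow> q (f\<^sub>0 x) = f (p x)"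
    "\<And>a. a \<in> carrier A \<Longrightarrow> j (f\<^sub>1 a) = f\<^sub>0 (i a)"
proof -
  note s' = sesD[OF s] and t' = sesD[OF t]
  obtain f0 where f0: "f0 \<in> Hm P Q" "\<And>x. x \<in> carrier P \<Longrightarrow> q (f0 x) = f (p x)"
  proof (rule proj_lift[OF P t'(2,3,6) mod_hom_comp[OF s'(6) f]])
    show "f (p x) \<in> q ` carrier Q" if "x \<in> carrier P" for x
      using s'(6,11) t'(7) f that by auto
  qed (rule that)
  obtain f1 where "f1 \<in> Hm A B" "\<And>a. a \<in> carrier A \<Longrightarrow> j (f1 a) = f0 (i a)"
  proof (rule ses_factor_inj[OF t mod_hom_comp[OF s'(4) f0(1)]])
    show "q (f0 (i w)) = \<zero>\<^bsub>Y\<^esub>" if "w \<in> carrier A" for w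
      using f0(2) s' t' f that by simp
  qed (rule that)
  then show ?thesis using f0 that by blast
qed

definition near_id :: "('a, 'x) module \<Rightarrow> ('x \<Rightarrow> 'x) \<Rightarrow> bool" where
  "near_id X k \<longleftrightarrow> (\<exists>r\<in>frank X X. \<forall>x\<in>carrier X. k x = x \<oplus>\<^bsub>X\<^esub> r x)"

text \<open>Isomorphism in the stable category, in which maps of finite rank are zero.\<close>

definition st :: "('a, 'x) module \<Rightarrow> ('a, 'y) module \<Rightarrow> bool" where
  "st X Y \<longleftrightarrow> Modl X \<and> Modl Y \<and>
     (\<exists>f\<in>Hm X Y. \<exists>g\<in>Hm Y X. near_id X (\<lambda>x. g (f x)) \<and> near_id Y (\<lambda>y. f (g y)))"

lemma stD: "st X Y \<Longrightarrow> Modl X" "st X Y \<Longrightarrow> Modl Y"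
  by (auto simp: st_def)

lemma near_idI: "r \<in> frank X X \<Longrightarrow> (\<And>x. x \<in> carrier X \<Longrightarrow> k x = x \<oplus>\<^bsub>X\<^esub> r x) \<Longrightarrow> near_id X k"
  unfolding near_id_def by blast

lemma near_id_id: "Modl X \<Longrightarrow> (\<And>x. x \<in> carrier X \<Longrightarrow> k x = x) \<Longrightarrow> near_id X k"
  unfolding near_id_def by (rule bexI[OF _ frank.zero]) auto

lemma stI: "Modl X \<Longrightarrow> Modl Y \<Longrightarrow> f \<in> Hm X Y \<Longrightarrow> g \<in> Hm Y X \<Longrightarrow> near_id X (\<lambda>x. g (f x)) \<Longrightarrow>
    near_id Y (\<lambda>y. f (g y)) \<Longrightarrow> st X Y"
  unfolding st_def by blast

lemma st_iso:
  assumes "Modl X" "Modl Y" "f \<in> mod_iso R X Y"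
  shows "st X Y"
proof -
  obtain g where "g \<in> Hm Y X" "\<And>x. x \<in> carrier X \<Longrightarrow> g (f x) = x" "\<And>y. y \<in> carrier Y \<Longrightarrow> f (g y) = y"
    using mod_iso_inverse[OF assms(3) Mod_simps(2,3)[OF assms(1)]] by blast
  then show ?thesis using assms by (intro stI[of X Y f g] near_id_id) (auto simp: mod_iso_def)
qed

lemma st_refl: "Modl X \<Longrightarrow> st X X"
  by (rule stI[OF _ _ mod_hom_id mod_hom_id]) (auto intro: near_id_id)

lemma st_sym: "st X Y \<Longrightarrow> st Y X"
  unfolding st_def by blast

text \<open>If k is the identity plus s, then inserting k between \<open>f\<close> and
  \<open>g\<close> changes the composite only by g s f, which has finite rank.\<close>

lemma near_id_comp:
  assumes m: "Modl X" "Modl Y" and f: "f \<in> Hm X Y" "g \<in> Hm Y X" "near_id X (\<lambda>x. g (f x))"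
    and k: "k \<in> Hm Y Y" "near_id Y k"
  shows "near_id X (\<lambda>x. g (k (f x)))"
proof -
  obtain r where r: "r \<in> frank X X" "\<forall>x\<in>carrier X. g (f x) = x \<oplus>\<^bsub>X\<^esub> r x" using f by (auto simp: near_id_def)
  obtain s where s: "s \<in> frank Y Y" "\<forall>x\<in>carrier Y. k x = x \<oplus>\<^bsub>Y\<^esub> s x" using k by (auto simp: near_id_def)
  have h: "r \<in> Hm X X" "s \<in> Hm Y Y" using r s m frank_hom by blast+
  have "(\<lambda>x. r x \<oplus>\<^bsub>X\<^esub> g (s (f x))) \<in> frank X X"
    by (intro frank_plus frank_comp_left[OF m(1,2,1) f(2)] frank_comp_right[OF f(1)] r s m)
  then show ?thesis unfolding near_id_def
    by (rule rev_bexI) (use m f k r s h in \<open>auto simp: hom_simps Mod_arith(3)\<close>)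
qed

lemma st_trans:
  assumes "st X Y" "st Y Z" shows "st X Z"
proof -
  obtain f g where 1: "f \<in> Hm X Y" "g \<in> Hm Y X" "near_id X (\<lambda>x. g (f x))" "near_id Y (\<lambda>y. f (g y))"
    using assms(1) by (auto simp: st_def)
  obtain f' g' where 2: "f' \<in> Hm Y Z" "g' \<in> Hm Z Y" "near_id Y (\<lambda>x. g' (f' x))" "near_id Z (\<lambda>y. f' (g' y))"
    using assms(2) by (auto simp: st_def)
  note m = stD[OF assms(1)] stD[OF assms(2)]
  show ?thesis
  proof (rule stI[OF m(1,4) mod_hom_comp[OF 1(1) 2(1)] mod_hom_comp[OF 2(2) 1(2)]])
    show "near_id X (\<lambda>x. g (g' (f' (f x))))"
      by (rule near_id_comp[OF m(1,2) 1(1-3) mod_hom_comp[OF 2(1,2)] 2(3)])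
    show "near_id Z (\<lambda>x. f' (f (g (g' x))))"
      by (rule near_id_comp[OF m(4,2) 2(2,1,4) mod_hom_comp[OF 1(2,1)] 1(4)])
  qed
qed

lemma st_dual:
  assumes "st X Y" shows "st (X\<^sup>\<star>) (Y\<^sup>\<star>)"
proof -
  obtain f g where 1: "f \<in> Hm X Y" "g \<in> Hm Y X" "near_id X (\<lambda>x. g (f x))" "near_id Y (\<lambda>y. f (g y))"
    using assms(1) by (auto simp: st_def)
  note m = stD[OF assms(1)]
  have *: "near_id (V\<^sup>\<star>) (\<lambda>\<psi>. dual_map V u (dual_map W v \<psi>))"
    if uv: "near_id V (\<lambda>x. v (u x))" "u \<in> Hm V W" "v \<in> Hm W V" "Modl V" for u v and V :: "('a, 'v) module" and W :: "('a, 'w) module"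
  proof -
    obtain r where r: "r \<in> frank V V" "\<forall>x\<in>carrier V. v (u x) = x \<oplus>\<^bsub>V\<^esub> r x" using uv by (auto simp: near_id_def)
    have h: "r \<in> Hm V V" using r uv frank_hom by blast
    show ?thesis unfolding near_id_def
      by (rule bexI[OF _ frank_dual[OF uv(4,4) r(1)]])
        (use r h uv in \<open>auto simp: fun_eq_iff dual_map_def hom_simps extensional_def\<close>)
  qed
  show ?thesis
    by (rule stI[OF _ _ dual_map_hom[OF m(2) 1(2)] dual_map_hom[OF m(1) 1(1)]])
      (use 1 m * in \<open>auto intro: Mod_dual\<close>)
qed

text \<open>Lifting to covers is unique up to maps that factor through the cover.\<close>

lemma lifts_near_id:
  assumes s: "ses A i P p X" and t: "ses B j Q q Y" and f: "f \<in> Hm X Y" and g: "g \<in> Hm Y X"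
    and fg: "near_id Y (\<lambda>y. f (g y))"
    and f0: "f\<^sub>0 \<in> Hm P Q" "\<And>x. x \<in> carrier P \<Longrightarrow> q (f\<^sub>0 x) = f (p x)"
    and f1: "f\<^sub>1 \<in> Hm A B" "\<And>a. a \<in> carrier A \<Longrightarrow> j (f\<^sub>1 a) = f\<^sub>0 (i a)"
    and g0: "g\<^sub>0 \<in> Hm Q P" "\<And>y. y \<in> carrier Q \<Longrightarrow> p (g\<^sub>0 y) = g (q y)"
    and g1: "g\<^sub>1 \<in> Hm B A" "\<And>b. b \<in> carrier B \<Longrightarrow> i (g\<^sub>1 b) = g\<^sub>0 (j b)"
  obtains h where "h \<in> Hm Q B" "\<And>b. b \<in> carrier B \<Longrightarrow> f\<^sub>1 (g\<^sub>1 b) = b \<oplus>\<^bsub>B\<^esub> h (j b)"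
proof -
  note s' = sesD[OF s] and t' = sesD[OF t]
  obtain r where r: "r \<in> frank Y Y" "\<forall>x\<in>carrier Y. f (g x) = x \<oplus>\<^bsub>Y\<^esub> r x" using fg by (auto simp: near_id_def)
  obtain k where k: "k \<in> frank Y Q" "\<And>y. y \<in> carrier Y \<Longrightarrow> q (k y) = r y"
    using frank_lift[OF t'(3,3,2,6,7) r(1)] by blast
  have hk: "k \<in> Hm Y Q" "r \<in> Hm Y Y" using frank_hom k r t' by blast+
  \<comment> \<open>On Y the composite f g is the identity plus r, and k lifts r to Q. After
    subtracting both the identity and this lift, the map on Q is killed by \<open>q\<close> and
    therefore has values in the image of B.\<close>
  let ?l = "\<lambda>x. (f\<^sub>0 (g\<^sub>0 x) \<ominus>\<^bsub>Q\<^esub> x) \<ominus>\<^bsub>Q\<^esub> k (q x)"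
  have l: "?l \<in> Hm Q Q"
    by (intro hom_minus t' mod_hom_comp[OF g0(1) f0(1)] mod_hom_id mod_hom_comp[OF t'(6) hk(1)])
  have qx: "f (g (q x)) = q x \<oplus>\<^bsub>Y\<^esub> r (q x)" "r (q x) \<in> carrier Y" "q x \<in> carrier Y" if "x \<in> carrier Q" for x
    using r t' that hk by auto
  obtain h where h: "h \<in> Hm Q B" "\<And>w. w \<in> carrier Q \<Longrightarrow> j (h w) = ?l w"
  proof (rule ses_factor_inj[OF t l])
    show "q (?l w) = \<zero>\<^bsub>Y\<^esub>" if "w \<in> carrier Q" for w
      using that t' f0 g0 f g hk k qx[OF that] s'
      by (simp add: hom_simps Mod_ac)
  qed (rule that)
  show ?thesis
  proof
    show "f\<^sub>1 (g\<^sub>1 b) = b \<oplus>\<^bsub>B\<^esub> h (j b)" if b: "b \<in> carrier B" for b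
    proof (rule ses_inj[OF t])
      have jb: "j b \<in> carrier Q" "q (j b) = \<zero>\<^bsub>Y\<^esub>" using t' b by auto
      have c: "f\<^sub>0 (g\<^sub>0 (j b)) \<in> carrier Q" using f0 g0 jb by auto
      have "j (b \<oplus>\<^bsub>B\<^esub> h (j b)) = j b \<oplus>\<^bsub>Q\<^esub> ?l (j b)" using h t' b jb by (simp add: hom_simps)
      also have "\<dots> = f\<^sub>0 (g\<^sub>0 (j b))" using c jb t' hk by (simp add: hom_simps Mod_ac)
      also have "\<dots> = j (f\<^sub>1 (g\<^sub>1 b))" using f1 g1 b by (simp add: hom_simps)
      finally show "j (f\<^sub>1 (g\<^sub>1 b)) = j (b \<oplus>\<^bsub>B\<^esub> h (j b))" ..
    qed (use b f1 g1 h t' in \<open>auto simp: hom_simps\<close>)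
  qed (rule h)
qed

text \<open>By \<open>lifts_near_id\<close> the composites on the syzygies differ from the identity
  by a map that extends to a projective cover, hence by a map of finite rank.\<close>

lemma st_syz:
  assumes s: "ses A i P p X" and t: "ses B j Q q Y" and P: "proj P" "proj Q" and st: "st X Y"
  shows "st A B"
proof -
  obtain f g where 1: "f \<in> Hm X Y" "g \<in> Hm Y X" "near_id X (\<lambda>x. g (f x))" "near_id Y (\<lambda>y. f (g y))"
    using st by (auto simp: st_def)
  obtain f0 f1 where f: "f0 \<in> Hm P Q" "f1 \<in> Hm A B" "\<And>x. x \<in> carrier P \<Longrightarrow> q (f0 x) = f (p x)"
    "\<And>a. a \<in> carrier A \<Longrightarrow> j (f1 a) = f0 (i a)" using ses_hom_lifts[OF s t P(1) 1(1)] by blast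
  obtain g0 g1 where g: "g0 \<in> Hm Q P" "g1 \<in> Hm B A" "\<And>x. x \<in> carrier Q \<Longrightarrow> p (g0 x) = g (q x)"
    "\<And>a. a \<in> carrier B \<Longrightarrow> i (g1 a) = g0 (j a)" using ses_hom_lifts[OF t s P(2) 1(2)] by blast
  note s' = sesD[OF s] and t' = sesD[OF t]
  obtain h where h: "h \<in> Hm Q B" "\<And>b. b \<in> carrier B \<Longrightarrow> f1 (g1 b) = b \<oplus>\<^bsub>B\<^esub> h (j b)"
    using lifts_near_id[OF s t 1(1,2,4) f(1,3,2,4) g(1,3,2,4)] by blast
  obtain h' where h': "h' \<in> Hm P A" "\<And>b. b \<in> carrier A \<Longrightarrow> g1 (f1 b) = b \<oplus>\<^bsub>A\<^esub> h' (i b)"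
    using lifts_near_id[OF t s 1(2,1,3) g(1,3,2,4) f(1,3,2,4)] by blast
  have "near_id B (\<lambda>b. f1 (g1 b))" unfolding near_id_def
    by (rule bexI[OF _ frank_comp_right[OF t'(4) proj_frank_from[OF P(2) t'(1) h(1)]]]) (use h in auto)
  moreover have "near_id A (\<lambda>b. g1 (f1 b))" unfolding near_id_def
    by (rule bexI[OF _ frank_comp_right[OF s'(4) proj_frank_from[OF P(1) s'(1) h'(1)]]]) (use h' in auto)
  ultimately show ?thesis using stI[OF s'(1) t'(1) f(2) g(2)] by blast
qed

text \<open>A functional on B is pulled back to A, extended to P and brought to Q by the lift of
  \<open>g\<close>. On B this returns the functional up to an error of the form \<phi> h j; as
  \<phi> h is already defined on all of Q, it can be subtracted there.\<close>

lemma ext_prop_st: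
  assumes s: "ses A i P p X" and t: "ses B j Q q Y" and P: "proj P" "proj Q" and st: "st X Y"
    and e: "ext_prop A i P"
  shows "ext_prop B j Q"
  unfolding ext_prop_def
proof
  fix \<phi> assume \<phi>: "\<phi> \<in> Hm B RR"
  obtain f g where 1: "f \<in> Hm X Y" "g \<in> Hm Y X" "near_id X (\<lambda>x. g (f x))" "near_id Y (\<lambda>y. f (g y))"
    using st by (auto simp: st_def)
  obtain f0 f1 where f: "f0 \<in> Hm P Q" "f1 \<in> Hm A B" "\<And>x. x \<in> carrier P \<Longrightarrow> q (f0 x) = f (p x)"
    "\<And>a. a \<in> carrier A \<Longrightarrow> j (f1 a) = f0 (i a)" using ses_hom_lifts[OF s t P(1) 1(1)] by blast
  obtain g0 g1 where g: "g0 \<in> Hm Q P" "g1 \<in> Hm B A" "\<And>x. x \<in> carrier Q \<Longrightarrow> p (g0 x) = g (q x)"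
    "\<And>a. a \<in> carrier B \<Longrightarrow> i (g1 a) = g0 (j a)" using ses_hom_lifts[OF t s P(2) 1(2)] by blast
  note s' = sesD[OF s] and t' = sesD[OF t]
  obtain h where h: "h \<in> Hm Q B" "\<And>b. b \<in> carrier B \<Longrightarrow> f1 (g1 b) = b \<oplus>\<^bsub>B\<^esub> h (j b)"
    using lifts_near_id[OF s t 1(1,2,4) f(1,3,2,4) g(1,3,2,4)] by blast
  obtain \<psi> where \<psi>: "\<psi> \<in> Hm P RR" "\<And>a. a \<in> carrier A \<Longrightarrow> \<psi> (i a) = \<phi> (f1 a)"
    using ext_propD[OF e mod_hom_comp[OF f(2) \<phi>]] by blast
  show "\<exists>\<psi>\<in>Hm Q RR. \<forall>a\<in>carrier B. \<psi> (j a) = \<phi> a"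
  proof
    show "(\<lambda>y. \<psi> (g0 y) \<ominus>\<^bsub>RR\<^esub> \<phi> (h y)) \<in> Hm Q RR"
      by (intro hom_minus Mod_RR mod_hom_comp[OF g(1) \<psi>(1)] mod_hom_comp[OF h(1) \<phi>])
    show "\<forall>b\<in>carrier B. \<psi> (g0 (j b)) \<ominus>\<^bsub>RR\<^esub> \<phi> (h (j b)) = \<phi> b"
    proof
      fix b assume b: "b \<in> carrier B"
      have c: "h (j b) \<in> carrier B" "\<phi> b \<in> carrier RR" "\<phi> (h (j b)) \<in> carrier RR"
        using mod_hom_closed[OF h(1)] mod_hom_closed[OF \<phi>] t' b by auto
      have "\<psi> (g0 (j b)) = \<phi> (f1 (g1 b))" using g \<psi> b by (metis mod_hom_closed)
      also have "\<dots> = \<phi> b \<oplus>\<^bsub>RR\<^esub> \<phi> (h (j b))" using h \<phi> b c by (simp add: mod_hom_add)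
      finally show "\<psi> (g0 (j b)) \<ominus>\<^bsub>RR\<^esub> \<phi> (h (j b)) = \<phi> b"
        using c Mod_RR by (simp only: Mod_arith Mod_simps Mod_RR)
    qed
  qed
qed

text \<open>The module W is the pushout of B and P over A: B \<oplus> P maps onto W, with kernel the
  pairs (- f1 a, i a). The given functional on B and the extension to P of its pullback to A cancel
  on these pairs, so they glue to a functional on W. Thus one projective cover of X decides about
  every sequence ending in X.\<close>

lemma ext_prop_any:
  assumes s: "ses A i P p X" and P: "proj P" and e: "ext_prop A i P" and t: "ses B j W q X"
  shows "ext_prop B j W"
  unfolding ext_prop_def
proof
  fix \<phi> assume \<phi>: "\<phi> \<in> Hm B RR"
  note s' = sesD[OF s] and t' = sesD[OF t]
  obtain f0 f1 where f: "f0 \<in> Hm P W" "f1 \<in> Hm A B" "\<And>x. x \<in> carrier P \<Longrightarrow> q (f0 x) = p x"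
    "\<And>a. a \<in> carrier A \<Longrightarrow> j (f1 a) = f0 (i a)" using ses_hom_lifts[OF s t P mod_hom_id] by metis
  obtain \<psi> where \<psi>: "\<psi> \<in> Hm P RR" "\<And>a. a \<in> carrier A \<Longrightarrow> \<psi> (i a) = \<phi> (f1 a)"
    using ext_propD[OF e mod_hom_comp[OF f(2) \<phi>]] by blast
  let ?D = "dsum_mod B P"
  let ?p = "\<lambda>x. j (fst x) \<oplus>\<^bsub>W\<^esub> f0 (snd x)" and ?h = "\<lambda>x. \<phi> (fst x) \<oplus>\<^bsub>RR\<^esub> \<psi> (snd x)"
  have D: "Modl ?D" by (rule Mod_dsum[OF t'(1) s'(2)])
  have p: "?p \<in> Hm ?D W" by (rule hom_copair[OF t'(4) f(1) t'(2)])
  have "?p ` carrier ?D = carrier W"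
  proof
    show "?p ` carrier ?D \<subseteq> carrier W" using p by (auto dest: mod_hom_closed)
    show "carrier W \<subseteq> ?p ` carrier ?D"
    proof
      fix w assume w: "w \<in> carrier W"
      obtain x where x: "x \<in> carrier P" "q w = p x" using ses_lift[OF s] t' w by metis
      have f0x: "f0 x \<in> carrier W" using f x by auto
      have "q (w \<ominus>\<^bsub>W\<^esub> f0 x) = \<zero>\<^bsub>X\<^esub>" using w x f t' f0x s'(11)[OF x(1)] by (simp add: hom_diff)
      then obtain b where b: "b \<in> carrier B" "w \<ominus>\<^bsub>W\<^esub> f0 x = j b"
        using ses_preimage[OF t, of "w \<ominus>\<^bsub>W\<^esub> f0 x"] w f0x t'(2) by auto
      have "?p (b, x) = w" unfolding fst_conv snd_conv b(2)[symmetric]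
        using w f0x t' by (simp add: Mod_ac)
      then show "w \<in> ?p ` carrier ?D" using b x by force
    qed
  qed
  note p = p this
  have h: "?h \<in> Hm ?D RR" by (rule hom_copair[OF \<phi> \<psi>(1) Mod_RR])
  have "?h z = \<zero>\<^bsub>RR\<^esub>" if z: "z \<in> carrier ?D" "?p z = \<zero>\<^bsub>W\<^esub>" for z
  proof -
    obtain b x where [simp]: "z = (b, x)" by (cases z)
    have bx: "b \<in> carrier B" "x \<in> carrier P" "j b \<oplus>\<^bsub>W\<^esub> f0 x = \<zero>\<^bsub>W\<^esub>" using z by auto
    have c: "j b \<in> carrier W" "f0 x \<in> carrier W" using bx f t' by auto
    have "q (j b \<oplus>\<^bsub>W\<^esub> f0 x) = \<zero>\<^bsub>X\<^esub> \<oplus>\<^bsub>X\<^esub> p x"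
      using mod_hom_add[OF t'(6) c] t'(9)[OF bx(1)] f(3)[OF bx(2)] by simp
    then have "p x = \<zero>\<^bsub>X\<^esub>" using bx(3) hom_zero[OF t'(2,3,6)] s'(3) s'(11)[OF bx(2)] by simp
    then obtain a where a: "a \<in> carrier A" "x = i a" using ses_preimage[OF s] bx by blast
    have fa: "f1 a \<in> carrier B" using f a by auto
    have "j (b \<oplus>\<^bsub>B\<^esub> f1 a) = j \<zero>\<^bsub>B\<^esub>" using bx a f t' fa by (simp add: mod_hom_add)
    then have "b \<oplus>\<^bsub>B\<^esub> f1 a = \<zero>\<^bsub>B\<^esub>" using ses_inj[OF t] bx fa t' by simp
    then have "\<phi> (b \<oplus>\<^bsub>B\<^esub> f1 a) = \<zero>\<^bsub>RR\<^esub>" using t' Mod_RR \<phi> by simp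
    then show ?thesis using \<phi> \<psi> a bx fa by (simp add: mod_hom_add)
  qed
  from hom_factor_surj[OF D t'(2) Mod_RR p h this] obtain F where
    F: "F \<in> Hm W RR" "\<And>x. x \<in> carrier ?D \<Longrightarrow> F (?p x) = ?h x" by blast
  show "\<exists>\<psi>\<in>Hm W RR. \<forall>a\<in>carrier B. \<psi> (j a) = \<phi> a"
  proof (intro bexI ballI)
    fix b assume b: "b \<in> carrier B"
    then show "F (j b) = \<phi> b" using F(2)[of "(b, \<zero>\<^bsub>P\<^esub>)"] s' t' f \<psi> \<phi> Mod_RR by auto
  qed (rule F)
qed

text \<open>The finite-rank error r on A extends to a finite-rank map l from P to A. What then
  remains of k0 - 1, namely k0 - 1 - i l, vanishes on A and factors through a map u from X to P.
  Since \<open>p\<close> kills i l, the error of k on X is p u, which factors through the projective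
  module P.\<close>

lemma near_id_descend:
  assumes s: "ses A i P p X" and P: "proj P" and e: "ext_prop A i P"
    and k: "k \<in> Hm X X" "k\<^sub>0 \<in> Hm P P" "\<And>x. x \<in> carrier P \<Longrightarrow> p (k\<^sub>0 x) = k (p x)"
      "\<And>a. a \<in> carrier A \<Longrightarrow> i (k\<^sub>1 a) = k\<^sub>0 (i a)"
    and n: "near_id A k\<^sub>1"
  shows "near_id X k"
proof -
  note s' = sesD[OF s]
  obtain r where r: "r \<in> frank A A" "\<forall>x\<in>carrier A. k\<^sub>1 x = x \<oplus>\<^bsub>A\<^esub> r x" using n by (auto simp: near_id_def)
  obtain l where l: "l \<in> frank P A" "\<And>a. a \<in> carrier A \<Longrightarrow> l (i a) = r a"
    using frank_extend[OF s'(1,2,1,4) e r(1)] by blast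
  have hl: "l \<in> Hm P A" "r \<in> Hm A A" using frank_hom l r s' by blast+
  let ?m = "\<lambda>x. (k\<^sub>0 x \<ominus>\<^bsub>P\<^esub> x) \<ominus>\<^bsub>P\<^esub> i (l x)"
  have m: "?m \<in> Hm P P"
    by (intro hom_minus s' k mod_hom_id mod_hom_comp[OF hl(1) s'(4)])
  obtain u where u: "u \<in> Hm X P" "\<And>x. x \<in> carrier P \<Longrightarrow> u (p x) = ?m x"
  proof (rule ses_factor[OF s s'(2) m])
    fix a assume a: "a \<in> carrier A"
    have c: "r a \<in> carrier A" "i a \<in> carrier P" "i (r a) \<in> carrier P" using a hl s' by auto
    have "k\<^sub>0 (i a) = i a \<oplus>\<^bsub>P\<^esub> i (r a)" using k(4)[OF a, symmetric] r(2) a mod_hom_add[OF s'(4) a c(1)] by simp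
    then show "?m (i a) = \<zero>\<^bsub>P\<^esub>" using l(2)[OF a] c(2,3) s'(2) by (simp add: Mod_ac)
  qed (rule that)
  have pu: "(\<lambda>x. p (u x)) \<in> frank X X"
    by (rule frank_comp_left[OF s'(3,2,3,6) proj_frank_to[OF P u(1)]])
  have "k y = y \<oplus>\<^bsub>X\<^esub> p (u y)" if y: "y \<in> carrier X" for y
  proof -
    obtain x where x: "x \<in> carrier P" "y = p x" using ses_lift[OF s y] by blast
    have lx: "l x \<in> carrier A" using mod_hom_closed[OF hl(1) x(1)] .
    have c: "k\<^sub>0 x \<in> carrier P" "i (l x) \<in> carrier P" "p x \<in> carrier X" "k (p x) \<in> carrier X"
      using mod_hom_closed[OF k(2)] mod_hom_closed[OF k(1)] s'(10,11) x lx by auto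
    have "p (u y) = (k (p x) \<ominus>\<^bsub>X\<^esub> p x) \<ominus>\<^bsub>X\<^esub> \<zero>\<^bsub>X\<^esub>"
      using x u(2)[OF x(1)] c s'(2,3,6) k(3)[OF x(1)] s'(9)[OF lx] by (simp add: hom_diff)
    then show ?thesis using x c s'(3) by (simp add: Mod_ac)
  qed
  then show ?thesis by (rule near_idI[OF pu])
qed

lemma hom_extend_proj:
  assumes m: "Modl A" "Modl P" and i: "i \<in> Hm A P" "ext_prop A i P" and Q: "proj Q" and h: "h \<in> Hm A Q"
  obtains k where "k \<in> Hm P Q" "\<And>a. a \<in> carrier A \<Longrightarrow> k (i a) = h a"
proof -
  obtain k where k: "k \<in> frank P Q" "\<And>a. a \<in> carrier A \<Longrightarrow> k (i a) = h a"
    using frank_extend[OF m proj_Mod[OF Q] i proj_frank_to[OF Q h]] by blast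
  show ?thesis by (rule that[OF frank_hom[OF m(2) proj_Mod[OF Q] k(1)] k(2)])
qed

text \<open>Dual to \<open>ses_hom_lifts\<close>: a map from A into the projective module Q has
  finite rank, so extending functionals is enough to extend it to P; the quotients then
  follow.\<close>

lemma ses_hom_extends:
  assumes s: "ses A i P p X" and t: "ses B j Q q Y" and Q: "proj Q" and e: "ext_prop A i P"
    and f: "f\<^sub>1 \<in> Hm A B"
  obtains f\<^sub>0 f where "f\<^sub>0 \<in> Hm P Q" "f \<in> Hm X Y" "\<And>x. x \<in> carrier P \<Longrightarrow> q (f\<^sub>0 x) = f (p x)"
    "\<And>a. a \<in> carrier A \<Longrightarrow> j (f\<^sub>1 a) = f\<^sub>0 (i a)"
proof -
  note s' = sesD[OF s] and t' = sesD[OF t]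
  obtain f0 where f0: "f0 \<in> Hm P Q" "\<And>a. a \<in> carrier A \<Longrightarrow> f0 (i a) = j (f\<^sub>1 a)"
    using hom_extend_proj[OF s'(1,2,4) e Q mod_hom_comp[OF f t'(4)]] by blast
  obtain g where g: "g \<in> Hm X Y" "\<And>x. x \<in> carrier P \<Longrightarrow> g (p x) = q (f0 x)"
  proof (rule ses_factor[OF s t'(3) mod_hom_comp[OF f0(1) t'(6)]])
    show "q (f0 (i a)) = \<zero>\<^bsub>Y\<^esub>" if "a \<in> carrier A" for a
      using f0 t'(9) f that by (auto simp: mod_hom_closed)
  qed (rule that)
  show ?thesis by (rule that[OF f0(1) g(1)]) (simp_all add: g(2) f0(2))
qed

lemma st_cosyz:
  assumes s: "ses A i P p X" and t: "ses B j Q q Y" and P: "proj P" "proj Q"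
    and e: "ext_prop A i P" "ext_prop B j Q" and st: "st A B"
  shows "st X Y"
proof -
  obtain f1 g1 where 1: "f1 \<in> Hm A B" "g1 \<in> Hm B A" "near_id A (\<lambda>x. g1 (f1 x))" "near_id B (\<lambda>y. f1 (g1 y))"
    using st by (auto simp: st_def)
  obtain f0 f where f: "f0 \<in> Hm P Q" "f \<in> Hm X Y" "\<And>x. x \<in> carrier P \<Longrightarrow> q (f0 x) = f (p x)"
    "\<And>a. a \<in> carrier A \<Longrightarrow> j (f1 a) = f0 (i a)" using ses_hom_extends[OF s t P(2) e(1) 1(1)] by blast
  obtain g0 g where g: "g0 \<in> Hm Q P" "g \<in> Hm Y X" "\<And>x. x \<in> carrier Q \<Longrightarrow> p (g0 x) = g (q x)"
    "\<And>a. a \<in> carrier B \<Longrightarrow> i (g1 a) = g0 (j a)" using ses_hom_extends[OF t s P(1) e(2) 1(2)] by blast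
  have "near_id X (\<lambda>x. g (f x))"
    by (rule near_id_descend[OF s P(1) e(1) mod_hom_comp[OF f(2) g(2)] mod_hom_comp[OF f(1) g(1)] _ _ 1(3)])
      (use f g 1 in \<open>auto simp: mod_hom_closed\<close>)
  moreover have "near_id Y (\<lambda>x. f (g x))"
    by (rule near_id_descend[OF t P(2) e(2) mod_hom_comp[OF g(2) f(2)] mod_hom_comp[OF g(1) f(1)] _ _ 1(4)])
      (use f g 1 in \<open>auto simp: mod_hom_closed\<close>)
  ultimately show ?thesis using stI[OF sesD(3)[OF s] sesD(3)[OF t] f(2) g(2)] by blast
qed

end

section \<open>Finitely generated modules over a noetherian ring\<close>

context cring begin

section \<open>Free modules of finite rank and finitely generated modules\<close>

abbreviation fr (\<open>\<F>\<close>) where "\<F> n \<equiv> free_mod R n"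

definition fres :: "nat \<Rightarrow> (nat \<Rightarrow> 'a) \<Rightarrow> nat \<Rightarrow> 'a" where
  "fres n z = (\<lambda>i\<in>{..<n}. z i)"

text \<open>Together with \<open>fres\<close> this realises R^(n+1) as the sum of R^n and R, the
  decomposition behind the inductions on the rank.\<close>

definition fsnoc :: "nat \<Rightarrow> (nat \<Rightarrow> 'a) \<Rightarrow> 'a \<Rightarrow> nat \<Rightarrow> 'a" where
  "fsnoc n x a = (\<lambda>i\<in>{..<Suc n}. if i < n then x i else a)"

lemma fres_hom: "fres n \<in> Hm (\<F> (Suc n)) (\<F> n)"
  by (rule mod_homI) (auto simp: fres_def fun_eq_iff PiE_iff)

lemma fsnoc_hom: "(\<lambda>x. fsnoc n x \<zero>) \<in> Hm (\<F> n) (\<F> (Suc n))"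
  by (rule mod_homI) (auto simp: fsnoc_def fun_eq_iff PiE_iff)

lemma coord_hom: "i < n \<Longrightarrow> (\<lambda>z. z i) \<in> Hm (\<F> n) RR"
  by (rule mod_homI) (auto simp: PiE_iff)

lemma fsnoc_closed: "x \<in> carrier (\<F> n) \<Longrightarrow> a \<in> carrier R \<Longrightarrow> fsnoc n x a \<in> carrier (\<F> (Suc n))"
  by (auto simp: fsnoc_def PiE_iff)

lemma fsnoc_last [simp]: "fsnoc n x a n = a"
  by (simp add: fsnoc_def)

lemma fres_fsnoc: "x \<in> carrier (\<F> n) \<Longrightarrow> fres n (fsnoc n x a) = x"
  by (auto simp: fres_def fsnoc_def fun_eq_iff PiE_iff extensional_def)

lemma fsnoc_fres: "z \<in> carrier (\<F> (Suc n)) \<Longrightarrow> fsnoc n (fres n z) (z n) = z"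
  by (auto simp: fres_def fsnoc_def fun_eq_iff PiE_iff extensional_def less_Suc_eq)

lemma fsnoc_decomp: "x \<in> carrier (\<F> n) \<Longrightarrow> a \<in> carrier R \<Longrightarrow>
    fsnoc n x a = fsnoc n x \<zero> \<oplus>\<^bsub>\<F> (Suc n)\<^esub> a \<odot>\<^bsub>\<F> (Suc n)\<^esub> fsnoc n \<zero>\<^bsub>\<F> n\<^esub> \<one>"
  by (auto simp: fsnoc_def fun_eq_iff PiE_iff)

lemma free_0: "carrier (\<F> 0) = {\<zero>\<^bsub>\<F> 0\<^esub>}"
  by (simp add: restrict_def)

lemma proj_free: "proj (\<F> n)"
proof (induction n)
  case 0
  have "(\<lambda>x. x) \<in> frank (\<F> 0) (\<F> 0)"
    by (rule frank.eq_on[OF frank.zero]) (auto simp: fun_eq_iff)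
  then show ?case by (simp add: proj_def Mod_free)
next
  case (Suc n)
  let ?S = "\<F> (Suc n)"
  have 1: "(\<lambda>z. fsnoc n (fres n z) \<zero>) \<in> frank ?S ?S"
    by (rule frank_comp_left[OF Mod_free Mod_free Mod_free fsnoc_hom proj_frank_to[OF Suc fres_hom]])
  have "fsnoc n \<zero>\<^bsub>\<F> n\<^esub> \<one> \<in> carrier ?S"
    by (rule fsnoc_closed[OF Mod_simps(1)[OF Mod_free] one_closed])
  note 2 = frank.add[OF 1 coord_hom[OF lessI] this]
  have "(\<lambda>x. x) \<in> frank ?S ?S"
  proof (rule frank.eq_on[OF 2])
    fix z assume z: "z \<in> carrier ?S"
    have "fres n z \<in> carrier (\<F> n)" "z n \<in> carrier R"
      using mod_hom_closed[OF fres_hom z] z by (auto simp: PiE_iff)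
    from fsnoc_decomp[OF this] show "z = fsnoc n (fres n z) \<zero> \<oplus>\<^bsub>?S\<^esub> z n \<odot>\<^bsub>?S\<^esub> fsnoc n \<zero>\<^bsub>\<F> n\<^esub> \<one>"
      using fsnoc_fres[OF z] by simp
  qed
  then show ?case by (simp only: proj_def Mod_free simp_thms)
qed

text \<open>A surjection from a free module replaces the finite spanning set because it can serve
  directly as a cover. \<open>fgm_span\<close> and \<open>fg_module_fgm\<close> give the passage
  from and to \<open>fg_module\<close>.\<close>

definition fgm :: "('a, 'x) module \<Rightarrow> bool" where
  "fgm X \<longleftrightarrow> Modl X \<and> (\<exists>n. \<exists>p\<in>Hm (\<F> n) X. p ` carrier (\<F> n) = carrier X)"

lemma fgm_Mod: "fgm X \<Longrightarrow> Modl X"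
  by (simp add: fgm_def)

lemma hom_free_snoc:
  assumes Y: "Modl Y" and p: "p \<in> Hm (\<F> n) Y" and y: "y \<in> carrier Y"
  obtains q where "q \<in> Hm (\<F> (Suc n)) Y"
    "\<And>x a. x \<in> carrier (\<F> n) \<Longrightarrow> a \<in> carrier R \<Longrightarrow> q (fsnoc n x a) = p x \<oplus>\<^bsub>Y\<^esub> a \<odot>\<^bsub>Y\<^esub> y"
    "q ` carrier (\<F> (Suc n)) = {p x \<oplus>\<^bsub>Y\<^esub> a \<odot>\<^bsub>Y\<^esub> y | x a. x \<in> carrier (\<F> n) \<and> a \<in> carrier R}"
proof -
  let ?q = "\<lambda>z. p (fres n z) \<oplus>\<^bsub>Y\<^esub> z n \<odot>\<^bsub>Y\<^esub> y"
  have q: "?q \<in> Hm (\<F> (Suc n)) Y"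
    by (rule hom_plus[OF Y mod_hom_comp[OF fres_hom p] hom_rank_one[OF Y coord_hom[OF lessI] y]])
  have e: "?q (fsnoc n x a) = p x \<oplus>\<^bsub>Y\<^esub> a \<odot>\<^bsub>Y\<^esub> y" if "x \<in> carrier (\<F> n)" for x a
    by (simp only: fres_fsnoc[OF that] fsnoc_last)
  show ?thesis
  proof (rule that[OF q e])
    show "?q ` carrier (\<F> (Suc n)) = {p x \<oplus>\<^bsub>Y\<^esub> a \<odot>\<^bsub>Y\<^esub> y | x a. x \<in> carrier (\<F> n) \<and> a \<in> carrier R}"
    proof (intro equalityI subsetI)
      fix v assume "v \<in> ?q ` carrier (\<F> (Suc n))"
      then obtain z where z: "z \<in> carrier (\<F> (Suc n))" "v = ?q z" by blast
      have "fres n z \<in> carrier (\<F> n)" "z n \<in> carrier R"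
        using mod_hom_closed[OF fres_hom z(1)] z(1) by (auto simp: PiE_iff)
      then show "v \<in> {p x \<oplus>\<^bsub>Y\<^esub> a \<odot>\<^bsub>Y\<^esub> y | x a. x \<in> carrier (\<F> n) \<and> a \<in> carrier R}" using z(2) by blast
    next
      fix v assume "v \<in> {p x \<oplus>\<^bsub>Y\<^esub> a \<odot>\<^bsub>Y\<^esub> y | x a. x \<in> carrier (\<F> n) \<and> a \<in> carrier R}"
      then obtain x a where *: "x \<in> carrier (\<F> n)" "a \<in> carrier R" "v = p x \<oplus>\<^bsub>Y\<^esub> a \<odot>\<^bsub>Y\<^esub> y" by blast
      from imageI[OF fsnoc_closed[OF *(1,2)], of ?q] show "v \<in> ?q ` carrier (\<F> (Suc n))"
        by (simp only: e[OF *(1)] *(3))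
    qed
  qed
qed

text \<open>The vectors of the rank-one summands generate a submodule containing the image. Equality
  cannot be expected, as the functionals need not take all values.\<close>

lemma frank_image_fg:
  assumes Y: "Modl Y" and h: "h \<in> frank X Y"
  obtains n p where "p \<in> Hm (\<F> n) Y" "h ` carrier X \<subseteq> p ` carrier (\<F> n)"
proof -
  have "\<exists>n. \<exists>p\<in>Hm (\<F> n) Y. h ` carrier X \<subseteq> p ` carrier (\<F> n)" using h
  proof induction
    case zero
    have "(\<lambda>x. \<zero>\<^bsub>Y\<^esub>) ` carrier X \<subseteq> (\<lambda>x. \<zero>\<^bsub>Y\<^esub>) ` carrier (\<F> 0)" by auto
    then show ?case using hom_const_zero[OF Y] by blast
  next
    case (add h \<phi> y)
    obtain n p where p: "p \<in> Hm (\<F> n) Y" "h ` carrier X \<subseteq> p ` carrier (\<F> n)" using add by blast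
    obtain q where q: "q \<in> Hm (\<F> (Suc n)) Y"
      "q ` carrier (\<F> (Suc n)) = {p x \<oplus>\<^bsub>Y\<^esub> a \<odot>\<^bsub>Y\<^esub> y | x a. x \<in> carrier (\<F> n) \<and> a \<in> carrier R}"
      by (rule hom_free_snoc[OF Y p(1) add(3)])
    have "(\<lambda>x. h x \<oplus>\<^bsub>Y\<^esub> \<phi> x \<odot>\<^bsub>Y\<^esub> y) ` carrier X \<subseteq> q ` carrier (\<F> (Suc n))"
    proof
      fix v assume "v \<in> (\<lambda>x. h x \<oplus>\<^bsub>Y\<^esub> \<phi> x \<odot>\<^bsub>Y\<^esub> y) ` carrier X"
      then obtain x where x: "x \<in> carrier X" "v = h x \<oplus>\<^bsub>Y\<^esub> \<phi> x \<odot>\<^bsub>Y\<^esub> y" by blast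
      moreover obtain u where "u \<in> carrier (\<F> n)" "h x = p u" using p(2) x(1) by blast
      moreover have "\<phi> x \<in> carrier R" using add(2) x(1) by simp
      ultimately show "v \<in> q ` carrier (\<F> (Suc n))" unfolding q(2) by auto
    qed
    then show ?case using q(1) by blast
  next
    case (eq_on h g)
    then have "g ` carrier X = h ` carrier X" by (auto simp: image_iff)
    then show ?case using eq_on by simp
  qed
  then show ?thesis using that by blast
qed

lemma fgm_surj:
  assumes "fgm X" "Modl Y" "f \<in> Hm X Y" "f ` carrier X = carrier Y"
  shows "fgm Y"
proof -
  obtain n p where p: "p \<in> Hm (\<F> n) X" "p ` carrier (\<F> n) = carrier X" using assms(1) by (auto simp: fgm_def)
  have "(\<lambda>x. f (p x)) ` carrier (\<F> n) = carrier Y" using p(2) assms(4) by (simp flip: image_image)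
  then show ?thesis unfolding fgm_def using assms(2) mod_hom_comp[OF p(1) assms(3)] by blast
qed

lemma fgm_proj: assumes "proj P" shows "fgm P"
proof -
  have P: "Modl P" "(\<lambda>x. x) \<in> frank P P" using assms by (auto simp: proj_def)
  obtain n p where p: "p \<in> Hm (\<F> n) P" "(\<lambda>x. x) ` carrier P \<subseteq> p ` carrier (\<F> n)"
    by (rule frank_image_fg[OF P])
  have "p ` carrier (\<F> n) = carrier P" using p(2) mod_hom_closed[OF p(1)] by auto
  then show ?thesis using P p by (auto simp: fgm_def)
qed

lemma fgm_ses_proj: "ses A i P p X \<Longrightarrow> proj P \<Longrightarrow> fgm X"
  by (rule fgm_surj[OF fgm_proj sesD(3,6,7)])

lemma fgmE:
  assumes "fgm X"
  obtains n p where "p \<in> Hm (\<F> n) X" "p ` carrier (\<F> n) = carrier X"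
  using assms unfolding fgm_def by blast

lemma fgm_span:
  assumes "fg_module R X" shows "fgm X"
proof -
  obtain S where X: "Modl X" and S: "finite S" "S \<subseteq> carrier X" "mod_span R X S = carrier X"
    using assms by (auto simp: fg_module_def)
  have "\<exists>n. \<exists>p\<in>Hm (\<F> n) X. S \<subseteq> p ` carrier (\<F> n)" using S(1,2)
  proof induction
    case empty
    show ?case using hom_const_zero[OF X] by blast
  next
    case (insert s S)
    then obtain n p where p: "p \<in> Hm (\<F> n) X" "S \<subseteq> p ` carrier (\<F> n)" by blast
    have s: "s \<in> carrier X" using insert by simp
    obtain q where q: "q \<in> Hm (\<F> (Suc n)) X"
      "q ` carrier (\<F> (Suc n)) = {p x \<oplus>\<^bsub>X\<^esub> a \<odot>\<^bsub>X\<^esub> s | x a. x \<in> carrier (\<F> n) \<and> a \<in> carrier R}"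
      by (rule hom_free_snoc[OF X p(1) s])
    have z: "\<zero>\<^bsub>\<F> n\<^esub> \<in> carrier (\<F> n)" by (rule Mod_simps(1)[OF Mod_free])
    have "s = p \<zero>\<^bsub>\<F> n\<^esub> \<oplus>\<^bsub>X\<^esub> \<one> \<odot>\<^bsub>X\<^esub> s" unfolding hom_zero[OF Mod_free X p(1)] using s X by simp
    then have "s \<in> q ` carrier (\<F> (Suc n))" unfolding q(2) using z one_closed by blast
    moreover have "t \<in> q ` carrier (\<F> (Suc n))" if t: "t \<in> S" for t
    proof -
      obtain u where u: "u \<in> carrier (\<F> n)" "t = p u" using p(2) t by blast
      have "t = p u \<oplus>\<^bsub>X\<^esub> \<zero> \<odot>\<^bsub>X\<^esub> s" using u s X mod_hom_closed[OF p(1) u(1)] by simp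
      then show ?thesis unfolding q(2) using u zero_closed by blast
    qed
    ultimately show ?case using q(1) by blast
  qed
  then obtain n p where p: "p \<in> Hm (\<F> n) X" "S \<subseteq> p ` carrier (\<F> n)" by (elim exE bexE)
  have "carrier X \<subseteq> p ` carrier (\<F> n)"
    using S(3) p(2) submod_image[OF Mod_free X p(1)] unfolding mod_span_def by blast
  then have "p ` carrier (\<F> n) = carrier X" using mod_hom_closed[OF p(1)] by blast
  then show ?thesis using X p by (auto simp: fgm_def)
qed

lemma fg_module_fgm:
  assumes "fgm X" shows "fg_module R X"
proof -
  have X: "Modl X" by (rule fgm_Mod[OF assms])
  obtain n p where p: "p \<in> Hm (\<F> n) X" "p ` carrier (\<F> n) = carrier X" by (rule fgmE[OF assms])
  have "\<exists>S. finite S \<and> S \<subseteq> carrier X \<and> (\<forall>H. submodule H R X \<and> S \<subseteq> H \<longrightarrow> p ` carrier (\<F> n) \<subseteq> H)"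
    if "p \<in> Hm (\<F> n) X" for n p using that
  proof (induction n arbitrary: p)
    case 0
    have p0: "p ` carrier (\<F> 0) \<subseteq> {\<zero>\<^bsub>X\<^esub>}" by (simp only: free_0 image_insert image_empty hom_zero[OF Mod_free X 0] order_refl)
    show ?case
    proof (intro exI[of _ "{}"] conjI allI impI)
      fix H assume "submodule H R X \<and> {} \<subseteq> H"
      from submodD(2)[OF X conjunct1[OF this]] show "p ` carrier (\<F> 0) \<subseteq> H"
        by (intro order_trans[OF p0]) simp
    qed auto
  next
    case (Suc n)
    from Suc.IH[OF mod_hom_comp[OF fsnoc_hom Suc.prems]]
    obtain S where S: "finite S" "S \<subseteq> carrier X" "\<forall>H. submodule H R X \<and> S \<subseteq> H \<longrightarrow>
      (\<lambda>x. p (fsnoc n x \<zero>)) ` carrier (\<F> n) \<subseteq> H"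
      by (elim exE conjE)
    let ?e = "fsnoc n \<zero>\<^bsub>\<F> n\<^esub> \<one>"
    have e: "?e \<in> carrier (\<F> (Suc n))"
      by (rule fsnoc_closed[OF Mod_simps(1)[OF Mod_free] one_closed])
    show ?case
    proof (intro exI[of _ "insert (p ?e) S"] conjI allI impI)
      fix H assume H: "submodule H R X \<and> insert (p ?e) S \<subseteq> H"
      show "p ` carrier (\<F> (Suc n)) \<subseteq> H"
      proof
        fix v assume "v \<in> p ` carrier (\<F> (Suc n))"
        then obtain z where z: "z \<in> carrier (\<F> (Suc n))" "v = p z" by (elim imageE)
        have c: "fres n z \<in> carrier (\<F> n)" "z n \<in> carrier R"
          using mod_hom_closed[OF fres_hom z(1)] z(1) by (auto simp: PiE_iff)
        have "z = fsnoc n (fres n z) \<zero> \<oplus>\<^bsub>\<F> (Suc n)\<^esub> z n \<odot>\<^bsub>\<F> (Suc n)\<^esub> ?e"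
          using fsnoc_decomp[OF c] fsnoc_fres[OF z(1)] by simp
        then have "v = p (fsnoc n (fres n z) \<zero>) \<oplus>\<^bsub>X\<^esub> z n \<odot>\<^bsub>X\<^esub> p ?e"
          using z(2) mod_hom_add[OF Suc.prems fsnoc_closed[OF c(1) zero_closed] Mod_simps(3)[OF Mod_free c(2) e]]
            mod_hom_smult[OF Suc.prems c(2) e] by simp
        moreover have "p (fsnoc n (fres n z) \<zero>) \<in> H"
          using S(3)[rule_format, of H] H imageI[OF c(1), of "\<lambda>x. p (fsnoc n x \<zero>)"] by auto
        ultimately show "v \<in> H" using H submodD(3,4)[OF X, of H] c(2) by simp
      qed
    qed (use S e mod_hom_closed[OF Suc.prems] in auto)
  qed
  from this[OF p(1)] obtain S where S: "finite S" "S \<subseteq> carrier X"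
    "\<forall>H. submodule H R X \<and> S \<subseteq> H \<longrightarrow> carrier X \<subseteq> H" unfolding p(2) by (elim exE conjE)
  have "submodule (carrier X) R X" using module.carrier_is_submodule[OF X] .
  then have "mod_span R X S = carrier X" unfolding mod_span_def using S by blast
  then show ?thesis unfolding fg_module_def using X S by blast
qed

lemma hom_inl: "Modl N \<Longrightarrow> (\<lambda>x. (x, \<zero>\<^bsub>N\<^esub>)) \<in> Hm M (dsum_mod M N)"
  and hom_inr: "Modl M \<Longrightarrow> (\<lambda>y. (\<zero>\<^bsub>M\<^esub>, y)) \<in> Hm N (dsum_mod M N)"
  by (auto intro!: mod_homI)

lemma proj_dsum:
  assumes "proj P" "proj Q" shows "proj (dsum_mod P Q)"
proof -
  note m = proj_Mod[OF assms(1)] proj_Mod[OF assms(2)]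
  let ?D = "dsum_mod P Q"
  have D: "Modl ?D" by (rule Mod_dsum[OF m])
  note 1 = frank_comp_left[OF D m(1) D hom_inl[OF m(2)] proj_frank_to[OF assms(1) hom_fst]]
  note 2 = frank_comp_left[OF D m(2) D hom_inr[OF m(1)] proj_frank_to[OF assms(2) hom_snd]]
  have "(\<lambda>x. x) \<in> frank ?D ?D"
    by (rule frank.eq_on[OF frank_plus[OF D D 1 2]]) (use m in auto)
  then show ?thesis using D by (simp add: proj_def)
qed

text \<open>The surjectivity argument of the horseshoe lemma: once the image of b in C is matched by
  an element coming from Q, the difference lies in A and is matched by P.\<close>

lemma ses_dsum_cover:
  assumes s: "ses A i B p C" and f: "f \<in> Hm P A" "f ` carrier P = carrier A"
    and g: "g \<in> Hm Q B" "(\<lambda>x. p (g x)) ` carrier Q = carrier C" and m: "Modl P" "Modl Q"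
  shows "(\<lambda>z. i (f (fst z)) \<oplus>\<^bsub>B\<^esub> g (snd z)) ` carrier (dsum_mod P Q) = carrier B" (is "?h ` _ = _")
    "(\<lambda>z. i (f (fst z)) \<oplus>\<^bsub>B\<^esub> g (snd z)) \<in> Hm (dsum_mod P Q) B"
proof -
  note s' = sesD[OF s]
  show h: "?h \<in> Hm (dsum_mod P Q) B"
    by (rule hom_copair[OF mod_hom_comp[OF f(1) s'(4)] g(1) s'(2)])
  show "?h ` carrier (dsum_mod P Q) = carrier B"
  proof (intro equalityI subsetI)
    fix b assume b: "b \<in> carrier B"
    have "p b \<in> (\<lambda>x. p (g x)) ` carrier Q" using g(2) s'(11)[OF b] by simp
    then obtain y where y: "y \<in> carrier Q" "p b = p (g y)" by blast
    have gy: "g y \<in> carrier B" by (rule mod_hom_closed[OF g(1) y(1)])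
    have "p (b \<ominus>\<^bsub>B\<^esub> g y) = \<zero>\<^bsub>C\<^esub>"
      using hom_diff[OF s'(2,3,6) b gy] y(2) s'(11)[OF gy] s'(3) by simp
    then obtain a where a: "a \<in> carrier A" "b \<ominus>\<^bsub>B\<^esub> g y = i a"
      using ses_preimage[OF s Mod_simps(5)[OF s'(2) b gy]] by blast
    have "a \<in> f ` carrier P" using f(2) a(1) by simp
    then obtain x where x: "a = f x" "x \<in> carrier P" by (elim imageE)
    have "?h (x, y) = b" unfolding fst_conv snd_conv x(1)[symmetric] a(2)[symmetric] using b gy s'(2) by (simp add: Mod_ac)
    then show "b \<in> ?h ` carrier (dsum_mod P Q)"
      using rev_image_eqI[of "(x, y)" "carrier (dsum_mod P Q)" b ?h] x(2) y(1) by simp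
  qed (use mod_hom_closed[OF h] in blast)
qed

lemma fgm_ext:
  assumes s: "ses A i B p C" and fg: "fgm A" "fgm C"
  shows "fgm B"
proof -
  note s' = sesD[OF s]
  obtain m f where f: "f \<in> Hm (\<F> m) A" "f ` carrier (\<F> m) = carrier A" by (rule fgmE[OF fg(1)])
  obtain n g where g: "g \<in> Hm (\<F> n) C" "g ` carrier (\<F> n) = carrier C" by (rule fgmE[OF fg(2)])
  have im: "g x \<in> p ` carrier B" if "x \<in> carrier (\<F> n)" for x using s'(7) mod_hom_closed[OF g(1) that] by simp
  obtain k where k: "k \<in> Hm (\<F> n) B" "\<And>x. x \<in> carrier (\<F> n) \<Longrightarrow> p (k x) = g x"
    by (rule proj_lift[OF proj_free s'(2,3,6) g(1)]) (rule im, assumption, rule that)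
  have "(\<lambda>x. p (k x)) ` carrier (\<F> n) = carrier C" unfolding g(2)[symmetric] by (rule image_cong) (simp_all only: k(2))
  from ses_dsum_cover[OF s f k(1) this Mod_free Mod_free]
  show ?thesis by (rule fgm_surj[OF fgm_proj[OF proj_dsum[OF proj_free proj_free]] s'(2), rotated])
qed

lemma ses_dsum: "Modl X \<Longrightarrow> Modl Y \<Longrightarrow> ses X (\<lambda>x. (x, \<zero>\<^bsub>Y\<^esub>)) (dsum_mod X Y) snd Y"
proof -
  assume m: "Modl X" "Modl Y"
  have "snd ` carrier (dsum_mod X Y) = carrier Y"
    using Mod_simps(1)[OF m(1)] by (auto simp: image_iff)
  then show ?thesis unfolding ses_def
    using m by (auto simp: Mod_dsum hom_inl hom_snd inj_on_def)
qed

lemma fgm_dsum: "fgm X \<Longrightarrow> fgm Y \<Longrightarrow> fgm (dsum_mod X Y)"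
  by (rule fgm_ext[OF ses_dsum]) (auto dest: fgm_Mod)

section \<open>Noetherian modules\<close>

definition noeth :: "('a, 'x) module \<Rightarrow> bool" where
  "noeth X \<longleftrightarrow> (\<forall>H. submodule H R X \<longrightarrow> fgm (sub_mod X H))"

text \<open>A submodule H of B is an extension of its image in C by its preimage in A, and both of
  these are finitely generated.\<close>

lemma noeth_ext:
  assumes s: "ses A i B p C" and n: "noeth A" "noeth C"
  shows "noeth B"
  unfolding noeth_def
proof (intro allI impI)
  fix H assume H: "submodule H R B"
  note s' = sesD[OF s]
  have HB: "H \<subseteq> carrier B" by (rule submodD(1)[OF s'(2) H])
  let ?K = "{a \<in> carrier A. i a \<in> H}"
  have K: "submodule ?K R A" by (rule submod_vimage[OF s'(1,2,4) H])
  have MH: "Modl (sub_mod B H)" by (rule Mod_sub[OF s'(2) H])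
  have L: "submodule (p ` H) R C" using submod_image[OF MH s'(3) hom_from_sub[OF s'(6) HB]] by simp
  have "ses (sub_mod A ?K) i (sub_mod B H) p (sub_mod C (p ` H))"
    unfolding ses_def
  proof (intro conjI MH Mod_sub[OF s'(1) K] Mod_sub[OF s'(3) L])
    show "i \<in> Hm (sub_mod A ?K) (sub_mod B H)" by (rule hom_to_sub[OF hom_from_sub[OF s'(4)]]) auto
    show "inj_on i (carrier (sub_mod A ?K))" using s'(5) by (auto intro: inj_on_subset)
    show "p \<in> Hm (sub_mod B H) (sub_mod C (p ` H))" by (rule hom_to_sub[OF hom_from_sub[OF s'(6) HB]]) auto
    show "i ` carrier (sub_mod A ?K) = {x \<in> carrier (sub_mod B H). p x = \<zero>\<^bsub>sub_mod C (p ` H)\<^esub>}"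
      using s'(8,9) HB by (auto 4 3)
  qed auto
  then show "fgm (sub_mod B H)" using fgm_ext n K L unfolding noeth_def by blast
qed

end

locale noeth_cring = cring R + noetherian_ring R for R (structure)
begin

lemma noeth_RR: "noeth RR"
  unfolding noeth_def
proof (intro allI impI)
  fix H assume H: "submodule H R RR"
  have ideal: "ideal K R" if K: "submodule K R RR" for K
  proof (rule idealI[OF ring_axioms])
    note k = submodD[OF Mod_RR K]
    show "subgroup K (add_monoid R)"
    proof (rule add.subgroupI)
      show "\<ominus> a \<in> K" if "a \<in> K" for a
      proof -
        have "\<ominus> \<one> \<otimes> a \<in> K" using k(4)[of "\<ominus> \<one>" a] that by simp
        then show ?thesis using k(1) that by (auto simp: l_minus)
      qed
    qed (use k in auto)
    show xa: "x \<otimes> a \<in> K" if "a \<in> K" "x \<in> carrier R" for a x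
      using k(4)[OF that(2,1)] by simp
    show "a \<otimes> x \<in> K" if "a \<in> K" "x \<in> carrier R" for a x
      using xa[OF that] m_comm[OF that(2), of a] k(1) that(1) by auto
  qed
  obtain A where A: "A \<subseteq> carrier R" "finite A" "H = Idl A" using finetely_gen[OF ideal[OF H]] by blast
  have AH: "A \<subseteq> H" using A genideal_self by simp
  let ?M = "sub_mod RR H"
  have M: "Modl ?M" by (rule Mod_sub[OF Mod_RR H])
  \<comment> \<open>A submodule of the ideal H is again an ideal of R, so the finite set generating
    H as an ideal also spans it as a module.\<close>
  have "H \<subseteq> K" if K: "submodule K R ?M" "A \<subseteq> K" for K
  proof -
    note k = submodD[OF M K(1)]
    have "submodule K R RR" by (rule submodI) (use k submodD[OF Mod_RR H] in auto)
    then show ?thesis using genideal_minimal[OF ideal _ ] K(2) A(3) by blast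
  qed
  moreover have "submodule H R ?M" using module.carrier_is_submodule[OF M] by simp
  ultimately have "mod_span R ?M A = carrier ?M" unfolding mod_span_def using AH by auto
  then have "fg_module R ?M" unfolding fg_module_def using A AH M by auto
  then show "fgm ?M" by (rule fgm_span)
qed

lemma noeth_free: "noeth (\<F> n)"
proof (induction n)
  case 0
  show ?case unfolding noeth_def
  proof (intro allI impI)
    fix H assume H: "submodule H R (\<F> 0)"
    have "H = carrier (\<F> 0)" using submodD(1,2)[OF Mod_free H] by auto
    then have "Modl (sub_mod (\<F> 0) H)" "(\<lambda>x. x) ` carrier (\<F> 0) = carrier (sub_mod (\<F> 0) H)"
      "(\<lambda>x. x) \<in> Hm (\<F> 0) (sub_mod (\<F> 0) H)"
      using Mod_sub[OF Mod_free H] hom_to_sub[OF mod_hom_id, of "\<F> 0" H] by auto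
    then show "fgm (sub_mod (\<F> 0) H)" unfolding fgm_def by blast
  qed
next
  case (Suc n)
  have "ses (\<F> n) (\<lambda>x. fsnoc n x \<zero>) (\<F> (Suc n)) (\<lambda>z. z n) RR"
    unfolding ses_def
  proof (intro conjI Mod_free Mod_RR fsnoc_hom coord_hom[OF lessI])
    show "inj_on (\<lambda>x. fsnoc n x \<zero>) (carrier (\<F> n))"
      by (rule inj_on_inverseI[of _ "fres n"]) (rule fres_fsnoc)
    show "(\<lambda>z. z n) ` carrier (\<F> (Suc n)) = carrier RR"
    proof (intro equalityI subsetI)
      fix a assume "a \<in> carrier RR"
      then have "fsnoc n \<zero>\<^bsub>\<F> n\<^esub> a \<in> carrier (\<F> (Suc n))"
        using fsnoc_closed[OF Mod_simps(1)[OF Mod_free]] by simp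
      then show "a \<in> (\<lambda>z. z n) ` carrier (\<F> (Suc n))" by (rule rev_image_eqI) simp
    qed (auto simp: PiE_iff)
    show "(\<lambda>x. fsnoc n x \<zero>) ` carrier (\<F> n) = {x \<in> carrier (\<F> (Suc n)). x n = \<zero>\<^bsub>RR\<^esub>}"
    proof (intro equalityI subsetI)
      fix z assume z: "z \<in> {x \<in> carrier (\<F> (Suc n)). x n = \<zero>\<^bsub>RR\<^esub>}"
      then have zc: "z \<in> carrier (\<F> (Suc n))" and zn: "z n = \<zero>" by simp_all
      have "z = fsnoc n (fres n z) \<zero>" using fsnoc_fres[OF zc] zn by simp
      then show "z \<in> (\<lambda>x. fsnoc n x \<zero>) ` carrier (\<F> n)" using mod_hom_closed[OF fres_hom zc] by blast
    next
      fix z assume "z \<in> (\<lambda>x. fsnoc n x \<zero>) ` carrier (\<F> n)"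
      then obtain x where x: "x \<in> carrier (\<F> n)" "z = fsnoc n x \<zero>" by blast
      show "z \<in> {x \<in> carrier (\<F> (Suc n)). x n = \<zero>\<^bsub>RR\<^esub>}"
        using fsnoc_closed[OF x(1) zero_closed] x(2) by simp
    qed
  qed
  then show ?case using noeth_ext Suc noeth_RR by blast
qed

text \<open>The part of a free cover of B that lies over the image of A is finitely generated,
  because free modules of finite rank are noetherian, and it maps onto A.\<close>

lemma fgm_sub:
  assumes B: "fgm B" and A: "Modl A" and i: "i \<in> Hm A B" "inj_on i (carrier A)"
  shows "fgm A"
proof -
  note mB = fgm_Mod[OF B]
  obtain n p where p: "p \<in> Hm (\<F> n) B" "p ` carrier (\<F> n) = carrier B" by (rule fgmE[OF B])
  let ?H = "{x \<in> carrier (\<F> n). p x \<in> i ` carrier A}"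
  have H: "submodule ?H R (\<F> n)" by (rule submod_vimage[OF Mod_free mB p(1) submod_image[OF A mB i(1)]])
  have fg: "fgm (sub_mod (\<F> n) ?H)" using noeth_free H by (simp only: noeth_def)
  have "p \<in> Hm (sub_mod (\<F> n) ?H) B" by (rule hom_from_sub[OF p(1)]) auto
  then obtain f where f: "f \<in> Hm (sub_mod (\<F> n) ?H) A"
    "\<And>x. x \<in> carrier (sub_mod (\<F> n) ?H) \<Longrightarrow> i (f x) = p x"
    by (rule hom_factor_inj[OF A mB i]) auto
  have "f ` carrier (sub_mod (\<F> n) ?H) = carrier A"
  proof (intro equalityI subsetI)
    fix a assume a: "a \<in> carrier A"
    have "i a \<in> p ` carrier (\<F> n)" using p(2) mod_hom_closed[OF i(1) a] by simp
    then obtain x where x: "x \<in> carrier (\<F> n)" "i a = p x" by blast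
    then have xH: "x \<in> carrier (sub_mod (\<F> n) ?H)" using a by (auto intro: rev_image_eqI)
    then have "i (f x) = i a" using f(2)[OF xH] x by simp
    then have "a = f x" using inj_onD[OF i(2) _ mod_hom_closed[OF f(1) xH] a] by simp
    then show "a \<in> f ` carrier (sub_mod (\<F> n) ?H)" using xH by blast
  qed (use mod_hom_closed[OF f(1)] in blast)
  then show ?thesis by (rule fgm_surj[OF fg A f(1)])
qed

lemma fgm_ses_sub: "ses A i B p C \<Longrightarrow> fgm B \<Longrightarrow> fgm A"
  by (rule fgm_sub[OF _ sesD(1,4,5)])

lemma fgm_ses_quot: "ses A i B p C \<Longrightarrow> fgm B \<Longrightarrow> fgm C"
  by (rule fgm_surj[OF _ sesD(3,6,7)])

end

section \<open>Syzygies\<close>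

context cring begin

definition transport :: "('x \<Rightarrow> 'y) \<Rightarrow> ('a, 'x) module \<Rightarrow> ('a, 'y) module" where
  "transport j X = (let k = inv_into (carrier X) j in \<lparr>carrier = j ` carrier X, mult = undefined,
     one = undefined, zero = j \<zero>\<^bsub>X\<^esub>, add = (\<lambda>u v. j (k u \<oplus>\<^bsub>X\<^esub> k v)),
     smult = (\<lambda>a u. j (a \<odot>\<^bsub>X\<^esub> k u))\<rparr>)"

lemma transport:
  assumes X: "Modl X" and j: "inj_on j (carrier X)"
  shows "Modl (transport j X)" "j \<in> mod_iso R X (transport j X)"
proof -
  let ?T = "transport j X"
  have c: "carrier ?T = j ` carrier X" "\<zero>\<^bsub>?T\<^esub> = j \<zero>\<^bsub>X\<^esub>" by (simp_all add: transport_def Let_def)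
  have "j x \<oplus>\<^bsub>?T\<^esub> j y = j (x \<oplus>\<^bsub>X\<^esub> y)" if "x \<in> carrier X" "y \<in> carrier X" for x y
    using that j by (simp add: transport_def Let_def)
  moreover have "a \<odot>\<^bsub>?T\<^esub> j x = j (a \<odot>\<^bsub>X\<^esub> x)" if "x \<in> carrier X" for a x
    using that j by (simp add: transport_def Let_def)
  ultimately have "Modl ?T \<and> j \<in> Hm X ?T" using Mod_surj_image[OF X c] by simp
  then show "Modl ?T" "j \<in> mod_iso R X ?T" using j c by (auto simp: mod_iso_def bij_betw_def)
qed

text \<open>Each element of X is encoded by its fibre under a surjection from R^n, a set of
  functions on the naturals. Fibres are nonempty, so different elements have different
  fibres.\<close>

lemma fgm_iso_copy:
  assumes X: "fgm X"
  shows "\<exists>Y :: ('a, (nat \<Rightarrow> 'a) set) module. Modl Y \<and> mod_isomorphic R X Y"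
proof -
  obtain n p where p: "p \<in> Hm (\<F> n) X" "p ` carrier (\<F> n) = carrier X" by (rule fgmE[OF X])
  let ?j = "\<lambda>x. {v \<in> carrier (\<F> n). p v = x}"
  have "inj_on ?j (carrier X)"
  proof (rule inj_onI)
    fix x y assume *: "x \<in> carrier X" "y \<in> carrier X" "?j x = ?j y"
    have "x \<in> p ` carrier (\<F> n)" using p(2) *(1) by simp
    then obtain v where "v \<in> ?j x" by blast
    then show "x = y" using *(3) by auto
  qed
  from transport[OF fgm_Mod[OF X] this] show ?thesis unfolding mod_isomorphic_def by blast
qed

text \<open>Syzygies are moved to one element type, so that the syzygy operator can be iterated.\<close>

definition copy :: "('a, 'x) module \<Rightarrow> ('a, (nat \<Rightarrow> 'a) set) module" where
  "copy X = (SOME Y. Modl Y \<and> mod_isomorphic R X Y)"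

lemma copy: 
  assumes "fgm X"
  shows "Modl (copy X)" "\<exists>f. f \<in> mod_iso R X (copy X)" "st X (copy X)" "fgm (copy X)"
proof -
  have "Modl (copy X) \<and> mod_isomorphic R X (copy X)"
    unfolding copy_def by (rule someI_ex[OF fgm_iso_copy[OF assms]])
  then show 1: "Modl (copy X)" and 2: "\<exists>f. f \<in> mod_iso R X (copy X)" by (auto simp: mod_isomorphic_def)
  then obtain f where f: "f \<in> mod_iso R X (copy X)" by blast
  show "st X (copy X)" by (rule st_iso[OF fgm_Mod[OF assms] 1 f])
  show "fgm (copy X)"
    by (rule fgm_surj[OF assms 1, of f]) (use f in \<open>auto simp: mod_iso_def bij_betw_def\<close>)
qed

lemma ses_iso:
  assumes s: "ses A i B p C" and m: "Modl A'" "Modl B'" "Modl C'"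
    and a: "a \<in> mod_iso R A' A" and b: "b \<in> mod_iso R B B'" and c: "c \<in> mod_iso R C C'"
  shows "ses A' (\<lambda>x. b (i (a x))) B' (\<lambda>y. c (p (inv_into (carrier B) b y))) C'"
proof -
  note s' = sesD[OF s]
  let ?b = "inv_into (carrier B) b"
  have a': "a \<in> Hm A' A" "bij_betw a (carrier A') (carrier A)"
    and b': "b \<in> Hm B B'" "bij_betw b (carrier B) (carrier B')"
    and c': "c \<in> Hm C C'" "bij_betw c (carrier C) (carrier C')"
    using a b c by (auto simp: mod_iso_def)
  obtain b2 where b2: "b2 \<in> Hm B' B" "\<And>x. x \<in> carrier B \<Longrightarrow> b2 (b x) = x" "\<And>y. y \<in> carrier B' \<Longrightarrow> b (b2 y) = y"
    by (rule mod_iso_inverse[OF b Mod_simps(2,3)[OF s'(2)]]) (assumption+, rule that)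
  have be: "?b y = b2 y" if "y \<in> carrier B'" for y
    using inv_into_f_eq[OF bij_betw_imp_inj_on[OF b'(2)] mod_hom_closed[OF b2(1) that] b2(3)[OF that]] .
  have bh: "?b \<in> Hm B' B" by (rule hom_cong[OF m(2) b2(1) be])
  show ?thesis unfolding ses_def
  proof (intro conjI m)
    show "(\<lambda>x. b (i (a x))) \<in> Hm A' B'" by (rule mod_hom_comp[OF mod_hom_comp[OF a'(1) s'(4)] b'(1)])
    show "inj_on (\<lambda>x. b (i (a x))) (carrier A')"
    proof (rule inj_onI)
      fix x y assume *: "x \<in> carrier A'" "y \<in> carrier A'" "b (i (a x)) = b (i (a y))"
      have ac: "a x \<in> carrier A" "a y \<in> carrier A" using mod_hom_closed[OF a'(1)] * by blast+
      have "i (a x) = i (a y)"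
        using inj_onD[OF bij_betw_imp_inj_on[OF b'(2)] *(3)] s'(10) ac by blast
      then have "a x = a y" by (rule ses_inj[OF s ac])
      then show "x = y" using inj_onD[OF bij_betw_imp_inj_on[OF a'(2)]] * by blast
    qed
    show "(\<lambda>y. c (p (?b y))) \<in> Hm B' C'" by (rule mod_hom_comp[OF mod_hom_comp[OF bh s'(6)] c'(1)])
    have "?b ` carrier B' = carrier B" using bij_betw_imp_surj_on[OF bij_betw_inv_into[OF b'(2)]] .
    then have "(\<lambda>y. c (p (?b y))) ` carrier B' = c ` p ` carrier B" by (metis image_image)
    then show "(\<lambda>y. c (p (?b y))) ` carrier B' = carrier C'"
      using s'(7) bij_betw_imp_surj_on[OF c'(2)] by simp
    show "(\<lambda>x. b (i (a x))) ` carrier A' = {y \<in> carrier B'. c (p (?b y)) = \<zero>\<^bsub>C'\<^esub>}"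
    proof (intro equalityI subsetI)
      fix y assume "y \<in> (\<lambda>x. b (i (a x))) ` carrier A'"
      then obtain x where x: "x \<in> carrier A'" "y = b (i (a x))" by blast
      have ac: "a x \<in> carrier A" by (rule mod_hom_closed[OF a'(1) x(1)])
      have yc: "y \<in> carrier B'" using mod_hom_closed[OF b'(1) s'(10)[OF ac]] x by simp
      have "?b y = i (a x)" using be[OF yc] b2(2)[OF s'(10)[OF ac]] x by simp
      then show "y \<in> {y \<in> carrier B'. c (p (?b y)) = \<zero>\<^bsub>C'\<^esub>}"
        using yc s'(9)[OF ac] hom_zero[OF s'(3) m(3) c'(1)] by simp
    next
      fix y assume "y \<in> {y \<in> carrier B'. c (p (?b y)) = \<zero>\<^bsub>C'\<^esub>}"
      then have y: "y \<in> carrier B'" "c (p (?b y)) = \<zero>\<^bsub>C'\<^esub>" by simp_all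
      have yB: "?b y \<in> carrier B" by (rule mod_hom_closed[OF bh y(1)])
      have "c (p (?b y)) = c \<zero>\<^bsub>C\<^esub>" using y(2) hom_zero[OF s'(3) m(3) c'(1)] by simp
      then have "p (?b y) = \<zero>\<^bsub>C\<^esub>"
        using inj_onD[OF bij_betw_imp_inj_on[OF c'(2)]] s'(11)[OF yB] Mod_simps(1)[OF s'(3)] by blast
      then obtain z where z: "z \<in> carrier A" "?b y = i z" using ses_preimage[OF s yB] by blast
      have "z \<in> a ` carrier A'" using bij_betw_imp_surj_on[OF a'(2)] z(1) by simp
      then obtain x where x: "z = a x" "x \<in> carrier A'" by (elim imageE)
      have "b (i (a x)) = y" using z(2) x(1) be[OF y(1)] b2(3)[OF y(1)] by simp
      then show "y \<in> (\<lambda>x. b (i (a x))) ` carrier A'" using x(2) by blast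
    qed
  qed
qed

lemma iso_sym:
  assumes "Modl X" "f \<in> mod_iso R X Y"
  shows "\<exists>g. g \<in> mod_iso R Y X"
proof -
  obtain g where g: "g \<in> Hm Y X" "\<And>x. x \<in> carrier X \<Longrightarrow> g (f x) = x" "\<And>y. y \<in> carrier Y \<Longrightarrow> f (g y) = y"
    by (rule mod_iso_inverse[OF assms(2) Mod_simps(2,3)[OF assms(1)]]) (assumption+, rule that)
  have f: "f \<in> Hm X Y" using assms(2) by (simp add: mod_iso_def)
  have "g \<in> mod_iso R Y X" by (rule mod_isoI[OF g(1) f]) (simp_all add: g)
  then show ?thesis by blast
qed

lemma iso_id: "(\<lambda>x. x) \<in> mod_iso R X X"
  by (rule mod_isoI[OF mod_hom_id mod_hom_id]) auto

lemma ses_copy_left: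
  assumes s: "ses A i B p C" and A: "fgm A"
  obtains j where "ses (copy A) j B p C"
proof -
  obtain f where "f \<in> mod_iso R A (copy A)" using copy(2)[OF A] by blast
  then obtain g where g: "g \<in> mod_iso R (copy A) A" using iso_sym[OF sesD(1)[OF s]] by blast
  have "ses (copy A) (\<lambda>x. i (g x)) B (\<lambda>y. p (inv_into (carrier B) (\<lambda>x. x) y)) C"
    by (rule ses_iso[OF s copy(1)[OF A] sesD(2,3)[OF s] g iso_id iso_id])
  then have "ses (copy A) (\<lambda>x. i (g x)) B p C" 
    using sesD(6)[OF s] unfolding ses_def
    by (auto simp: inv_into_f_eq[of "\<lambda>x. x", simplified] cong: image_cong conj_cong)
  then show ?thesis by (rule that)
qed

lemma ses_copy:
  assumes s: "ses A i B p C" and fg: "fgm A" "fgm B" "fgm C"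
  obtains j q where "ses (copy A) j (copy B) q (copy C)"
proof -
  obtain f where "f \<in> mod_iso R A (copy A)" using copy(2)[OF fg(1)] by blast
  then obtain a where a: "a \<in> mod_iso R (copy A) A" using iso_sym[OF sesD(1)[OF s]] by blast
  obtain b where b: "b \<in> mod_iso R B (copy B)" using copy(2)[OF fg(2)] by blast
  obtain c where c: "c \<in> mod_iso R C (copy C)" using copy(2)[OF fg(3)] by blast
  show ?thesis by (rule that[OF ses_iso[OF s copy(1)[OF fg(1)] copy(1)[OF fg(2)] copy(1)[OF fg(3)] a b c]])
qed

text \<open>\<open>E1 X\<close> stands for \<open>Ext\<^sup>1(X, R) = 0\<close>; by dimension shifting, \<open>Einf X\<close> below stands for
  the vanishing of \<open>Ext\<^sup>i(X, R)\<close> for all \<open>i > 0\<close>.\<close>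

definition E1 :: "('a, 'x) module \<Rightarrow> bool" where
  "E1 X \<longleftrightarrow> (\<exists>n. \<exists>p\<in>Hm (\<F> n) X. p ` carrier (\<F> n) = carrier X \<and>
     ext_prop (sub_mod (\<F> n) (a_kernel (\<F> n) X p)) (\<lambda>x. x) (\<F> n))"

text \<open>What \<open>E1\<close> requires of a single free cover, \<open>ext_prop_any\<close>
  carries over to every sequence ending in X, whatever its middle term.\<close>

lemma E1_ext:
  assumes E: "E1 X" and s: "ses B j W q X" shows "ext_prop B j W"
proof -
  obtain n p where p: "p \<in> Hm (\<F> n) X" "p ` carrier (\<F> n) = carrier X"
    "ext_prop (sub_mod (\<F> n) (a_kernel (\<F> n) X p)) (\<lambda>x. x) (\<F> n)" using E unfolding E1_def by blast
  show ?thesis by (rule ext_prop_any[OF ses_kernel[OF Mod_free sesD(3)[OF s] p(1,2)] proj_free p(3) s])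
qed

lemma E1_I:
  assumes s: "ses A i P p X" and P: "proj P" and e: "ext_prop A i P"
  shows "E1 X"
proof -
  obtain n q where q: "q \<in> Hm (\<F> n) X" "q ` carrier (\<F> n) = carrier X" by (rule fgmE[OF fgm_ses_proj[OF s P]])
  have "ext_prop (sub_mod (\<F> n) (a_kernel (\<F> n) X q)) (\<lambda>x. x) (\<F> n)"
    by (rule ext_prop_any[OF s P e ses_kernel[OF Mod_free sesD(3)[OF s] q]])
  then show ?thesis unfolding E1_def using q by blast
qed

lemma ses_cover: "fgm X \<Longrightarrow> \<exists>n p. ses (sub_mod (\<F> n) (a_kernel (\<F> n) X p)) (\<lambda>x. x) (\<F> n) p X"
proof -
  assume X: "fgm X"
  obtain n p where p: "p \<in> Hm (\<F> n) X" "p ` carrier (\<F> n) = carrier X" by (rule fgmE[OF X])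
  from ses_kernel[OF Mod_free fgm_Mod[OF X] p] show ?thesis by blast
qed

lemma E1_st:
  assumes st: "st X Y" and fg: "fgm X" "fgm Y" and E: "E1 X"
  shows "E1 Y"
proof -
  obtain n p where s: "ses (sub_mod (\<F> n) (a_kernel (\<F> n) X p)) (\<lambda>x. x) (\<F> n) p X" using ses_cover[OF fg(1)] by blast
  obtain m q where t: "ses (sub_mod (\<F> m) (a_kernel (\<F> m) Y q)) (\<lambda>x. x) (\<F> m) q Y" using ses_cover[OF fg(2)] by blast
  show ?thesis by (rule E1_I[OF t proj_free ext_prop_st[OF s t proj_free proj_free st E1_ext[OF E s]]])
qed

lemma ses_proj_cong:
  assumes s: "ses A i P p X" and t: "ses B j Q q X" and P: "proj P" "proj Q"
  shows "st A B"
  by (rule st_syz[OF s t P st_refl[OF sesD(3)[OF s]]])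

text \<open>A chosen kernel of a free cover, meaningful once \<open>om_ses\<close> applies. Neither
  the cover nor the kernel is canonical; by \<open>st_om\<close> the choice matters only up to
  \<open>st\<close>, and statements about \<open>om\<close> are made up to
  \<open>st\<close>.\<close>

definition om :: "('a, 'x) module \<Rightarrow> ('a, (nat \<Rightarrow> 'a) set) module" where
  "om X = (SOME Z. \<exists>n i p. ses Z i (\<F> n) p X)"

text \<open>The iteration starts from the copy of X, so that all stages have one element type, the
  zeroth included.\<close>

definition Om :: "nat \<Rightarrow> ('a, 'x) module \<Rightarrow> ('a, (nat \<Rightarrow> 'a) set) module" where
  "Om k X = (om ^^ k) (copy X)"

lemma Om_0: "Om 0 X = copy X" and Om_Suc: "Om (Suc k) X = om (Om k X)"
  by (simp_all add: Om_def)

text \<open>Projectivity of Q gives a section t of \<open>p\<close>, which splits W into A and Q.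
  The idempotent t p factors through Q, so it is stably zero and the retraction onto A is a stable
  inverse of \<open>i\<close>.\<close>

lemma st_split:
  assumes s: "ses A i W p Q" and Q: "proj Q"
  shows "st W A"
proof -
  note s' = sesD[OF s]
  obtain t where t: "t \<in> Hm Q W" "\<And>x. x \<in> carrier Q \<Longrightarrow> p (t x) = x"
  proof (rule proj_lift[OF Q s'(2,3,6) mod_hom_id])
    show "x \<in> p ` carrier W" if "x \<in> carrier Q" for x using s'(7) that by simp
  qed (rule that)
  let ?k = "\<lambda>w. w \<ominus>\<^bsub>W\<^esub> t (p w)"
  have tp: "(\<lambda>w. t (p w)) \<in> Hm W W" by (rule mod_hom_comp[OF s'(6) t(1)])
  have k: "?k \<in> Hm W W" by (rule hom_minus[OF s'(2) mod_hom_id tp])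
  obtain r where r: "r \<in> Hm W A" "\<And>w. w \<in> carrier W \<Longrightarrow> i (r w) = ?k w"
  proof (rule ses_factor_inj[OF s k])
    show "p (?k w) = \<zero>\<^bsub>Q\<^esub>" if "w \<in> carrier W" for w
      using hom_diff[OF s'(2,3,6) that mod_hom_closed[OF tp that]] t(2)[OF s'(11)[OF that]] s'(3) s'(11)[OF that]
      by simp
  qed (rule that)
  show ?thesis
  proof (rule stI[OF s'(2,1) r(1) s'(4)])
    have fr: "(\<lambda>w. \<ominus>\<^bsub>W\<^esub> t (p w)) \<in> frank W W"
      by (rule frank_neg[OF s'(2,2) frank_comp_left[OF s'(2,3,2) t(1) proj_frank_to[OF Q s'(6)]]])
    show "near_id W (\<lambda>x. i (r x))"
      by (rule near_idI[OF fr]) (simp add: r(2) Mod_arith(1)[OF s'(2)])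
    show "near_id A (\<lambda>y. r (i y))"
    proof (rule near_id_id[OF s'(1)])
      fix a assume a: "a \<in> carrier A"
      have "i (r (i a)) = i a" using r(2)[OF s'(10)[OF a]] s'(9)[OF a] hom_zero[OF s'(3,2) t(1)] s'(2) s'(10)[OF a]
        by (simp add: Mod_arith(1))
      then show "r (i a) = a" using ses_inj[OF s mod_hom_closed[OF r(1) s'(10)[OF a]] a] by simp
    qed
  qed
qed

text \<open>The projective modules are the zero objects of the stable category. Explicitly, the
  identity of Y is f g - r, where f g has finite rank because it factors through X.\<close>

lemma proj_st:
  assumes st: "st X Y" and X: "proj X" shows "proj Y"
proof -
  obtain f g where fg: "f \<in> Hm X Y" "g \<in> Hm Y X" "near_id Y (\<lambda>y. f (g y))" using st by (auto simp: st_def)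
  note m = stD[OF st]
  obtain r where r: "r \<in> frank Y Y" "\<forall>x\<in>carrier Y. f (g x) = x \<oplus>\<^bsub>Y\<^esub> r x" using fg(3) by (auto simp: near_id_def)
  have rh: "r \<in> Hm Y Y" by (rule frank_hom[OF m(2,2) r(1)])
  have "(\<lambda>y. f (g y)) \<in> frank Y Y" by (rule frank_comp_left[OF m(2,1,2) fg(1) proj_frank_to[OF X fg(2)]])
  then have *: "(\<lambda>y. f (g y) \<oplus>\<^bsub>Y\<^esub> \<ominus>\<^bsub>Y\<^esub> r y) \<in> frank Y Y"
    by (rule frank_plus[OF m(2,2) _ frank_neg[OF m(2,2) r(1)]])
  have "(\<lambda>x. x) \<in> frank Y Y"
  proof (rule frank.eq_on[OF *])
    fix y assume y: "y \<in> carrier Y"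
    have "r y \<in> carrier Y" by (rule mod_hom_closed[OF rh y])
    then show "y = f (g y) \<oplus>\<^bsub>Y\<^esub> \<ominus>\<^bsub>Y\<^esub> r y" using r(2) y m(2) by (simp add: Mod_ac)
  qed
  then show ?thesis using m by (simp add: proj_def)
qed

text \<open>The fibre product of B and Q over C is an extension in two ways: of Q by A and of B by
  Z. With Q free, the first splits, and the second is the rotated sequence.\<close>

lemma ses_pullback:
  assumes s: "ses A i B p C" and t: "ses Z j Q c C"
  obtains W where "ses A (\<lambda>a. (i a, \<zero>\<^bsub>Q\<^esub>)) W snd Q" "ses Z (\<lambda>z. (\<zero>\<^bsub>B\<^esub>, j z)) W fst B"
proof -
  note s' = sesD[OF s] and t' = sesD[OF t]
  let ?D = "dsum_mod B Q"
  let ?H = "{w \<in> carrier ?D. p (fst w) = c (snd w)}"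
  let ?W = "sub_mod ?D ?H"
  have D: "Modl ?D" by (rule Mod_dsum[OF s'(2) t'(2)])
  have "submodule ?H R ?D"
    by (rule submodI[OF D])
      (use s'(2,3,6) t'(2,6) in \<open>auto simp: hom_simps\<close>)
  then have W: "Modl ?W" by (rule Mod_sub[OF D])
  have z: "c \<zero>\<^bsub>Q\<^esub> = \<zero>\<^bsub>C\<^esub>" "p \<zero>\<^bsub>B\<^esub> = \<zero>\<^bsub>C\<^esub>" "\<zero>\<^bsub>Q\<^esub> \<in> carrier Q" "\<zero>\<^bsub>B\<^esub> \<in> carrier B"
    using hom_zero[OF t'(2,3,6)] hom_zero[OF s'(2,3,6)] Mod_simps(1)[OF t'(2)] Mod_simps(1)[OF s'(2)] by auto
  show ?thesis
  proof (rule that[of ?W]; unfold ses_def; intro conjI W s'(1,2) t'(1,2))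
    show "(\<lambda>a. (i a, \<zero>\<^bsub>Q\<^esub>)) \<in> Hm A ?W"
      by (rule hom_to_sub[OF mod_hom_comp[OF s'(4) hom_inl[OF t'(2)]]]) (use z s'(9,10) in auto)
    show "(\<lambda>a. (\<zero>\<^bsub>B\<^esub>, j a)) \<in> Hm Z ?W"
      by (rule hom_to_sub[OF mod_hom_comp[OF t'(4) hom_inr[OF s'(2)]]]) (use z t'(9,10) in auto)
    show "inj_on (\<lambda>a. (i a, \<zero>\<^bsub>Q\<^esub>)) (carrier A)" "inj_on (\<lambda>a. (\<zero>\<^bsub>B\<^esub>, j a)) (carrier Z)"
      using s'(5) t'(5) by (auto simp: inj_on_def)
    show "snd \<in> Hm ?W Q" "fst \<in> Hm ?W B"
      by (rule hom_from_sub[OF hom_snd], force, rule hom_from_sub[OF hom_fst], force)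
    show "snd ` carrier ?W = carrier Q"
    proof (intro equalityI subsetI)
      fix y assume y: "y \<in> carrier Q"
      obtain x where "x \<in> carrier B" "c y = p x" using ses_lift[OF s t'(11)[OF y]] by blast
      then show "y \<in> snd ` carrier ?W" using y by (intro rev_image_eqI[of "(x, y)"]) auto
    qed auto
    show "fst ` carrier ?W = carrier B"
    proof (intro equalityI subsetI)
      fix y assume y: "y \<in> carrier B"
      obtain x where "x \<in> carrier Q" "p y = c x" using ses_lift[OF t s'(11)[OF y]] by blast
      then show "y \<in> fst ` carrier ?W" using y by (intro rev_image_eqI[of "(y, x)"]) auto
    qed auto
    show "(\<lambda>a. (i a, \<zero>\<^bsub>Q\<^esub>)) ` carrier A = {x \<in> carrier ?W. snd x = \<zero>\<^bsub>Q\<^esub>}"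
    proof (intro equalityI subsetI)
      fix w assume "w \<in> {x \<in> carrier ?W. snd x = \<zero>\<^bsub>Q\<^esub>}"
      then have *: "fst w \<in> carrier B" "p (fst w) = \<zero>\<^bsub>C\<^esub>" "w = (fst w, \<zero>\<^bsub>Q\<^esub>)" using z by (auto simp: prod_eq_iff)
      obtain a where a: "a \<in> carrier A" "fst w = i a" using ses_preimage[OF s *(1,2)] by blast
      show "w \<in> (\<lambda>a. (i a, \<zero>\<^bsub>Q\<^esub>)) ` carrier A" using imageI[OF a(1), of "\<lambda>a. (i a, \<zero>\<^bsub>Q\<^esub>)"] *(3) a(2) by simp
    qed (use z s'(9,10) in auto)
    show "(\<lambda>a. (\<zero>\<^bsub>B\<^esub>, j a)) ` carrier Z = {x \<in> carrier ?W. fst x = \<zero>\<^bsub>B\<^esub>}"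
    proof (intro equalityI subsetI)
      fix w assume "w \<in> {x \<in> carrier ?W. fst x = \<zero>\<^bsub>B\<^esub>}"
      then have *: "snd w \<in> carrier Q" "c (snd w) = \<zero>\<^bsub>C\<^esub>" "w = (\<zero>\<^bsub>B\<^esub>, snd w)" using z by (auto simp: prod_eq_iff)
      obtain a where a: "a \<in> carrier Z" "snd w = j a" using ses_preimage[OF t *(1,2)] by blast
      show "w \<in> (\<lambda>a. (\<zero>\<^bsub>B\<^esub>, j a)) ` carrier Z" using imageI[OF a(1), of "\<lambda>a. (\<zero>\<^bsub>B\<^esub>, j a)"] *(3) a(2) by simp
    qed (use z t'(9,10) in auto)
  qed
qed

end

context noeth_cring begin

lemma om_ses:
  assumes "fgm X" shows "\<exists>n i p. ses (om X) i (\<F> n) p X"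
proof -
  obtain n p where s: "ses (sub_mod (\<F> n) (a_kernel (\<F> n) X p)) (\<lambda>x. x) (\<F> n) p X" using ses_cover[OF assms] by blast
  obtain i where "ses (copy (sub_mod (\<F> n) (a_kernel (\<F> n) X p))) i (\<F> n) p X"
    by (rule ses_copy_left[OF s fgm_ses_sub[OF s fgm_proj[OF proj_free]]])
  then have "\<exists>Z. \<exists>n i p. ses (Z :: ('a, (nat \<Rightarrow> 'a) set) module) i (\<F> n) p X" by blast
  then show ?thesis unfolding om_def by (rule someI_ex)
qed

lemma fgm_om: "fgm X \<Longrightarrow> fgm (om X)"
  using om_ses fgm_ses_sub fgm_proj[OF proj_free] by blast

lemma fgm_Om: "fgm X \<Longrightarrow> fgm (Om k X)"
  by (induction k) (auto simp: Om_0 Om_Suc copy fgm_om)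

lemma st_om:
  assumes "ses A i P p X" "proj P" shows "st A (om X)"
proof -
  obtain n j q where "ses (om X) j (\<F> n) q X" using om_ses[OF fgm_ses_proj[OF assms]] by blast
  from ses_proj_cong[OF assms(1) this assms(2) proj_free] show ?thesis .
qed

lemma om_cong:
  assumes "st X Y" "fgm X" "fgm Y" shows "st (om X) (om Y)"
proof -
  obtain n j q where s: "ses (om X) j (\<F> n) q X" using om_ses[OF assms(2)] by blast
  obtain m j' q' where t: "ses (om Y) j' (\<F> m) q' Y" using om_ses[OF assms(3)] by blast
  show ?thesis by (rule st_syz[OF s t proj_free proj_free assms(1)])
qed

lemma Om_cong:
  assumes "st X Y" "fgm X" "fgm Y" shows "st (Om k X) (Om k Y)"
proof (induction k)
  case 0
  show ?case unfolding Om_0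
    by (rule st_trans[OF st_sym[OF copy(3)[OF assms(2)]] st_trans[OF assms(1) copy(3)[OF assms(3)]]])
next
  case (Suc k)
  show ?case unfolding Om_Suc by (rule om_cong[OF Suc fgm_Om[OF assms(2)] fgm_Om[OF assms(3)]])
qed

lemma Om_add: assumes "fgm X" shows "st (Om k (Om l X)) (Om (k + l) X)"
proof (induction k)
  case 0
  show ?case unfolding Om_0 by (simp add: st_sym copy(3) fgm_Om assms)
next
  case (Suc k)
  show ?case unfolding Om_Suc add_Suc by (rule om_cong[OF Suc fgm_Om[OF fgm_Om[OF assms]] fgm_Om[OF assms]])
qed

text \<open>\<open>Om\<close> adds syzygies on the outside and begins with a copy, so taking the
  syzygy of X beforehand agrees with it only up to stable isomorphism.\<close>

lemma Om_om:
  assumes "fgm X" shows "st (Om k (om X)) (Om (Suc k) X)"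
proof -
  have 1: "st (om X) (Om 1 X)" using om_cong[OF copy(3) assms copy(4)] assms by (simp add: Om_0 Om_Suc)
  have "st (Om k (om X)) (Om k (Om 1 X))" by (rule Om_cong[OF 1 fgm_om[OF assms] fgm_Om[OF assms]])
  from st_trans[OF this Om_add[OF assms]] show ?thesis by simp
qed

text \<open>Every y equals f (g y) - r y: it lies in the image of X plus the finitely generated
  submodule that contains the image of r.\<close>

lemma st_fgm:
  assumes st: "st X Y" and X: "fgm X" shows "fgm Y"
proof -
  obtain f g where fg: "f \<in> Hm X Y" "g \<in> Hm Y X" "near_id Y (\<lambda>y. f (g y))" using st by (auto simp: st_def)
  note m = stD[OF st]
  obtain r where r: "r \<in> frank Y Y" "\<forall>x\<in>carrier Y. f (g x) = x \<oplus>\<^bsub>Y\<^esub> r x" using fg(3) by (auto simp: near_id_def)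
  have rh: "r \<in> Hm Y Y" by (rule frank_hom[OF m(2,2) r(1)])
  obtain n p where p: "p \<in> Hm (\<F> n) Y" "r ` carrier Y \<subseteq> p ` carrier (\<F> n)" by (rule frank_image_fg[OF m(2) r(1)])
  let ?h = "\<lambda>z. f (fst z) \<oplus>\<^bsub>Y\<^esub> p (snd z)"
  have h: "?h \<in> Hm (dsum_mod X (\<F> n)) Y" by (rule hom_copair[OF fg(1) p(1) m(2)])
  have "?h ` carrier (dsum_mod X (\<F> n)) = carrier Y"
  proof (intro equalityI subsetI)
    fix y assume y: "y \<in> carrier Y"
    have ry: "r y \<in> carrier Y" by (rule mod_hom_closed[OF rh y])
    have "r y \<in> p ` carrier (\<F> n)" using p(2) y by (rule subsetD[OF _ imageI])
    then obtain v where v: "r y = p v" "v \<in> carrier (\<F> n)" by (elim imageE)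
    have "p (\<ominus>\<^bsub>\<F> n\<^esub> v) = \<ominus>\<^bsub>Y\<^esub> r y" using hom_uminus[OF Mod_free m(2) p(1) v(2)] v(1) by simp
    then have "?h (g y, \<ominus>\<^bsub>\<F> n\<^esub> v) = y" using r(2) y ry m(2) by (simp add: Mod_ac)
    then show "y \<in> ?h ` carrier (dsum_mod X (\<F> n))"
      using rev_image_eqI[of "(g y, \<ominus>\<^bsub>\<F> n\<^esub> v)" "carrier (dsum_mod X (\<F> n))" y ?h]
        mod_hom_closed[OF fg(2) y] Mod_simps(4)[OF Mod_free v(2)] by simp
  qed (use mod_hom_closed[OF h] in blast)
  then show ?thesis by (rule fgm_surj[OF fgm_dsum[OF X fgm_proj[OF proj_free]] m(2) h])
qed

text \<open>Restriction along a surjection from R^n embeds the dual of X into the dual of R^n, which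
  is finitely generated; \<open>fgm_sub\<close> concludes.\<close>

lemma fgm_dual:
  assumes X: "fgm X" shows "fgm (X\<^sup>\<star>)"
proof -
  note m = fgm_Mod[OF X]
  obtain n p where p: "p \<in> Hm (\<F> n) X" "p ` carrier (\<F> n) = carrier X" by (rule fgmE[OF X])
  have "inj_on (dual_map (\<F> n) p) (carrier (X\<^sup>\<star>))"
  proof (rule inj_onI)
    fix \<phi> \<psi> assume *: "\<phi> \<in> carrier (X\<^sup>\<star>)" "\<psi> \<in> carrier (X\<^sup>\<star>)" "dual_map (\<F> n) p \<phi> = dual_map (\<F> n) p \<psi>"
    show "\<phi> = \<psi>"
    proof (rule dual_eqI[OF *(1,2)])
      fix x assume "x \<in> carrier X"
      then have "x \<in> p ` carrier (\<F> n)" using p(2) by simp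
      then obtain v where v: "x = p v" "v \<in> carrier (\<F> n)" by (elim imageE)
      show "\<phi> x = \<psi> x" using fun_cong[OF *(3), of v] v by (simp only: dual_map_apply)
    qed
  qed
  then show ?thesis
    by (rule fgm_sub[OF fgm_proj[OF proj_dual[OF proj_free]] Mod_dual[OF m] dual_map_hom[OF Mod_free p(1)]])
qed

text \<open>Rotating a short exact sequence three times applies the syzygy functor to it.\<close>

lemma ses_rotate:
  assumes s: "ses A (i :: 'x \<Rightarrow> 'y) B p C" and fg: "fgm A" "fgm C"
  shows "\<exists>(W :: ('a, (nat \<Rightarrow> 'a) set) module) j q. ses (om C) j W q B \<and> st W A \<and> fgm W"
proof -
  obtain n j q where t: "ses (om C) j (\<F> n) q C" using om_ses[OF fg(2)] by blast
  obtain W where W: "ses A (\<lambda>a. (i a, \<zero>\<^bsub>\<F> n\<^esub>)) W snd (\<F> n)" "ses (om C) (\<lambda>z. (\<zero>\<^bsub>B\<^esub>, j z)) W fst B"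
    by (rule ses_pullback[OF s t])
  have fW: "fgm W" by (rule fgm_ext[OF W(1) fg(1) fgm_proj[OF proj_free]])
  obtain b where b: "b \<in> mod_iso R W (copy W)" using copy(2)[OF fW] by blast
  have "ses (om C) (\<lambda>x. b (\<zero>\<^bsub>B\<^esub>, j x)) (copy W) (\<lambda>y. fst (inv_into (carrier W) b y)) B"
    using ses_iso[OF W(2) sesD(1)[OF W(2)] copy(1)[OF fW] sesD(3)[OF W(2)] iso_id b iso_id] by simp
  moreover have "st (copy W) A" by (rule st_trans[OF st_sym[OF copy(3)[OF fW]] st_split[OF W(1) proj_free]])
  ultimately show ?thesis using copy(4)[OF fW] by blast
qed

lemma ses_om:
  assumes s: "ses A i B p C" and fg: "fgm A" "fgm B" "fgm C"
  shows "\<exists>(A' :: ('a, (nat \<Rightarrow> 'a) set) module) (B' :: ('a, (nat \<Rightarrow> 'a) set) module)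
    (C' :: ('a, (nat \<Rightarrow> 'a) set) module) j q. ses A' j B' q C' \<and> st A' (om A) \<and> st B' (om B) \<and> st C' (om C)
      \<and> fgm A' \<and> fgm B' \<and> fgm C'"
proof -
  obtain W :: "('a, (nat \<Rightarrow> 'a) set) module" and j1 q1 where
    1: "ses (om C) j1 W q1 B" "st W A" "fgm W" using ses_rotate[OF s fg(1,3)] by blast
  obtain V :: "('a, (nat \<Rightarrow> 'a) set) module" and j2 q2 where
    2: "ses (om B) j2 V q2 W" "st V (om C)" "fgm V" using ses_rotate[OF 1(1) fgm_om[OF fg(3)] fg(2)] by blast
  obtain U :: "('a, (nat \<Rightarrow> 'a) set) module" and j3 q3 where
    3: "ses (om W) j3 U q3 V" "st U (om B)" "fgm U" using ses_rotate[OF 2(1) fgm_om[OF fg(2)] 1(3)] by blast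
  show ?thesis using 3 2(2,3) om_cong[OF 1(2,3) fg(1)] fgm_om[OF 1(3)] by blast
qed

text \<open>Rotation replaces terms by stably isomorphic ones, so the syzygies themselves need not
  form the sequence; modules stably isomorphic to them do, which suffices for every property
  invariant under \<open>st\<close>.\<close>

lemma ses_Om:
  assumes s: "ses A i B p C" and fg: "fgm A" "fgm B" "fgm C"
  shows "\<exists>(A' :: ('a, (nat \<Rightarrow> 'a) set) module) (B' :: ('a, (nat \<Rightarrow> 'a) set) module)
    (C' :: ('a, (nat \<Rightarrow> 'a) set) module) j q. ses A' j B' q C' \<and> st A' (Om k A) \<and> st B' (Om k B) \<and> st C' (Om k C)
      \<and> fgm A' \<and> fgm B' \<and> fgm C'"
proof (induction k)
  case 0
  obtain j q where "ses (copy A) j (copy B) q (copy C)" by (rule ses_copy[OF s fg])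
  then show ?case unfolding Om_0 by (intro exI conjI, assumption) (auto intro: st_refl copy fg)
next
  case (Suc k)
  then obtain A' B' C' :: "('a, (nat \<Rightarrow> 'a) set) module" and j q where
    1: "ses A' j B' q C'" "st A' (Om k A)" "st B' (Om k B)" "st C' (Om k C)" "fgm A'" "fgm B'" "fgm C'" by blast
  obtain A2 B2 C2 :: "('a, (nat \<Rightarrow> 'a) set) module" and j2 q2 where
    2: "ses A2 j2 B2 q2 C2" "st A2 (om A')" "st B2 (om B')" "st C2 (om C')" "fgm A2" "fgm B2" "fgm C2"
    using ses_om[OF 1(1,5,6,7)] by blast
  have "st A2 (Om (Suc k) A)" "st B2 (Om (Suc k) B)" "st C2 (Om (Suc k) C)" unfolding Om_Suc
    using st_trans[OF 2(2) om_cong[OF 1(2,5) fgm_Om[OF fg(1)]]]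
      st_trans[OF 2(3) om_cong[OF 1(3,6) fgm_Om[OF fg(2)]]]
      st_trans[OF 2(4) om_cong[OF 1(4,7) fgm_Om[OF fg(3)]]] by blast+
  then show ?case using 2 by blast
qed

end

section \<open>Totally reflexive modules\<close>

context cring begin

text \<open>A free cover of B composes to a free cover of C, whose kernel K contains the kernel Z of
  the first, with quotient A. Functionals on Z extend to K because Ext^1(A, R) = 0, and from K to
  the free module because Ext^1(C, R) = 0.\<close>

lemma E1_extension:
  assumes s: "ses A i B p C" and B: "fgm B" and E: "E1 A" "E1 C"
  shows "E1 B"
proof -
  note s' = sesD[OF s]
  obtain n q where q: "q \<in> Hm (\<F> n) B" "q ` carrier (\<F> n) = carrier B" by (rule fgmE[OF B])
  let ?Z = "sub_mod (\<F> n) (a_kernel (\<F> n) B q)"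
  let ?c = "\<lambda>x. p (q x)"
  let ?K = "sub_mod (\<F> n) (a_kernel (\<F> n) C ?c)"
  have Z: "ses ?Z (\<lambda>x. x) (\<F> n) q B" by (rule ses_kernel[OF Mod_free s'(2) q])
  have c: "?c \<in> Hm (\<F> n) C" by (rule mod_hom_comp[OF q(1) s'(6)])
  have "?c ` carrier (\<F> n) = p ` q ` carrier (\<F> n)" by (simp only: image_image)
  then have cim: "?c ` carrier (\<F> n) = carrier C" using q(2) s'(7) by simp
  have K: "ses ?K (\<lambda>x. x) (\<F> n) ?c C" by (rule ses_kernel[OF Mod_free s'(3) c cim])
  note K' = sesD[OF K]
  have kc: "x \<in> carrier ?K \<longleftrightarrow> x \<in> carrier (\<F> n) \<and> p (q x) = \<zero>\<^bsub>C\<^esub>" for x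
    by (simp add: a_kernel_eq)
  have qK: "q \<in> Hm ?K B" by (rule hom_from_sub[OF q(1)]) (auto simp: a_kernel_eq)
  obtain f where f: "f \<in> Hm ?K A" "\<And>x. x \<in> carrier ?K \<Longrightarrow> i (f x) = q x"
  proof (rule ses_factor_inj[OF s qK])
    show "p (q w) = \<zero>\<^bsub>C\<^esub>" if "w \<in> carrier ?K" for w using that kc by simp
  qed (rule that)
  have f0: "f x = \<zero>\<^bsub>A\<^esub> \<longleftrightarrow> q x = \<zero>\<^bsub>B\<^esub>" if x: "x \<in> carrier ?K" for x
  proof
    assume "f x = \<zero>\<^bsub>A\<^esub>"
    then show "q x = \<zero>\<^bsub>B\<^esub>" using f(2)[OF x] hom_zero[OF s'(1,2,4)] by simp
  next
    assume "q x = \<zero>\<^bsub>B\<^esub>"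
    then have "i (f x) = i \<zero>\<^bsub>A\<^esub>" using f(2)[OF x] hom_zero[OF s'(1,2,4)] by simp
    then show "f x = \<zero>\<^bsub>A\<^esub>" by (rule ses_inj[OF s mod_hom_closed[OF f(1) x] Mod_simps(1)[OF s'(1)]])
  qed
  have qz: "q x = \<zero>\<^bsub>B\<^esub> \<Longrightarrow> p (q x) = \<zero>\<^bsub>C\<^esub>" for x using hom_zero[OF s'(2,3,6)] by simp
  have "ses ?Z (\<lambda>x. x) ?K f A"
    unfolding ses_def
  proof (intro conjI sesD(1)[OF Z] K'(1) s'(1) f(1))
    show "(\<lambda>x. x) \<in> Hm ?Z ?K"
      by (rule hom_to_sub[OF sesD(4)[OF Z]]) (simp add: a_kernel_eq hom_zero[OF s'(2,3,6)] del: free_mod_simps)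
    show "f ` carrier ?K = carrier A"
    proof (intro equalityI subsetI)
      fix a assume a: "a \<in> carrier A"
      have "i a \<in> q ` carrier (\<F> n)" using q(2) s'(10)[OF a] by simp
      then obtain x where x: "i a = q x" "x \<in> carrier (\<F> n)" by (elim imageE)
      have xK: "x \<in> carrier ?K" using kc x s'(9)[OF a] by simp
      have "f x = a" using ses_inj[OF s mod_hom_closed[OF f(1) xK] a] f(2)[OF xK] x(1) by simp
      then show "a \<in> f ` carrier ?K" using xK by blast
    qed (use mod_hom_closed[OF f(1)] in blast)
    have "x \<in> carrier ?Z \<longleftrightarrow> x \<in> carrier ?K \<and> f x = \<zero>\<^bsub>A\<^esub>" for x
      using kc[of x] f0[of x] qz[of x] by (auto simp: a_kernel_eq simp del: free_mod_simps)
    then show "(\<lambda>x. x) ` carrier ?Z = {x \<in> carrier ?K. f x = \<zero>\<^bsub>A\<^esub>}" by (simp only: image_ident) blast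
  qed auto
  note e1 = E1_ext[OF E(1) this] and e2 = E1_ext[OF E(2) K]
  show ?thesis
  proof (rule E1_I[OF Z proj_free])
    show "ext_prop ?Z (\<lambda>x. x) (\<F> n)" unfolding ext_prop_def
    proof
      fix \<phi> assume "\<phi> \<in> Hm ?Z RR"
      then obtain \<psi> where 1: "\<psi> \<in> Hm ?K RR" "\<And>a. a \<in> carrier ?Z \<Longrightarrow> \<psi> a = \<phi> a" by (rule ext_propD[OF e1]) (rule that)
      obtain \<chi> where 2: "\<chi> \<in> Hm (\<F> n) RR" "\<And>a. a \<in> carrier ?K \<Longrightarrow> \<chi> a = \<psi> a" by (rule ext_propD[OF e2 1(1)]) (rule that)
      have "carrier ?Z \<subseteq> carrier ?K" by (auto simp: a_kernel_eq hom_zero[OF s'(2,3,6)] simp del: free_mod_simps)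
      then show "\<exists>\<psi>\<in>Hm (\<F> n) RR. \<forall>a\<in>carrier ?Z. \<psi> a = \<phi> a" using 1(2) 2 by (intro bexI[OF _ 2(1)]) auto
    qed
  qed
qed

text \<open>Exactness on the left and in the middle is automatic; the extension property is exactly
  surjectivity of the last map.\<close>

lemma ses_dual:
  assumes s: "ses A i B p C" and e: "ext_prop A i B"
  shows "ses (C\<^sup>\<star>) (dual_map B p) (B\<^sup>\<star>) (dual_map A i) (A\<^sup>\<star>)"
proof -
  note s' = sesD[OF s]
  show ?thesis unfolding ses_def
  proof (intro conjI Mod_dual s' dual_map_hom)
    show "inj_on (dual_map B p) (carrier (C\<^sup>\<star>))"
    proof (rule inj_onI)
      fix \<phi> \<psi> assume *: "\<phi> \<in> carrier (C\<^sup>\<star>)" "\<psi> \<in> carrier (C\<^sup>\<star>)" "dual_map B p \<phi> = dual_map B p \<psi>"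
      show "\<phi> = \<psi>"
      proof (rule dual_eqI[OF *(1,2)])
        fix x assume "x \<in> carrier C"
        then obtain v where v: "v \<in> carrier B" "x = p v" using ses_lift[OF s] by blast
        show "\<phi> x = \<psi> x" using fun_cong[OF *(3), of v] v by (simp only: dual_map_apply)
      qed
    qed
    show "dual_map A i ` carrier (B\<^sup>\<star>) = carrier (A\<^sup>\<star>)"
    proof (intro equalityI subsetI)
      fix \<phi> assume \<phi>: "\<phi> \<in> carrier (A\<^sup>\<star>)"
      obtain \<psi> where \<psi>: "\<psi> \<in> Hm B RR" "\<And>a. a \<in> carrier A \<Longrightarrow> \<psi> (i a) = \<phi> a" by (rule ext_propD[OF e dual_hom[OF \<phi>]]) (rule that)
      note r = dual_memI[OF s'(2) \<psi>(1)]
      have "dual_map A i (restrict \<psi> (carrier B)) = \<phi>"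
        by (rule dual_eqI[OF dual_map_in[OF s'(1,4) r] \<phi>]) (simp add: \<psi>(2) s'(10))
      then show "\<phi> \<in> dual_map A i ` carrier (B\<^sup>\<star>)" using r by blast
    next
      fix \<phi> assume "\<phi> \<in> dual_map A i ` carrier (B\<^sup>\<star>)"
      then show "\<phi> \<in> carrier (A\<^sup>\<star>)" using dual_map_in[OF s'(1,4)] by (elim imageE) (simp only:)
    qed
    show "dual_map B p ` carrier (C\<^sup>\<star>) = {x \<in> carrier (B\<^sup>\<star>). dual_map A i x = \<zero>\<^bsub>A\<^sup>\<star>\<^esub>}"
    proof (intro equalityI subsetI)
      fix \<phi> assume "\<phi> \<in> dual_map B p ` carrier (C\<^sup>\<star>)"
      then obtain \<psi> where \<psi>: "\<phi> = dual_map B p \<psi>" "\<psi> \<in> carrier (C\<^sup>\<star>)" by (elim imageE)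
      have \<phi>: "\<phi> \<in> carrier (B\<^sup>\<star>)" unfolding \<psi>(1) by (rule dual_map_in[OF s'(2,6) \<psi>(2)])
      have "dual_map A i \<phi> = \<zero>\<^bsub>A\<^sup>\<star>\<^esub>"
      proof (rule dual_eqI[OF dual_map_in[OF s'(1,4) \<phi>] Mod_simps(1)[OF Mod_dual[OF s'(1)]]])
        fix a assume a: "a \<in> carrier A"
        then show "dual_map A i \<phi> a = \<zero>\<^bsub>A\<^sup>\<star>\<^esub> a"
          using s'(9,10)[OF a] hom_RR_zero[OF s'(3) dual_hom[OF \<psi>(2)]] by (simp add: \<psi>(1))
      qed
      then show "\<phi> \<in> {x \<in> carrier (B\<^sup>\<star>). dual_map A i x = \<zero>\<^bsub>A\<^sup>\<star>\<^esub>}" using \<phi> by blast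
    next
      fix \<phi> assume "\<phi> \<in> {x \<in> carrier (B\<^sup>\<star>). dual_map A i x = \<zero>\<^bsub>A\<^sup>\<star>\<^esub>}"
      then have \<phi>: "\<phi> \<in> carrier (B\<^sup>\<star>)" "dual_map A i \<phi> = \<zero>\<^bsub>A\<^sup>\<star>\<^esub>" by blast+
      obtain \<psi> where \<psi>: "\<psi> \<in> Hm C RR" "\<And>x. x \<in> carrier B \<Longrightarrow> \<psi> (p x) = \<phi> x"
      proof (rule ses_factor[OF s Mod_RR dual_hom[OF \<phi>(1)]])
        show "\<phi> (i a) = \<zero>\<^bsub>RR\<^esub>" if "a \<in> carrier A" for a using fun_cong[OF \<phi>(2), of a] that by simp
      qed (rule that)
      note r = dual_memI[OF s'(3) \<psi>(1)]
      have "dual_map B p (restrict \<psi> (carrier C)) = \<phi>"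
        by (rule dual_eqI[OF dual_map_in[OF s'(2,6) r] \<phi>(1)]) (simp add: \<psi>(2) s'(11))
      then show "\<phi> \<in> dual_map B p ` carrier (C\<^sup>\<star>)" using r by blast
    qed
  qed
qed

text \<open>Bijectivity of the biduality map, spelled out as two conditions on functionals: they
  separate the elements of X, and each functional on the dual is an evaluation.
  \<open>bidual_iso\<close> translates.\<close>

definition refl_mod :: "('a, 'x) module \<Rightarrow> bool" where
  "refl_mod X \<longleftrightarrow> (\<forall>x\<in>carrier X. (\<forall>\<phi>\<in>Hm X RR. \<phi> x = \<zero>) \<longrightarrow> x = \<zero>\<^bsub>X\<^esub>) \<and>
     (\<forall>\<xi>\<in>Hm (X\<^sup>\<star>) RR. \<exists>x\<in>carrier X. \<forall>\<phi>\<in>carrier (X\<^sup>\<star>). \<xi> \<phi> = \<phi> x)"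

lemma refl_zero: "refl_mod X \<Longrightarrow> x \<in> carrier X \<Longrightarrow> (\<And>\<phi>. \<phi> \<in> Hm X RR \<Longrightarrow> \<phi> x = \<zero>) \<Longrightarrow> x = \<zero>\<^bsub>X\<^esub>"
  unfolding refl_mod_def by blast

lemma refl_eval:
  assumes "refl_mod X" "\<xi> \<in> Hm (X\<^sup>\<star>) RR"
  obtains x where "x \<in> carrier X" "\<And>\<phi>. \<phi> \<in> carrier (X\<^sup>\<star>) \<Longrightarrow> \<xi> \<phi> = \<phi> x"
  using assms unfolding refl_mod_def by blast

lemma reflI:
  assumes "\<And>x. x \<in> carrier X \<Longrightarrow> (\<And>\<phi>. \<phi> \<in> Hm X RR \<Longrightarrow> \<phi> x = \<zero>) \<Longrightarrow> x = \<zero>\<^bsub>X\<^esub>"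
    "\<And>\<xi>. \<xi> \<in> Hm (X\<^sup>\<star>) RR \<Longrightarrow> \<exists>x\<in>carrier X. \<forall>\<phi>\<in>carrier (X\<^sup>\<star>). \<xi> \<phi> = \<phi> x"
  shows "refl_mod X"
  using assms unfolding refl_mod_def by blast

lemma frank_torsionless:
  assumes m: "Modl X" "Modl Y" and x: "x \<in> carrier X" "\<And>\<phi>. \<phi> \<in> Hm X RR \<Longrightarrow> \<phi> x = \<zero>" and h: "h \<in> frank X Y"
  shows "h x = \<zero>\<^bsub>Y\<^esub>"
  using h
proof induction
  case (add h \<phi> y)
  then show ?case using x(2)[OF add(2)] m by simp
next
  case (eq_on h g)
  then show ?case using x(1) by simp
qed simp

text \<open>Each rank-one summand, with functional \<phi> and vector y, adds the multiple of y by
  the scalar \<xi>(\<phi>) to the point of evaluation. Applied to the identity of a projective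
  module, this yields its reflexivity.\<close>

lemma frank_bidual:
  assumes m: "Modl X" "Modl Y" and \<xi>: "\<xi> \<in> Hm (X\<^sup>\<star>) RR" and h: "h \<in> frank X Y"
  shows "\<exists>y\<in>carrier Y. \<forall>\<psi>\<in>carrier (Y\<^sup>\<star>). \<xi> (dual_map X h \<psi>) = \<psi> y"
  using h
proof induction
  case zero
  have "dual_map X (\<lambda>x. \<zero>\<^bsub>Y\<^esub>) \<psi> = \<zero>\<^bsub>X\<^sup>\<star>\<^esub>" if "\<psi> \<in> carrier (Y\<^sup>\<star>)" for \<psi>
    using that m by (auto simp: dual_map_def fun_eq_iff)
  then have "\<xi> (dual_map X (\<lambda>x. \<zero>\<^bsub>Y\<^esub>) \<psi>) = \<psi> \<zero>\<^bsub>Y\<^esub>" if "\<psi> \<in> carrier (Y\<^sup>\<star>)" for \<psi>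
    using that hom_RR_zero[OF Mod_dual[OF m(1)] \<xi>] hom_RR_zero[OF m(2) dual_hom[OF that]] by simp
  then show ?case using Mod_simps(1)[OF m(2)] by blast
next
  case (add h \<phi> y)
  then obtain z where z: "z \<in> carrier Y" "\<forall>\<psi>\<in>carrier (Y\<^sup>\<star>). \<xi> (dual_map X h \<psi>) = \<psi> z" by blast
  let ?r = "restrict \<phi> (carrier X)"
  have r: "?r \<in> carrier (X\<^sup>\<star>)" by (rule dual_memI[OF m(1) add(2)])
  have h: "h \<in> Hm X Y" by (rule frank_hom[OF m add(1)])
  have xr: "\<xi> ?r \<in> carrier R" by (rule hom_RR_closed[OF \<xi> r])
  have w: "z \<oplus>\<^bsub>Y\<^esub> \<xi> ?r \<odot>\<^bsub>Y\<^esub> y \<in> carrier Y" using m z(1) add(3) xr by simp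
  have "\<xi> (dual_map X (\<lambda>x. h x \<oplus>\<^bsub>Y\<^esub> \<phi> x \<odot>\<^bsub>Y\<^esub> y) \<psi>) = \<psi> (z \<oplus>\<^bsub>Y\<^esub> \<xi> ?r \<odot>\<^bsub>Y\<^esub> y)"
    if \<psi>: "\<psi> \<in> carrier (Y\<^sup>\<star>)" for \<psi>
  proof -
    have \<psi>h: "\<psi> \<in> Hm Y RR" by (rule dual_hom[OF \<psi>])
    have \<psi>y: "\<psi> y \<in> carrier R" by (rule hom_RR_closed[OF \<psi>h add(3)])
    have e: "dual_map X (\<lambda>x. h x \<oplus>\<^bsub>Y\<^esub> \<phi> x \<odot>\<^bsub>Y\<^esub> y) \<psi> = dual_map X h \<psi> \<oplus>\<^bsub>X\<^sup>\<star>\<^esub> \<psi> y \<odot>\<^bsub>X\<^sup>\<star>\<^esub> ?r"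
      using \<psi>h m h add(2,3) by (auto simp: dual_map_def fun_eq_iff hom_simps m_comm)
    have "\<xi> (dual_map X h \<psi> \<oplus>\<^bsub>X\<^sup>\<star>\<^esub> \<psi> y \<odot>\<^bsub>X\<^sup>\<star>\<^esub> ?r) = \<psi> z \<oplus> \<psi> y \<otimes> \<xi> ?r"
      using mod_hom_add[OF \<xi> dual_map_in[OF m(1) h \<psi>] Mod_simps(3)[OF Mod_dual[OF m(1)] \<psi>y r]]
        mod_hom_smult[OF \<xi> \<psi>y r] z(2) \<psi> by simp
    moreover have "\<psi> (z \<oplus>\<^bsub>Y\<^esub> \<xi> ?r \<odot>\<^bsub>Y\<^esub> y) = \<psi> z \<oplus> \<xi> ?r \<otimes> \<psi> y"
      using mod_hom_add[OF \<psi>h z(1) Mod_simps(3)[OF m(2) xr add(3)]] mod_hom_smult[OF \<psi>h xr add(3)] by simp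
    ultimately show ?thesis using m_comm[OF xr \<psi>y] by (simp only: e)
  qed
  then show ?case using w by blast
next
  case (eq_on h g)
  have "dual_map X g = dual_map X h" using eq_on(2) by (auto simp: dual_map_def fun_eq_iff)
  then show ?case using eq_on(3) by simp
qed

lemma refl_proj:
  assumes P: "proj P" shows "refl_mod P"
proof (rule reflI)
  have m: "Modl P" by (rule proj_Mod[OF P])
  have fr: "(\<lambda>x. x) \<in> frank P P" using P by (simp add: proj_def)
  show "x = \<zero>\<^bsub>P\<^esub>" if x: "x \<in> carrier P" "\<And>\<phi>. \<phi> \<in> Hm P RR \<Longrightarrow> \<phi> x = \<zero>" for x
    by (rule frank_torsionless[OF m m x(1) _ fr]) (rule x(2))
  show "\<exists>x\<in>carrier P. \<forall>\<phi>\<in>carrier (P\<^sup>\<star>). \<xi> \<phi> = \<phi> x" if \<xi>: "\<xi> \<in> Hm (P\<^sup>\<star>) RR" for \<xi>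
  proof -
    obtain y where y: "y \<in> carrier P" "\<forall>\<psi>\<in>carrier (P\<^sup>\<star>). \<xi> (dual_map P (\<lambda>x. x) \<psi>) = \<psi> y"
      using frank_bidual[OF m m \<xi> fr] by blast
    have "dual_map P (\<lambda>x. x) \<psi> = \<psi>" if "\<psi> \<in> carrier (P\<^sup>\<star>)" for \<psi>
      by (rule dual_eqI[OF dual_map_in[OF m mod_hom_id that] that]) simp
    then show ?thesis using y by (intro bexI[of _ y]) auto
  qed
qed

text \<open>The identity of Y is f g minus a map r of finite rank. \<open>frank_torsionless\<close>
  and \<open>frank_bidual\<close> settle the two halves of reflexivity for r, and f g passes through
  the reflexive module X.\<close>

lemma refl_st:
  assumes st: "st X Y" and X: "refl_mod X" shows "refl_mod Y"
proof -
  obtain f g where fg: "f \<in> Hm X Y" "g \<in> Hm Y X" "near_id Y (\<lambda>y. f (g y))" using st by (auto simp: st_def)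
  note m = stD[OF st]
  obtain r where r: "r \<in> frank Y Y" "\<forall>x\<in>carrier Y. f (g x) = x \<oplus>\<^bsub>Y\<^esub> r x" using fg(3) by (auto simp: near_id_def)
  have rh: "r \<in> Hm Y Y" by (rule frank_hom[OF m(2,2) r(1)])
  show ?thesis
  proof (rule reflI)
    fix y assume y: "y \<in> carrier Y" "\<And>\<phi>. \<phi> \<in> Hm Y RR \<Longrightarrow> \<phi> y = \<zero>"
    have "r y = \<zero>\<^bsub>Y\<^esub>" by (rule frank_torsionless[OF m(2,2) y(1) _ r(1)]) (rule y(2))
    then have "f (g y) = y" using r(2) y(1) m by simp
    moreover have "g y = \<zero>\<^bsub>X\<^esub>"
    proof (rule refl_zero[OF X mod_hom_closed[OF fg(2) y(1)]])
      show "\<phi> (g y) = \<zero>" if "\<phi> \<in> Hm X RR" for \<phi> by (rule y(2)[OF mod_hom_comp[OF fg(2) that]])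
    qed
    ultimately show "y = \<zero>\<^bsub>Y\<^esub>" using hom_zero[OF m fg(1)] by simp
  next
    fix \<xi> assume \<xi>: "\<xi> \<in> Hm (Y\<^sup>\<star>) RR"
    have "(\<lambda>\<phi>. \<xi> (dual_map Y g \<phi>)) \<in> Hm (X\<^sup>\<star>) RR" by (rule mod_hom_comp[OF dual_map_hom[OF m(2) fg(2)] \<xi>])
    from refl_eval[OF X this] obtain x where
      x: "x \<in> carrier X" "\<And>\<phi>. \<phi> \<in> carrier (X\<^sup>\<star>) \<Longrightarrow> \<xi> (dual_map Y g \<phi>) = \<phi> x" by blast
    obtain z where z: "z \<in> carrier Y" "\<forall>\<psi>\<in>carrier (Y\<^sup>\<star>). \<xi> (dual_map Y r \<psi>) = \<psi> z"
      using frank_bidual[OF m(2,2) \<xi> r(1)] by blast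
    have fx: "f x \<in> carrier Y" by (rule mod_hom_closed[OF fg(1) x(1)])
    have "\<xi> \<psi> = \<psi> (f x \<ominus>\<^bsub>Y\<^esub> z)" if \<psi>: "\<psi> \<in> carrier (Y\<^sup>\<star>)" for \<psi>
    proof -
      note d = dual_map_in[OF m(1) fg(1) \<psi>] dual_map_in[OF m(2) rh \<psi>]
      have c: "\<xi> \<psi> \<in> carrier RR" "\<psi> z \<in> carrier RR"
        using hom_RR_closed[OF \<xi> \<psi>] hom_RR_closed[OF dual_hom[OF \<psi>] z(1)] by simp_all
      have "dual_map Y g (dual_map X f \<psi>) = \<psi> \<oplus>\<^bsub>Y\<^sup>\<star>\<^esub> dual_map Y r \<psi>"
      proof (rule dual_eqI[OF dual_map_in[OF m(2) fg(2) d(1)] Mod_simps(2)[OF Mod_dual[OF m(2)] \<psi> d(2)]])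
        fix y assume y: "y \<in> carrier Y"
        show "dual_map Y g (dual_map X f \<psi>) y = (\<psi> \<oplus>\<^bsub>Y\<^sup>\<star>\<^esub> dual_map Y r \<psi>) y"
          using y r(2) mod_hom_closed[OF fg(2) y] mod_hom_add[OF dual_hom[OF \<psi>] y mod_hom_closed[OF rh y]] by simp
      qed
      then have "\<psi> (f x) = \<xi> \<psi> \<oplus>\<^bsub>RR\<^esub> \<psi> z"
        using x(2)[OF d(1)] x(1) mod_hom_add[OF \<xi> \<psi> d(2)] z(2) \<psi> by simp
      then have "\<psi> (f x \<ominus>\<^bsub>Y\<^esub> z) = (\<xi> \<psi> \<oplus>\<^bsub>RR\<^esub> \<psi> z) \<ominus>\<^bsub>RR\<^esub> \<psi> z"
        using hom_diff[OF m(2) Mod_RR dual_hom[OF \<psi>] fx z(1)] by simp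
      also have "\<dots> = \<xi> \<psi>" unfolding Mod_arith(1)[OF Mod_RR] Mod_arith(3)[OF Mod_RR c Mod_simps(4)[OF Mod_RR c(2)]]
          Mod_arith(8)[OF Mod_RR c(2)] by (rule Mod_simps(7)[OF Mod_RR c(1)])
      finally show ?thesis by (rule sym)
    qed
    moreover have "f x \<ominus>\<^bsub>Y\<^esub> z \<in> carrier Y" by (rule Mod_simps(5)[OF m(2) fx z(1)])
    ultimately show "\<exists>y\<in>carrier Y. \<forall>\<psi>\<in>carrier (Y\<^sup>\<star>). \<xi> \<psi> = \<psi> y" by blast
  qed
qed

text \<open>A functional on the dual of A, pulled back to the dual of P, is evaluation at some b in
  P. Every functional on X vanishes at p b, because its restriction to A is zero; hence p b = 0 and
  b comes from A.\<close>

lemma refl_kernel: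
  assumes s: "ses A i P p X" and P: "proj P" and X: "refl_mod X" and e: "ext_prop A i P"
  shows "refl_mod A"
proof (rule reflI)
  note s' = sesD[OF s]
  have rP: "refl_mod P" by (rule refl_proj[OF P])
  fix a assume a: "a \<in> carrier A" "\<And>\<phi>. \<phi> \<in> Hm A RR \<Longrightarrow> \<phi> a = \<zero>"
  have "i a = \<zero>\<^bsub>P\<^esub>"
  proof (rule refl_zero[OF rP s'(10)[OF a(1)]])
    show "\<phi> (i a) = \<zero>" if "\<phi> \<in> Hm P RR" for \<phi> by (rule a(2)[OF mod_hom_comp[OF s'(4) that]])
  qed
  then have "i a = i \<zero>\<^bsub>A\<^esub>" using hom_zero[OF s'(1,2,4)] by simp
  then show "a = \<zero>\<^bsub>A\<^esub>" by (rule ses_inj[OF s a(1) Mod_simps(1)[OF s'(1)]])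
next
  note s' = sesD[OF s]
  have rP: "refl_mod P" by (rule refl_proj[OF P])
  fix \<xi> assume \<xi>: "\<xi> \<in> Hm (A\<^sup>\<star>) RR"
  have "(\<lambda>\<psi>. \<xi> (dual_map A i \<psi>)) \<in> Hm (P\<^sup>\<star>) RR" by (rule mod_hom_comp[OF dual_map_hom[OF s'(1,4)] \<xi>])
  from refl_eval[OF rP this] obtain b where
    b: "b \<in> carrier P" "\<And>\<psi>. \<psi> \<in> carrier (P\<^sup>\<star>) \<Longrightarrow> \<xi> (dual_map A i \<psi>) = \<psi> b" by blast
  note d = sesD[OF ses_dual[OF s e]]
  have "p b = \<zero>\<^bsub>X\<^esub>"
  proof (rule refl_zero[OF X s'(11)[OF b(1)]])
    fix \<phi> assume \<phi>: "\<phi> \<in> Hm X RR"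
    let ?\<phi> = "restrict \<phi> (carrier X)"
    have r: "?\<phi> \<in> carrier (X\<^sup>\<star>)" by (rule dual_memI[OF s'(3) \<phi>])
    have "\<xi> (dual_map A i (dual_map P p ?\<phi>)) = dual_map P p ?\<phi> b" by (rule b(2)[OF d(10)[OF r]])
    then show "\<phi> (p b) = \<zero>"
      using d(9)[OF r] hom_RR_zero[OF Mod_dual[OF s'(1)] \<xi>] b(1) s'(11)[OF b(1)] by simp
  qed
  then obtain a where a: "a \<in> carrier A" "b = i a" using ses_preimage[OF s b(1)] by blast
  have "\<xi> \<phi> = \<phi> a" if \<phi>: "\<phi> \<in> carrier (A\<^sup>\<star>)" for \<phi>
  proof -
    obtain \<psi> where \<psi>: "\<psi> \<in> carrier (P\<^sup>\<star>)" "\<phi> = dual_map A i \<psi>" using ses_lift[OF ses_dual[OF s e] \<phi>] by blast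
    show ?thesis using b(2)[OF \<psi>(1)] a \<psi>(2) by simp
  qed
  then show "\<exists>x\<in>carrier A. \<forall>\<phi>\<in>carrier (A\<^sup>\<star>). \<xi> \<phi> = \<phi> x" using a by blast
qed

text \<open>A five-lemma chase: the functional restricted to the dual of C is evaluation at some c;
  after subtracting the evaluation at a preimage b of c, the rest factors through the dual of A and
  is evaluation at a point of A.\<close>

lemma refl_extension:
  assumes s: "ses A i B p C" and A: "refl_mod A" and C: "refl_mod C" and e: "ext_prop A i B"
  shows "refl_mod B"
proof (rule reflI)
  note s' = sesD[OF s]
  fix b assume b: "b \<in> carrier B" "\<And>\<phi>. \<phi> \<in> Hm B RR \<Longrightarrow> \<phi> b = \<zero>"
  have "p b = \<zero>\<^bsub>C\<^esub>"
  proof (rule refl_zero[OF C s'(11)[OF b(1)]])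
    show "\<phi> (p b) = \<zero>" if "\<phi> \<in> Hm C RR" for \<phi> by (rule b(2)[OF mod_hom_comp[OF s'(6) that]])
  qed
  then obtain a where a: "a \<in> carrier A" "b = i a" using ses_preimage[OF s b(1)] by blast
  have "a = \<zero>\<^bsub>A\<^esub>"
  proof (rule refl_zero[OF A a(1)])
    fix \<phi> assume "\<phi> \<in> Hm A RR"
    then obtain \<psi> where "\<psi> \<in> Hm B RR" "\<And>a. a \<in> carrier A \<Longrightarrow> \<psi> (i a) = \<phi> a" by (rule ext_propD[OF e]) (rule that)
    then show "\<phi> a = \<zero>" using b(2) a by metis
  qed
  then show "b = \<zero>\<^bsub>B\<^esub>" using a(2) hom_zero[OF s'(1,2,4)] by simp
next
  note s' = sesD[OF s]
  note sd = ses_dual[OF s e]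
  note d = sesD[OF sd]
  fix \<xi> assume \<xi>: "\<xi> \<in> Hm (B\<^sup>\<star>) RR"
  have "(\<lambda>\<psi>. \<xi> (dual_map B p \<psi>)) \<in> Hm (C\<^sup>\<star>) RR" by (rule mod_hom_comp[OF d(4) \<xi>])
  from refl_eval[OF C this] obtain c where
    c: "c \<in> carrier C" "\<And>\<psi>. \<psi> \<in> carrier (C\<^sup>\<star>) \<Longrightarrow> \<xi> (dual_map B p \<psi>) = \<psi> c" by blast
  obtain b where b: "b \<in> carrier B" "c = p b" using ses_lift[OF s c(1)] by blast
  let ?\<xi> = "\<lambda>\<psi>. \<xi> \<psi> \<ominus>\<^bsub>RR\<^esub> \<psi> b"
  have "?\<xi> \<in> Hm (B\<^sup>\<star>) RR" by (rule hom_minus[OF Mod_RR \<xi> eval_hom[OF b(1)]])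
  then obtain \<eta> where \<eta>: "\<eta> \<in> Hm (A\<^sup>\<star>) RR" "\<And>\<psi>. \<psi> \<in> carrier (B\<^sup>\<star>) \<Longrightarrow> \<eta> (dual_map A i \<psi>) = ?\<xi> \<psi>"
  proof (rule ses_factor[OF sd Mod_RR])
    fix \<psi> assume \<psi>: "\<psi> \<in> carrier (C\<^sup>\<star>)"
    have "\<psi> c \<in> carrier RR" using hom_RR_closed[OF dual_hom[OF \<psi>] c(1)] by simp
    then show "\<xi> (dual_map B p \<psi>) \<ominus>\<^bsub>RR\<^esub> dual_map B p \<psi> b = \<zero>\<^bsub>RR\<^esub>"
      using c(2)[OF \<psi>] b by (simp only: dual_map_apply Mod_simps(8)[OF Mod_RR])
  qed (rule that)
  obtain a where a: "a \<in> carrier A" "\<And>\<phi>. \<phi> \<in> carrier (A\<^sup>\<star>) \<Longrightarrow> \<eta> \<phi> = \<phi> a" by (rule refl_eval[OF A \<eta>(1)]) (rule that)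
  have ia: "i a \<in> carrier B" by (rule s'(10)[OF a(1)])
  have "\<xi> \<psi> = \<psi> (b \<oplus>\<^bsub>B\<^esub> i a)" if \<psi>: "\<psi> \<in> carrier (B\<^sup>\<star>)" for \<psi>
  proof -
    have c: "\<xi> \<psi> \<in> carrier RR" "\<psi> b \<in> carrier RR" "\<psi> (i a) \<in> carrier RR"
      using hom_RR_closed[OF \<xi> \<psi>] hom_RR_closed[OF dual_hom[OF \<psi>]] b(1) ia by simp_all
    have "\<psi> (i a) = \<xi> \<psi> \<ominus>\<^bsub>RR\<^esub> \<psi> b" using \<eta>(2)[OF \<psi>] a(2)[OF d(11)[OF \<psi>]] a(1) by simp
    then have "\<psi> b \<oplus>\<^bsub>RR\<^esub> \<psi> (i a) = \<psi> b \<oplus>\<^bsub>RR\<^esub> (\<xi> \<psi> \<oplus>\<^bsub>RR\<^esub> \<ominus>\<^bsub>RR\<^esub> \<psi> b)" by (simp only: Mod_arith(1)[OF Mod_RR])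
    also have "\<dots> = \<xi> \<psi>" by (rule Mod_cancel_neg(1)[OF Mod_RR c(2,1)])
    finally show ?thesis using mod_hom_add[OF dual_hom[OF \<psi>] b(1) ia] by simp
  qed
  moreover have "b \<oplus>\<^bsub>B\<^esub> i a \<in> carrier B" by (rule Mod_simps(2)[OF s'(2) b(1) ia])
  ultimately show "\<exists>x\<in>carrier B. \<forall>\<phi>\<in>carrier (B\<^sup>\<star>). \<xi> \<phi> = \<phi> x" by blast
qed

lemma bidual_iso:
  assumes m: "Modl X" shows "refl_mod X \<longleftrightarrow> bidual_map R X \<in> mod_iso R X ((X\<^sup>\<star>)\<^sup>\<star>)"
proof
  have ev: "bidual_map R X x = restrict (\<lambda>\<phi>. \<phi> x) (carrier (X\<^sup>\<star>))" for x by (simp add: bidual_map_def)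
  have c: "bidual_map R X x \<in> carrier ((X\<^sup>\<star>)\<^sup>\<star>)" if "x \<in> carrier X" for x
    unfolding ev by (rule dual_memI[OF Mod_dual[OF m] eval_hom[OF that]])
  have h: "bidual_map R X \<in> Hm X ((X\<^sup>\<star>)\<^sup>\<star>)"
    by (rule mod_homI[OF c]) (use m in \<open>auto simp: ev fun_eq_iff hom_simps\<close>)
  {
    assume X: "refl_mod X"
    have "inj_on (bidual_map R X) (carrier X)"
    proof (rule inj_onI_hom[OF m Mod_dual[OF Mod_dual[OF m]] h])
      fix x assume x: "x \<in> carrier X" "bidual_map R X x = \<zero>\<^bsub>(X\<^sup>\<star>)\<^sup>\<star>\<^esub>"
      show "x = \<zero>\<^bsub>X\<^esub>"
      proof (rule refl_zero[OF X x(1)])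
        fix \<phi> assume "\<phi> \<in> Hm X RR"
        note r = dual_memI[OF m this]
        from fun_cong[OF x(2), of "restrict \<phi> (carrier X)"] show "\<phi> x = \<zero>"
          using r x(1) by (simp add: ev)
      qed
    qed
    moreover have "bidual_map R X ` carrier X = carrier ((X\<^sup>\<star>)\<^sup>\<star>)"
    proof (intro equalityI subsetI)
      fix \<xi> assume \<xi>: "\<xi> \<in> carrier ((X\<^sup>\<star>)\<^sup>\<star>)"
      obtain x where x: "x \<in> carrier X" "\<And>\<phi>. \<phi> \<in> carrier (X\<^sup>\<star>) \<Longrightarrow> \<xi> \<phi> = \<phi> x" by (rule refl_eval[OF X dual_hom[OF \<xi>]]) (rule that)
      have "\<xi> = bidual_map R X x" by (rule dual_eqI[OF \<xi> c[OF x(1)]]) (simp only: ev restrict_apply' x(2))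
      then show "\<xi> \<in> bidual_map R X ` carrier X" using x(1) by blast
    qed (use c in blast)
    ultimately show "bidual_map R X \<in> mod_iso R X ((X\<^sup>\<star>)\<^sup>\<star>)" using h by (simp add: mod_iso_def bij_betw_def)
  }
  {
    assume "bidual_map R X \<in> mod_iso R X ((X\<^sup>\<star>)\<^sup>\<star>)"
    then have inj: "inj_on (bidual_map R X) (carrier X)" and surj: "bidual_map R X ` carrier X = carrier ((X\<^sup>\<star>)\<^sup>\<star>)"
      by (simp_all add: mod_iso_def bij_betw_def)
    show "refl_mod X"
    proof (rule reflI)
      fix x assume x: "x \<in> carrier X" "\<And>\<phi>. \<phi> \<in> Hm X RR \<Longrightarrow> \<phi> x = \<zero>"
      have "bidual_map R X x = bidual_map R X \<zero>\<^bsub>X\<^esub>"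
        by (rule dual_eqI[OF c[OF x(1)] c[OF Mod_simps(1)[OF m]]]) (simp add: ev x(2) m)
      then show "x = \<zero>\<^bsub>X\<^esub>" using inj_onD[OF inj _ x(1) Mod_simps(1)[OF m]] by simp
    next
      fix \<xi> assume \<xi>: "\<xi> \<in> Hm (X\<^sup>\<star>) RR"
      have "restrict \<xi> (carrier (X\<^sup>\<star>)) \<in> bidual_map R X ` carrier X"
        using dual_memI[OF Mod_dual[OF m] \<xi>] surj by simp
      then obtain x where x: "restrict \<xi> (carrier (X\<^sup>\<star>)) = bidual_map R X x" "x \<in> carrier X" by (elim imageE)
      have "\<xi> \<phi> = \<phi> x" if "\<phi> \<in> carrier (X\<^sup>\<star>)" for \<phi>
        using fun_cong[OF x(1), of \<phi>] that by (simp only: ev restrict_apply')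
      then show "\<exists>x\<in>carrier X. \<forall>\<phi>\<in>carrier (X\<^sup>\<star>). \<xi> \<phi> = \<phi> x" using x(2) by blast
    qed
  }
qed

text \<open>Every element of the bidual is evaluation at a point of X, so a functional on the bidual
  is determined by its pullback to X, and this pullback is the element of the dual that is
  sought.\<close>

lemma refl_dual:
  assumes m: "Modl X" and X: "refl_mod X" shows "refl_mod (X\<^sup>\<star>)"
proof (rule reflI)
  fix \<phi> assume \<phi>: "\<phi> \<in> carrier (X\<^sup>\<star>)" "\<And>\<xi>. \<xi> \<in> Hm (X\<^sup>\<star>) RR \<Longrightarrow> \<xi> \<phi> = \<zero>"
  show "\<phi> = \<zero>\<^bsub>X\<^sup>\<star>\<^esub>"
    by (rule dual_eqI[OF \<phi>(1) Mod_simps(1)[OF Mod_dual[OF m]]]) (use \<phi>(2)[OF eval_hom] in simp)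
next
  fix \<Xi> assume \<Xi>: "\<Xi> \<in> Hm ((X\<^sup>\<star>)\<^sup>\<star>) RR"
  have h: "bidual_map R X \<in> mod_iso R X ((X\<^sup>\<star>)\<^sup>\<star>)" using bidual_iso[OF m] X by blast
  then have hh: "bidual_map R X \<in> Hm X ((X\<^sup>\<star>)\<^sup>\<star>)" by (simp add: mod_iso_def)
  note r = dual_memI[OF m mod_hom_comp[OF hh \<Xi>]]
  have "\<Xi> \<xi> = \<xi> (restrict (\<lambda>x. \<Xi> (bidual_map R X x)) (carrier X))" if \<xi>: "\<xi> \<in> carrier ((X\<^sup>\<star>)\<^sup>\<star>)" for \<xi>
  proof -
    have "\<xi> \<in> bidual_map R X ` carrier X" using h \<xi> by (simp add: mod_iso_def bij_betw_def)
    then obtain x where x: "\<xi> = bidual_map R X x" "x \<in> carrier X" by (elim imageE)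
    have "\<xi> (restrict (\<lambda>x. \<Xi> (bidual_map R X x)) (carrier X)) = \<Xi> (bidual_map R X x)"
      using r x(2) by (simp only: x(1) bidual_map_def restrict_apply')
    then show ?thesis using x(1) by simp
  qed
  then show "\<exists>x\<in>carrier (X\<^sup>\<star>). \<forall>\<phi>\<in>carrier ((X\<^sup>\<star>)\<^sup>\<star>). \<Xi> \<phi> = \<phi> x" using r by blast
qed

end

context noeth_cring begin

section \<open>Higher Ext vanishing and total reflexivity up to stable isomorphism\<close>

definition Einf :: "('a, 'x) module \<Rightarrow> bool" where
  "Einf X \<longleftrightarrow> (\<forall>k. E1 (Om k X))"

lemma Einf_st: "st X Y \<Longrightarrow> fgm X \<Longrightarrow> Einf X \<Longrightarrow> Einf Y"
  unfolding Einf_def using E1_st[OF Om_cong fgm_Om fgm_Om] st_fgm by blast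

lemma Einf_E1: assumes "fgm X" "Einf X" shows "E1 X"
proof -
  have "E1 (copy X)" using assms(2) by (simp add: Einf_def flip: Om_0)
  then show ?thesis by (rule E1_st[OF st_sym[OF copy(3)[OF assms(1)]] copy(4)[OF assms(1)] assms(1)])
qed

lemma Einf_om_iff: assumes X: "fgm X" shows "Einf X \<longleftrightarrow> E1 X \<and> Einf (om X)"
proof
  assume E: "Einf X"
  have "E1 (Om k (om X))" for k
    using E1_st[OF st_sym[OF Om_om[OF X]] fgm_Om[OF X] fgm_Om[OF fgm_om[OF X]]] E by (simp add: Einf_def)
  then show "E1 X \<and> Einf (om X)" using Einf_E1[OF X E] by (simp add: Einf_def)
next
  assume E: "E1 X \<and> Einf (om X)"
  have "E1 (Om k X)" for k
  proof (cases k)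
    case 0
    then show ?thesis using E1_st[OF copy(3)[OF X] X copy(4)[OF X]] E by (simp add: Om_0)
  next
    case (Suc l)
    then show ?thesis using E1_st[OF Om_om[OF X] fgm_Om[OF fgm_om[OF X]] fgm_Om[OF X]] E by (simp add: Einf_def)
  qed
  then show "Einf X" by (simp add: Einf_def)
qed

text \<open>By \<open>ses_Om\<close> the k-th syzygies again form an exact sequence up to stable
  isomorphism, which reduces each degree to \<open>E1_extension\<close>.\<close>

lemma Einf_extension:
  assumes s: "ses A i B p C" and fg: "fgm A" "fgm C" and E: "Einf A" "Einf C"
  shows "Einf B"
  unfolding Einf_def
proof
  fix k
  have B: "fgm B" by (rule fgm_ext[OF s fg])
  obtain A' B' C' :: "('a, (nat \<Rightarrow> 'a) set) module" and j q where
    1: "ses A' j B' q C'" "st A' (Om k A)" "st B' (Om k B)" "st C' (Om k C)" "fgm A'" "fgm B'" "fgm C'"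
    using ses_Om[OF s fg(1) B fg(2), of k] by blast
  have "E1 A'" "E1 C'"
    using E1_st[OF st_sym[OF 1(2)] fgm_Om[OF fg(1)] 1(5)] E1_st[OF st_sym[OF 1(4)] fgm_Om[OF fg(2)] 1(7)] E
    by (simp_all add: Einf_def)
  then have "E1 B'" by (rule E1_extension[OF 1(1,6)])
  then show "E1 (Om k B)" by (rule E1_st[OF 1(3,6) fgm_Om[OF B]])
qed

lemma st_of_om:
  assumes "fgm X" "fgm Y" "E1 X" "E1 Y" "st (om X) (om Y)"
  shows "st X Y"
proof -
  obtain n j q where s: "ses (om X) j (\<F> n) q X" using om_ses[OF assms(1)] by blast
  obtain m j' q' where t: "ses (om Y) j' (\<F> m) q' Y" using om_ses[OF assms(2)] by blast
  show ?thesis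
    by (rule st_cosyz[OF s t proj_free proj_free E1_ext[OF assms(3) s] E1_ext[OF assms(4) t] assms(5)])
qed

lemma st_of_Om:
  assumes fg: "fgm X" "fgm Y" and E: "Einf X" "Einf Y" and st: "st (Om k X) (Om k Y)"
  shows "st X Y"
  using st
proof (induction k)
  case 0
  then show ?case unfolding Om_0
    using st_trans[OF copy(3)[OF fg(1)] st_trans[OF _ st_sym[OF copy(3)[OF fg(2)]]]] by blast
next
  case (Suc k)
  have "st (Om k X) (Om k Y)"
    by (rule st_of_om[OF fgm_Om[OF fg(1)] fgm_Om[OF fg(2)]]) (use E Suc.prems in \<open>simp_all add: Einf_def Om_Suc\<close>)
  then show ?case by (rule Suc.IH)
qed

text \<open>All four conditions are invariant under stable isomorphism, so the predicate may be
  moved freely between syzygies taken from different resolutions.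
  \<open>totally_reflexive_TR\<close> derives it from \<open>totally_reflexive\<close>.\<close>

definition TR :: "('a, 'x) module \<Rightarrow> bool" where
  "TR X \<longleftrightarrow> fgm X \<and> refl_mod X \<and> Einf X \<and> Einf (X\<^sup>\<star>)"

lemma TR_D:
  assumes "TR X" shows "fgm X" "refl_mod X" "Einf X" "Einf (X\<^sup>\<star>)" "Modl X" "E1 X" "fgm (X\<^sup>\<star>)"
  using assms fgm_Mod Einf_E1 fgm_dual by (auto simp: TR_def)

lemma TR_st:
  assumes "st X Y" "TR X" shows "TR Y"
proof -
  note X = TR_D[OF assms(2)]
  show ?thesis unfolding TR_def
    using st_fgm[OF assms(1) X(1)] refl_st[OF assms(1) X(2)] Einf_st[OF assms(1) X(1,3)]
      Einf_st[OF st_dual[OF assms(1)] X(7,4)] by blast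
qed

lemma TR_dual:
  assumes "TR X" shows "TR (X\<^sup>\<star>)"
proof -
  note X = TR_D[OF assms]
  have "bidual_map R X \<in> mod_iso R X ((X\<^sup>\<star>)\<^sup>\<star>)" using bidual_iso[OF X(5)] X(2) by blast
  then have "st X ((X\<^sup>\<star>)\<^sup>\<star>)" by (rule st_iso[OF X(5) Mod_dual[OF Mod_dual[OF X(5)]]])
  from Einf_st[OF this X(1,3)] show ?thesis unfolding TR_def using X(7,4) refl_dual[OF X(5,2)] by blast
qed

lemma st_bidual: "TR X \<Longrightarrow> st X ((X\<^sup>\<star>)\<^sup>\<star>)"
  using st_iso[OF _ Mod_dual[OF Mod_dual]] bidual_iso TR_D(2,5) by blast

text \<open>Dualising the cover makes the dual of X a syzygy of the dual of A, so the higher Ext of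
  the latter vanish. For its Ext^1, a functional on the dual of X is evaluation at a point of X by
  reflexivity, and evaluation at a preimage in P extends it.\<close>

lemma TR_syzygy:
  assumes X: "TR X" and s: "ses A i P p X" and P: "proj P"
  shows "TR A" "st (om (A\<^sup>\<star>)) (X\<^sup>\<star>)"
proof -
  note X' = TR_D[OF X] and s' = sesD[OF s]
  have e: "ext_prop A i P" by (rule E1_ext[OF X'(6) s])
  note d = ses_dual[OF s e]
  have A: "fgm A" by (rule fgm_ses_sub[OF s fgm_proj[OF P]])
  have st1: "st (X\<^sup>\<star>) (om (A\<^sup>\<star>))" by (rule st_om[OF d proj_dual[OF P]])
  then show "st (om (A\<^sup>\<star>)) (X\<^sup>\<star>)" by (rule st_sym)
  have "ext_prop (X\<^sup>\<star>) (dual_map P p) (P\<^sup>\<star>)" unfolding ext_prop_def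
  proof
    fix \<xi> assume \<xi>: "\<xi> \<in> Hm (X\<^sup>\<star>) RR"
    obtain x where x: "x \<in> carrier X" "\<And>\<phi>. \<phi> \<in> carrier (X\<^sup>\<star>) \<Longrightarrow> \<xi> \<phi> = \<phi> x" by (rule refl_eval[OF X'(2) \<xi>]) (rule that)
    obtain b where b: "b \<in> carrier P" "x = p b" using ses_lift[OF s x(1)] by blast
    show "\<exists>\<psi>\<in>Hm (P\<^sup>\<star>) RR. \<forall>a\<in>carrier (X\<^sup>\<star>). \<psi> (dual_map P p a) = \<xi> a"
      by (rule bexI[OF _ eval_hom[OF b(1)]]) (use x b in simp)
  qed
  then have "E1 (A\<^sup>\<star>)" by (rule E1_I[OF d proj_dual[OF P]])
  moreover have "Einf (om (A\<^sup>\<star>))" by (rule Einf_st[OF st1 X'(7,4)])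
  ultimately have "Einf (A\<^sup>\<star>)" using Einf_om_iff[OF fgm_dual[OF A]] by blast
  moreover have "Einf A"
    by (rule Einf_st[OF st_sym[OF st_om[OF s P]] fgm_om[OF X'(1)]]) (use Einf_om_iff[OF X'(1)] X'(3) in blast)
  ultimately show "TR A" unfolding TR_def using A refl_kernel[OF s P X'(2) e] by blast
qed

lemma TR_om:
  assumes "TR X" shows "TR (om X)" "st (om ((om X)\<^sup>\<star>)) (X\<^sup>\<star>)"
proof -
  obtain n j q where s: "ses (om X) j (\<F> n) q X" using om_ses[OF TR_D(1)[OF assms]] by blast
  from TR_syzygy[OF assms s proj_free] show "TR (om X)" "st (om ((om X)\<^sup>\<star>)) (X\<^sup>\<star>)" .
qed

lemma TR_Om: "TR X \<Longrightarrow> TR (Om k X)"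
proof (induction k)
  case 0
  then show ?case unfolding Om_0 using TR_st[OF copy(3)] TR_D(1) by blast
next
  case (Suc k)
  then show ?case unfolding Om_Suc by (intro TR_om)
qed

text \<open>The dual of Z is a syzygy of the dual of \<Omega> Z, by \<open>TR_om\<close>. Hence each
  outer syzygy cancels one inner syzygy.\<close>

lemma Om_dual_Om:
  assumes X: "TR X" shows "st (Om k ((Om k X)\<^sup>\<star>)) (X\<^sup>\<star>)"
proof (induction k)
  case 0
  note X' = TR_D[OF X]
  have 1: "st ((copy X)\<^sup>\<star>) (X\<^sup>\<star>)" by (rule st_dual[OF st_sym[OF copy(3)[OF X'(1)]]])
  have "st (copy ((copy X)\<^sup>\<star>)) ((copy X)\<^sup>\<star>)" by (rule st_sym[OF copy(3)[OF fgm_dual[OF copy(4)[OF X'(1)]]]])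
  from st_trans[OF this 1] show ?case by (simp add: Om_0)
next
  case (Suc k)
  let ?Z = "Om k X"
  have Z: "TR ?Z" by (rule TR_Om[OF X])
  have f: "fgm ((om ?Z)\<^sup>\<star>)" by (rule TR_D(7)[OF TR_om(1)[OF Z]])
  have "st (Om (Suc k) ((om ?Z)\<^sup>\<star>)) (Om k (om ((om ?Z)\<^sup>\<star>)))" by (rule st_sym[OF Om_om[OF f]])
  moreover have "st (Om k (om ((om ?Z)\<^sup>\<star>))) (Om k (?Z\<^sup>\<star>))"
    by (rule Om_cong[OF TR_om(2)[OF Z] fgm_om[OF f] TR_D(7)[OF Z]])
  ultimately show ?case using Suc st_trans by (simp only: Om_Suc) blast
qed

text \<open>Since Ext^1(C, R) = 0, the dual sequence is exact too, and the argument for the Ext of B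
  applies to the dual of B as well.\<close>

lemma TR_extension:
  assumes s: "ses A i B p C" and A: "TR A" and C: "TR C"
  shows "TR B"
proof -
  note A' = TR_D[OF A] and C' = TR_D[OF C]
  have e: "ext_prop A i B" by (rule E1_ext[OF C'(6) s])
  show ?thesis unfolding TR_def
    using fgm_ext[OF s A'(1) C'(1)] refl_extension[OF s A'(2) C'(2) e] Einf_extension[OF s A'(1) C'(1) A'(3) C'(3)]
      Einf_extension[OF ses_dual[OF s e] C'(7) A'(7) C'(4) A'(4)] by blast
qed

text \<open>Rotation turns the kernel into a middle term: up to stable isomorphism A is an extension
  of B by \<Omega> C.\<close>

lemma TR_kernel:
  assumes s: "ses A i B p C" and B: "TR B" and C: "TR C"
  shows "TR A"
proof -
  have A: "fgm A" by (rule fgm_ses_sub[OF s TR_D(1)[OF B]])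
  obtain W :: "('a, (nat \<Rightarrow> 'a) set) module" and j q where
    W: "ses (om C) j W q B" "st W A" using ses_rotate[OF s A TR_D(1)[OF C]] by blast
  show ?thesis by (rule TR_st[OF W(2) TR_extension[OF W(1) TR_om(1)[OF C] B]])
qed

text \<open>Gorenstein dimension at most n, measured by repeated kernels. One element type is
  enough: the kernel of a map from G keeps the element type of G.\<close>

inductive TR_dim_le :: "nat \<Rightarrow> ('a, (nat \<Rightarrow> 'a) set) module \<Rightarrow> bool" where
  base: "TR X \<Longrightarrow> TR_dim_le 0 X"
| step: "ses X' i G p X \<Longrightarrow> TR (G :: ('a, (nat \<Rightarrow> 'a) set) module) \<Longrightarrow> TR_dim_le n X' \<Longrightarrow> TR_dim_le (Suc n) X"

text \<open>Rotating the first step of the resolution gives a sequence from \<Omega> X through a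
  module stably isomorphic to X' to G. In its n-th syzygies the middle and right terms are totally
  reflexive, hence so is the kernel, which is \<Omega>^(n+1) X.\<close>

lemma TR_Om_of_TR_dim_le: "TR_dim_le n X \<Longrightarrow> TR (Om n X)"
proof (induction rule: TR_dim_le.induct)
  case (base X)
  then show ?case by (rule TR_Om)
next
  case (step X' i G p X n)
  note G = TR_D[OF step(2)]
  have fX: "fgm X" by (rule fgm_ses_quot[OF step(1) G(1)])
  have fX': "fgm X'" by (rule fgm_ses_sub[OF step(1) G(1)])
  obtain W :: "('a, (nat \<Rightarrow> 'a) set) module" and j q where
    W: "ses (om X) j W q G" "st W X'" "fgm W" using ses_rotate[OF step(1) fX' fX] by blast
  obtain A' B' C' :: "('a, (nat \<Rightarrow> 'a) set) module" and j q where
    1: "ses A' j B' q C'" "st A' (Om n (om X))" "st B' (Om n W)" "st C' (Om n G)"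
    using ses_Om[OF W(1) fgm_om[OF fX] W(3) G(1), of n] by blast
  have "TR B'"
    by (rule TR_st[OF st_sym[OF st_trans[OF 1(3) Om_cong[OF W(2,3) fX']]] step(4)])
  moreover have "TR C'" by (rule TR_st[OF st_sym[OF 1(4)] TR_Om[OF step(2)]])
  ultimately have "TR A'" by (rule TR_kernel[OF 1(1)])
  then show ?case by (rule TR_st[OF st_trans[OF 1(2) Om_om[OF fX]]])
qed

text \<open>After k syzygies the left term is projective. One rotation then yields a sequence with
  projective middle term, which makes \<Omega>^(k+1) C a syzygy of \<Omega>^k B.\<close>

lemma Om_quotient_proj:
  assumes s: "ses A i B p C" and fg: "fgm A" "fgm B" "fgm C" and P: "proj (Om k A)" and l: "Suc k \<le> l"
  shows "st (Om l B) (Om l C)"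
  using l
proof (induction l rule: dec_induct)
  case base
  obtain A' B' C' :: "('a, (nat \<Rightarrow> 'a) set) module" and j q where
    1: "ses A' j B' q C'" "st A' (Om k A)" "st B' (Om k B)" "st C' (Om k C)" "fgm A'" "fgm B'" "fgm C'"
    using ses_Om[OF s fg, of k] by blast
  have A': "proj A'" by (rule proj_st[OF st_sym[OF 1(2)] P])
  obtain W :: "('a, (nat \<Rightarrow> 'a) set) module" and j q where
    W: "ses (om C') j W q B'" "st W A'" using ses_rotate[OF 1(1,5,7)] by blast
  have "st (om C') (om B')" by (rule st_om[OF W(1) proj_st[OF st_sym[OF W(2)] A']])
  then have 2: "st (om B') (om C')" by (rule st_sym)
  have 3: "st (Om (Suc k) B) (om B')" "st (om C') (Om (Suc k) C)" unfolding Om_Suc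
    by (rule st_sym[OF om_cong[OF 1(3,6) fgm_Om[OF fg(2)]]], rule om_cong[OF 1(4,7) fgm_Om[OF fg(3)]])
  show ?case by (rule st_trans[OF 3(1) st_trans[OF 2 3(2)]])
next
  case (step l)
  then show ?case unfolding Om_Suc by (intro om_cong fgm_Om fg)
qed

end

section \<open>Stable isomorphism\<close>

context cring begin

lemma proj_projective:
  assumes "proj P" shows "projective_mod R P"
  unfolding projective_mod_def
proof (intro conjI allI impI)
  show "fg_module R P" by (rule fg_module_fgm[OF fgm_proj[OF assms]])
  fix A B :: "('a, (nat \<Rightarrow> 'a) set) module" and p f
  assume *: "Modl A \<and> Modl B \<and> p \<in> Hm A B \<and> p ` carrier A = carrier B \<and> f \<in> Hm P B"
  then have im: "f x \<in> p ` carrier A" if "x \<in> carrier P" for x using that mod_hom_closed[of f R P B x] by simp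
  from * have m: "Modl A" "Modl B" "p \<in> Hm A B" "f \<in> Hm P B" by simp_all
  obtain h where "h \<in> Hm P A" "\<And>x. x \<in> carrier P \<Longrightarrow> p (h x) = f x"
    by (rule proj_lift[OF assms m]) (rule im, assumption, rule that)
  then show "\<exists>h\<in>Hm P A. \<forall>x\<in>carrier P. p (h x) = f x" by blast
qed

text \<open>The identity of P is lifted along a free cover and so factors through a free module.
  \<open>projective_mod\<close> tests lifting only at one element type, which is why P has that type
  and the free module is replaced by its copy.\<close>

lemma projective_proj:
  fixes P :: "('a, (nat \<Rightarrow> 'a) set) module"
  assumes P: "projective_mod R P" shows "proj P"
proof -
  have fP: "fgm P" using P fgm_span unfolding projective_mod_def by blast
  note m = fgm_Mod[OF fP]
  obtain n p where p: "p \<in> Hm (\<F> n) P" "p ` carrier (\<F> n) = carrier P" by (rule fgmE[OF fP])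
  let ?A = "copy (\<F> n)"
  have fF: "fgm (\<F> n)" by (rule fgm_proj[OF proj_free])
  obtain a where a: "a \<in> mod_iso R ?A (\<F> n)" using copy(2)[OF fF] iso_sym[OF Mod_free] by blast
  then have a': "a \<in> Hm ?A (\<F> n)" "a ` carrier ?A = carrier (\<F> n)" by (auto simp: mod_iso_def bij_betw_def)
  have q: "(\<lambda>x. p (a x)) \<in> Hm ?A P" by (rule mod_hom_comp[OF a'(1) p(1)])
  have "(\<lambda>x. p (a x)) ` carrier ?A = p ` a ` carrier ?A" by (simp only: image_image)
  then have "(\<lambda>x. p (a x)) ` carrier ?A = carrier P" using a'(2) p(2) by simp
  then have "Modl ?A \<and> Modl P \<and> (\<lambda>x. p (a x)) \<in> Hm ?A P \<and> (\<lambda>x. p (a x)) ` carrier ?A = carrier P \<and>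
      (\<lambda>x. x) \<in> Hm P P"
    by (intro conjI copy(1)[OF fF] m q mod_hom_id)
  from conjunct2[OF P[unfolded projective_mod_def], rule_format, OF this]
  obtain h where h: "h \<in> Hm P ?A" "\<And>x. x \<in> carrier P \<Longrightarrow> p (a (h x)) = x" by blast
  have "(\<lambda>x. p (a (h x))) \<in> frank P P"
    by (rule frank_comp_left[OF m Mod_free m p(1) proj_frank_to[OF proj_free mod_hom_comp[OF h(1) a'(1)]]])
  then have "(\<lambda>x. x) \<in> frank P P" by (rule frank.eq_on) (simp add: h(2))
  then show ?thesis using m by (simp add: proj_def)
qed

lemma stably_iso_st:
  assumes "stably_iso R X Y" "Modl X" "Modl Y" shows "st X Y"
proof -
  obtain P Q :: "('a, (nat \<Rightarrow> 'a) set) module" and f where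
    *: "projective_mod R P" "projective_mod R Q" "f \<in> mod_iso R (dsum_mod X P) (dsum_mod Y Q)"
    using assms(1) unfolding stably_iso_def mod_isomorphic_def by blast
  note P = projective_proj[OF *(1)] and Q = projective_proj[OF *(2)]
  have 1: "st (dsum_mod X P) X" by (rule st_split[OF ses_dsum[OF assms(2) proj_Mod[OF P]] P])
  have 2: "st (dsum_mod Y Q) Y" by (rule st_split[OF ses_dsum[OF assms(3) proj_Mod[OF Q]] Q])
  have "st (dsum_mod X P) (dsum_mod Y Q)"
    by (rule st_iso[OF Mod_dsum[OF assms(2) proj_Mod[OF P]] Mod_dsum[OF assms(3) proj_Mod[OF Q]] *(3)])
  from st_trans[OF st_sym[OF 1] st_trans[OF this 2]] show ?thesis .
qed

text \<open>Adding a free module to X makes the stable isomorphism surjective, and its stable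
  inverse can then be corrected to a genuine section. So X \<oplus> Q splits as Y plus a kernel, and
  the projection onto that kernel turns out to have finite rank, which makes the kernel
  projective.\<close>

lemma st_stably_iso:
  assumes st: "st X Y" and Y: "fgm Y" and X: "fgm X" shows "stably_iso R X Y"
proof -
  obtain f g where fg: "f \<in> Hm X Y" "g \<in> Hm Y X" "near_id X (\<lambda>x. g (f x))" "near_id Y (\<lambda>y. f (g y))"
    using st by (auto simp: st_def)
  note m = stD[OF st]
  obtain r where r: "r \<in> frank Y Y" "\<forall>x\<in>carrier Y. f (g x) = x \<oplus>\<^bsub>Y\<^esub> r x" using fg(4) by (auto simp: near_id_def)
  obtain r' where r': "r' \<in> frank X X" "\<forall>x\<in>carrier X. g (f x) = x \<oplus>\<^bsub>X\<^esub> r' x" using fg(3) by (auto simp: near_id_def)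
  have rh: "r \<in> Hm Y Y" "r' \<in> Hm X X" by (rule frank_hom[OF m(2,2) r(1)], rule frank_hom[OF m(1,1) r'(1)])
  obtain n \<pi> where \<pi>: "\<pi> \<in> Hm (\<F> n) Y" "\<pi> ` carrier (\<F> n) = carrier Y" by (rule fgmE[OF Y])
  let ?Q = "copy (\<F> n)"
  have fF: "fgm (\<F> n)" by (rule fgm_proj[OF proj_free])
  have Q: "proj ?Q" by (rule proj_st[OF copy(3)[OF fF] proj_free])
  note mQ = proj_Mod[OF Q]
  obtain a where a: "a \<in> mod_iso R ?Q (\<F> n)" using copy(2)[OF fF] iso_sym[OF Mod_free] by blast
  then have a': "a \<in> Hm ?Q (\<F> n)" "a ` carrier ?Q = carrier (\<F> n)" by (auto simp: mod_iso_def bij_betw_def)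
  define q where "q x = \<pi> (a x)" for x
  have q: "q \<in> Hm ?Q Y" unfolding q_def by (rule mod_hom_comp[OF a'(1) \<pi>(1)])
  have "q ` carrier ?Q = \<pi> ` a ` carrier ?Q" unfolding image_image by (rule image_cong[OF refl q_def])
  then have qs: "q ` carrier ?Q = carrier Y" using a'(2) \<pi>(2) by simp
  let ?X = "dsum_mod X ?Q"
  have mX: "Modl ?X" by (rule Mod_dsum[OF m(1) mQ])
  define F where "F z = f (fst z) \<oplus>\<^bsub>Y\<^esub> q (snd z)" for z
  have F: "F \<in> Hm ?X Y" unfolding F_def by (rule hom_copair[OF fg(1) q m(2)])
  have Fs: "F ` carrier ?X = carrier Y"
  proof (intro equalityI subsetI)
    fix y assume y: "y \<in> carrier Y"
    then have "y \<in> q ` carrier ?Q" using qs by simp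
    then obtain v where v: "y = q v" "v \<in> carrier ?Q" by (elim imageE)
    have "F (\<zero>\<^bsub>X\<^esub>, v) = y" using v y m hom_zero[OF m fg(1)] by (simp add: F_def)
    then show "y \<in> F ` carrier ?X" using rev_image_eqI[of "(\<zero>\<^bsub>X\<^esub>, v)" "carrier ?X" y F] v(2) m(1) by simp
  qed (use mod_hom_closed[OF F] in blast)
  obtain k where k: "k \<in> frank Y ?X" "\<And>y. y \<in> carrier Y \<Longrightarrow> F (k y) = r y"
    by (rule frank_lift[OF m(2,2) mX F Fs r(1)]) (rule that)
  have kh: "k \<in> Hm Y ?X" by (rule frank_hom[OF m(2) mX k(1)])
  \<comment> \<open>Since F sends (g y, 0) to y + r y and k y to r y, the difference is an exact
    preimage of y.\<close>
  define s where "s y = (g y, \<zero>\<^bsub>?Q\<^esub>) \<ominus>\<^bsub>?X\<^esub> k y" for y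
  have gi: "(\<lambda>y. (g y, \<zero>\<^bsub>?Q\<^esub>)) \<in> Hm Y ?X" by (rule mod_hom_comp[OF fg(2) hom_inl[OF mQ]])
  have s: "s \<in> Hm Y ?X" unfolding s_def by (rule hom_minus[OF mX gi kh])
  have Fsy: "F (s y) = y" if y: "y \<in> carrier Y" for y
  proof -
    have c: "r y \<in> carrier Y" "f (g y) \<in> carrier Y"
      using mod_hom_closed[OF rh(1) y] mod_hom_closed[OF fg(1) mod_hom_closed[OF fg(2) y]] by simp_all
    have "F (s y) = F (g y, \<zero>\<^bsub>?Q\<^esub>) \<ominus>\<^bsub>Y\<^esub> r y"
      unfolding s_def using hom_diff[OF mX m(2) F mod_hom_closed[OF gi y] mod_hom_closed[OF kh y]] k(2)[OF y] by simp
    also have "F (g y, \<zero>\<^bsub>?Q\<^esub>) = f (g y)" using hom_zero[OF mQ m(2) q] c m(2) by (simp add: F_def)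
    finally show ?thesis using r(2) y c m(2) by (simp add: Mod_ac)
  qed
  \<comment> \<open>The projection onto the kernel of F along the section s.\<close>
  define e where "e z = z \<ominus>\<^bsub>?X\<^esub> s (F z)" for z
  have eh: "e \<in> Hm ?X ?X" unfolding e_def by (rule hom_minus[OF mX mod_hom_id mod_hom_comp[OF F s]])
  have Fe: "F (e z) = \<zero>\<^bsub>Y\<^esub>" if z: "z \<in> carrier ?X" for z
    using hom_diff[OF mX m(2) F z mod_hom_closed[OF s mod_hom_closed[OF F z]]] Fsy[OF mod_hom_closed[OF F z]]
      mod_hom_closed[OF F z] m(2) by (simp add: e_def)
  have es: "e z = z" if "z \<in> carrier ?X" "F z = \<zero>\<^bsub>Y\<^esub>" for z
    using that hom_zero[OF m(2) mX s] Mod_arith(1)[OF mX] Mod_simps(12)[OF mX] Mod_simps(7)[OF mX that(1)]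
    by (simp only: e_def)
  \<comment> \<open>On z = (x, v) the summand x in g (F z) = x + r' x + g (q v) cancels. What is
    left is a sum of four maps, each of which factors through Q or through r' or k.\<close>
  have "e \<in> frank ?X ?X"
  proof -
    note fr2 = frank_comp_left[OF mX mQ mX hom_inr[OF m(1)] proj_frank_to[OF Q hom_snd]]
    note i1 = hom_inl[OF mQ, of X]
    have "(\<lambda>z. (\<ominus>\<^bsub>X\<^esub> r' (fst z), \<zero>\<^bsub>?Q\<^esub>)) \<in> frank ?X ?X"
      by (rule frank_comp_left[OF mX m(1) mX i1 frank_comp_right[OF hom_fst frank_neg[OF m(1,1) r'(1)]]])
    moreover have "(\<lambda>z. (\<ominus>\<^bsub>X\<^esub> g (q (snd z)), \<zero>\<^bsub>?Q\<^esub>)) \<in> frank ?X ?X"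
      by (rule frank_comp_left[OF mX mQ mX mod_hom_comp[OF hom_neg[OF m(1) mod_hom_comp[OF q fg(2)]] i1]
            proj_frank_to[OF Q hom_snd]])
    moreover have "(\<lambda>z. k (F z)) \<in> frank ?X ?X" by (rule frank_comp_right[OF F k(1)])
    ultimately have *: "(\<lambda>z. ((\<zero>\<^bsub>X\<^esub>, snd z) \<oplus>\<^bsub>?X\<^esub> (\<ominus>\<^bsub>X\<^esub> r' (fst z), \<zero>\<^bsub>?Q\<^esub>)) \<oplus>\<^bsub>?X\<^esub>
        ((\<ominus>\<^bsub>X\<^esub> g (q (snd z)), \<zero>\<^bsub>?Q\<^esub>) \<oplus>\<^bsub>?X\<^esub> k (F z))) \<in> frank ?X ?X"
      by (intro frank_plus[OF mX mX] fr2)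
    show ?thesis
    proof (rule frank.eq_on[OF *])
      fix z assume z: "z \<in> carrier ?X"
      obtain x v where zx: "z = (x, v)" by (cases z)
      have x: "x \<in> carrier X" "v \<in> carrier ?Q" using z zx by simp_all
      have Fz: "F z \<in> carrier Y" by (rule mod_hom_closed[OF F z])
      have kz: "k (F z) \<in> carrier ?X" by (rule mod_hom_closed[OF kh Fz])
      have c: "f x \<in> carrier Y" "q v \<in> carrier Y" "r' x \<in> carrier X" "g (q v) \<in> carrier X"
        using mod_hom_closed[OF fg(1) x(1)] mod_hom_closed[OF q x(2)] mod_hom_closed[OF rh(2) x(1)]
          mod_hom_closed[OF fg(2) mod_hom_closed[OF q x(2)]] by simp_all
      have gF: "g (F z) = (x \<oplus>\<^bsub>X\<^esub> r' x) \<oplus>\<^bsub>X\<^esub> g (q v)"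
        using mod_hom_add[OF fg(2) c(1,2)] r'(2) x(1) by (simp add: F_def zx)
      have gz: "(g (F z), \<zero>\<^bsub>?Q\<^esub>) \<in> carrier ?X" by (rule mod_hom_closed[OF gi Fz])
      have "(\<ominus>\<^bsub>?X\<^esub> (g (F z), \<zero>\<^bsub>?Q\<^esub>)) = (\<ominus>\<^bsub>X\<^esub> g (F z), \<zero>\<^bsub>?Q\<^esub>)"
        using hom_uminus[OF m(1) mX i1 mod_hom_closed[OF fg(2) Fz]] by simp
      then have "e z = (z \<oplus>\<^bsub>?X\<^esub> (\<ominus>\<^bsub>X\<^esub> g (F z), \<zero>\<^bsub>?Q\<^esub>)) \<oplus>\<^bsub>?X\<^esub> k (F z)"
        unfolding e_def s_def
        using Mod_arith(1)[OF mX] Mod_arith(3)[OF mX z Mod_simps(4)[OF mX gz] kz] 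
          Mod_arith(5)[OF mX gz Mod_simps(4)[OF mX kz]] Mod_arith(10)[OF mX kz] by simp
      also have "z \<oplus>\<^bsub>?X\<^esub> (\<ominus>\<^bsub>X\<^esub> g (F z), \<zero>\<^bsub>?Q\<^esub>) = ((\<zero>\<^bsub>X\<^esub>, snd z) \<oplus>\<^bsub>?X\<^esub> (\<ominus>\<^bsub>X\<^esub> r' (fst z), \<zero>\<^bsub>?Q\<^esub>)) \<oplus>\<^bsub>?X\<^esub>
        (\<ominus>\<^bsub>X\<^esub> g (q (snd z)), \<zero>\<^bsub>?Q\<^esub>)"
        using gF zx x c m(1) mQ by (simp add: Mod_ac)
      also have "\<dots> \<oplus>\<^bsub>?X\<^esub> k (F z) = ((\<zero>\<^bsub>X\<^esub>, snd z) \<oplus>\<^bsub>?X\<^esub> (\<ominus>\<^bsub>X\<^esub> r' (fst z), \<zero>\<^bsub>?Q\<^esub>)) \<oplus>\<^bsub>?X\<^esub>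
        ((\<ominus>\<^bsub>X\<^esub> g (q (snd z)), \<zero>\<^bsub>?Q\<^esub>) \<oplus>\<^bsub>?X\<^esub> k (F z))"
        by (rule Mod_arith(3)[OF mX _ _ kz]) (use x c zx m(1) mQ in simp_all)
      finally show "e z = ((\<zero>\<^bsub>X\<^esub>, snd z) \<oplus>\<^bsub>?X\<^esub> (\<ominus>\<^bsub>X\<^esub> r' (fst z), \<zero>\<^bsub>?Q\<^esub>)) \<oplus>\<^bsub>?X\<^esub>
        ((\<ominus>\<^bsub>X\<^esub> g (q (snd z)), \<zero>\<^bsub>?Q\<^esub>) \<oplus>\<^bsub>?X\<^esub> k (F z))" .
    qed
  qed
  note ef = this
  let ?D = "sub_mod ?X (a_kernel ?X Y F)"
  have mD: "Modl ?D" by (rule Mod_sub[OF mX submod_kernel[OF mX m(2) F]])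
  have inD: "(\<lambda>x. x) \<in> Hm ?D ?X" by (rule hom_sub_incl[OF mX]) (auto simp: a_kernel_eq)
  have Dc: "z \<in> carrier ?D \<longleftrightarrow> z \<in> carrier ?X \<and> F z = \<zero>\<^bsub>Y\<^esub>" for z
    by (simp only: sub_mod_simps a_kernel_eq mem_Collect_eq)
  have eD: "e \<in> Hm ?X ?D"
    by (rule hom_to_sub[OF eh]) (simp only: a_kernel_eq mem_Collect_eq mod_hom_closed[OF eh] Fe)
  have D: "proj ?D"
  proof -
    have "(\<lambda>z. e (e z)) \<in> frank ?D ?D"
      by (rule frank_comp_right[OF inD frank_comp_left[OF mX mX mD eD ef]])
    then have "(\<lambda>z. z) \<in> frank ?D ?D" by (rule frank.eq_on) (simp only: Dc es)
    then show ?thesis using mD by (simp add: proj_def)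
  qed
  have fD: "fgm ?D" by (rule fgm_proj[OF D])
  have pD: "proj (copy ?D)" by (rule proj_st[OF copy(3)[OF fD] D])
  obtain c where "c \<in> mod_iso R ?D (copy ?D)" using copy(2)[OF fD] by blast
  then have ch: "c \<in> Hm ?D (copy ?D)" and c0: "c \<in> mod_iso R ?D (copy ?D)" by (simp_all add: mod_iso_def)
  obtain c' where c': "c' \<in> Hm (copy ?D) ?D" "\<And>x. x \<in> carrier ?D \<Longrightarrow> c' (c x) = x"
    "\<And>y. y \<in> carrier (copy ?D) \<Longrightarrow> c (c' y) = y"
    by (rule mod_iso_inverse[OF c0 Mod_simps(2,3)[OF mD]]) (assumption+, rule that)
  have "(\<lambda>z. (F z, c (e z))) \<in> mod_iso R ?X (dsum_mod Y (copy ?D))"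
  proof (rule mod_isoI)
    show "(\<lambda>z. (F z, c (e z))) \<in> Hm ?X (dsum_mod Y (copy ?D))" by (rule hom_pair[OF F mod_hom_comp[OF eD ch]])
    show "(\<lambda>w. s (fst w) \<oplus>\<^bsub>?X\<^esub> c' (snd w)) \<in> Hm (dsum_mod Y (copy ?D)) ?X"
      by (rule hom_copair[OF s mod_hom_comp[OF c'(1) inD] mX])
    show "s (fst (F z, c (e z))) \<oplus>\<^bsub>?X\<^esub> c' (snd (F z, c (e z))) = z" if z: "z \<in> carrier ?X" for z
    proof -
      have "s (F z) \<in> carrier ?X" by (rule mod_hom_closed[OF s mod_hom_closed[OF F z]])
      then have "s (F z) \<oplus>\<^bsub>?X\<^esub> e z = z"
        unfolding e_def Mod_arith(1)[OF mX] by (rule Mod_cancel_neg(1)[OF mX _ z])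
      then show ?thesis unfolding fst_conv snd_conv c'(2)[OF mod_hom_closed[OF eD z]] .
    qed
    show "(F (s (fst w) \<oplus>\<^bsub>?X\<^esub> c' (snd w)), c (e (s (fst w) \<oplus>\<^bsub>?X\<^esub> c' (snd w)))) = w"
      if w: "w \<in> carrier (dsum_mod Y (copy ?D))" for w
    proof -
      obtain y v where yv: "w = (y, v)" "y \<in> carrier Y" "v \<in> carrier (copy ?D)" using w by auto
      have vD: "c' v \<in> carrier ?D" by (rule mod_hom_closed[OF c'(1) yv(3)])
      then have v: "c' v \<in> carrier ?X" "F (c' v) = \<zero>\<^bsub>Y\<^esub>" using Dc by blast+
      have sy: "s y \<in> carrier ?X" by (rule mod_hom_closed[OF s yv(2)])
      have 1: "F (s y \<oplus>\<^bsub>?X\<^esub> c' v) = y" using mod_hom_add[OF F sy v(1)] Fsy[OF yv(2)] v(2) yv(2) m(2) by simp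
      have "e (s y \<oplus>\<^bsub>?X\<^esub> c' v) = (s y \<oplus>\<^bsub>?X\<^esub> c' v) \<oplus>\<^bsub>?X\<^esub> \<ominus>\<^bsub>?X\<^esub> s y"
        unfolding e_def 1 by (rule Mod_arith(1)[OF mX])
      also have "\<dots> = c' v"
        unfolding Mod_arith(3)[OF mX sy v(1) Mod_simps(4)[OF mX sy]] by (rule Mod_cancel_neg(1)[OF mX sy v(1)])
      finally show ?thesis using 1 c'(3)[OF yv(3)] yv(1) by simp
    qed
  qed
  then have "mod_isomorphic R (dsum_mod X ?Q) (dsum_mod Y (copy ?D))" unfolding mod_isomorphic_def by blast
  then show ?thesis unfolding stably_iso_def using proj_projective[OF Q] proj_projective[OF pD] by blast
qed

section \<open>Resolutions\<close>

lemma quot_mod: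
  assumes M: "Modl M" and K: "submodule K R M"
  shows "Modl (quot_mod M K)" "(\<lambda>x. K +>\<^bsub>M\<^esub> x) \<in> Hm M (quot_mod M K)"
    "(\<lambda>x. K +>\<^bsub>M\<^esub> x) ` carrier M = carrier (quot_mod M K)" "\<zero>\<^bsub>quot_mod M K\<^esub> = K"
    "x \<in> carrier M \<Longrightarrow> K +>\<^bsub>M\<^esub> x = K \<longleftrightarrow> x \<in> K"
proof -
  note k = submodD[OF M K]
  have cs: "K +>\<^bsub>M\<^esub> x = {h \<oplus>\<^bsub>M\<^esub> x | h. h \<in> K}" for x unfolding a_r_coset_def' by blast
  have eq: "K +>\<^bsub>M\<^esub> (h \<oplus>\<^bsub>M\<^esub> x) = K +>\<^bsub>M\<^esub> x" if h: "h \<in> K" and x: "x \<in> carrier M" for h x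
  proof (intro equalityI subsetI)
    have hc: "h \<in> carrier M" using k(1) h by blast
    fix u assume "u \<in> K +>\<^bsub>M\<^esub> (h \<oplus>\<^bsub>M\<^esub> x)"
    then obtain l where l: "l \<in> K" "u = l \<oplus>\<^bsub>M\<^esub> (h \<oplus>\<^bsub>M\<^esub> x)" unfolding cs by blast
    have "u = (l \<oplus>\<^bsub>M\<^esub> h) \<oplus>\<^bsub>M\<^esub> x" using l(2) Mod_arith(3)[OF M subsetD[OF k(1) l(1)] hc x] by simp
    then show "u \<in> K +>\<^bsub>M\<^esub> x" unfolding cs using k(3)[OF l(1) h] by blast
  next
    have hc: "h \<in> carrier M" using k(1) h by blast
    fix u assume "u \<in> K +>\<^bsub>M\<^esub> x"
    then obtain l where l: "l \<in> K" "u = l \<oplus>\<^bsub>M\<^esub> x" unfolding cs by blast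
    have "u = (l \<ominus>\<^bsub>M\<^esub> h) \<oplus>\<^bsub>M\<^esub> (h \<oplus>\<^bsub>M\<^esub> x)" using l subsetD[OF k(1) l(1)] hc x M by (simp add: Mod_ac)
    then show "u \<in> K +>\<^bsub>M\<^esub> (h \<oplus>\<^bsub>M\<^esub> x)" unfolding cs using k(6)[OF l(1) h] by blast
  qed
  show z: "\<zero>\<^bsub>quot_mod M K\<^esub> = K" by (simp add: quot_mod_def)
  have K0: "K +>\<^bsub>M\<^esub> \<zero>\<^bsub>M\<^esub> = K" by (rule abelian_group.a_coset_add_zero[OF Mod_ag[OF M] k(1)])
  show "K +>\<^bsub>M\<^esub> x = K \<longleftrightarrow> x \<in> K" if x: "x \<in> carrier M" for x
  proof
    assume *: "K +>\<^bsub>M\<^esub> x = K"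
    have "\<zero>\<^bsub>M\<^esub> \<oplus>\<^bsub>M\<^esub> x \<in> K +>\<^bsub>M\<^esub> x" unfolding cs using k(2) by blast
    then show "x \<in> K" using * M x by simp
  next
    assume "x \<in> K"
    from eq[OF this Mod_simps(1)[OF M]] show "K +>\<^bsub>M\<^esub> x = K" using K0 M x by simp
  qed
  have im: "carrier (quot_mod M K) = (\<lambda>x. K +>\<^bsub>M\<^esub> x) ` carrier M"
    by (auto simp: quot_mod_def A_RCOSETS_def')
  then show "(\<lambda>x. K +>\<^bsub>M\<^esub> x) ` carrier M = carrier (quot_mod M K)" ..
  have add: "(K +>\<^bsub>M\<^esub> x) \<oplus>\<^bsub>quot_mod M K\<^esub> (K +>\<^bsub>M\<^esub> y) = K +>\<^bsub>M\<^esub> (x \<oplus>\<^bsub>M\<^esub> y)"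
    if x: "x \<in> carrier M" and y: "y \<in> carrier M" for x y
  proof -
    have "set_add M (K +>\<^bsub>M\<^esub> x) (K +>\<^bsub>M\<^esub> y) = K +>\<^bsub>M\<^esub> (x \<oplus>\<^bsub>M\<^esub> y)"
    proof (intro equalityI subsetI)
      fix u assume "u \<in> set_add M (K +>\<^bsub>M\<^esub> x) (K +>\<^bsub>M\<^esub> y)"
      then obtain h l where hl: "h \<in> K" "l \<in> K" "u = (h \<oplus>\<^bsub>M\<^esub> x) \<oplus>\<^bsub>M\<^esub> (l \<oplus>\<^bsub>M\<^esub> y)"
        unfolding set_add_def' cs by blast
      have "u = (h \<oplus>\<^bsub>M\<^esub> l) \<oplus>\<^bsub>M\<^esub> (x \<oplus>\<^bsub>M\<^esub> y)"
        using hl(3) subsetD[OF k(1) hl(1)] subsetD[OF k(1) hl(2)] x y M by (simp add: Mod_arith)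
      then show "u \<in> K +>\<^bsub>M\<^esub> (x \<oplus>\<^bsub>M\<^esub> y)" unfolding cs using k(3)[OF hl(1,2)] by blast
    next
      fix u assume "u \<in> K +>\<^bsub>M\<^esub> (x \<oplus>\<^bsub>M\<^esub> y)"
      then obtain h where h: "h \<in> K" "u = h \<oplus>\<^bsub>M\<^esub> (x \<oplus>\<^bsub>M\<^esub> y)" unfolding cs by blast
      have "u = (h \<oplus>\<^bsub>M\<^esub> x) \<oplus>\<^bsub>M\<^esub> (\<zero>\<^bsub>M\<^esub> \<oplus>\<^bsub>M\<^esub> y)" using h(2) subsetD[OF k(1) h(1)] x y M by (simp add: Mod_arith(3))
      then show "u \<in> set_add M (K +>\<^bsub>M\<^esub> x) (K +>\<^bsub>M\<^esub> y)" unfolding set_add_def' cs using h(1) k(2) by blast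
    qed
    then show ?thesis by (simp add: quot_mod_def)
  qed
  have sm: "a \<odot>\<^bsub>quot_mod M K\<^esub> (K +>\<^bsub>M\<^esub> x) = K +>\<^bsub>M\<^esub> (a \<odot>\<^bsub>M\<^esub> x)" if a: "a \<in> carrier R" and x: "x \<in> carrier M" for a x
  proof -
    have "K +>\<^bsub>M\<^esub> (a \<odot>\<^bsub>M\<^esub> u) = K +>\<^bsub>M\<^esub> (a \<odot>\<^bsub>M\<^esub> x)" if u: "u \<in> K +>\<^bsub>M\<^esub> x" for u
    proof -
      obtain h where h: "h \<in> K" "u = h \<oplus>\<^bsub>M\<^esub> x" using u unfolding cs by blast
      have "a \<odot>\<^bsub>M\<^esub> u = a \<odot>\<^bsub>M\<^esub> h \<oplus>\<^bsub>M\<^esub> a \<odot>\<^bsub>M\<^esub> x" using h(2) Mod_arith(11)[OF M a subsetD[OF k(1) h(1)] x] by simp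
      then show ?thesis using eq[OF k(4)[OF a h(1)] Mod_simps(3)[OF M a x]] by simp
    qed
    moreover have "x \<in> K +>\<^bsub>M\<^esub> x"
    proof -
      have "\<zero>\<^bsub>M\<^esub> \<oplus>\<^bsub>M\<^esub> x \<in> K +>\<^bsub>M\<^esub> x" unfolding cs using k(2) by blast
      then show ?thesis using M x by simp
    qed
    ultimately have "(\<Union>u\<in>K +>\<^bsub>M\<^esub> x. K +>\<^bsub>M\<^esub> (a \<odot>\<^bsub>M\<^esub> u)) = K +>\<^bsub>M\<^esub> (a \<odot>\<^bsub>M\<^esub> x)" by blast
    then show ?thesis by (simp add: quot_mod_def)
  qed
  show "Modl (quot_mod M K)" "(\<lambda>x. K +>\<^bsub>M\<^esub> x) \<in> Hm M (quot_mod M K)"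
    using Mod_surj_image[OF M im _ add sm] z K0 by simp_all
qed

lemma ses_quot:
  assumes M: "Modl M" and K: "submodule K R M"
  shows "ses (sub_mod M K) (\<lambda>x. x) M (\<lambda>x. K +>\<^bsub>M\<^esub> x) (quot_mod M K)"
proof -
  note q = quot_mod[OF M K]
  have "a_kernel M (quot_mod M K) (\<lambda>x. K +>\<^bsub>M\<^esub> x) = K"
    using q(4,5) submodD(1)[OF M K] by (auto simp: a_kernel_eq)
  then show ?thesis using ses_kernel[OF M q(1,2,3)] by simp
qed

lemma resolutionD:
  assumes "resolution R X F d e"
  shows "Modl (F n)" "d (Suc n) \<in> Hm (F (Suc n)) (F n)" "e \<in> Hm (F 0) X" "e ` carrier (F 0) = carrier X"
    "d (Suc 0) ` carrier (F (Suc 0)) = a_kernel (F 0) X e"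
    "d (Suc (Suc n)) ` carrier (F (Suc (Suc n))) = a_kernel (F (Suc n)) (F n) (d (Suc n))"
  using assms unfolding resolution_def by (simp_all only: One_nat_def)

lemma resolution_submod:
  assumes "resolution R X F d e"
  shows "submodule (d (Suc n) ` carrier (F (Suc n))) R (F n)"
  by (rule submod_image[OF resolutionD(1)[OF assms] resolutionD(1)[OF assms] resolutionD(2)[OF assms]])

lemma fg_free_proj: assumes "fg_free R P" shows "proj P"
proof -
  obtain n f where "Modl P" "f \<in> mod_iso R (\<F> n) P" using assms unfolding fg_free_def mod_isomorphic_def by blast
  from proj_st[OF st_iso[OF Mod_free this] proj_free] show ?thesis .
qed

abbreviation syz_proj :: "(nat \<Rightarrow> ('a, 'f) module) \<Rightarrow> (nat \<Rightarrow> 'f \<Rightarrow> 'f) \<Rightarrow> nat \<Rightarrow> 'f \<Rightarrow> 'f set" where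
  "syz_proj F d n \<equiv> (\<lambda>x. (d (Suc n) ` carrier (F (Suc n))) +>\<^bsub>F n\<^esub> x)"

lemma syzygy_proj:
  assumes r: "resolution R X F d e"
  shows "Modl (syzygy F d n)" "syz_proj F d n \<in> Hm (F n) (syzygy F d n)"
    "syz_proj F d n ` carrier (F n) = carrier (syzygy F d n)"
    "x \<in> carrier (F n) \<Longrightarrow> syz_proj F d n x = \<zero>\<^bsub>syzygy F d n\<^esub> \<longleftrightarrow> x \<in> d (Suc n) ` carrier (F (Suc n))"
  using quot_mod[OF resolutionD(1)[OF r, where n = n] resolution_submod[OF r]] by (simp_all add: syzygy_def)

text \<open>The injection is induced by the differential out of degree n + 1, whose kernel is the
  image of the next one. The second equation keeps it tied to \<open>d\<close>, as needed to recover
  cocycles and chain maps from maps of syzygies.\<close>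

lemma ses_syzygy:
  assumes r: "resolution R X F d e"
  obtains \<iota> where "ses (syzygy F d (Suc n)) \<iota> (F n) (syz_proj F d n) (syzygy F d n)"
    "\<And>x. x \<in> carrier (F (Suc n)) \<Longrightarrow> \<iota> (syz_proj F d (Suc n) x) = d (Suc n) x"
proof -
  note r' = resolutionD[OF r]
  note p = syzygy_proj[OF r, where n = n] and p' = syzygy_proj[OF r, where n = "Suc n"]
  let ?A = "syzygy F d (Suc n)"
  have ker: "x \<in> d (Suc (Suc n)) ` carrier (F (Suc (Suc n))) \<longleftrightarrow> d (Suc n) x = \<zero>\<^bsub>F n\<^esub>"
    if "x \<in> carrier (F (Suc n))" for x
    unfolding r'(6) using that by (simp add: a_kernel_eq)
  obtain \<iota> where \<iota>: "\<iota> \<in> Hm ?A (F n)"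
    "\<And>x. x \<in> carrier (F (Suc n)) \<Longrightarrow> \<iota> (syz_proj F d (Suc n) x) = d (Suc n) x"
    by (rule hom_factor_surj[OF r'(1) p'(1) r'(1) p'(2,3) r'(2)]) (use p'(4) ker in blast, rule that)
  have s: "ses ?A \<iota> (F n) (syz_proj F d n) (syzygy F d n)" unfolding ses_def
  proof (intro conjI p(1,2,3) p'(1) r'(1) \<iota>(1))
    show "inj_on \<iota> (carrier ?A)"
    proof (rule inj_onI_hom[OF p'(1) r'(1) \<iota>(1)])
      fix y assume y: "y \<in> carrier ?A" "\<iota> y = \<zero>\<^bsub>F n\<^esub>"
      have "y \<in> syz_proj F d (Suc n) ` carrier (F (Suc n))" using p'(3) y(1) by simp
      then obtain x where x: "y = syz_proj F d (Suc n) x" "x \<in> carrier (F (Suc n))" by (elim imageE)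
      have "d (Suc n) x = \<zero>\<^bsub>F n\<^esub>" using \<iota>(2)[OF x(2)] y(2) x(1) by simp
      then show "y = \<zero>\<^bsub>?A\<^esub>" using p'(4)[OF x(2)] ker[OF x(2)] x(1) by blast
    qed
    have "\<iota> ` carrier ?A = (\<lambda>x. \<iota> (syz_proj F d (Suc n) x)) ` carrier (F (Suc n))"
      by (simp only: image_image flip: p'(3))
    also have "\<dots> = d (Suc n) ` carrier (F (Suc n))" by (rule image_cong[OF refl \<iota>(2)])
    finally have im: "\<iota> ` carrier ?A = d (Suc n) ` carrier (F (Suc n))" .
    have "d (Suc n) ` carrier (F (Suc n)) \<subseteq> carrier (F n)" using mod_hom_closed[OF r'(2)] by blast
    then show "\<iota> ` carrier ?A = {x \<in> carrier (F n). syz_proj F d n x = \<zero>\<^bsub>syzygy F d n\<^esub>}"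
      unfolding im using p(4) by blast
  qed
  show ?thesis by (rule that[OF s \<iota>(2)])
qed

lemma iso_of_bij: "h \<in> Hm X Y \<Longrightarrow> inj_on h (carrier X) \<Longrightarrow> h ` carrier X = carrier Y \<Longrightarrow> h \<in> mod_iso R X Y"
  by (simp add: mod_iso_def bij_betw_def)

lemma syzygy_0:
  assumes r: "resolution R X F d e" and X: "Modl X"
  shows "st (syzygy F d 0) X"
proof -
  note r' = resolutionD[OF r] and p = syzygy_proj[OF r, where n = 0]
  have ker: "x \<in> d (Suc 0) ` carrier (F (Suc 0)) \<longleftrightarrow> e x = \<zero>\<^bsub>X\<^esub>" if "x \<in> carrier (F 0)" for x
    unfolding r'(5) using that by (simp add: a_kernel_eq)
  obtain h where h: "h \<in> Hm (syzygy F d 0) X" "\<And>x. x \<in> carrier (F 0) \<Longrightarrow> h (syz_proj F d 0 x) = e x"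
    by (rule hom_factor_surj[OF r'(1) p(1) X p(2,3) r'(3)]) (use p(4) ker in blast, rule that)
  have "inj_on h (carrier (syzygy F d 0))"
  proof (rule inj_onI_hom[OF p(1) X h(1)])
    fix y assume y: "y \<in> carrier (syzygy F d 0)" "h y = \<zero>\<^bsub>X\<^esub>"
    have "y \<in> syz_proj F d 0 ` carrier (F 0)" using p(3) y(1) by simp
    then obtain x where x: "y = syz_proj F d 0 x" "x \<in> carrier (F 0)" by (elim imageE)
    have "e x = \<zero>\<^bsub>X\<^esub>" using h(2)[OF x(2)] y(2) x(1) by simp
    then show "y = \<zero>\<^bsub>syzygy F d 0\<^esub>" using p(4)[OF x(2)] ker[OF x(2)] x(1) by blast
  qed
  moreover have "h ` carrier (syzygy F d 0) = carrier X"
  proof -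
    have "h ` carrier (syzygy F d 0) = (\<lambda>x. h (syz_proj F d 0 x)) ` carrier (F 0)" by (simp only: image_image flip: p(3))
    also have "\<dots> = e ` carrier (F 0)" by (rule image_cong[OF refl h(2)])
    finally show ?thesis using r'(4) by simp
  qed
  ultimately show ?thesis using st_iso[OF p(1) X iso_of_bij[OF h(1)]] by blast
qed

end

context noeth_cring begin

lemma free_resolution_fgm:
  assumes r: "free_resolution R X F d e" and X: "Modl X"
  shows "fgm X" "fgm (syzygy F d k)" "proj (F k)"
proof -
  have r1: "resolution R X F d e" and f: "fg_free R (F n)" for n using r by (simp_all add: free_resolution_def)
  show P: "proj (F k)" for k by (rule fg_free_proj[OF f])
  show "fgm X" by (rule fgm_surj[OF fgm_proj[OF P] X resolutionD(3,4)[OF r1]])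
  show "fgm (syzygy F d k)" by (rule fgm_surj[OF fgm_proj[OF P] syzygy_proj(1,2,3)[OF r1]])
qed

text \<open>Successive cokernels are linked by the projective modules of the resolution, so stably
  the syzygies do not depend on it. Minimal and chosen resolutions are both reduced to
  \<open>Om\<close> here.\<close>

lemma syzygy_Om:
  assumes r: "free_resolution R X F d e" and X: "Modl X"
  shows "st (syzygy F d k) (Om k X)"
proof (induction k)
  note r' = free_resolution_fgm[OF r X]
  have r1: "resolution R X F d e" using r by (simp add: free_resolution_def)
  case 0
  show ?case unfolding Om_0 by (rule st_trans[OF syzygy_0[OF r1 X] copy(3)[OF r'(1)]])
next
  note r' = free_resolution_fgm[OF r X]
  have r1: "resolution R X F d e" using r by (simp add: free_resolution_def)
  case (Suc k)
  obtain \<iota> where s: "ses (syzygy F d (Suc k)) \<iota> (F k) (syz_proj F d k) (syzygy F d k)"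
    by (rule ses_syzygy[OF r1])
  show ?case unfolding Om_Suc
    by (rule st_trans[OF st_om[OF s r'(3)] om_cong[OF Suc r'(2) fgm_Om[OF r'(1)]]])
qed

lemma free_cover_kernel:
  assumes B: "Modl B" and h: "h \<in> Hm (\<F> m) B"
  shows "\<exists>k h'. h' \<in> Hm (\<F> k) (\<F> m) \<and> h' ` carrier (\<F> k) = a_kernel (\<F> m) B h"
proof -
  have K: "submodule (a_kernel (\<F> m) B h) R (\<F> m)" by (rule submod_kernel[OF Mod_free B h])
  then have "fgm (sub_mod (\<F> m) (a_kernel (\<F> m) B h))" using noeth_free by (simp only: noeth_def)
  then obtain k p where p: "p \<in> Hm (\<F> k) (sub_mod (\<F> m) (a_kernel (\<F> m) B h))"
    "p ` carrier (\<F> k) = carrier (sub_mod (\<F> m) (a_kernel (\<F> m) B h))" by (rule fgmE)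
  have "p \<in> Hm (\<F> k) (\<F> m)"
    using mod_hom_comp[OF p(1) hom_sub_incl[OF Mod_free submodD(1)[OF Mod_free K]]] by simp
  then show ?thesis using p(2) by (intro exI conjI) (assumption, simp only: sub_mod_simps)
qed

lemma free_resolution_exists:
  assumes X: "fgm X"
  shows "\<exists>(F :: nat \<Rightarrow> ('a, nat \<Rightarrow> 'a) module) d e. free_resolution R X F d e"
proof -
  note m = fgm_Mod[OF X]
  obtain n0 e where e: "e \<in> Hm (\<F> n0) X" "e ` carrier (\<F> n0) = carrier X" by (rule fgmE[OF X])
  obtain n1 d1 where d1: "d1 \<in> Hm (\<F> n1) (\<F> n0)" "d1 ` carrier (\<F> n1) = a_kernel (\<F> n0) X e"
    using free_cover_kernel[OF m e(1)] by blast
  \<comment> \<open>A stage is a triple (a, b, h) with h from R^b to R^a, and consecutive stages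
    overlap in one module. The dependent choice below starts from any stage satisfying P 0, so the
    prescribed first differential is made part of P.\<close>
  define P where "P n t \<longleftrightarrow> (case t of (a, b, h) \<Rightarrow> h \<in> Hm (\<F> b) (\<F> a) \<and>
      (n = (0::nat) \<longrightarrow> a = n0 \<and> b = n1 \<and> h = d1))" for n and t :: "nat \<times> nat \<times> ((nat \<Rightarrow> 'a) \<Rightarrow> nat \<Rightarrow> 'a)"
  define Q where "Q n t t' \<longleftrightarrow> (case t of (a, b, h) \<Rightarrow> case t' of (b', c, h') \<Rightarrow> b' = b \<and>
      h' ` carrier (\<F> c) = a_kernel (\<F> b) (\<F> a) h)"
    for n :: nat and t t' :: "nat \<times> nat \<times> ((nat \<Rightarrow> 'a) \<Rightarrow> nat \<Rightarrow> 'a)"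
  have "\<exists>f. \<forall>n. P n (f n) \<and> Q n (f n) (f (Suc n))"
  proof (rule dependent_nat_choice)
    show "\<exists>t. P 0 t" using d1(1) by (intro exI[of _ "(n0, n1, d1)"]) (simp add: P_def)
    fix t n assume t: "P n t"
    obtain a b h where abh: "t = (a, b, h)" by (cases t) auto
    have h: "h \<in> Hm (\<F> b) (\<F> a)" using t unfolding P_def abh prod.case by (rule conjunct1)
    obtain c h' where h': "h' \<in> Hm (\<F> c) (\<F> b)" "h' ` carrier (\<F> c) = a_kernel (\<F> b) (\<F> a) h"
      using free_cover_kernel[OF Mod_free h] by blast
    have "P (Suc n) (b, c, h')" unfolding P_def prod.case using h'(1) by blast
    moreover have "Q n t (b, c, h')" unfolding Q_def abh prod.case using h'(2) by blast
    ultimately show "\<exists>t'. P (Suc n) t' \<and> Q n t t'" by blast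
  qed
  then obtain f where f: "\<And>n. P n (f n)" "\<And>n. Q n (f n) (f (Suc n))" by blast
  define F where "F n = \<F> (fst (f n))" for n
  define d where "d n = (case n of 0 \<Rightarrow> undefined | Suc k \<Rightarrow> snd (snd (f k)))" for n
  have q: "fst (f (Suc n)) = fst (snd (f n)) \<and> snd (snd (f (Suc n))) ` carrier (\<F> (fst (snd (f (Suc n))))) =
      a_kernel (\<F> (fst (snd (f n)))) (\<F> (fst (f n))) (snd (snd (f n)))" for n
    using f(2)[of n] unfolding Q_def case_prod_unfold .
  have b: "fst (snd (f n)) = fst (f (Suc n))" for n by (rule sym[OF conjunct1[OF q]])
  have p: "snd (snd (f n)) \<in> Hm (\<F> (fst (snd (f n)))) (\<F> (fst (f n)))" for n
    using f(1)[of n] unfolding P_def case_prod_unfold by (rule conjunct1)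
  have dS: "d (Suc n) = snd (snd (f n))" for n by (simp add: d_def)
  have dh: "d (Suc n) \<in> Hm (F (Suc n)) (F n)" for n
    unfolding dS F_def b[symmetric] by (rule p)
  have im: "d (Suc (Suc n)) ` carrier (F (Suc (Suc n))) = a_kernel (F (Suc n)) (F n) (d (Suc n))" for n
    using conjunct2[OF q[of n]] unfolding dS F_def b .
  have f0: "f 0 = (n0, n1, d1)" using f(1)[of 0] unfolding P_def case_prod_unfold by (simp add: prod_eq_iff)
  have F0: "F 0 = \<F> n0" "F (Suc 0) = \<F> n1" "d (Suc 0) = d1" using f0 b[of 0] by (simp_all add: F_def d_def)
  have "resolution R X F d e" unfolding resolution_def One_nat_def F0
  proof (intro conjI allI dh im e)
    show "Modl (F n)" for n unfolding F_def by (rule Mod_free)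
    show "d1 ` carrier (\<F> n1) = a_kernel (\<F> n0) X e" by (rule d1(2))
  qed
  moreover have "fg_free R (F n)" for n
    unfolding fg_free_def F_def mod_isomorphic_def using Mod_free iso_id by blast
  ultimately show ?thesis unfolding free_resolution_def by blast
qed

lemma some_free_resolution:
  assumes "fgm X"
  obtains F d e where "some_free_resolution R X = (F, d)" "free_resolution R X F d e"
proof -
  obtain F d where Fd: "some_free_resolution R X = (F, d)" by (cases "some_free_resolution R X")
  have "\<exists>t. case t of (F :: nat \<Rightarrow> ('a, nat \<Rightarrow> 'a) module, d) \<Rightarrow> \<exists>e. free_resolution R X F d e"
    using free_resolution_exists[OF assms] by auto
  from someI_ex[OF this] have "case some_free_resolution R X of (F, d) \<Rightarrow> \<exists>e. free_resolution R X F d e"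
    unfolding some_free_resolution_def .
  then show ?thesis using that Fd by auto
qed

end

section \<open>Ext, grade and Gorenstein dimension\<close>

context noeth_cring begin

lemma cocycles_kernel:
  assumes r: "resolution R X F d e"
  shows "cocycles R F d RR i = a_kernel ((F i)\<^sup>\<star>) ((F (Suc i))\<^sup>\<star>) (dual_map (F (Suc i)) (d (Suc i)))"
  unfolding cocycles_def a_kernel_eq dual_mod_def[symmetric]
  by (rule Collect_cong) (auto simp: dual_map_def fun_eq_iff)

lemma submod_cocycles:
  assumes r: "resolution R X F d e"
  shows "submodule (cocycles R F d RR i) R ((F i)\<^sup>\<star>)"
  unfolding cocycles_kernel[OF r]
  by (rule submod_kernel[OF Mod_dual Mod_dual dual_map_hom]) (rule resolutionD[OF r])+

lemma coboundaries_0: "coboundaries R F d RR 0 = {\<zero>\<^bsub>(F 0)\<^sup>\<star>\<^esub>}"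
  by (simp add: coboundaries_def dual_mod_def)

lemma coboundaries_Suc:
  "coboundaries R F d RR (Suc j) = dual_map (F (Suc j)) (d (Suc j)) ` carrier ((F j)\<^sup>\<star>)"
  by (simp add: coboundaries_def dual_mod_def dual_map_def)

lemma submod_coboundaries:
  assumes r: "resolution R X F d e"
  shows "submodule (coboundaries R F d RR i) R ((F i)\<^sup>\<star>)"
proof (cases i)
  case 0
  have m: "Modl ((F 0)\<^sup>\<star>)" by (rule Mod_dual[OF resolutionD(1)[OF r]])
  show ?thesis unfolding 0 coboundaries_0 by (rule submodI[OF m]) (use m in \<open>simp_all del: dual_mod_simps\<close>)
next
  case (Suc j)
  show ?thesis unfolding Suc coboundaries_Suc
    by (rule submod_image[OF Mod_dual Mod_dual dual_map_hom]) (rule resolutionD[OF r])+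
qed

lemma coboundaries_cocycles:
  assumes r: "resolution R X F d e"
  shows "coboundaries R F d RR i \<subseteq> cocycles R F d RR i"
proof (cases i)
  case 0
  show ?thesis unfolding 0 coboundaries_0 using submodD(2)[OF Mod_dual[OF resolutionD(1)[OF r]] submod_cocycles[OF r]] by simp
next
  case (Suc j)
  note r' = resolutionD[OF r]
  show ?thesis
  proof
    fix \<phi> assume "\<phi> \<in> coboundaries R F d RR i"
    then obtain \<psi> where \<psi>: "\<phi> = dual_map (F i) (d i) \<psi>" "\<psi> \<in> carrier ((F j)\<^sup>\<star>)" unfolding Suc coboundaries_Suc by (elim imageE)
    have \<phi>: "\<phi> \<in> carrier ((F i)\<^sup>\<star>)" unfolding \<psi>(1) Suc by (rule dual_map_in[OF r'(1,2) \<psi>(2)])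
    have "\<phi> (d (Suc i) x) = \<zero>" if x: "x \<in> carrier (F (Suc i))" for x
    proof -
      have dx: "d (Suc i) x \<in> carrier (F i)" by (rule mod_hom_closed[OF r'(2) x])
      have "d (Suc i) x \<in> a_kernel (F (Suc j)) (F j) (d (Suc j))" using r'(6)[of j] x unfolding Suc by blast
      then have "d i (d (Suc i) x) = \<zero>\<^bsub>F j\<^esub>" unfolding a_kernel_eq Suc by blast
      then show ?thesis using \<psi> dx hom_RR_zero[OF r'(1) dual_hom[OF \<psi>(2)]] by simp
    qed
    then show "\<phi> \<in> cocycles R F d RR i" unfolding cocycles_def dual_mod_def[symmetric] using \<phi> by simp
  qed
qed

lemma submod_coboundaries_cocycles:
  assumes r: "resolution R X F d e"
  shows "submodule (coboundaries R F d RR i) R (sub_mod ((F i)\<^sup>\<star>) (cocycles R F d RR i))"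
proof (rule submodI)
  note m = Mod_dual[OF resolutionD(1)[OF r]]
  note b = submodD[OF m submod_coboundaries[OF r]]
  show "Modl (sub_mod ((F i)\<^sup>\<star>) (cocycles R F d RR i))" by (rule Mod_sub[OF m submod_cocycles[OF r]])
qed (use submodD[OF Mod_dual[OF resolutionD(1)[OF r]] submod_coboundaries[OF r]] coboundaries_cocycles[OF r] in
    \<open>simp_all del: dual_mod_simps\<close>)

lemma Ext_eq:
  assumes "some_free_resolution R X = (F, d)"
  shows "Ext R i X RR = quot_mod (sub_mod ((F i)\<^sup>\<star>) (cocycles R F d RR i)) (coboundaries R F d RR i)"
  by (simp add: Ext_def assms dual_mod_def sub_mod_def)

lemma Ext_zero:
  assumes s: "some_free_resolution R X = (F, d)" and r: "resolution R X F d e" and z: "zero_mod (Ext R i X RR)"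
  shows "cocycles R F d RR i = coboundaries R F d RR i"
proof (rule equalityI[OF _ coboundaries_cocycles[OF r]], rule subsetI)
  let ?M = "sub_mod ((F i)\<^sup>\<star>) (cocycles R F d RR i)" and ?K = "coboundaries R F d RR i"
  have M: "Modl ?M" by (rule Mod_sub[OF Mod_dual[OF resolutionD(1)[OF r]] submod_cocycles[OF r]])
  note q = quot_mod[OF M submod_coboundaries_cocycles[OF r]]
  fix \<phi> assume "\<phi> \<in> cocycles R F d RR i"
  then have \<phi>: "\<phi> \<in> carrier ?M" by simp
  have "carrier (quot_mod ?M ?K) = {?K}" using z unfolding zero_mod_def Ext_eq[OF s] q(4) .
  then have "?K +>\<^bsub>?M\<^esub> \<phi> = ?K" using mod_hom_closed[OF q(2) \<phi>] by simp
  then show "\<phi> \<in> ?K" using q(5)[OF \<phi>] by simp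
qed

text \<open>A cocycle of degree j + 1 is a functional on the syzygy of that degree, and it is a
  coboundary when it extends to \<open>F j\<close>. Vanishing of Ext in degree j + 1 is therefore
  the extension property for the cover \<open>F j\<close> of the j-th syzygy.\<close>

lemma Ext_E1:
  assumes X: "fgm X" and z: "zero_mod (Ext R (Suc j) X RR)"
  shows "E1 (Om j X)"
proof -
  obtain F d e where s: "some_free_resolution R X = (F, d)" and fr: "free_resolution R X F d e"
    by (rule some_free_resolution[OF X])
  have r: "resolution R X F d e" using fr by (simp add: free_resolution_def)
  note r' = resolutionD[OF r] and f = free_resolution_fgm[OF fr fgm_Mod[OF X]]
  note p = syzygy_proj[OF r, where n = "Suc j"]
  let ?A = "syzygy F d (Suc j)"
  obtain \<iota> where \<iota>: "ses ?A \<iota> (F j) (syz_proj F d j) (syzygy F d j)"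
    "\<And>x. x \<in> carrier (F (Suc j)) \<Longrightarrow> \<iota> (syz_proj F d (Suc j) x) = d (Suc j) x"
    by (rule ses_syzygy[OF r]) (rule that)
  have "ext_prop ?A \<iota> (F j)" unfolding ext_prop_def
  proof
    fix \<phi> assume \<phi>: "\<phi> \<in> Hm ?A RR"
    let ?\<psi> = "restrict (\<lambda>x. \<phi> (syz_proj F d (Suc j) x)) (carrier (F (Suc j)))"
    have c: "?\<psi> \<in> carrier ((F (Suc j))\<^sup>\<star>)" by (rule dual_memI[OF r'(1) mod_hom_comp[OF p(2) \<phi>]])
    have "?\<psi> (d (Suc (Suc j)) x) = \<zero>" if x: "x \<in> carrier (F (Suc (Suc j)))" for x
    proof -
      have dx: "d (Suc (Suc j)) x \<in> carrier (F (Suc j))" by (rule mod_hom_closed[OF r'(2) x])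
      have "syz_proj F d (Suc j) (d (Suc (Suc j)) x) = \<zero>\<^bsub>?A\<^esub>" using p(4)[OF dx] x by blast
      then show ?thesis using dx hom_RR_zero[OF p(1) \<phi>] by simp
    qed
    then have "?\<psi> \<in> cocycles R F d RR (Suc j)"
      unfolding cocycles_def dual_mod_def[symmetric] mem_Collect_eq ring_mod_simps using c by blast
    then obtain \<chi> where \<chi>: "?\<psi> = dual_map (F (Suc j)) (d (Suc j)) \<chi>" "\<chi> \<in> carrier ((F j)\<^sup>\<star>)"
      unfolding Ext_zero[OF s r z] coboundaries_Suc by (elim imageE)
    have "\<chi> (\<iota> a) = \<phi> a" if a: "a \<in> carrier ?A" for a
    proof -
      have "a \<in> syz_proj F d (Suc j) ` carrier (F (Suc j))" using p(3) a by simp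
      then obtain x where x: "a = syz_proj F d (Suc j) x" "x \<in> carrier (F (Suc j))" by (elim imageE)
      show ?thesis using fun_cong[OF \<chi>(1), of x] x(2) \<iota>(2)[OF x(2)] unfolding x(1) by simp
    qed
    then show "\<exists>\<psi>\<in>Hm (F j) RR. \<forall>a\<in>carrier ?A. \<psi> (\<iota> a) = \<phi> a" using dual_hom[OF \<chi>(2)] by blast
  qed
  then have "E1 (syzygy F d j)" by (rule E1_I[OF \<iota>(1) f(3)])
  then show ?thesis by (rule E1_st[OF syzygy_Om[OF fr fgm_Mod[OF X]] f(2) fgm_Om[OF X]])
qed

lemma totally_reflexive_TR:
  assumes "totally_reflexive R G" shows "TR G"
proof -
  have G: "fgm G" using assms fgm_span unfolding totally_reflexive_def by blast
  have b: "bidual_map R G \<in> mod_iso R G ((G\<^sup>\<star>)\<^sup>\<star>)"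
    and z: "zero_mod (Ext R (Suc j) G RR)" "zero_mod (Ext R (Suc j) (G\<^sup>\<star>) RR)" for j
    using assms unfolding totally_reflexive_def by simp_all
  have "Einf G" "Einf (G\<^sup>\<star>)" unfolding Einf_def
    using Ext_E1[OF G z(1)] Ext_E1[OF fgm_dual[OF G] z(2)] by simp_all
  then show ?thesis unfolding TR_def using G bidual_iso[OF fgm_Mod[OF G]] b by blast
qed

text \<open>The kernel of the augmentation is resolved by the shifted complex, with the first
  differential as its augmentation. For n = 0 the next module is zero, so the augmentation is an
  isomorphism.\<close>

lemma resolution_TR_dim_le:
  fixes G :: "nat \<Rightarrow> ('a, (nat \<Rightarrow> 'a) set) module" and X :: "('a, (nat \<Rightarrow> 'a) set) module"
  assumes "resolution R X G d e" "Modl X" "\<And>i. i \<le> n \<Longrightarrow> TR (G i)" "\<And>i. i > n \<Longrightarrow> zero_mod (G i)"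
  shows "TR_dim_le n X"
  using assms
proof (induction n arbitrary: X G d e)
  case 0
  note r' = resolutionD[OF 0(1)]
  have "carrier (G (Suc 0)) = {\<zero>\<^bsub>G (Suc 0)\<^esub>}" using 0(4)[of "Suc 0"] by (simp add: zero_mod_def)
  then have "a_kernel (G 0) X e = {\<zero>\<^bsub>G 0\<^esub>}" using r'(5) hom_zero[OF r'(1,1,2)] by simp
  then have k: "x \<in> carrier (G 0) \<Longrightarrow> e x = \<zero>\<^bsub>X\<^esub> \<Longrightarrow> x = \<zero>\<^bsub>G 0\<^esub>" for x unfolding a_kernel_eq by blast
  have "inj_on e (carrier (G 0))" by (rule inj_onI_hom[OF r'(1) 0(2) r'(3) k])
  then have "st (G 0) X" by (rule st_iso[OF r'(1) 0(2) iso_of_bij[OF r'(3) _ r'(4)]])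
  then show ?case using TR_dim_le.base TR_st 0(3) by blast
next
  case (Suc n)
  note r' = resolutionD[OF Suc(2)]
  let ?X = "sub_mod (G 0) (a_kernel (G 0) X e)"
  have s: "ses ?X (\<lambda>x. x) (G 0) e X" by (rule ses_kernel[OF r'(1) Suc(3) r'(3,4)])
  have "resolution R ?X (\<lambda>n. G (Suc n)) (\<lambda>n. d (Suc n)) (d (Suc 0))"
    unfolding resolution_def One_nat_def
  proof (intro conjI allI r')
    show "d (Suc 0) \<in> Hm (G (Suc 0)) ?X" by (rule hom_to_sub[OF r'(2)]) (use r'(5) in blast)
    show "d (Suc 0) ` carrier (G (Suc 0)) = carrier ?X" using r'(5) by simp
    show "d (Suc (Suc 0)) ` carrier (G (Suc (Suc 0))) = a_kernel (G (Suc 0)) ?X (d (Suc 0))"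
      unfolding r'(6) by (simp add: a_kernel_eq)
  qed
  then have "TR_dim_le n ?X" by (rule Suc(1)[OF _ sesD(1)[OF s]]) (use Suc.prems(3,4) in auto)
  then show ?case by (rule TR_dim_le.step[OF s Suc.prems(3)[OF le0]])
qed

lemma G_dim_TR:
  assumes M: "fgm M" and g: "G_dim R M = enat g" shows "TR (Om g M)"
proof -
  define P where "P n \<longleftrightarrow> (\<exists>(G :: nat \<Rightarrow> ('a, (nat \<Rightarrow> 'a) set) module) d e. resolution R M G d e \<and>
       (\<forall>i\<le>n. totally_reflexive R (G i)) \<and> (\<forall>i>n. zero_mod (G i)))" for n
  have G: "G_dim R M = Inf {enat n | n. P n}" unfolding G_dim_def P_def ..
  \<comment> \<open>A finite infimum of extended naturals is attained; the empty set is excluded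
    because its infimum is \<infinity>.\<close>
  have "enat g \<in> {enat n | n. P n}"
  proof -
    have ne: "{enat n | n. P n} \<noteq> {}"
    proof
      assume "{enat n | n. P n} = {}"
      then show False using g unfolding G Inf_enat_def by simp
    qed
    have "(LEAST x. x \<in> {enat n | n. P n}) = enat g" using g unfolding G Inf_enat_def if_not_P[OF ne] .
    moreover have "(LEAST x. x \<in> {enat n | n. P n}) \<in> {enat n | n. P n}"
      by (rule LeastI_ex) (use ne in blast)
    ultimately show ?thesis by (simp only:)
  qed
  then have "P g" by simp
  then obtain G :: "nat \<Rightarrow> ('a, (nat \<Rightarrow> 'a) set) module" and d e where
    r: "resolution R M G d e" and t: "\<forall>i\<le>g. totally_reflexive R (G i)" and z: "\<forall>i>g. zero_mod (G i)"
    unfolding P_def by blast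
  note r' = resolutionD[OF r] and m = fgm_Mod[OF M]
  \<comment> \<open>\<open>TR_dim_le\<close> is confined to one element type, so the resolution is
    augmented to the copy of M.\<close>
  obtain c where c: "c \<in> mod_iso R M (copy M)" using copy(2)[OF M] by blast
  then have ch: "c \<in> Hm M (copy M)" "inj_on c (carrier M)" "c ` carrier M = carrier (copy M)"
    by (auto simp: mod_iso_def bij_betw_def)
  have c0: "c x = \<zero>\<^bsub>copy M\<^esub> \<longleftrightarrow> x = \<zero>\<^bsub>M\<^esub>" if "x \<in> carrier M" for x
    using inj_onD[OF ch(2) _ that Mod_simps(1)[OF m]] hom_zero[OF m copy(1)[OF M] ch(1)] by auto
  have "resolution R (copy M) G d (\<lambda>x. c (e x))"
    unfolding resolution_def One_nat_def
  proof (intro conjI allI r' mod_hom_comp[OF r'(3) ch(1)])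
    show "(\<lambda>x. c (e x)) ` carrier (G 0) = carrier (copy M)" using r'(4) ch(3) by (simp flip: image_image)
    show "d (Suc 0) ` carrier (G (Suc 0)) = a_kernel (G 0) (copy M) (\<lambda>x. c (e x))"
      unfolding r'(5) a_kernel_eq using c0 mod_hom_closed[OF r'(3)] by auto
  qed
  then have "TR_dim_le g (copy M)" by (rule resolution_TR_dim_le[OF _ copy(1)[OF M]]) (use t z totally_reflexive_TR in auto)
  then have "TR (Om g (copy M))" by (rule TR_Om_of_TR_dim_le)
  then show ?thesis by (rule TR_st[OF Om_cong[OF st_sym[OF copy(3)[OF M]] copy(4)[OF M] M]])
qed

lemma grade_zero:
  assumes "grade R M = enat g" "i < g" shows "zero_mod (Ext R i M RR)"
proof (rule ccontr)
  assume "\<not> zero_mod (Ext R i M RR)"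
  then have "grade R M \<le> enat i" unfolding grade_def by (intro Inf_lower) blast
  then show False using assms by simp
qed

text \<open>A cocycle of degree i is a functional on \<open>F i\<close> that kills the image of the
  next differential, which is the same as a functional on the cokernel.\<close>

lemma dual_syzygy_cocycles:
  assumes fr: "free_resolution R X F d e" and X: "Modl X"
  shows "st (sub_mod ((F i)\<^sup>\<star>) (cocycles R F d RR i)) ((syzygy F d i)\<^sup>\<star>)"
proof -
  have r: "resolution R X F d e" using fr by (simp add: free_resolution_def)
  note r' = resolutionD[OF r] and p = syzygy_proj[OF r, where n = i]
  let ?V = "sub_mod ((F i)\<^sup>\<star>) (cocycles R F d RR i)" and ?A = "syzygy F d i"
  let ?h = "dual_map (F i) (syz_proj F d i)"
  have V: "Modl ?V" by (rule Mod_sub[OF Mod_dual[OF r'(1)] submod_cocycles[OF r]])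
  have h: "?h \<in> Hm (?A\<^sup>\<star>) ((F i)\<^sup>\<star>)" by (rule dual_map_hom[OF r'(1) p(2)])
  have coc: "\<phi> \<in> cocycles R F d RR i \<longleftrightarrow> \<phi> \<in> carrier ((F i)\<^sup>\<star>) \<and> (\<forall>x\<in>carrier (F (Suc i)). \<phi> (d (Suc i) x) = \<zero>)" for \<phi>
    unfolding cocycles_def dual_mod_def[symmetric] by (simp only: mem_Collect_eq ring_mod_simps)
  have hV: "?h \<psi> \<in> cocycles R F d RR i" if \<psi>: "\<psi> \<in> carrier (?A\<^sup>\<star>)" for \<psi>
    unfolding coc
  proof (intro conjI ballI mod_hom_closed[OF h \<psi>])
    fix x assume x: "x \<in> carrier (F (Suc i))"
    have dx: "d (Suc i) x \<in> carrier (F i)" by (rule mod_hom_closed[OF r'(2) x])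
    have "syz_proj F d i (d (Suc i) x) = \<zero>\<^bsub>?A\<^esub>" using p(4)[OF dx] x by blast
    then show "?h \<psi> (d (Suc i) x) = \<zero>" using dx hom_RR_zero[OF p(1) dual_hom[OF \<psi>]] by simp
  qed
  have "?h \<in> mod_iso R (?A\<^sup>\<star>) ?V"
  proof (rule iso_of_bij)
    show "?h \<in> Hm (?A\<^sup>\<star>) ?V" by (rule hom_to_sub[OF h hV])
    show "inj_on ?h (carrier (?A\<^sup>\<star>))"
    proof (rule inj_onI)
      fix \<phi> \<psi> assume *: "\<phi> \<in> carrier (?A\<^sup>\<star>)" "\<psi> \<in> carrier (?A\<^sup>\<star>)" "?h \<phi> = ?h \<psi>"
      show "\<phi> = \<psi>"
      proof (rule dual_eqI[OF *(1,2)])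
        fix a assume "a \<in> carrier ?A"
        then have "a \<in> syz_proj F d i ` carrier (F i)" using p(3) by simp
        then obtain x where x: "a = syz_proj F d i x" "x \<in> carrier (F i)" by (elim imageE)
        show "\<phi> a = \<psi> a" using fun_cong[OF *(3), of x] x by (simp only: dual_map_apply)
      qed
    qed
    show "?h ` carrier (?A\<^sup>\<star>) = carrier ?V"
    proof (intro equalityI subsetI)
      fix \<phi> assume "\<phi> \<in> carrier ?V"
      then have \<phi>: "\<phi> \<in> carrier ((F i)\<^sup>\<star>)" "\<And>x. x \<in> carrier (F (Suc i)) \<Longrightarrow> \<phi> (d (Suc i) x) = \<zero>"
        by (simp_all only: sub_mod_simps coc)
      obtain \<psi> where \<psi>: "\<psi> \<in> Hm ?A RR" "\<And>x. x \<in> carrier (F i) \<Longrightarrow> \<psi> (syz_proj F d i x) = \<phi> x"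
      proof (rule hom_factor_surj[OF r'(1) p(1) Mod_RR p(2,3) dual_hom[OF \<phi>(1)]])
        fix x assume x: "x \<in> carrier (F i)" "syz_proj F d i x = \<zero>\<^bsub>?A\<^esub>"
        then have "x \<in> d (Suc i) ` carrier (F (Suc i))" using p(4) by blast
        then show "\<phi> x = \<zero>\<^bsub>RR\<^esub>" using \<phi>(2) by auto
      qed (rule that)
      note m = dual_memI[OF p(1) \<psi>(1)]
      have "?h (restrict \<psi> (carrier ?A)) = \<phi>"
        by (rule dual_eqI[OF mod_hom_closed[OF h m] \<phi>(1)]) (simp add: \<psi>(2) mod_hom_closed[OF p(2)])
      then show "\<phi> \<in> ?h ` carrier (?A\<^sup>\<star>)" using m by blast
    next
      fix \<phi> assume "\<phi> \<in> ?h ` carrier (?A\<^sup>\<star>)"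
      then show "\<phi> \<in> carrier ?V" using hV by (elim imageE) (simp only: sub_mod_simps)
    qed
  qed
  then have "st (?A\<^sup>\<star>) ?V" by (rule st_iso[OF Mod_dual[OF p(1)] V])
  then show ?thesis by (rule st_sym)
qed

text \<open>The dual of a free resolution of \<open>M\<close> is exact below the grade \<open>g\<close>, so the coboundaries of
  degree \<open>g\<close> have projective dimension less than \<open>g\<close>; hence passing from the cocycles to
  \<open>Ext\<^sup>g(M, R)\<close> does not change the syzygies from degree \<open>g\<close> on.\<close>

lemma Om_Ext_grade:
  assumes M: "fgm M" and z: "\<And>i. i < g \<Longrightarrow> zero_mod (Ext R i M RR)" and l: "g \<le> l"
  shows "Modl (Ext R g M RR)" "st (Om l (Ext R g M RR)) (Om l ((Om g M)\<^sup>\<star>))"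
proof -
  obtain F d e where s: "some_free_resolution R M = (F, d)" and fr: "free_resolution R M F d e"
    by (rule some_free_resolution[OF M])
  have r: "resolution R M F d e" using fr by (simp add: free_resolution_def)
  note r' = resolutionD[OF r] and f = free_resolution_fgm[OF fr fgm_Mod[OF M]]
  define V where "V = sub_mod ((F g)\<^sup>\<star>) (cocycles R F d RR g)"
  define I where "I j = sub_mod ((F j)\<^sup>\<star>) (coboundaries R F d RR j)" for j
  have N: "Ext R g M RR = quot_mod V (coboundaries R F d RR g)" unfolding V_def by (rule Ext_eq[OF s])
  have mF: "Modl ((F j)\<^sup>\<star>)" for j by (rule Mod_dual[OF r'(1)])
  have mV: "Modl V" unfolding V_def by (rule Mod_sub[OF mF submod_cocycles[OF r]])
  have mI: "Modl (I j)" for j unfolding I_def by (rule Mod_sub[OF mF submod_coboundaries[OF r]])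
  have K: "submodule (coboundaries R F d RR g) R V" unfolding V_def by (rule submod_coboundaries_cocycles[OF r])
  note q = quot_mod[OF mV K]
  show "Modl (Ext R g M RR)" unfolding N by (rule q(1))
  have PF: "proj ((F j)\<^sup>\<star>)" for j by (rule proj_dual[OF f(3)])
  have fV: "fgm V" unfolding V_def
    by (rule fgm_sub[OF fgm_proj[OF PF] Mod_sub[OF mF submod_cocycles[OF r]] hom_sub_incl[OF mF]])
      (use submodD(1)[OF mF submod_cocycles[OF r]] in \<open>simp_all del: dual_mod_simps\<close>)
  have fI: "fgm (I j)" for j unfolding I_def
    by (rule fgm_sub[OF fgm_proj[OF PF] Mod_sub[OF mF submod_coboundaries[OF r]] hom_sub_incl[OF mF]])
      (use submodD(1)[OF mF submod_coboundaries[OF r]] in \<open>simp_all del: dual_mod_simps\<close>)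
  have fN: "fgm (Ext R g M RR)" unfolding N by (rule fgm_surj[OF fV q(1,2,3)])
  have stV: "st V ((Om g M)\<^sup>\<star>)" unfolding V_def
    by (rule st_trans[OF dual_syzygy_cocycles[OF fr fgm_Mod[OF M]] st_dual[OF syzygy_Om[OF fr fgm_Mod[OF M]]]])
  have fK: "fgm ((Om g M)\<^sup>\<star>)" by (rule fgm_dual[OF fgm_Om[OF M]])
  \<comment> \<open>Below the grade every cocycle is a coboundary, so the kernel of the transposed
    differential is the coboundary module of the same degree.\<close>
  have sI: "ses (I j) (\<lambda>x. x) ((F j)\<^sup>\<star>) (dual_map (F (Suc j)) (d (Suc j))) (I (Suc j))" if j: "j < g" for j
  proof -
    let ?h = "dual_map (F (Suc j)) (d (Suc j))"
    have h: "?h \<in> Hm ((F j)\<^sup>\<star>) (I (Suc j))" unfolding I_def coboundaries_Suc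
      by (rule hom_to_sub[OF dual_map_hom[OF r'(1,2)]]) (rule imageI)
    have hs: "?h ` carrier ((F j)\<^sup>\<star>) = carrier (I (Suc j))" by (simp only: I_def coboundaries_Suc sub_mod_simps)
    have "a_kernel ((F j)\<^sup>\<star>) (I (Suc j)) ?h = coboundaries R F d RR j"
      unfolding Ext_zero[OF s r z[OF j], symmetric] cocycles_kernel[OF r] a_kernel_eq by (simp only: I_def sub_mod_simps)
    then show ?thesis using ses_kernel[OF mF mI h hs] by (simp only: I_def)
  qed
  \<comment> \<open>Each coboundary module is a syzygy of the next one. As \<open>I 0\<close> is
    zero, \<open>I 1\<close> is the dual of \<open>F 0\<close>, and j further steps lead to
    \<open>I (Suc j)\<close>.\<close>
  have pI: "proj (Om j (I (Suc j)))" if "j < g" for j using that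
  proof (induction j)
    case 0
    note s0 = sesD[OF sI[OF 0]]
    have c0: "carrier (I 0) = {\<zero>\<^bsub>(F 0)\<^sup>\<star>\<^esub>}" unfolding I_def coboundaries_0 by (simp only: sub_mod_simps)
    have "inj_on (dual_map (F (Suc 0)) (d (Suc 0))) (carrier ((F 0)\<^sup>\<star>))"
      by (rule inj_onI_hom[OF s0(2,3,6)]) (use s0(8) c0 in blast)
    then have "st ((F 0)\<^sup>\<star>) (I (Suc 0))" using st_iso[OF s0(2,3) iso_of_bij[OF s0(6) _ s0(7)]] by blast
    then show ?case unfolding Om_0 by (intro proj_st[OF st_trans[OF _ copy(3)[OF fI]] PF])
  next
    case (Suc j)
    have "st (om (I (Suc (Suc j)))) (I (Suc j))" by (rule st_sym[OF st_om[OF sI[OF Suc(2)] PF]])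
    from st_trans[OF st_sym[OF Om_om[OF fI]] Om_cong[OF this fgm_om[OF fI] fI]]
    show ?case using proj_st[OF st_sym] Suc by (meson Suc_lessD)
  qed
  have sN: "ses (I g) (\<lambda>x. x) V (\<lambda>x. coboundaries R F d RR g +>\<^bsub>V\<^esub> x) (Ext R g M RR)"
  proof -
    have "sub_mod V (coboundaries R F d RR g) = I g" by (simp add: V_def I_def sub_mod_def)
    then show ?thesis using ses_quot[OF mV K] unfolding N by simp
  qed
  have "st (Om l V) (Om l (Ext R g M RR))"
  \<comment> \<open>In degree 0 the coboundaries are zero and Ext is the module of cocycles itself.
    Otherwise g = k + 1, the k-th syzygy of \<open>I g\<close> is projective, and k + 1 \<le> l is
    exactly the bound on l.\<close>
  proof (cases g)
    case 0
    note s0 = sesD[OF sN]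
    have c0: "carrier (I g) = {\<zero>\<^bsub>V\<^esub>}" unfolding I_def V_def 0 coboundaries_0 by (simp only: sub_mod_simps)
    have "inj_on (\<lambda>x. coboundaries R F d RR g +>\<^bsub>V\<^esub> x) (carrier V)"
      by (rule inj_onI_hom[OF s0(2,3,6)]) (use s0(8) c0 in blast)
    then have "st V (Ext R g M RR)" using st_iso[OF s0(2,3) iso_of_bij[OF s0(6) _ s0(7)]] by blast
    then show ?thesis by (rule Om_cong[OF _ fV fN])
  next
    case (Suc k)
    have "proj (Om k (I g))" using pI[of k] Suc by simp
    then show ?thesis by (rule Om_quotient_proj[OF sN fI fV fN]) (use l Suc in simp)
  qed
  from st_trans[OF st_sym[OF this] Om_cong[OF stV fV fK]]
  show "st (Om l (Ext R g M RR)) (Om l ((Om g M)\<^sup>\<star>))" .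
qed

text \<open>Here \<open>?K\<close> is the dual of \<Omega>^g M. Stably, \<Omega>^i of
  \<open>Ext R g M RR\<close> is \<Omega>^i of \<open>?K\<close>; dualising and taking i syzygies
  leads back to the dual of \<open>?K\<close> by \<open>Om_dual_Om\<close>, and biduality ends at
  \<Omega>^g M.\<close>

lemma dual_syzygy_Ext:
  assumes M: "fgm M" and TR: "TR (Om g M)" and z: "\<And>i. i < g \<Longrightarrow> zero_mod (Ext R i M RR)"
    and H: "free_resolution R (Ext R g M RR) H d e" and i: "g \<le> i"
  shows "TR ((syzygy H d i)\<^sup>\<star>)" "st (Om i ((syzygy H d i)\<^sup>\<star>)) (Om g M)"
proof -
  note N = Om_Ext_grade[OF M z i]
  let ?K = "(Om g M)\<^sup>\<star>"
  have K: "TR ?K" by (rule TR_dual[OF TR])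
  have X: "TR ((Om i ?K)\<^sup>\<star>)" by (rule TR_dual[OF TR_Om[OF K]])
  have st: "st ((Om i ?K)\<^sup>\<star>) ((syzygy H d i)\<^sup>\<star>)"
    by (rule st_sym[OF st_dual[OF st_trans[OF syzygy_Om[OF H N(1)] N(2)]]])
  then show T: "TR ((syzygy H d i)\<^sup>\<star>)" by (rule TR_st[OF _ X])
  have "st (Om i ((syzygy H d i)\<^sup>\<star>)) (?K\<^sup>\<star>)"
    by (rule st_trans[OF Om_cong[OF st_sym[OF st] TR_D(1)[OF T] TR_D(1)[OF X]] Om_dual_Om[OF K]])
  then show "st (Om i ((syzygy H d i)\<^sup>\<star>)) (Om g M)" by (rule st_trans[OF _ st_sym[OF st_bidual[OF TR]]])
qed

section \<open>Periodic resolutions\<close>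

lemma st_quot_iso:
  assumes m: "Modl A" "Modl B" and f: "f \<in> mod_iso R A B" and K: "submodule K R A" "submodule (f ` K) R B"
  shows "st (quot_mod A K) (quot_mod B (f ` K))"
proof -
  note p = quot_mod[OF m(1) K(1)] and q = quot_mod[OF m(2) K(2)]
  have fh: "f \<in> Hm A B" "inj_on f (carrier A)" "f ` carrier A = carrier B" using f by (auto simp: mod_iso_def bij_betw_def)
  let ?\<pi> = "\<lambda>x. K +>\<^bsub>A\<^esub> x" and ?\<rho> = "\<lambda>x. f ` K +>\<^bsub>B\<^esub> x"
  have e: "?\<rho> (f x) = \<zero>\<^bsub>quot_mod B (f ` K)\<^esub> \<longleftrightarrow> ?\<pi> x = \<zero>\<^bsub>quot_mod A K\<^esub>" if x: "x \<in> carrier A" for x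
    unfolding q(4) p(4) p(5)[OF x] q(5)[OF mod_hom_closed[OF fh(1) x]]
    using inj_on_image_mem_iff[OF fh(2) x submodD(1)[OF m(1) K(1)]] .
  obtain h where h: "h \<in> Hm (quot_mod A K) (quot_mod B (f ` K))" "\<And>x. x \<in> carrier A \<Longrightarrow> h (?\<pi> x) = ?\<rho> (f x)"
    by (rule hom_factor_surj[OF m(1) p(1) q(1) p(2,3) mod_hom_comp[OF fh(1) q(2)]]) (use e in blast, rule that)
  have "inj_on h (carrier (quot_mod A K))"
  proof (rule inj_onI_hom[OF p(1) q(1) h(1)])
    fix y assume y: "y \<in> carrier (quot_mod A K)" "h y = \<zero>\<^bsub>quot_mod B (f ` K)\<^esub>"
    have "y \<in> ?\<pi> ` carrier A" using p(3) y(1) by simp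
    then obtain x where x: "y = ?\<pi> x" "x \<in> carrier A" by (elim imageE)
    show "y = \<zero>\<^bsub>quot_mod A K\<^esub>" using e[OF x(2)] h(2)[OF x(2)] y(2) x(1) by simp
  qed
  moreover have "h ` carrier (quot_mod A K) = carrier (quot_mod B (f ` K))"
  proof -
    have "h ` carrier (quot_mod A K) = (\<lambda>x. h (?\<pi> x)) ` carrier A" by (simp only: image_image flip: p(3))
    also have "\<dots> = (\<lambda>x. ?\<rho> (f x)) ` carrier A" by (rule image_cong[OF refl h(2)])
    also have "\<dots> = ?\<rho> ` carrier B" by (simp only: image_image flip: fh(3))
    finally show ?thesis using q(3) by simp
  qed
  ultimately show ?thesis by (rule st_iso[OF p(1) q(1) iso_of_bij[OF h(1)]])
qed

lemma periodic_syzygies: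
  fixes F :: "nat \<Rightarrow> ('a, 'f) module"
  assumes r: "resolution R X F d e" and per: "eventually_periodic R F d a"
  obtains n where "\<And>k m. n \<le> k \<Longrightarrow> st (syzygy F d k) (syzygy F d (k + m * a))"
proof -
  from per show thesis unfolding eventually_periodic_def
  proof (elim conjE exE)
    fix n and G :: "nat \<Rightarrow> ('a, 'f) module" and \<delta>
    assume *: "\<forall>k. Modl (G k)" "\<forall>k. \<delta> (Suc k) \<in> Hm (G (Suc k)) (G k)" and
      iso: "complex_isomorphic R F d G \<delta>" and **: "\<forall>k\<ge>n. G (k + a) = G k"
      "\<forall>k>n. \<forall>x\<in>carrier (G k). \<delta> (k + a) x = \<delta> k x"
  have mG: "Modl (G k)" and \<delta>: "\<delta> (Suc k) \<in> Hm (G (Suc k)) (G k)" for k using * by simp_all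
  have G: "G (k + a) = G k" if "n \<le> k" for k using **(1) that by simp
  have \<delta>p: "\<delta> (k + a) x = \<delta> k x" if "n < k" "x \<in> carrier (G k)" for k x using **(2) that by simp
  obtain \<theta> where \<theta>: "\<And>k. \<theta> k \<in> mod_iso R (F k) (G k)"
    "\<And>k x. x \<in> carrier (F (Suc k)) \<Longrightarrow> \<theta> k (d (Suc k) x) = \<delta> (Suc k) (\<theta> (Suc k) x)"
    using iso unfolding complex_isomorphic_def by blast
  have im: "\<theta> k ` d (Suc k) ` carrier (F (Suc k)) = \<delta> (Suc k) ` carrier (G (Suc k))" for k
  proof -
    have "\<theta> k ` d (Suc k) ` carrier (F (Suc k)) = (\<lambda>x. \<delta> (Suc k) (\<theta> (Suc k) x)) ` carrier (F (Suc k))"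
      unfolding image_image by (rule image_cong[OF refl \<theta>(2)])
    also have "\<dots> = \<delta> (Suc k) ` \<theta> (Suc k) ` carrier (F (Suc k))" by (simp only: image_image)
    also have "\<theta> (Suc k) ` carrier (F (Suc k)) = carrier (G (Suc k))" using \<theta>(1) by (simp add: mod_iso_def bij_betw_def)
    finally show ?thesis .
  qed
  have sF: "st (syzygy F d k) (syzygy G \<delta> k)" for k
    unfolding syzygy_def im[symmetric]
    by (rule st_quot_iso[OF resolutionD(1)[OF r] mG \<theta>(1) resolution_submod[OF r]])
      (unfold im, rule submod_image[OF mG mG \<delta>])
  \<comment> \<open>The k-th syzygy involves only \<open>G k\<close> and the image of the
    differential out of degree k + 1. The differentials repeat above degree n, so the two syzygies
    are equal already for k = n.\<close>
  have sG: "syzygy G \<delta> (k + a) = syzygy G \<delta> k" if k: "n \<le> k" for k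
  proof -
    have c: "G (Suc (k + a)) = G (Suc k)" using G[of "Suc k"] k by simp
    have "\<delta> (Suc (k + a)) ` carrier (G (Suc (k + a))) = \<delta> (Suc k) ` carrier (G (Suc k))"
      unfolding c by (rule image_cong[OF refl]) (use \<delta>p[of "Suc k"] k in simp)
    then show ?thesis unfolding syzygy_def G[OF k] by simp
  qed
  have one: "st (syzygy F d k) (syzygy F d (k + a))" if "n \<le> k" for k
    using st_trans[OF sF[of k] st_sym[OF sF[of "k + a"], unfolded sG[OF that]]] .
  have "st (syzygy F d k) (syzygy F d (k + m * a))" if k: "n \<le> k" for k m
  proof (induction m)
    case 0
    show ?case using st_refl[OF syzygy_proj(1)[OF r]] by simp
  next
    case (Suc m)
    have "st (syzygy F d (k + m * a)) (syzygy F d (k + m * a + a))" by (rule one) (use k in simp)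
    from st_trans[OF Suc this] show ?case by (simp add: ac_simps)
  qed
  then show thesis by (rule that)
  qed
qed

lemma stably_iso_periodic:
  assumes M: "fgm M" and TR: "TR (Om g M)" and X: "TR X" "st (Om i X) (Om g M)"
    and F: "free_resolution R M F d e" and per: "eventually_periodic R F d a" and m: "i \<le> m * a"
  shows "stably_iso R X (syzygy F d (g + m * a - i))"
proof -
  let ?s = "g + m * a - i"
  have r: "resolution R M F d e" using F by (simp add: free_resolution_def)
  have sM: "st (syzygy F d k) (Om k M)" for k by (rule syzygy_Om[OF F fgm_Mod[OF M]])
  obtain n where n: "\<And>k m. n \<le> k \<Longrightarrow> st (syzygy F d k) (syzygy F d (k + m * a))"
    by (rule periodic_syzygies[OF r per]) (rule that)
  \<comment> \<open>From i \<le> m a it follows that \<open>?s\<close> is at least g, so that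
    \<Omega>^s M is a syzygy of the totally reflexive module \<Omega>^g M.\<close>
  have e: "?s - g + g = ?s" using m by simp
  have "st (Om (?s - g) (Om g M)) (Om ?s M)" using Om_add[OF M, of "?s - g" g] unfolding e .
  then have Y: "TR (Om ?s M)" by (rule TR_st[OF _ TR_Om[OF TR]])
  \<comment> \<open>The comparison takes place n degrees further up, where the syzygies repeat:
    \<Omega>^(n+i) X is \<Omega>^(n+g) M and hence \<Omega>^(n+g+ma) M, where n + g + m a = (n + i)
    + s.\<close>
  have 1: "st (Om (n + i) X) (Om n (Om i X))" by (rule st_sym[OF Om_add[OF TR_D(1)[OF X(1)]]])
  have 2: "st (Om n (Om i X)) (Om n (Om g M))"
    by (rule Om_cong[OF X(2) fgm_Om[OF TR_D(1)[OF X(1)]] fgm_Om[OF M]])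
  have 3: "st (Om n (Om g M)) (Om (n + g) M)" by (rule Om_add[OF M])
  have 4: "st (Om (n + g) M) (Om (n + g + m * a) M)"
    by (rule st_trans[OF st_sym[OF sM] st_trans[OF n sM]]) simp
  have 5: "st (Om (n + g + m * a) M) (Om (n + i) (Om ?s M))"
    using st_sym[OF Om_add[OF M, of "n + i" ?s]] m by (simp add: ac_simps)
  have "st (Om (n + i) X) (Om (n + i) (Om ?s M))"
    by (rule st_trans[OF 1 st_trans[OF 2 st_trans[OF 3 st_trans[OF 4 5]]]])
  then have "st X (Om ?s M)" by (rule st_of_Om[OF TR_D(1)[OF X(1)] TR_D(1)[OF Y] TR_D(3)[OF X(1)] TR_D(3)[OF Y]])
  from st_trans[OF this st_sym[OF sM]]
  show ?thesis by (rule st_stably_iso[OF _ free_resolution_fgm(2)[OF F fgm_Mod[OF M]] TR_D(1)[OF X(1)]])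
qed

lemma st_syzygies_of_stably_iso:
  assumes M: "fgm M" and X: "TR X" "st (Om i X) (Om g M)"
    and F: "free_resolution R M F d e" and s: "stably_iso R X (syzygy F d j)"
  shows "st (syzygy F d g) (syzygy F d (i + j))"
proof -
  have sM: "st (syzygy F d k) (Om k M)" for k by (rule syzygy_Om[OF F fgm_Mod[OF M]])
  have "st X (syzygy F d j)" by (rule stably_iso_st[OF s TR_D(5)[OF X(1)] stD(1)[OF sM]])
  then have "st X (Om j M)" by (rule st_trans[OF _ sM])
  then have "st (Om i X) (Om i (Om j M))" by (rule Om_cong[OF _ TR_D(1)[OF X(1)] fgm_Om[OF M]])
  then have "st (Om i X) (Om (i + j) M)" by (rule st_trans[OF _ Om_add[OF M]])
  from st_trans[OF st_sym[OF X(2)] this] have "st (Om g M) (Om (i + j) M)" .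
  from st_trans[OF sM st_trans[OF this st_sym[OF sM]]] show ?thesis .
qed

end

section \<open>Minimal resolutions over a local ring\<close>

context cring begin

section \<open>Spans, and periodicity from isomorphisms of high degrees\<close>

lemma mod_span_submodule:
  assumes M: "Modl M" and S: "S \<subseteq> carrier M"
  shows "submodule (mod_span R M S) R M" "S \<subseteq> mod_span R M S"
proof -
  have c: "submodule (carrier M) R M" by (rule module.carrier_is_submodule[OF M])
  show "S \<subseteq> mod_span R M S" unfolding mod_span_def by blast
  show "submodule (mod_span R M S) R M"
  proof (rule submodI[OF M])
    show "mod_span R M S \<subseteq> carrier M" unfolding mod_span_def using c S by blast
    show "\<zero>\<^bsub>M\<^esub> \<in> mod_span R M S" unfolding mod_span_def using submodD(2)[OF M] by blast
    show "x \<oplus>\<^bsub>M\<^esub> y \<in> mod_span R M S" if "x \<in> mod_span R M S" "y \<in> mod_span R M S" for x y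
      using that submodD(3)[OF M] unfolding mod_span_def by blast
    show "a \<odot>\<^bsub>M\<^esub> x \<in> mod_span R M S" if "a \<in> carrier R" "x \<in> mod_span R M S" for a x
      using that submodD(4)[OF M] unfolding mod_span_def by blast
  qed
qed

lemma mod_span_least: "submodule H R M \<Longrightarrow> S \<subseteq> H \<Longrightarrow> mod_span R M S \<subseteq> H"
  unfolding mod_span_def by blast

definition mgen :: "('a, 'x) module \<Rightarrow> 'x set" where
  "mgen M = {a \<odot>\<^bsub>M\<^esub> x | a x. a \<in> max_ideal R \<and> x \<in> carrier M}"

text \<open>The product of the maximal ideal with M, written as a span so that it agrees with the
  bound in \<open>minimal_free_resolution\<close>.\<close>

definition rad :: "('a, 'x) module \<Rightarrow> 'x set" where
  "rad M = mod_span R M (mgen M)"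

text \<open>In contrast to \<open>mod_iso_inverse\<close> this concerns the specific inverse
  \<open>inv_into\<close>, by which differentials are conjugated below.\<close>

lemma inv_into_hom:
  assumes f: "f \<in> mod_iso R X Y" and X: "Modl X"
  shows "inv_into (carrier X) f \<in> Hm Y X"
proof -
  have fh: "f \<in> Hm X Y" "bij_betw f (carrier X) (carrier Y)" using f by (auto simp: mod_iso_def)
  obtain g where g: "g \<in> Hm Y X" "\<And>x. x \<in> carrier X \<Longrightarrow> g (f x) = x" "\<And>y. y \<in> carrier Y \<Longrightarrow> f (g y) = y"
    by (rule mod_iso_inverse[OF f Mod_simps(2,3)[OF X]]) (assumption+, rule that)
  have c: "inv_into (carrier X) f y = g y" if y: "y \<in> carrier Y" for y
    by (rule inv_into_f_eq[OF bij_betw_imp_inj_on[OF fh(2)] mod_hom_closed[OF g(1) y] g(3)[OF y]])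
  have "y \<in> carrier Y \<Longrightarrow> inv_into (carrier X) f y \<in> carrier X" for y using c mod_hom_closed[OF g(1)] by simp
  moreover have "x \<oplus>\<^bsub>Y\<^esub> y \<in> carrier Y" if xy: "x \<in> carrier Y" "y \<in> carrier Y" for x y
  proof -
    have "f (g x \<oplus>\<^bsub>X\<^esub> g y) = x \<oplus>\<^bsub>Y\<^esub> y" using mod_hom_add[OF fh(1)] mod_hom_closed[OF g(1)] g(3) xy by simp
    then show ?thesis using mod_hom_closed[OF fh(1) Mod_simps(2)[OF X]] mod_hom_closed[OF g(1)] xy by metis
  qed
  moreover have "a \<odot>\<^bsub>Y\<^esub> y \<in> carrier Y" if ay: "a \<in> carrier R" "y \<in> carrier Y" for a y
  proof -
    have "f (a \<odot>\<^bsub>X\<^esub> g y) = a \<odot>\<^bsub>Y\<^esub> y" using mod_hom_smult[OF fh(1)] mod_hom_closed[OF g(1)] g(3) ay by simp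
    then show ?thesis using mod_hom_closed[OF fh(1) Mod_simps(3)[OF X]] mod_hom_closed[OF g(1)] ay by metis
  qed
  ultimately show ?thesis using c mod_hom_add[OF g(1)] mod_hom_smult[OF g(1)] by (intro mod_homI) simp_all
qed

text \<open>The isomorphisms \<open>F (n + a + t) \<rightarrow> F (n + t)\<close> are composed to carry every \<open>F k\<close> back to the block
  of degrees \<open>n, \<dots>, n + a - 1\<close>.\<close>

lemma eventually_periodicI:
  fixes F :: "nat \<Rightarrow> ('a, 'f) module" and d :: "nat \<Rightarrow> 'f \<Rightarrow> 'f"
  assumes m: "\<And>k. Modl (F k)" and d: "\<And>k. d (Suc k) \<in> Hm (F (Suc k)) (F k)" and a: "a > 0"
    and \<phi>: "\<And>t. \<phi> t \<in> mod_iso R (F (n + a + t)) (F (n + t))"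
    and com: "\<And>t x. x \<in> carrier (F (Suc (n + a + t))) \<Longrightarrow> \<phi> t (d (Suc (n + a + t)) x) = d (Suc (n + t)) (\<phi> (Suc t) x)"
  shows "eventually_periodic R F d a"
proof -
  define \<Phi> where "\<Phi> q r = rec_nat (\<lambda>x. x) (\<lambda>q h x. h (\<phi> (q * a + r) x)) q" for q r
  define G where "G k = (if k < n then F k else F (n + (k - n) mod a))" for k
  define \<theta> where "\<theta> k = (if k < n then (\<lambda>x. x) else \<Phi> ((k - n) div a) ((k - n) mod a))" for k
  \<comment> \<open>Conjugating \<open>d\<close> by \<theta> makes \<theta> an isomorphism of
    complexes by construction; the commutation assumption \<open>com\<close> is left for the proof
    that \<delta> repeats.\<close>
  define \<delta> where "\<delta> k y = \<theta> (k - 1) (d k (inv_into (carrier (F k)) (\<theta> k) y))" for k y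
  have \<Phi>S: "\<Phi> (Suc q) r x = \<Phi> q r (\<phi> (q * a + r) x)" for q r x by (simp add: \<Phi>_def)
  have \<Phi>0: "\<Phi> 0 r = (\<lambda>x. x)" for r by (simp add: \<Phi>_def)
  have comp: "(\<lambda>x. g (f x)) \<in> mod_iso R X Z" if "f \<in> mod_iso R X Y" "g \<in> mod_iso R Y Z"
    for f g and X Y Z :: "('a, 'f) module"
    using that mod_hom_comp bij_betw_trans[of f "carrier X" "carrier Y" g "carrier Z"]
    unfolding mod_iso_def comp_def by blast
  have \<Phi>: "\<Phi> q r \<in> mod_iso R (F (n + (q * a + r))) (F (n + r))" for q r
  proof (induction q)
    case 0
    show ?case unfolding \<Phi>0 using iso_id by simp
  next
    case (Suc q)
    have "\<phi> (q * a + r) \<in> mod_iso R (F (n + (Suc q * a + r))) (F (n + (q * a + r)))"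
      using \<phi>[of "q * a + r"] by (simp add: ac_simps)
    from comp[OF this Suc] show ?case unfolding \<Phi>S[symmetric] .
  qed
  have \<theta>: "\<theta> k \<in> mod_iso R (F k) (G k)" for k
  proof (cases "k < n")
    case True
    then show ?thesis by (simp add: \<theta>_def G_def iso_id)
  next
    case False
    then have "n + ((k - n) div a * a + (k - n) mod a) = k" by simp
    then show ?thesis using \<Phi>[of "(k - n) div a" "(k - n) mod a"] False by (simp add: \<theta>_def G_def)
  qed
  have \<theta>p: "\<theta> (k + a) x = \<theta> k (\<phi> (k - n) x)" if k: "n \<le> k" for k x
  proof -
    have e: "k + a - n = (k - n) + a" using k by simp
    have "(k + a - n) div a = Suc ((k - n) div a)" unfolding e using div_add_self2[of a "k - n"] a by simp
    moreover have "(k + a - n) mod a = (k - n) mod a" unfolding e by (rule mod_add_self2)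
    ultimately have "\<theta> (k + a) x = \<Phi> (Suc ((k - n) div a)) ((k - n) mod a) x" using k by (simp add: \<theta>_def)
    also have "\<dots> = \<theta> k (\<phi> (k - n) x)" unfolding \<Phi>S using k by (simp add: \<theta>_def)
    finally show ?thesis .
  qed
  have mG: "Modl (G k)" for k by (simp add: G_def m)
  have Gp: "G (k + a) = G k" if k: "n \<le> k" for k
  proof -
    have "k + a - n = (k - n) + a" using k by simp
    then have "(k + a - n) mod a = (k - n) mod a" by (simp only: mod_add_self2)
    then show ?thesis using k by (simp add: G_def)
  qed
  have \<theta>h: "\<theta> k \<in> Hm (F k) (G k)" and \<theta>b: "bij_betw (\<theta> k) (carrier (F k)) (carrier (G k))" for k
    using \<theta>[of k] by (auto simp: mod_iso_def)
  have \<theta>inv: "inv_into (carrier (F k)) (\<theta> k) (\<theta> k x) = x" if "x \<in> carrier (F k)" for k x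
    by (rule bij_betw_inv_into_left[OF \<theta>b that])
  have \<delta>: "\<delta> (Suc k) \<in> Hm (G (Suc k)) (G k)" for k
  proof -
    have "(\<lambda>y. \<theta> k (d (Suc k) (inv_into (carrier (F (Suc k))) (\<theta> (Suc k)) y))) \<in> Hm (G (Suc k)) (G k)"
      by (rule mod_hom_comp[OF mod_hom_comp[OF inv_into_hom[OF \<theta> m] d] \<theta>h])
    then show ?thesis by (simp add: \<delta>_def[abs_def])
  qed
  have "complex_isomorphic R F d G \<delta>" unfolding complex_isomorphic_def
    by (intro exI[of _ \<theta>] conjI allI \<theta> ballI) (simp add: \<delta>_def \<theta>inv)
  moreover have "G k = F k" if "n \<le> k" "k < n + a" for k
    using that by (simp add: G_def)
  moreover have "\<delta> (k + a) x = \<delta> k x" if k: "n < k" and x: "x \<in> carrier (G k)" for k x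
  proof -
    obtain j where j: "k = Suc j" "n \<le> j" using k by (cases k) auto
    have eq: "n + a + (j - n) = j + a" "n + (j - n) = j" "n + a + Suc (j - n) = Suc j + a" "n + Suc (j - n) = Suc j"
      "Suc j - n = Suc (j - n)"
      using j(2) by simp_all
    have "x \<in> \<theta> (k + a) ` carrier (F (k + a))" using x \<theta>b[of "k + a"] Gp[of k] k by (simp add: bij_betw_def)
    then obtain y where y: "x = \<theta> (k + a) y" "y \<in> carrier (F (k + a))" by (elim imageE)
    have z: "\<phi> (Suc (j - n)) y \<in> carrier (F (Suc j))"
    proof -
      have "\<phi> (Suc (j - n)) \<in> mod_iso R (F (Suc j + a)) (F (Suc j))" using \<phi>[of "Suc (j - n)"] unfolding eq .
      then show ?thesis using mod_hom_closed y(2) unfolding j(1) mod_iso_def by blast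
    qed
    have xz: "x = \<theta> k (\<phi> (Suc (j - n)) y)" using \<theta>p[of k y] k eq(5) unfolding y(1) j(1) by simp
    have 1: "\<delta> (k + a) x = \<theta> (j + a) (d (Suc (j + a)) y)"
      using \<theta>inv[OF y(2)] unfolding \<delta>_def y(1) j(1) by simp
    have 2: "\<delta> k x = \<theta> j (d (Suc j) (\<phi> (Suc (j - n)) y))"
      using \<theta>inv[OF z] unfolding \<delta>_def xz j(1) by simp
    have "\<phi> (j - n) (d (Suc (j + a)) y) = d (Suc j) (\<phi> (Suc (j - n)) y)"
      using com[of y "j - n"] y(2) unfolding eq j(1) by simp
    then show ?thesis unfolding 1 2 \<theta>p[OF j(2)] by simp
  qed
  ultimately have *: "(\<forall>k. Modl (G k)) \<and> (\<forall>k. \<delta> (Suc k) \<in> Hm (G (Suc k)) (G k)) \<and> complex_isomorphic R F d G \<delta> \<and>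
      (\<forall>k. n \<le> k \<and> k < n + a \<longrightarrow> G k = F k) \<and> (\<forall>k\<ge>n. G (k + a) = G k) \<and>
      (\<forall>k>n. \<forall>x\<in>carrier (G k). \<delta> (k + a) x = \<delta> k x)"
    using mG \<delta> Gp by (intro conjI allI impI ballI) simp_all
  show ?thesis unfolding eventually_periodic_def
    by (intro conjI a exI[of _ n] exI[of _ G] exI[of _ \<delta>]) (use * in simp_all)
qed

end

locale noeth_local = noeth_cring +
  assumes local: "local_ring R"
begin

abbreviation \<mm> where "\<mm> \<equiv> max_ideal R"

lemma max_ideal: "maximalideal \<mm> R" "maximalideal I R \<Longrightarrow> I = \<mm>"
proof -
  have ex: "\<exists>!I. maximalideal I R" using local by (simp add: local_ring_def)
  show "maximalideal \<mm> R" unfolding max_ideal_def by (rule theI'[OF ex])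
  then show "maximalideal I R \<Longrightarrow> I = \<mm>" using ex by blast
qed

lemma max_ideal_carrier: "a \<in> \<mm> \<Longrightarrow> a \<in> carrier R"
  using ideal.Icarr[OF maximalideal.axioms(1)[OF max_ideal(1)]] .

text \<open>If 1 - a generated a proper ideal, Zorn's lemma would put it into a maximal ideal, that
  is, into the only one. This would then contain 1 as the sum of 1 - a and a.\<close>

lemma unit_one_minus:
  assumes a: "a \<in> \<mm>"
  obtains u where "u \<in> carrier R" "u \<otimes> (\<one> \<ominus> a) = \<one>"
proof -
  let ?b = "\<one> \<ominus> a"
  have ac: "a \<in> carrier R" by (rule max_ideal_carrier[OF a])
  then have b: "?b \<in> carrier R" by simp
  interpret m: maximalideal \<mm> R by (rule max_ideal(1))
  have "PIdl ?b = carrier R"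
  proof (rule ccontr)
    assume ne: "PIdl ?b \<noteq> carrier R"
    let ?A = "{I. ideal I R \<and> PIdl ?b \<subseteq> I \<and> \<one> \<notin> I}"
    have "\<one> \<notin> PIdl ?b" using ne ideal.one_imp_carrier[OF cgenideal_ideal[OF b]] by blast
    then have "PIdl ?b \<in> ?A" using cgenideal_ideal[OF b] by blast
    then have "?A \<noteq> {}" by blast
    from subset_Zorn_nonempty[OF this] obtain I where I: "I \<in> ?A" "\<forall>J\<in>?A. I \<subseteq> J \<longrightarrow> J = I"
    proof
      fix C assume C: "C \<noteq> {}" "subset.chain ?A C"
      then have "subset.chain {I. ideal I R} C" by (auto simp: subset.chain_def)
      from ideal_chain_is_trivial[OF C(1) this] show "\<Union>C \<in> ?A" using C(2) by (auto simp: subset.chain_def)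
    qed
    have "maximalideal I R"
    proof (rule maximalidealI)
      show "ideal I R" "carrier R \<noteq> I" using I(1) by auto
      fix J assume J: "ideal J R" "I \<subseteq> J" "J \<subseteq> carrier R"
      show "J = I \<or> J = carrier R"
      proof (cases "\<one> \<in> J")
        case True
        then show ?thesis using ideal.one_imp_carrier[OF J(1)] by blast
      next
        case False
        then show ?thesis using I J by blast
      qed
    qed
    then have "I = \<mm>" by (rule max_ideal(2))
    then have "?b \<in> \<mm>" using I(1) cgenideal_self[OF b] by blast
    then have "?b \<oplus> a \<in> \<mm>" using a by (rule m.a_closed)
    moreover have "?b \<oplus> a = \<one>" using ac by algebra
    ultimately show False using m.one_imp_carrier m.I_notcarr by simp
  qed
  then have "\<one> \<in> PIdl ?b" by simp
  then obtain u where "u \<in> carrier R" "\<one> = u \<otimes> ?b" unfolding cgenideal_def by blast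
  then show ?thesis using that by simp
qed

section \<open>Multiples of the maximal ideal and Nakayama's lemma\<close>

lemma mgen_carrier: "Modl M \<Longrightarrow> mgen M \<subseteq> carrier M"
  unfolding mgen_def using max_ideal_carrier by auto

lemma rad_submodule: "Modl M \<Longrightarrow> submodule (rad M) R M"
  unfolding rad_def by (rule mod_span_submodule(1)[OF _ mgen_carrier])

lemma rad_carrier: "Modl M \<Longrightarrow> x \<in> rad M \<Longrightarrow> x \<in> carrier M"
  using submodD(1)[OF _ rad_submodule] by blast

lemma rad_hom:
  assumes m: "Modl A" "Modl B" and h: "h \<in> Hm A B" and x: "x \<in> rad A"
  shows "h x \<in> rad B"
proof -
  have "submodule {x \<in> carrier A. h x \<in> rad B} R A" by (rule submod_vimage[OF m h rad_submodule[OF m(2)]])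
  moreover have "mgen A \<subseteq> {x \<in> carrier A. h x \<in> rad B}"
  proof
    fix v assume v: "v \<in> mgen A"
    then obtain a u where au: "a \<in> \<mm>" "u \<in> carrier A" "v = a \<odot>\<^bsub>A\<^esub> u" unfolding mgen_def by blast
    have "h v = a \<odot>\<^bsub>B\<^esub> h u" using au mod_hom_smult[OF h max_ideal_carrier] by simp
    then have "h v \<in> mgen B" unfolding mgen_def using au mod_hom_closed[OF h au(2)] by blast
    then show "v \<in> {x \<in> carrier A. h x \<in> rad B}"
      using mod_span_submodule(2)[OF m(2) mgen_carrier[OF m(2)]] v mgen_carrier[OF m(1)] unfolding rad_def by blast
  qed
  ultimately have "rad A \<subseteq> {x \<in> carrier A. h x \<in> rad B}" unfolding rad_def by (rule mod_span_least)
  then show ?thesis using x by blast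
qed

text \<open>A generator is a ring element of the maximal ideal times a vector; lifting the vector
  and keeping the ring element yields a generator upstairs.\<close>

lemma rad_surj:
  assumes m: "Modl A" "Modl B" and p: "p \<in> Hm A B" "p ` carrier A = carrier B" and y: "y \<in> rad B"
  obtains z where "z \<in> rad A" "y = p z"
proof -
  have A: "Modl (sub_mod A (rad A))" by (rule Mod_sub[OF m(1) rad_submodule[OF m(1)]])
  have sub: "submodule (p ` rad A) R B"
    using submod_image[OF A m(2) hom_from_sub[OF p(1) submodD(1)[OF m(1) rad_submodule[OF m(1)]]]] by simp
  have "mgen B \<subseteq> p ` rad A"
  proof
    fix v assume "v \<in> mgen B"
    then obtain a u where au: "a \<in> \<mm>" "u \<in> carrier B" "v = a \<odot>\<^bsub>B\<^esub> u" unfolding mgen_def by blast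
    have "u \<in> p ` carrier A" using p(2) au(2) by simp
    then obtain w where w: "u = p w" "w \<in> carrier A" by (elim imageE)
    have "v = p (a \<odot>\<^bsub>A\<^esub> w)" using mod_hom_smult[OF p(1) max_ideal_carrier[OF au(1)] w(2)] au(3) w(1) by simp
    moreover have "a \<odot>\<^bsub>A\<^esub> w \<in> mgen A" unfolding mgen_def using au(1) w(2) by blast
    ultimately show "v \<in> p ` rad A" using mod_span_submodule(2)[OF m(1) mgen_carrier[OF m(1)]] unfolding rad_def by blast
  qed
  from mod_span_least[OF sub this] have "y \<in> p ` rad A" using y unfolding rad_def by blast
  then show ?thesis using that by blast
qed

text \<open>Nakayama's lemma by induction on the generators modulo B; the last two premises say that
  B together with S, and B together with \<mm> A, generate A. Adjoining y to B gives A = B + R y by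
  induction. Then B + \<mm> y contains \<mm> A and is also all of A, so y = v + r y with v in B and
  r in \<mm>, and 1 - r is invertible.\<close>

lemma nakayama_aux:
  assumes A: "Modl A" and S: "finite S"
  shows "submodule B R A \<Longrightarrow> S \<subseteq> carrier A \<Longrightarrow>
    (\<And>H. submodule H R A \<Longrightarrow> B \<subseteq> H \<Longrightarrow> S \<subseteq> H \<Longrightarrow> H = carrier A) \<Longrightarrow>
    (\<And>H. submodule H R A \<Longrightarrow> B \<subseteq> H \<Longrightarrow> mgen A \<subseteq> H \<Longrightarrow> H = carrier A) \<Longrightarrow> B = carrier A"
  using S
proof (induction S arbitrary: B)
  case empty
  then show ?case by blast
next
  case (insert y S)
  note B = insert.prems(1) and N = insert.prems(4)
  note b = submodD[OF A B]
  have y: "y \<in> carrier A" using insert.prems(2) by blast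
  have sub: "submodule {v \<oplus>\<^bsub>A\<^esub> r \<odot>\<^bsub>A\<^esub> y | v r. v \<in> B \<and> r \<in> J} R A" if J: "ideal J R" for J
  proof (rule submodI[OF A])
    interpret J: ideal J R by (rule J)
    show "{v \<oplus>\<^bsub>A\<^esub> r \<odot>\<^bsub>A\<^esub> y | v r. v \<in> B \<and> r \<in> J} \<subseteq> carrier A" using b(1) J.Icarr A y by auto
    have "\<zero>\<^bsub>A\<^esub> = \<zero>\<^bsub>A\<^esub> \<oplus>\<^bsub>A\<^esub> \<zero> \<odot>\<^bsub>A\<^esub> y" using A y by simp
    then show "\<zero>\<^bsub>A\<^esub> \<in> {v \<oplus>\<^bsub>A\<^esub> r \<odot>\<^bsub>A\<^esub> y | v r. v \<in> B \<and> r \<in> J}" using b(2) J.zero_closed by blast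
    fix u assume "u \<in> {v \<oplus>\<^bsub>A\<^esub> r \<odot>\<^bsub>A\<^esub> y | v r. v \<in> B \<and> r \<in> J}"
    then obtain v r where u: "u = v \<oplus>\<^bsub>A\<^esub> r \<odot>\<^bsub>A\<^esub> y" "v \<in> B" "r \<in> J" by blast
    have c: "v \<in> carrier A" "r \<in> carrier R" using b(1) u J.Icarr by blast+
    {
      fix u' assume "u' \<in> {v \<oplus>\<^bsub>A\<^esub> r \<odot>\<^bsub>A\<^esub> y | v r. v \<in> B \<and> r \<in> J}"
      then obtain v' r' where u': "u' = v' \<oplus>\<^bsub>A\<^esub> r' \<odot>\<^bsub>A\<^esub> y" "v' \<in> B" "r' \<in> J" by blast
      have c': "v' \<in> carrier A" "r' \<in> carrier R" using b(1) u' J.Icarr by blast+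
      have "u \<oplus>\<^bsub>A\<^esub> u' = (v \<oplus>\<^bsub>A\<^esub> v') \<oplus>\<^bsub>A\<^esub> (r \<oplus> r') \<odot>\<^bsub>A\<^esub> y"
        using c c' A y by (simp add: u u' Mod_arith)
      then show "u \<oplus>\<^bsub>A\<^esub> u' \<in> {v \<oplus>\<^bsub>A\<^esub> r \<odot>\<^bsub>A\<^esub> y | v r. v \<in> B \<and> r \<in> J}"
        using b(3)[OF u(2) u'(2)] J.a_closed[OF u(3) u'(3)] by blast
    }
    fix s assume s: "s \<in> carrier R"
    have "s \<odot>\<^bsub>A\<^esub> u = s \<odot>\<^bsub>A\<^esub> v \<oplus>\<^bsub>A\<^esub> (s \<otimes> r) \<odot>\<^bsub>A\<^esub> y" using s c A y by (simp add: u Mod_arith)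
    then show "s \<odot>\<^bsub>A\<^esub> u \<in> {v \<oplus>\<^bsub>A\<^esub> r \<odot>\<^bsub>A\<^esub> y | v r. v \<in> B \<and> r \<in> J}"
      using b(4)[OF s u(2)] J.I_l_closed[OF u(3) s] by blast
  qed
  have incl: "B \<subseteq> {v \<oplus>\<^bsub>A\<^esub> r \<odot>\<^bsub>A\<^esub> y | v r. v \<in> B \<and> r \<in> J}" if J: "ideal J R" for J
  proof
    fix v assume v: "v \<in> B"
    have "v = v \<oplus>\<^bsub>A\<^esub> \<zero> \<odot>\<^bsub>A\<^esub> y" using subsetD[OF b(1) v] A y by simp
    then show "v \<in> {v \<oplus>\<^bsub>A\<^esub> r \<odot>\<^bsub>A\<^esub> y | v r. v \<in> B \<and> r \<in> J}"
      using v additive_subgroup.zero_closed[OF ideal.axioms(1)[OF J]] by blast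
  qed
  let ?B = "{v \<oplus>\<^bsub>A\<^esub> r \<odot>\<^bsub>A\<^esub> y | v r. v \<in> B \<and> r \<in> carrier R}"
  have "y = \<zero>\<^bsub>A\<^esub> \<oplus>\<^bsub>A\<^esub> \<one> \<odot>\<^bsub>A\<^esub> y" using A y by simp
  then have yB: "y \<in> ?B" using b(2) one_closed by blast
  have full: "?B = carrier A"
  proof (rule insert.IH[OF sub[OF oneideal]])
    show "S \<subseteq> carrier A" using insert.prems(2) by blast
    show "H = carrier A" if "submodule H R A" "?B \<subseteq> H" "S \<subseteq> H" for H
      by (rule insert.prems(3)[OF that(1)]) (use that incl[OF oneideal] yB in blast)+
    show "H = carrier A" if "submodule H R A" "?B \<subseteq> H" "mgen A \<subseteq> H" for H
      by (rule N[OF that(1) _ that(3)]) (use that incl[OF oneideal] in blast)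
  qed
  have mI: "ideal \<mm> R" by (rule maximalideal.axioms(1)[OF max_ideal(1)])
  let ?H = "{v \<oplus>\<^bsub>A\<^esub> r \<odot>\<^bsub>A\<^esub> y | v r. v \<in> B \<and> r \<in> \<mm>}"
  have "?H = carrier A"
  proof (rule N[OF sub[OF mI] incl[OF mI]])
    show "mgen A \<subseteq> ?H"
    proof
      fix w assume "w \<in> mgen A"
      then obtain a x where ax: "a \<in> \<mm>" "x \<in> carrier A" "w = a \<odot>\<^bsub>A\<^esub> x" unfolding mgen_def by blast
      obtain v r where vr: "x = v \<oplus>\<^bsub>A\<^esub> r \<odot>\<^bsub>A\<^esub> y" "v \<in> B" "r \<in> carrier R" using ax(2) full by blast
      have ac: "a \<in> carrier R" by (rule max_ideal_carrier[OF ax(1)])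
      have "w = a \<odot>\<^bsub>A\<^esub> v \<oplus>\<^bsub>A\<^esub> (a \<otimes> r) \<odot>\<^bsub>A\<^esub> y"
        using ac subsetD[OF b(1) vr(2)] vr(3) A y by (simp add: ax(3) vr(1) Mod_arith)
      then show "w \<in> ?H" using b(4)[OF ac vr(2)] ideal.I_r_closed[OF mI ax(1) vr(3)] by blast
    qed
  qed
  then obtain v r where vr: "y = v \<oplus>\<^bsub>A\<^esub> r \<odot>\<^bsub>A\<^esub> y" "v \<in> B" "r \<in> \<mm>" using y by blast
  have c: "r \<in> carrier R" "v \<in> carrier A" using max_ideal_carrier[OF vr(3)] subsetD[OF b(1) vr(2)] by blast+
  obtain u where u: "u \<in> carrier R" "u \<otimes> (\<one> \<ominus> r) = \<one>" by (rule unit_one_minus[OF vr(3)])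
  have ry: "r \<odot>\<^bsub>A\<^esub> y \<in> carrier A" using A c y by simp
  have "(\<one> \<ominus> r) \<odot>\<^bsub>A\<^esub> y = y \<oplus>\<^bsub>A\<^esub> \<ominus>\<^bsub>A\<^esub> (r \<odot>\<^bsub>A\<^esub> y)"
    using A c y by (simp add: minus_eq Mod_arith(12,15))
  also have "\<dots> = v \<oplus>\<^bsub>A\<^esub> (r \<odot>\<^bsub>A\<^esub> y \<oplus>\<^bsub>A\<^esub> \<ominus>\<^bsub>A\<^esub> (r \<odot>\<^bsub>A\<^esub> y))"
    using Mod_arith(3)[OF A c(2) ry Mod_simps(4)[OF A ry]] vr(1) by simp
  also have "\<dots> = v" using A c ry by (simp add: Mod_arith(8))
  finally have "u \<odot>\<^bsub>A\<^esub> v = (u \<otimes> (\<one> \<ominus> r)) \<odot>\<^bsub>A\<^esub> y" using Mod_arith(13)[OF A u(1) _ y, of "\<one> \<ominus> r"] c(1) by simp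
  then have "y = u \<odot>\<^bsub>A\<^esub> v" using u A y by simp
  then have "y \<in> B" using b(4)[OF u(1) vr(2)] by simp
  then have "?B \<subseteq> B" using b(3,4) by blast
  then show ?case using full b(1) by blast
qed

text \<open>Every x is f x minus an element of \<mm> A, so the image of \<open>f\<close> and \<mm> A
  together generate A.\<close>

lemma near_identity_surj:
  assumes A: "fgm A" and f: "f \<in> Hm A A" and n: "\<And>x. x \<in> carrier A \<Longrightarrow> f x \<ominus>\<^bsub>A\<^esub> x \<in> rad A"
  shows "f ` carrier A = carrier A"
proof -
  note m = fgm_Mod[OF A]
  obtain S where S: "finite S" "S \<subseteq> carrier A" "mod_span R A S = carrier A"
    using fg_module_fgm[OF A] unfolding fg_module_def by blast
  show ?thesis
  proof (rule nakayama_aux[OF m S(1) submod_image[OF m m f] S(2)])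
    fix H assume H: "submodule H R A"
    show "H = carrier A" if "S \<subseteq> H" using mod_span_least[OF H that] S(3) submodD(1)[OF m H] by blast
    show "H = carrier A" if fH: "f ` carrier A \<subseteq> H" and g: "mgen A \<subseteq> H"
    proof (rule equalityI[OF submodD(1)[OF m H]], rule subsetI)
      fix x assume x: "x \<in> carrier A"
      have fx: "f x \<in> carrier A" by (rule mod_hom_closed[OF f x])
      have "f x \<ominus>\<^bsub>A\<^esub> x \<in> H" using n[OF x] mod_span_least[OF H g] unfolding rad_def by blast
      then have "f x \<ominus>\<^bsub>A\<^esub> (f x \<ominus>\<^bsub>A\<^esub> x) \<in> H" using submodD(6)[OF m H] fH x by blast
      moreover have "f x \<ominus>\<^bsub>A\<^esub> (f x \<ominus>\<^bsub>A\<^esub> x) = x" using m x fx by (simp add: Mod_ac)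
      ultimately show "x \<in> H" by simp
    qed
  qed
qed

text \<open>The surjection \<open>f\<close> has a section s because P is projective. The section is
  again congruent to the identity, hence surjective itself, and this forces \<open>f\<close> to be
  injective.\<close>

lemma near_identity_inj:
  assumes P: "proj P" and f: "f \<in> Hm P P" and n: "\<And>x. x \<in> carrier P \<Longrightarrow> f x \<ominus>\<^bsub>P\<^esub> x \<in> rad P"
  shows "inj_on f (carrier P)"
proof -
  note m = proj_Mod[OF P]
  have fs: "f ` carrier P = carrier P" by (rule near_identity_surj[OF fgm_proj[OF P] f n])
  obtain s where s: "s \<in> Hm P P" "\<And>x. x \<in> carrier P \<Longrightarrow> f (s x) = x"
    by (rule proj_lift[OF P m m f mod_hom_id]) (use fs in simp, rule that)
  have "s x \<ominus>\<^bsub>P\<^esub> x \<in> rad P" if x: "x \<in> carrier P" for x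
  proof -
    have sx: "s x \<in> carrier P" by (rule mod_hom_closed[OF s(1) x])
    have r: "x \<ominus>\<^bsub>P\<^esub> s x \<in> rad P" using n[OF sx] s(2)[OF x] by simp
    have "\<ominus>\<^bsub>P\<^esub> (x \<ominus>\<^bsub>P\<^esub> s x) \<in> rad P" by (rule submodD(5)[OF m rad_submodule[OF m] r])
    moreover have "\<ominus>\<^bsub>P\<^esub> (x \<ominus>\<^bsub>P\<^esub> s x) = s x \<ominus>\<^bsub>P\<^esub> x" using m x sx by (simp add: Mod_ac)
    ultimately show ?thesis by simp
  qed
  then have ss: "s ` carrier P = carrier P" by (rule near_identity_surj[OF fgm_proj[OF P] s(1)])
  show ?thesis
  proof (rule inj_onI_hom[OF m m f])
    fix x assume x: "x \<in> carrier P" "f x = \<zero>\<^bsub>P\<^esub>"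
    have "x \<in> s ` carrier P" using ss x(1) by simp
    then obtain y where y: "x = s y" "y \<in> carrier P" by (elim imageE)
    then have "y = \<zero>\<^bsub>P\<^esub>" using s(2) x(2) by metis
    then show "x = \<zero>\<^bsub>P\<^esub>" using y(1) hom_zero[OF m m s(1)] by simp
  qed
qed

lemma near_identity_pair_iso:
  assumes P: "proj P" "proj Q" and f: "f \<in> Hm P Q" and g: "g \<in> Hm Q P"
    and n: "\<And>x. x \<in> carrier P \<Longrightarrow> g (f x) \<ominus>\<^bsub>P\<^esub> x \<in> rad P" "\<And>x. x \<in> carrier Q \<Longrightarrow> f (g x) \<ominus>\<^bsub>Q\<^esub> x \<in> rad Q"
  shows "f \<in> mod_iso R P Q"
proof (rule iso_of_bij[OF f])
  have "inj_on (\<lambda>x. g (f x)) (carrier P)" by (rule near_identity_inj[OF P(1) mod_hom_comp[OF f g] n(1)])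
  then show "inj_on f (carrier P)" unfolding inj_on_def by metis
  have s: "(\<lambda>x. f (g x)) ` carrier Q = carrier Q" by (rule near_identity_surj[OF fgm_proj[OF P(2)] mod_hom_comp[OF g f] n(2)])
  show "f ` carrier P = carrier Q"
  proof (intro equalityI subsetI)
    fix y assume "y \<in> carrier Q"
    then have "y \<in> (\<lambda>x. f (g x)) ` carrier Q" using s by simp
    then obtain x where x: "y = f (g x)" "x \<in> carrier Q" by (elim imageE)
    then show "y \<in> f ` carrier P" using mod_hom_closed[OF g] by blast
  qed (use mod_hom_closed[OF f] in blast)
qed

section \<open>Minimal covers and the lifting of isomorphisms\<close>

definition minimal_ses where
  "minimal_ses A i P p X \<longleftrightarrow> ses A i P p X \<and> proj P \<and> i ` carrier A \<subseteq> rad P"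

lemma minimal_sesD:
  assumes "minimal_ses A i P p X"
  shows "ses A i P p X" "proj P" "a \<in> carrier A \<Longrightarrow> i a \<in> rad P"
  using assms by (auto simp: minimal_ses_def)

lemma minimal_lift_iso:
  assumes s: "minimal_ses A i P p X" and t: "minimal_ses B j Q q Y"
    and f: "f \<in> Hm X Y" and g: "g \<in> Hm Y X"
    and gf: "\<And>x. x \<in> carrier X \<Longrightarrow> g (f x) \<ominus>\<^bsub>X\<^esub> x \<in> rad X" and fg: "\<And>y. y \<in> carrier Y \<Longrightarrow> f (g y) \<ominus>\<^bsub>Y\<^esub> y \<in> rad Y"
    and f0: "f\<^sub>0 \<in> Hm P Q" "\<And>x. x \<in> carrier P \<Longrightarrow> q (f\<^sub>0 x) = f (p x)"
    and g0: "g\<^sub>0 \<in> Hm Q P" "\<And>y. y \<in> carrier Q \<Longrightarrow> p (g\<^sub>0 y) = g (q y)"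
  shows "f\<^sub>0 \<in> mod_iso R P Q"
proof -
  \<comment> \<open>An endomorphism of a minimal cover that is congruent to the identity below is so
    above: the congruence lifts by \<open>rad_surj\<close>, and what remains lies in the kernel,
    which minimality places inside \<open>rad V\<close>.\<close>
  have *: "k x \<ominus>\<^bsub>V\<^esub> x \<in> rad V" if s: "minimal_ses U u V v W" and k: "k \<in> Hm V V" and x: "x \<in> carrier V"
    and r: "v (k x) \<ominus>\<^bsub>W\<^esub> v x \<in> rad W" for U u and V :: "('a, 'v) module" and v W k x
  proof -
    note s1 = minimal_sesD[OF s]
    note s' = sesD[OF s1(1)]
    have kx: "k x \<in> carrier V" by (rule mod_hom_closed[OF k x])
    have c: "k x \<ominus>\<^bsub>V\<^esub> x \<in> carrier V" by (rule Mod_simps(5)[OF s'(2) kx x])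
    obtain z where z: "z \<in> rad V" "v (k x) \<ominus>\<^bsub>W\<^esub> v x = v z" by (rule rad_surj[OF s'(2,3,6,7) r])
    have zc: "z \<in> carrier V" by (rule rad_carrier[OF s'(2) z(1)])
    have "v ((k x \<ominus>\<^bsub>V\<^esub> x) \<ominus>\<^bsub>V\<^esub> z) = \<zero>\<^bsub>W\<^esub>"
      using hom_diff[OF s'(2,3,6) c zc] hom_diff[OF s'(2,3,6) kx x] z(2) s'(3) s'(11)[OF zc] by simp
    then obtain a where a: "a \<in> carrier U" "(k x \<ominus>\<^bsub>V\<^esub> x) \<ominus>\<^bsub>V\<^esub> z = u a"
      using ses_preimage[OF s1(1) Mod_simps(5)[OF s'(2) c zc]] by blast
    have "z \<oplus>\<^bsub>V\<^esub> u a \<in> rad V" by (rule submodD(3)[OF s'(2) rad_submodule[OF s'(2)] z(1) s1(3)[OF a(1)]])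
    moreover have "z \<oplus>\<^bsub>V\<^esub> u a = k x \<ominus>\<^bsub>V\<^esub> x"
      unfolding a(2)[symmetric] Mod_arith(1)[OF s'(2), of "k x \<ominus>\<^bsub>V\<^esub> x"] by (rule Mod_cancel_neg(1)[OF s'(2) zc c])
    ultimately show ?thesis by simp
  qed
  note s' = sesD[OF minimal_sesD(1)[OF s]] and t' = sesD[OF minimal_sesD(1)[OF t]]
  show ?thesis
  proof (rule near_identity_pair_iso[OF minimal_sesD(2)[OF s] minimal_sesD(2)[OF t] f0(1) g0(1)])
    show "g\<^sub>0 (f\<^sub>0 x) \<ominus>\<^bsub>P\<^esub> x \<in> rad P" if x: "x \<in> carrier P" for x
      by (rule *[OF s mod_hom_comp[OF f0(1) g0(1)] x])
        (use gf[OF s'(11)[OF x]] g0(2)[OF mod_hom_closed[OF f0(1) x]] f0(2)[OF x] in simp)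
    show "f\<^sub>0 (g\<^sub>0 x) \<ominus>\<^bsub>Q\<^esub> x \<in> rad Q" if x: "x \<in> carrier Q" for x
      by (rule *[OF t mod_hom_comp[OF g0(1) f0(1)] x])
        (use fg[OF t'(11)[OF x]] f0(2)[OF mod_hom_closed[OF g0(1) x]] g0(2)[OF x] in simp)
  qed
qed

text \<open>The error on B is h j with h defined on Q. By minimality j maps into
  \<open>rad Q\<close>, and homomorphisms preserve \<open>rad\<close>, so the error is not only of
  finite rank but also small.\<close>

lemma minimal_syzygy_near_identity:
  assumes s: "minimal_ses A i P p X" and t: "minimal_ses B j Q q Y" and f: "f \<in> Hm X Y" and g: "g \<in> Hm Y X"
    and fg: "near_id Y (\<lambda>y. f (g y))"
    and f0: "f\<^sub>0 \<in> Hm P Q" "\<And>x. x \<in> carrier P \<Longrightarrow> q (f\<^sub>0 x) = f (p x)"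
    and f1: "f\<^sub>1 \<in> Hm A B" "\<And>a. a \<in> carrier A \<Longrightarrow> j (f\<^sub>1 a) = f\<^sub>0 (i a)"
    and g0: "g\<^sub>0 \<in> Hm Q P" "\<And>y. y \<in> carrier Q \<Longrightarrow> p (g\<^sub>0 y) = g (q y)"
    and g1: "g\<^sub>1 \<in> Hm B A" "\<And>b. b \<in> carrier B \<Longrightarrow> i (g\<^sub>1 b) = g\<^sub>0 (j b)"
  shows "near_id B (\<lambda>b. f\<^sub>1 (g\<^sub>1 b))" "\<And>b. b \<in> carrier B \<Longrightarrow> f\<^sub>1 (g\<^sub>1 b) \<ominus>\<^bsub>B\<^esub> b \<in> rad B"
proof -
  note t1 = minimal_sesD[OF t]
  note t' = sesD[OF t1(1)]
  obtain h where h: "h \<in> Hm Q B" "\<And>b. b \<in> carrier B \<Longrightarrow> f\<^sub>1 (g\<^sub>1 b) = b \<oplus>\<^bsub>B\<^esub> h (j b)"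
    by (rule lifts_near_id[OF minimal_sesD(1)[OF s] t1(1) f g fg f0 f1 g0 g1]) (assumption+, rule that)
  show "near_id B (\<lambda>b. f\<^sub>1 (g\<^sub>1 b))"
    by (rule near_idI[OF frank_comp_right[OF t'(4) proj_frank_from[OF t1(2) t'(1) h(1)]] h(2)])
  fix b assume b: "b \<in> carrier B"
  have r: "h (j b) \<in> rad B" by (rule rad_hom[OF t'(2,1) h(1) t1(3)[OF b]])
  have "f\<^sub>1 (g\<^sub>1 b) \<ominus>\<^bsub>B\<^esub> b = h (j b)"
    unfolding h(2)[OF b] using b rad_carrier[OF t'(1) r] t'(1) by (simp add: Mod_ac)
  then show "f\<^sub>1 (g\<^sub>1 b) \<ominus>\<^bsub>B\<^esub> b \<in> rad B" using r by simp
qed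

lemma restrict_iso:
  assumes s: "ses A i P p X" and t: "ses B j Q q Y" and f0: "f\<^sub>0 \<in> mod_iso R P Q"
    and f1: "f\<^sub>1 \<in> Hm A B" "\<And>a. a \<in> carrier A \<Longrightarrow> j (f\<^sub>1 a) = f\<^sub>0 (i a)" "f\<^sub>1 ` carrier A = carrier B"
  shows "f\<^sub>1 \<in> mod_iso R A B"
proof (rule iso_of_bij[OF f1(1) _ f1(3)], rule inj_onI)
  fix x y assume *: "x \<in> carrier A" "y \<in> carrier A" "f\<^sub>1 x = f\<^sub>1 y"
  then have "f\<^sub>0 (i x) = f\<^sub>0 (i y)" using f1(2) by metis
  then have "i x = i y" using f0 sesD(10)[OF s] * unfolding mod_iso_def bij_betw_def by (auto dest: inj_onD)
  then show "x = y" by (rule ses_inj[OF s *(1,2)])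
qed

text \<open>On the first minimal syzygies a stable inverse becomes an inverse modulo the maximal ideal, because
  \<open>i ` carrier A \<subseteq> rad P\<close>; by Nakayama's lemma it lifts to an isomorphism of the covers.\<close>

lemma st_second_syzygy_iso:
  assumes s: "minimal_ses A i P p X" and t: "minimal_ses B j Q q Y"
    and s2: "minimal_ses A' i' P' p' A" and t2: "minimal_ses B' j' Q' q' B" and st: "st X Y"
  obtains f where "f \<in> mod_iso R A' B'"
proof -
  note S = minimal_sesD[OF s] and T = minimal_sesD[OF t] and S2 = minimal_sesD[OF s2] and T2 = minimal_sesD[OF t2]
  obtain f g where 1: "f \<in> Hm X Y" "g \<in> Hm Y X" "near_id X (\<lambda>x. g (f x))" "near_id Y (\<lambda>y. f (g y))"
    using st by (auto simp: st_def)
  obtain f0 f1 where f: "f0 \<in> Hm P Q" "f1 \<in> Hm A B" "\<And>x. x \<in> carrier P \<Longrightarrow> q (f0 x) = f (p x)"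
    "\<And>a. a \<in> carrier A \<Longrightarrow> j (f1 a) = f0 (i a)" by (rule ses_hom_lifts[OF S(1) T(1) S(2) 1(1)]) (rule that)
  obtain g0 g1 where g: "g0 \<in> Hm Q P" "g1 \<in> Hm B A" "\<And>x. x \<in> carrier Q \<Longrightarrow> p (g0 x) = g (q x)"
    "\<And>a. a \<in> carrier B \<Longrightarrow> i (g1 a) = g0 (j a)" by (rule ses_hom_lifts[OF T(1) S(1) T(2) 1(2)]) (rule that)
  note n1 = minimal_syzygy_near_identity[OF s t 1(1,2,4) f(1,3,2,4) g(1,3,2,4)]
  note n2 = minimal_syzygy_near_identity[OF t s 1(2,1,3) g(1,3,2,4) f(1,3,2,4)]
  obtain f2 f3 where f': "f2 \<in> Hm P' Q'" "f3 \<in> Hm A' B'" "\<And>x. x \<in> carrier P' \<Longrightarrow> q' (f2 x) = f1 (p' x)"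
    "\<And>a. a \<in> carrier A' \<Longrightarrow> j' (f3 a) = f2 (i' a)" by (rule ses_hom_lifts[OF S2(1) T2(1) S2(2) f(2)]) (rule that)
  obtain g2 g3 where g': "g2 \<in> Hm Q' P'" "g3 \<in> Hm B' A'" "\<And>x. x \<in> carrier Q' \<Longrightarrow> p' (g2 x) = g1 (q' x)"
    "\<And>a. a \<in> carrier B' \<Longrightarrow> i' (g3 a) = g2 (j' a)" by (rule ses_hom_lifts[OF T2(1) S2(1) T2(2) g(2)]) (rule that)
  have iso: "f2 \<in> mod_iso R P' Q'"
    by (rule minimal_lift_iso[OF s2 t2 f(2) g(2) n2(2) n1(2) f'(1,3) g'(1,3)])
  note n3 = minimal_syzygy_near_identity[OF s2 t2 f(2) g(2) n1(1) f'(1,3,2,4) g'(1,3,2,4)]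
  have B': "fgm B'" by (rule fgm_ses_sub[OF T2(1) fgm_proj[OF T2(2)]])
  \<comment> \<open>Injectivity of f3 is inherited from the isomorphism f2 of the covers, so only
    surjectivity calls for Nakayama's lemma.\<close>
  have s3: "(\<lambda>b. f3 (g3 b)) ` carrier B' = carrier B'"
    by (rule near_identity_surj[OF B' mod_hom_comp[OF g'(2) f'(2)] n3(2)])
  have f3s: "f3 ` carrier A' = carrier B'"
  proof (intro equalityI subsetI)
    fix y assume "y \<in> carrier B'"
    then have "y \<in> (\<lambda>b. f3 (g3 b)) ` carrier B'" using s3 by simp
    then obtain x where x: "y = f3 (g3 x)" "x \<in> carrier B'" by (elim imageE)
    then show "y \<in> f3 ` carrier A'" using mod_hom_closed[OF g'(2)] by blast
  qed (use mod_hom_closed[OF f'(2)] in blast)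
  show ?thesis by (rule that[OF restrict_iso[OF S2(1) T2(1) iso f'(2,4) f3s]])
qed

text \<open>For a genuine isomorphism the congruences required by \<open>minimal_lift_iso\<close>
  are equalities. Since the lift to the covers comes with an isomorphism of the kernels, the step
  can be iterated through all later degrees.\<close>

lemma iso_lift:
  assumes s: "minimal_ses A i P p X" and t: "minimal_ses B j Q q Y" and \<phi>: "\<phi> \<in> mod_iso R X Y"
  obtains f \<phi>' where "f \<in> mod_iso R P Q" "\<phi>' \<in> mod_iso R A B"
    "\<And>x. x \<in> carrier P \<Longrightarrow> q (f x) = \<phi> (p x)" "\<And>a. a \<in> carrier A \<Longrightarrow> j (\<phi>' a) = f (i a)"
proof -
  note S = minimal_sesD[OF s] and T = minimal_sesD[OF t]
  note s' = sesD[OF S(1)] and t' = sesD[OF T(1)]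
  have h: "\<phi> \<in> Hm X Y" "inj_on \<phi> (carrier X)" using \<phi> by (auto simp: mod_iso_def bij_betw_def)
  obtain \<gamma> where \<gamma>: "\<gamma> \<in> Hm Y X" "\<And>x. x \<in> carrier X \<Longrightarrow> \<gamma> (\<phi> x) = x" "\<And>y. y \<in> carrier Y \<Longrightarrow> \<phi> (\<gamma> y) = y"
    by (rule mod_iso_inverse[OF \<phi> Mod_simps(2,3)[OF s'(3)]]) (assumption+, rule that)
  obtain f \<phi>' where f: "f \<in> Hm P Q" "\<phi>' \<in> Hm A B" "\<And>x. x \<in> carrier P \<Longrightarrow> q (f x) = \<phi> (p x)"
    "\<And>a. a \<in> carrier A \<Longrightarrow> j (\<phi>' a) = f (i a)" by (rule ses_hom_lifts[OF S(1) T(1) S(2) h(1)]) (rule that)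
  obtain g \<gamma>' where g: "g \<in> Hm Q P" "\<gamma>' \<in> Hm B A" "\<And>x. x \<in> carrier Q \<Longrightarrow> p (g x) = \<gamma> (q x)"
    "\<And>a. a \<in> carrier B \<Longrightarrow> i (\<gamma>' a) = g (j a)" by (rule ses_hom_lifts[OF T(1) S(1) T(2) \<gamma>(1)]) (rule that)
  have iso: "f \<in> mod_iso R P Q"
    by (rule minimal_lift_iso[OF s t h(1) \<gamma>(1) _ _ f(1,3) g(1,3)])
      (simp_all add: \<gamma> s'(3) t'(3) submodD(2)[OF s'(3) rad_submodule[OF s'(3)]] submodD(2)[OF t'(3) rad_submodule[OF t'(3)]])
  have \<phi>s: "\<phi>' ` carrier A = carrier B"
  proof (intro equalityI subsetI)
    fix b assume b: "b \<in> carrier B"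
    have "j b \<in> f ` carrier P" using iso t'(10)[OF b] by (simp add: mod_iso_def bij_betw_def)
    then obtain x where x: "j b = f x" "x \<in> carrier P" by (elim imageE)
    have "\<phi> (p x) = \<phi> \<zero>\<^bsub>X\<^esub>" using f(3)[OF x(2)] t'(9)[OF b] x(1) hom_zero[OF s'(3) t'(3) h(1)] by simp
    then have "p x = \<zero>\<^bsub>X\<^esub>" by (rule inj_onD[OF h(2) _ s'(11)[OF x(2)] Mod_simps(1)[OF s'(3)]])
    then obtain a where a: "a \<in> carrier A" "x = i a" using ses_preimage[OF S(1) x(2)] by blast
    have "j (\<phi>' a) = j b" using f(4)[OF a(1)] a(2) x(1) by simp
    then have "\<phi>' a = b" by (rule ses_inj[OF T(1) mod_hom_closed[OF f(2) a(1)] b])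
    then show "b \<in> \<phi>' ` carrier A" using a(1) by blast
  qed (use mod_hom_closed[OF f(2)] in blast)
  show ?thesis by (rule that[OF iso restrict_iso[OF S(1) T(1) iso f(2,4) \<phi>s] f(3,4)])
qed

lemma periodic_of_st_syzygies:
  fixes F :: "nat \<Rightarrow> ('a, 'f) module"
  assumes mr: "minimal_free_resolution R X F d e" and bl: "b < l" and st: "st (syzygy F d b) (syzygy F d l)"
  shows "eventually_periodic R F d (l - b)"
proof -
  have r: "resolution R X F d e" and P: "proj (F k)" for k
    using mr fg_free_proj by (auto simp: minimal_free_resolution_def free_resolution_def)
  note r' = resolutionD[OF r]
  have min: "d (Suc k) ` carrier (F (Suc k)) \<subseteq> rad (F k)" for k
    using mr unfolding minimal_free_resolution_def rad_def mgen_def by blast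
  have "\<exists>\<iota>. ses (syzygy F d (Suc k)) \<iota> (F k) (syz_proj F d k) (syzygy F d k) \<and>
      (\<forall>x\<in>carrier (F (Suc k)). \<iota> (syz_proj F d (Suc k) x) = d (Suc k) x)" for k
    by (rule ses_syzygy[OF r, of k]) blast
  then obtain \<iota> where \<iota>: "\<And>k. ses (syzygy F d (Suc k)) (\<iota> k) (F k) (syz_proj F d k) (syzygy F d k)"
    "\<And>k x. x \<in> carrier (F (Suc k)) \<Longrightarrow> \<iota> k (syz_proj F d (Suc k) x) = d (Suc k) x" by metis
  have ms: "minimal_ses (syzygy F d (Suc k)) (\<iota> k) (F k) (syz_proj F d k) (syzygy F d k)" for k
    unfolding minimal_ses_def
  proof (intro conjI \<iota>(1) P subsetI)
    fix v assume "v \<in> \<iota> k ` carrier (syzygy F d (Suc k))"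
    then have "v \<in> carrier (F k)" "syz_proj F d k v = \<zero>\<^bsub>syzygy F d k\<^esub>" using sesD(8)[OF \<iota>(1)[of k]] by blast+
    then show "v \<in> rad (F k)" using syzygy_proj(4)[OF r] min by blast
  qed
  \<comment> \<open>The shift by 2 comes from \<open>st_second_syzygy_iso\<close>: a stable
    isomorphism in degrees b and l becomes an isomorphism two degrees higher.\<close>
  let ?A = "syzygy F d" and ?n = "b + 2" and ?m = "l + 2"
  obtain \<phi>0 where \<phi>0: "\<phi>0 \<in> mod_iso R (?A (Suc (Suc b))) (?A (Suc (Suc l)))"
    by (rule st_second_syzygy_iso[OF ms ms ms ms st]) (rule that)
  \<comment> \<open>The isomorphism f of the free modules covers \<phi> on the quotients and
    restricts to \<phi>' on the kernels. Since \<phi>' is the \<phi> of the next stage, consecutive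
    f commute with the differentials.\<close>
  define C where "C t \<phi> \<phi>' f \<longleftrightarrow> f \<in> mod_iso R (F (?n + t)) (F (?m + t)) \<and>
      (\<forall>x\<in>carrier (F (?n + t)). syz_proj F d (?m + t) (f x) = \<phi> (syz_proj F d (?n + t) x)) \<and>
      (\<forall>a\<in>carrier (?A (Suc (?n + t))). \<iota> (?m + t) (\<phi>' a) = f (\<iota> (?n + t) a))" for t \<phi> \<phi>' f
  have "\<exists>\<phi>. \<forall>t. \<phi> t \<in> mod_iso R (?A (?n + t)) (?A (?m + t)) \<and> (\<exists>f. C t (\<phi> t) (\<phi> (Suc t)) f)"
  proof (rule dependent_nat_choice)
    show "\<exists>\<phi>. \<phi> \<in> mod_iso R (?A (?n + 0)) (?A (?m + 0))" using \<phi>0 by auto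
    fix \<phi> t assume i: "\<phi> \<in> mod_iso R (?A (?n + t)) (?A (?m + t))"
    obtain f \<phi>' where "f \<in> mod_iso R (F (?n + t)) (F (?m + t))"
      "\<phi>' \<in> mod_iso R (?A (Suc (?n + t))) (?A (Suc (?m + t)))"
      "\<And>x. x \<in> carrier (F (?n + t)) \<Longrightarrow> syz_proj F d (?m + t) (f x) = \<phi> (syz_proj F d (?n + t) x)"
      "\<And>a. a \<in> carrier (?A (Suc (?n + t))) \<Longrightarrow> \<iota> (?m + t) (\<phi>' a) = f (\<iota> (?n + t) a)"
      by (rule iso_lift[OF ms ms i]) (rule that)
    then have "\<phi>' \<in> mod_iso R (?A (?n + Suc t)) (?A (?m + Suc t)) \<and> C t \<phi> \<phi>' f" unfolding C_def by simp
    then show "\<exists>\<phi>'. \<phi>' \<in> mod_iso R (?A (?n + Suc t)) (?A (?m + Suc t)) \<and> (\<exists>f. C t \<phi> \<phi>' f)" by blast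
  qed
  then obtain \<phi> where \<phi>: "\<And>t. \<exists>f. C t (\<phi> t) (\<phi> (Suc t)) f" by blast
  then obtain f where f: "\<And>t. C t (\<phi> t) (\<phi> (Suc t)) (f t)" by metis
  have fi: "f t \<in> mod_iso R (F (?n + t)) (F (?m + t))" for t using f[of t] by (simp add: C_def)
  have fc: "f t (d (Suc (?n + t)) x) = d (Suc (?m + t)) (f (Suc t) x)" if x: "x \<in> carrier (F (Suc (?n + t)))" for t x
  proof -
    have fh: "f (Suc t) x \<in> carrier (F (Suc (?m + t)))" using fi[of "Suc t"] x by (auto simp: mod_iso_def)
    have px: "syz_proj F d (Suc (?n + t)) x \<in> carrier (?A (Suc (?n + t)))"
      by (rule mod_hom_closed[OF syzygy_proj(2)[OF r] x])
    have "d (Suc (?m + t)) (f (Suc t) x) = \<iota> (?m + t) (syz_proj F d (Suc (?m + t)) (f (Suc t) x))"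
      by (rule \<iota>(2)[OF fh, symmetric])
    also have "syz_proj F d (Suc (?m + t)) (f (Suc t) x) = \<phi> (Suc t) (syz_proj F d (Suc (?n + t)) x)"
      using f[of "Suc t"] x unfolding C_def by simp
    also have "\<iota> (?m + t) \<dots> = f t (\<iota> (?n + t) (syz_proj F d (Suc (?n + t)) x))"
      using f[of t] px unfolding C_def by blast
    also have "\<iota> (?n + t) (syz_proj F d (Suc (?n + t)) x) = d (Suc (?n + t)) x" by (rule \<iota>(2)[OF x])
    finally show ?thesis ..
  qed
  have e: "?n + (l - b) + t = ?m + t" for t using bl by simp
  show ?thesis
  \<comment> \<open>The maps f t raise the degree by l - b, whereas the criterion asks for maps
    lowering it; hence the inverses.\<close>
  proof (rule eventually_periodicI[of F d "l - b" "\<lambda>t. inv_into (carrier (F (?n + t))) (f t)" ?n, unfolded e])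
    fix t
    have h: "inv_into (carrier (F (?n + t))) (f t) \<in> Hm (F (?m + t)) (F (?n + t))" for t
      by (rule inv_into_hom[OF fi r'(1)])
    have b: "bij_betw (f t) (carrier (F (?n + t))) (carrier (F (?m + t)))" for t using fi by (simp add: mod_iso_def)
    show "inv_into (carrier (F (?n + t))) (f t) \<in> mod_iso R (F (?m + t)) (F (?n + t))"
      using h bij_betw_inv_into[OF b] by (simp add: mod_iso_def)
    fix x assume x: "x \<in> carrier (F (Suc (?m + t)))"
    have "x \<in> f (Suc t) ` carrier (F (?n + Suc t))" using b[of "Suc t"] x by (simp add: bij_betw_def)
    then obtain y where y: "x = f (Suc t) y" "y \<in> carrier (F (?n + Suc t))" by (elim imageE)
    then have y': "y \<in> carrier (F (Suc (?n + t)))" by simp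
    have "inv_into (carrier (F (?n + t))) (f t) (d (Suc (?m + t)) x) = d (Suc (?n + t)) y"
      unfolding y(1) fc[OF y', symmetric] by (rule bij_betw_inv_into_left[OF b mod_hom_closed[OF r'(2) y']])
    also have "y = inv_into (carrier (F (?n + Suc t))) (f (Suc t)) x"
      unfolding y(1) by (rule bij_betw_inv_into_left[OF b y(2), symmetric])
    finally show "inv_into (carrier (F (?n + t))) (f t) (d (Suc (?m + t)) x) =
        d (Suc (?n + t)) (inv_into (carrier (F (?n + Suc t))) (f (Suc t)) x)" .
  qed (use r' bl in auto)
qed

end

theorem theorem1p3:
  fixes R :: "('a, 'r) ring_scheme"
    and M :: "('a, 'm) module"
    and g :: nat
    and F :: "nat \<Rightarrow> ('a, 'f) module" and d :: "nat \<Rightarrow> 'f \<Rightarrow> 'f" and e :: "'f \<Rightarrow> 'm"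
    and N :: "('a, ((nat \<Rightarrow> 'a) \<Rightarrow> 'a) set) module"
    and H :: "nat \<Rightarrow> ('a, 'h) module" and d' :: "nat \<Rightarrow> 'h \<Rightarrow> 'h"
    and e' :: "'h \<Rightarrow> ((nat \<Rightarrow> 'a) \<Rightarrow> 'a) set"
  assumes "noetherian_ring R" and "local_ring R"
    and "G_perfect R M" and "grade R M = enat g"
    and "minimal_free_resolution R M F d e"
    and "N = Ext R g M (ring_mod R)"
    and "minimal_free_resolution R N H d' e'"
  shows "(\<forall>a>0. eventually_periodic R F d a \<longrightarrow>
           (\<forall>i m :: nat. i \<ge> g \<and> real m \<ge> real i / real a \<longrightarrow>
              stably_iso R (dual_mod R (syzygy H d' i)) (syzygy F d (g + m * a - i)))) \<and>
         (\<forall>i j :: nat. i \<ge> g \<and> i + j > g \<and>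
              stably_iso R (dual_mod R (syzygy H d' i)) (syzygy F d j) \<longrightarrow>
              eventually_periodic R F d (i + j - g))"
proof -
  interpret noeth_local R
    using assms(1,2) by (simp add: noeth_local_def noeth_cring_def noeth_local_axioms_def local_ring_def)
  have M: "fgm M" and gd: "G_dim R M = enat g"
    using assms(3,4) fgm_span by (auto simp: G_perfect_def)
  have fF: "free_resolution R M F d e" and fH: "free_resolution R (Ext R g M RR) H d' e'"
    using assms(5-7) by (simp_all add: minimal_free_resolution_def)
  have TR: "TR (Om g M)" by (rule G_dim_TR[OF M gd])
  have z: "zero_mod (Ext R i M RR)" if "i < g" for i by (rule grade_zero[OF assms(4) that])
  have X: "TR (dual_mod R (syzygy H d' i))" "st (Om i (dual_mod R (syzygy H d' i))) (Om g M)" if "g \<le> i" for i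
    by (rule dual_syzygy_Ext[OF M TR z fH that]; assumption)+
  show ?thesis
  proof (intro conjI allI impI; elim conjE)
    fix a i m :: nat
    assume a: "0 < a" "eventually_periodic R F d a" and i: "g \<le> i" "real i / real a \<le> real m"
    have "real i \<le> real (m * a)" using a(1) i(2) by (simp add: divide_le_eq)
    then have "i \<le> m * a" by linarith
    then show "stably_iso R (dual_mod R (syzygy H d' i)) (syzygy F d (g + m * a - i))"
      by (rule stably_iso_periodic[OF M TR X[OF i(1)] fF a(2)])
  next
    fix i j assume i: "g \<le> i" "g < i + j" and s: "stably_iso R (dual_mod R (syzygy H d' i)) (syzygy F d j)"
    \<comment> \<open>The syzygies that become stably isomorphic are those of degrees g and i + j,
      so the period is their difference, positive by assumption.\<close>
    show "eventually_periodic R F d (i + j - g)"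
      by (rule periodic_of_st_syzygies[OF assms(5) i(2) st_syzygies_of_stably_iso[OF M X[OF i(1)] fF s]])
  qed
qed

end
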